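(* Let $V$ be a finite-dimensional complex vector space, $G\subset\mathrm{GL}(V)$ a reductive group which is a Levi subgroup of $G_0$, and $H$ a Levi subgroup of $H_0$ containing $G$. Suppose that $V$ is an irreducible $G$-module. Then $G_0$ and $H_0$ are reductive and $H^0=\mathbb{C}^*G^0$.
   Context: The base field is $\mathbb{C}$; reductive groups are linear algebraic groups, possibly disconnected. Let $R=\mathbb{C}[V]$, $R^G$ the algebra of invariants, $R^G_+$ the ideal of $R^G$ of invariants vanishing at $0$, and $\mathcal{I}=R^G_+R$. Define $G_0=\{g\in\mathrm{GL}(V)\mid f\circ g=f\text{ for all }f\in R^G\}$ and $H_0=\{h\in\mathrm{GL}(V)\mid h\text{ preserves the ideal }\mathcal{I}\}$. A Levi subgroup of a linear algebraic group is a reductive subgroup complementary to the unipotent radical. Superscript $0$ denotes the identity component; $\mathbb{C}^*$ denotes the nonzero scalar transformations of $V$. *)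

theory Defs
  imports "HOL-Analysis.Analysis" "HOL-Algebra.Ideal"
begin

text \<open>
  Throughout, \<open>V\<close> is \<open>complex ^ 'n\<close> and \<open>GL(V)\<close> consists of the invertible matrices over
  \<open>'n\<close>. As \<open>\<complex>\<close> is infinite, \<open>\<complex>[V]\<close> is identified with the algebra of polynomial functions on \<open>V\<close>.
\<close>

text \<open>The \<open>\<complex>\<close>-algebra of functions generated by \<open>X\<close>.\<close>

inductive_set gen_algebra :: "('a \<Rightarrow> complex) set \<Rightarrow> ('a \<Rightarrow> complex) set"
  for X :: "('a \<Rightarrow> complex) set"
where
  gen: "f \<in> X \<Longrightarrow> f \<in> gen_algebra X"
| const: "(\<lambda>_. c) \<in> gen_algebra X"
| add: "f \<in> gen_algebra X \<Longrightarrow> g \<in> gen_algebra X \<Longrightarrow> (\<lambda>x. f x + g x) \<in> gen_algebra X"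
| mult: "f \<in> gen_algebra X \<Longrightarrow> g \<in> gen_algebra X \<Longrightarrow> (\<lambda>x. f x * g x) \<in> gen_algebra X"

definition poly_ring :: "(complex ^ 'n \<Rightarrow> complex) ring" where
  "poly_ring = \<lparr>carrier = gen_algebra {(\<lambda>v. v $ i) | i. True},
     mult = (\<lambda>f g v. f v * g v), one = (\<lambda>_. 1),
     zero = (\<lambda>_. 0), add = (\<lambda>f g v. f v + g v)\<rparr>"

lemma cring_poly_ring: "cring (poly_ring :: (complex ^ 'n \<Rightarrow> complex) ring)"
proof (rule cringI)
  show "abelian_group (poly_ring :: (complex ^ 'n \<Rightarrow> complex) ring)"
  proof (rule abelian_groupI)
    fix f :: "complex ^ 'n \<Rightarrow> complex"
    assume "f \<in> carrier poly_ring"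
    then have "(\<lambda>v. (- 1) * f v) \<in> carrier poly_ring"
      unfolding poly_ring_def partial_object.simps by (intro gen_algebra.mult gen_algebra.const)
    then show "\<exists>g\<in>carrier poly_ring. g \<oplus>\<^bsub>poly_ring\<^esub> f = \<zero>\<^bsub>poly_ring\<^esub>"
      by (rule bexI[rotated]) (simp add: poly_ring_def)
  qed (auto simp: poly_ring_def algebra_simps intro: gen_algebra.intros)
  show "Group.comm_monoid (poly_ring :: (complex ^ 'n \<Rightarrow> complex) ring)"
    by (rule comm_monoidI) (auto simp: poly_ring_def algebra_simps intro: gen_algebra.intros)
qed (auto simp: poly_ring_def algebra_simps)


definition GL :: "(complex ^ 'n ^ 'n) monoid" where
  "GL = \<lparr>carrier = {A. invertible A}, mult = (**), one = mat 1\<rparr>"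

lemma group_GL: "group (GL :: (complex ^ 'n ^ 'n) monoid)"
proof (rule groupI)
  fix A :: "complex ^ 'n ^ 'n"
  assume "A \<in> carrier GL"
  then obtain B where "A ** B = mat 1" "B ** A = mat 1"
    by (auto simp: GL_def invertible_def)
  then show "\<exists>B\<in>carrier GL. B \<otimes>\<^bsub>GL\<^esub> A = \<one>\<^bsub>GL\<^esub>"
    by (auto simp: GL_def invertible_def)
next
  show "\<one>\<^bsub>GL\<^esub> \<in> carrier (GL :: (complex ^ 'n ^ 'n) monoid)"
    by (auto simp: GL_def invertible_def intro!: exI[of _ "mat 1"])
qed (auto simp: GL_def invertible_mult matrix_mul_assoc)

definition scalars :: "(complex ^ 'n ^ 'n) set" where
  "scalars = {mat c | c. c \<noteq> 0}"


text \<open>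
  The closed sets are the zero loci of polynomials in the matrix entries. Inverse powers of the
  determinant can be omitted, since it vanishes nowhere on \<open>GL(V)\<close>.
\<close>

definition matrix_polys :: "(complex ^ 'n ^ 'n \<Rightarrow> complex) set" where
  "matrix_polys = gen_algebra {(\<lambda>A. A $ i $ j) | i j. True}"

definition zariski :: "(complex ^ 'n ^ 'n) topology" where
  "zariski = topology (\<lambda>U. \<exists>F\<subseteq>matrix_polys. U = carrier GL - {A. \<forall>f\<in>F. f A = 0})"

lemma openin_zariski:
  fixes U :: "(complex ^ 'n ^ 'n) set"
  shows "openin zariski U \<longleftrightarrow> (\<exists>F\<subseteq>matrix_polys. U = carrier GL - {A. \<forall>f\<in>F. f A = 0})"
proof -
  let ?P = "\<lambda>U :: (complex ^ 'n ^ 'n) set.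
    \<exists>F\<subseteq>matrix_polys. U = carrier GL - {A. \<forall>f\<in>F. f A = 0}"
  have "istopology ?P"
    unfolding istopology_def
  proof (intro conjI allI impI)
    fix S T assume "?P S" "?P T"
    then obtain F1 F2 :: "(complex ^ 'n ^ 'n \<Rightarrow> complex) set" where F: "F1 \<subseteq> matrix_polys" "F2 \<subseteq> matrix_polys"
      and S: "S = carrier GL - {A. \<forall>f\<in>F1. f A = 0}"
      and T: "T = carrier GL - {A. \<forall>f\<in>F2. f A = 0}"
      by blast
    let ?F = "{(\<lambda>A. f A * g A) | f g. f \<in> F1 \<and> g \<in> F2}"
    have "?F \<subseteq> matrix_polys"
      using F unfolding matrix_polys_def by (blast intro: gen_algebra.mult)
    moreover have "S \<inter> T = carrier GL - {A. \<forall>f\<in>?F. f A = 0}"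
    proof (intro Set.set_eqI iffI)
      fix A assume "A \<in> S \<inter> T"
      then obtain f g where "A \<in> carrier GL" "f \<in> F1" "f A \<noteq> 0" "g \<in> F2" "g A \<noteq> 0"
        unfolding S T by auto
      moreover from this obtain k where "k \<in> ?F" "k A \<noteq> 0"
        by (intro that[of "\<lambda>A. f A * g A"]) auto
      ultimately show "A \<in> carrier GL - {A. \<forall>f\<in>?F. f A = 0}"
        by (intro DiffI notI) (simp_all only: mem_Collect_eq, fast)
    next
      fix A assume "A \<in> carrier GL - {A. \<forall>f\<in>?F. f A = 0}"
      then obtain f g where "A \<in> carrier GL" "f \<in> F1" "f A * g A \<noteq> 0" "g \<in> F2"
        by auto
      then show "A \<in> S \<inter> T"
        unfolding S T by auto
    qed
    ultimately show "?P (S \<inter> T)" by blast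
  next
    fix K assume "\<forall>S\<in>K. ?P S"
    from bchoice[OF this] obtain F where *: "\<forall>S\<in>K. F S \<subseteq> matrix_polys \<and>
      S = carrier GL - {A. \<forall>f\<in>F S. f A = 0}" ..
    have F: "F S \<subseteq> matrix_polys" "S = carrier GL - {A. \<forall>f\<in>F S. f A = 0}" if "S \<in> K" for S
      using bspec[OF * that] by blast+
    have "\<Union>K = carrier GL - {A. \<forall>f\<in>\<Union>(F ` K). f A = 0}"
    proof (intro Set.set_eqI iffI)
      fix A assume "A \<in> \<Union>K"
      then obtain S where "S \<in> K" "A \<in> S" by blast
      have "A \<in> carrier GL - {A. \<forall>f\<in>F S. f A = 0}"
        by (subst F(2)[OF \<open>S \<in> K\<close>, symmetric]) fact
      with \<open>S \<in> K\<close> show "A \<in> carrier GL - {A. \<forall>f\<in>\<Union>(F ` K). f A = 0}"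
        by auto
    next
      fix A assume "A \<in> carrier GL - {A. \<forall>f\<in>\<Union>(F ` K). f A = 0}"
      then obtain S f where "S \<in> K" "f \<in> F S" "f A \<noteq> 0" "A \<in> carrier GL"
        by auto
      then have "A \<in> S"
        by (subst F(2)[OF \<open>S \<in> K\<close>]) blast
      with \<open>S \<in> K\<close> show "A \<in> \<Union>K" by blast
    qed
    moreover have "\<Union>(F ` K) \<subseteq> matrix_polys"
      using F(1) by blast
    ultimately show "?P (\<Union>K)" by blast
  qed
  then show ?thesis
    unfolding zariski_def by (simp add: topology_inverse')
qed

definition linear_algebraic_group :: "(complex ^ 'n ^ 'n) set \<Rightarrow> bool" where
  "linear_algebraic_group G \<longleftrightarrow> subgroup G GL \<and> closedin zariski G"

definition identity_component :: "(complex ^ 'n ^ 'n) set \<Rightarrow> (complex ^ 'n ^ 'n) set" where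
  "identity_component G = connected_component_of_set (subtopology zariski G) (mat 1)"

text \<open>
  Powers of matrices are expressed by iterating the associated linear map, because \<open>^\<close> on
  \<open>complex ^ 'n ^ 'n\<close> is the componentwise power.
\<close>

definition unipotent :: "complex ^ 'n ^ 'n \<Rightarrow> bool" where
  "unipotent A \<longleftrightarrow> (\<exists>k. \<forall>v. ((\<lambda>w. (A - mat 1) *v w) ^^ k) v = 0)"

definition unipotent_radical :: "(complex ^ 'n ^ 'n) set \<Rightarrow> (complex ^ 'n ^ 'n) set" where
  "unipotent_radical G = (GREATEST U. linear_algebraic_group U \<and> connectedin zariski U \<and>
     U \<lhd> GL\<lparr>carrier := G\<rparr> \<and> (\<forall>A\<in>U. unipotent A))"

definition reductive :: "(complex ^ 'n ^ 'n) set \<Rightarrow> bool" where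
  "reductive G \<longleftrightarrow> linear_algebraic_group G \<and> unipotent_radical G = {mat 1}"

definition levi_subgroup :: "(complex ^ 'n ^ 'n) set \<Rightarrow> (complex ^ 'n ^ 'n) set \<Rightarrow> bool" where
  "levi_subgroup L K \<longleftrightarrow> reductive L \<and> L \<subseteq> K \<and>
     L \<inter> unipotent_radical K = {mat 1} \<and> L <#>\<^bsub>GL\<^esub> unipotent_radical K = K"

definition irreducible_module :: "(complex ^ 'n ^ 'n) set \<Rightarrow> bool" where
  "irreducible_module G \<longleftrightarrow> (UNIV :: (complex ^ 'n) set) \<noteq> {0} \<and>
     (\<forall>W :: (complex ^ 'n) set. vec.subspace W \<and> (\<forall>g\<in>G. \<forall>w\<in>W. g *v w \<in> W) \<longrightarrow> W = {0} \<or> W = UNIV)"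


definition invariants :: "(complex ^ 'n ^ 'n) set \<Rightarrow> (complex ^ 'n \<Rightarrow> complex) set" where
  "invariants G = {f \<in> carrier poly_ring. \<forall>g\<in>G. f \<circ> (*v) g = f}"

definition invariants_plus :: "(complex ^ 'n ^ 'n) set \<Rightarrow> (complex ^ 'n \<Rightarrow> complex) set" where
  "invariants_plus G = {f \<in> invariants G. f 0 = 0}"

definition null_ideal :: "(complex ^ 'n ^ 'n) set \<Rightarrow> (complex ^ 'n \<Rightarrow> complex) set" where
  "null_ideal G = Idl\<^bsub>poly_ring\<^esub> (invariants_plus G)"

definition G\<^sub>0 :: "(complex ^ 'n ^ 'n) set \<Rightarrow> (complex ^ 'n ^ 'n) set" where
  "G\<^sub>0 G = {g \<in> carrier GL. \<forall>f\<in>invariants G. f \<circ> (*v) g = f}"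

definition H\<^sub>0 :: "(complex ^ 'n ^ 'n) set \<Rightarrow> (complex ^ 'n ^ 'n) set" where
  "H\<^sub>0 G = {h \<in> carrier GL. (\<lambda>f. f \<circ> (*v) h) ` null_ideal G = null_ideal G}"

end

theory Submission
  imports Defs "HOL-Computational_Algebra.Fundamental_Theorem_Algebra" "Jordan_Normal_Form.Determinant"
begin

text \<open>
  By Kolchin's theorem an irreducible linear group has no nontrivial normal unipotent subgroup, so
  \<open>G = G\<^sub>0\<close> and \<open>H = H\<^sub>0\<close> are reductive. The representation of \<open>GL(V)\<close> on the polynomials of bounded
  degree is treated as in Kempf and Ness: for a subspace \<open>A\<close> of polynomials with irreducible
  stabilizer, the volume of \<open>g A\<close> attains its minimum on \<open>{g. \<bar>det g\<bar> = 1}\<close>, and at a minimum the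
  stabilizer of \<open>A\<close> is self-adjoint for the transported Hermitian form. For \<open>A\<close> the elements
  of bounded degree in the ideal this makes \<open>H\<^sub>0\<close> completely reducible; a complement stable under \<open>H\<^sub>0\<close> consists of
  invariants of \<open>G\<close> and by Hilbert's argument generates the algebra \<open>R\<^sup>G\<close>, so \<open>H\<^sub>0\<close> preserves \<open>R\<^sup>G\<close>.
  For \<open>A\<close> the space of invariants of degree at most \<open>N\<close>, \<open>N\<close> large, Schur's lemma shows that the Lie
  algebra of the stabilizer of \<open>A\<close> is that of \<open>G\<close> plus the scalars. Polar decomposition and compactness
  of the unitary part then cover \<open>H\<close> by finitely many cosets of \<open>\<complex>\<^sup>* G\<^sup>0\<close>. As \<open>\<complex>\<^sup>* G\<^sup>0\<close> is Zariski closed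
  and connected, it is \<open>H\<^sup>0\<close>.
\<close>

no_notation Matrix.vec_index (infixl "$" 100)
no_notation Matrix.scalar_prod (infix "\<bullet>" 70)
hide_const (open) Module.smult Matrix.mat Matrix.vec Determinant.det Matrix.row Matrix.col
hide_fact (open) Matrix.mat_def Matrix.vec_eq_iff Determinant.det_def Determinant.det_transpose

section \<open>Hermitian linear algebra\<close>

text \<open>The infimum of \<open>VF\<close> could be approached only at infinity, although
  \<open>ln VF\<close> decreases at most logarithmically in \<open>norm g\<close>. Hence
  \<open>ln VF + e * (norm g)^2\<close> is minimized for \<open>e\<close> tending to 0. If these
  minimizers escape, their normalized limit \<open>l\<close> is nonzero and singular, and
  log-convexity on the paths joining \<open>g\<close> to \<open>\<gamma> ** g\<close> makes the
  range of \<open>l\<close> stable under the irreducible stabilizer, which is absurd. Each inner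
  product lives in one degree bound \<open>N\<close>, and a position that is good for one
  \<open>N\<close> is not known to be good for another. So self-adjointness is used for the fixer of
  the invariants of degree at most \<open>N\<close> instead of \<open>G\<close>, and the passage to
  all invariants uses that the Lie algebras \<open>liek G N\<close> decrease with \<open>N\<close>
  and become constant. Exponentials are formed of diagonalizable matrices: positive polar factors
  and unitary matrices near 1 lead to nothing else. Closedness of
  \<open>\<complex>\<^sup>* G\<^sup>0\<close> comes from a homogeneous invariant of positive degree;
  if there is none, \<open>G\<close> is all of \<open>GL\<close>.\<close>

definition cdot :: "complex ^ 'n \<Rightarrow> complex ^ 'n \<Rightarrow> complex" where
  "cdot u v = (\<Sum>i\<in>UNIV. u $ i * cnj (v $ i))"

definition adj :: "complex ^ 'n ^ 'm \<Rightarrow> complex ^ 'm ^ 'n" where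
  "adj A = (\<chi> i j. cnj (A $ j $ i))"

definition unitary :: "complex ^ 'n ^ 'n \<Rightarrow> bool" where
  "unitary k \<longleftrightarrow> adj k ** k = mat 1"

definition diagm :: "('n \<Rightarrow> complex) \<Rightarrow> complex ^ 'n ^ 'n" where
  "diagm d = (\<chi> i j. if i = j then d i else 0)"

lemma cdot_simps:
  "cdot (u + v) w = cdot u w + cdot v w" "cdot (u - v) w = cdot u w - cdot v w"
  "cdot (c *s u) w = c * cdot u w" "cdot w (u + v) = cdot w u + cdot w v"
  "cdot w (u - v) = cdot w u - cdot w v" "cdot w (c *s u) = cnj c * cdot w u"
  "cdot 0 w = 0" "cdot w 0 = 0"
  by (simp_all add: cdot_def algebra_simps sum.distrib sum_subtractf sum_distrib_left)

lemma cdot_sum_left: "cdot (\<Sum>i\<in>S. f i) w = (\<Sum>i\<in>S. cdot (f i) w)"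
  by (induction S rule: infinite_finite_induct) (auto simp: cdot_simps)

lemma cnj_cdot: "cnj (cdot u v) = cdot v u"
  by (simp add: cdot_def mult.commute)

lemma cdot_self: "cdot v v = of_real ((norm v)\<^sup>2)"
  by (simp add: cdot_def norm_vec_def L2_set_def sum_nonneg complex_mult_cnj cmod_power2)

lemma cdot_self_eq_0 [simp]: "cdot v v = 0 \<longleftrightarrow> v = 0"
  by (simp add: cdot_self)

lemma adj_adj [simp]: "adj (adj A) = A"
  by (simp add: adj_def vec_eq_iff)

lemma adj_mult: "adj (A ** B) = adj B ** adj A"
  by (simp add: adj_def matrix_matrix_mult_def vec_eq_iff mult.commute)

lemma adj_mat [simp]: "adj (mat c) = mat (cnj c)"
  by (auto simp: adj_def mat_def vec_eq_iff)

lemma adj_diagm: "adj (diagm d) = diagm (\<lambda>i. cnj (d i))"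
  by (auto simp: adj_def diagm_def vec_eq_iff)

lemma diagm_mult: "diagm c ** diagm d = diagm (\<lambda>i. c i * d i)"
  by (auto simp: diagm_def matrix_matrix_mult_def vec_eq_iff if_distrib[where f = "\<lambda>x. x * _"] cong: if_cong)

lemma mat_eq_diagm: "mat c = diagm (\<lambda>_. c)"
  by (simp add: mat_def diagm_def)

lemma diagm_vec: "(diagm d *v v) $ i = d i * v $ i"
  by (simp add: diagm_def matrix_vector_mult_def if_distrib[where f = "\<lambda>x. x * _"] cong: if_cong)

lemma mult_diagm: "(A ** diagm d) $ i $ j = A $ i $ j * d j"
  by (simp add: diagm_def matrix_matrix_mult_def if_distrib[where f = "\<lambda>x. _ * x"] cong: if_cong)

lemma mat_mult_eq: "(mat c ** A) $ i $ j = c * A $ i $ j"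
  by (simp add: mat_def matrix_matrix_mult_def if_distrib[where f = "\<lambda>x. x * _"] cong: if_cong)

lemma mat_mult_commute: "mat c ** A = A ** mat (c::complex)"
  by (simp add: vec_eq_iff mat_mult_eq mult_diagm[of A "\<lambda>_. c", folded mat_eq_diagm] mult.commute)

lemma mat_mult_vec: "mat c *v v = c *s (v :: complex ^ 'n)"
  by (simp add: vec_eq_iff mat_eq_diagm diagm_vec)

lemma mat_mult_mat: "mat c ** mat d = (mat (c * d) :: complex ^ 'n ^ 'n)"
  by (simp add: mat_eq_diagm diagm_mult)

lemma cdot_matrix: "cdot (A *v u) v = cdot u (adj A *v v)"
  unfolding cdot_def matrix_vector_mult_def adj_def
  by (simp add: sum_distrib_left sum_distrib_right mult.assoc, subst sum.swap)
     (simp add: mult_ac)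

lemma unitaryD: "unitary k \<Longrightarrow> adj k ** k = mat 1" "unitary k \<Longrightarrow> k ** adj k = mat 1"
  unfolding unitary_def using matrix_left_right_inverse by auto

lemma unitary_adj: "unitary k \<Longrightarrow> unitary (adj k)"
  using unitaryD(2)[of k] by (simp add: unitary_def)

lemma unitary_mult: "unitary k \<Longrightarrow> unitary l \<Longrightarrow> unitary (k ** l)"
  unfolding unitary_def adj_mult
  by (metis (no_types, lifting) matrix_mul_assoc matrix_mul_lid)

lemma unitary_mat_1 [simp]: "unitary (mat 1)"
  by (simp add: unitary_def)

lemma unitary_invertible: "unitary k \<Longrightarrow> invertible k"
  using unitaryD invertible_def by blast

lemma norm_matrix_cols: "(norm A)\<^sup>2 = (\<Sum>j\<in>UNIV. (norm (column j A))\<^sup>2)" for A :: "complex ^ 'n ^ 'm"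
proof -
  have "(norm A)\<^sup>2 = (\<Sum>i\<in>UNIV. \<Sum>j\<in>UNIV. (cmod (A $ i $ j))\<^sup>2)"
    by (simp add: norm_vec_def L2_set_def sum_nonneg)
  also have "\<dots> = (\<Sum>j\<in>UNIV. \<Sum>i\<in>UNIV. (cmod (A $ i $ j))\<^sup>2)"
    by (rule sum.swap)
  also have "\<dots> = (\<Sum>j\<in>UNIV. (norm (column j A))\<^sup>2)"
    by (simp add: norm_vec_def L2_set_def sum_nonneg column_def)
  finally show ?thesis .
qed

lemma norm_matrix_entries: "(norm A)\<^sup>2 = (\<Sum>i\<in>UNIV. \<Sum>j\<in>UNIV. (cmod (A $ i $ j))\<^sup>2)" for A :: "complex ^ 'n ^ 'm"
  by (simp add: norm_vec_def L2_set_def sum_nonneg)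

lemma norm_adj [simp]: "norm (adj A) = norm A"
proof -
  have "(norm (adj A))\<^sup>2 = (norm A)\<^sup>2"
    unfolding norm_matrix_entries by (subst sum.swap) (simp add: adj_def)
  then show ?thesis by simp
qed

lemma norm_unitary_vec: "unitary k \<Longrightarrow> norm (k *v v) = norm v"
proof -
  assume k: "unitary k"
  have "cdot (k *v v) (k *v v) = cdot v v"
    by (simp add: cdot_matrix matrix_vector_mul_assoc unitaryD[OF k])
  then have "(norm (k *v v))\<^sup>2 = (norm v)\<^sup>2"
    unfolding cdot_self of_real_eq_iff .
  then show ?thesis by simp
qed

lemma column_mult: "column j (A ** B) = A *v column j B"
  by (simp add: column_def matrix_matrix_mult_def matrix_vector_mult_def vec_eq_iff)

lemma norm_unitary_mult: "unitary k \<Longrightarrow> norm (k ** A) = norm A"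
proof -
  assume k: "unitary k"
  have "(norm (k ** A))\<^sup>2 = (norm A)\<^sup>2"
    unfolding norm_matrix_cols by (simp add: column_mult norm_unitary_vec[OF k])
  then show ?thesis by simp
qed

lemma norm_mult_unitary: "unitary k \<Longrightarrow> norm (A ** k) = norm A"
  by (metis adj_mult norm_adj norm_unitary_mult unitary_adj)

lemma norm_matrix_vec_le: "norm (A *v v) \<le> norm A * norm v" for A :: "complex ^ 'n ^ 'm"
proof -
  have "norm ((A *v v) $ i) \<le> norm (A $ i) * norm v" for i
  proof -
    have "norm ((A *v v) $ i) \<le> (\<Sum>j\<in>UNIV. \<bar>cmod (A $ i $ j)\<bar> * \<bar>cmod (v $ j)\<bar>)"
      unfolding matrix_vector_mult_def by (simp, rule order_trans[OF norm_sum]) (simp add: norm_mult)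
    also have "\<dots> \<le> norm (A $ i) * norm v"
      unfolding norm_vec_def by (rule L2_set_mult_ineq)
    finally show ?thesis .
  qed
  then have "L2_set (\<lambda>i. norm ((A *v v) $ i)) UNIV \<le> L2_set (\<lambda>i. norm (A $ i) * norm v) UNIV"
    by (intro L2_set_mono) auto
  also have "\<dots> = norm A * norm v"
    by (subst norm_vec_def[of A]) (simp add: L2_set_left_distrib)
  finally show ?thesis by (simp add: norm_vec_def[of "A *v v"])
qed

lemma det_diagm: "det (diagm d) = (\<Prod>i\<in>UNIV. d i)"
  by (subst det_diagonal) (auto simp: diagm_def)

lemma det_adj: "det (adj A) = cnj (det A)"
proof -
  have "det (adj A) = det (\<chi> i j. cnj (A $ i $ j))"
    by (subst det_transpose[symmetric]) (simp add: adj_def transpose_def)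
  also have "\<dots> = cnj (det A)"
    by (simp add: det_def)
  finally show ?thesis .
qed

lemma cmod_det_unitary: "unitary k \<Longrightarrow> cmod (det k) = 1"
proof -
  assume "unitary k"
  then have "det (adj k ** k) = 1" by (simp add: unitary_def)
  then have "cnj (det k) * det k = 1" by (simp add: det_mul det_adj)
  then have "cmod (cnj (det k) * det k) = 1" by simp
  then have "cmod (det k) * cmod (det k) = 1" by (simp add: norm_mult)
  then show ?thesis
    by (metis abs_norm_cancel abs_square_eq_1 power2_eq_square)
qed

lemma continuous_on_matrix_mult [continuous_intros]:
  fixes f g :: "'a :: topological_space \<Rightarrow> complex ^ 'n ^ 'n"
  shows "continuous_on S f \<Longrightarrow> continuous_on S g \<Longrightarrow> continuous_on S (\<lambda>x. f x ** g x)"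
  unfolding matrix_matrix_mult_def by (intro continuous_intros)

lemma continuous_on_det [continuous_intros]:
  fixes f :: "'a :: topological_space \<Rightarrow> complex ^ 'n ^ 'n"
  shows "continuous_on S f \<Longrightarrow> continuous_on S (\<lambda>x. det (f x))"
  unfolding det_def by (intro continuous_intros)

text \<open>For a nonzero \<open>v\<close> in \<open>U\<close>, take a nonzero polynomial
  \<open>q\<close> of least degree with \<open>q(P) v = 0\<close>. Splitting off a root
  \<open>z\<close> of \<open>q\<close> leaves \<open>r\<close> with \<open>r(P) v\<close> nonzero by
  minimality, and \<open>P - z\<close> kills that vector, which lies in \<open>U\<close>.\<close>

lemma eigenvector_exists:
  fixes P :: "complex ^ 'n ^ 'n"
  assumes U: "vec.subspace U" and ne: "U \<noteq> {0}" and stable: "\<And>v. v \<in> U \<Longrightarrow> P *v v \<in> U"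
  obtains v c where "v \<in> U" "v \<noteq> 0" "P *v v = c *s v"
proof -
  obtain v where v: "v \<in> U" "v \<noteq> 0"
    using ne vec.subspace_0[OF U] by auto
  define pw where "pw i = ((*v) P ^^ i) v" for i
  have pw_Suc: "pw (Suc i) = P *v pw i" for i by (simp add: pw_def)
  have pwU: "pw i \<in> U" for i
    by (induction i) (auto simp: pw_Suc stable, simp add: pw_def v)
  define ev where "ev q = (\<Sum>i<Suc (degree q). coeff q i *s pw i)" for q
  have ev_eq: "ev q = (\<Sum>i<m. coeff q i *s pw i)" if "degree q < m" for q m
    unfolding ev_def using that
    by (intro sum.mono_neutral_left) (auto simp: not_less_eq coeff_eq_0)
  have evU: "ev q \<in> U" for q
    unfolding ev_def by (intro vec.subspace_sum vec.subspace_scale U pwU)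
  have ev_diff: "ev (p - q) = ev p - ev q" for p q
  proof -
    define m where "m = Suc (max (degree p) (degree q))"
    have "degree (p - q) < m" "degree p < m" "degree q < m"
      using degree_diff_le_max[of p q] by (auto simp: m_def)
    then show ?thesis
      by (simp add: ev_eq[of _ m] sum_subtractf vec.scale_left_diff_distrib)
  qed
  have ev_smult: "ev (smult c q) = c *s ev q" for c q
    using ev_eq[of "smult c q" "Suc (degree q)"] degree_smult_le[of c q]
    by (simp add: ev_eq[of q "Suc (degree q)"] vec.scale_sum_right del: sum.lessThan_Suc)
  have ev_pCons: "ev (pCons a q) = a *s v + P *v ev q" for a q
  proof -
    have "degree (pCons a q) < Suc (Suc (degree q))"
      using degree_pCons_le[of a q] by simp
    then have "ev (pCons a q) = (\<Sum>i<Suc (Suc (degree q)). coeff (pCons a q) i *s pw i)"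
      by (rule ev_eq)
    also have "\<dots> = a *s v + (\<Sum>i<Suc (degree q). coeff q i *s pw (Suc i))"
      by (subst sum.lessThan_Suc_shift) (simp add: pw_def del: sum.lessThan_Suc)
    also have "(\<Sum>i<Suc (degree q). coeff q i *s pw (Suc i)) = P *v ev q"
      unfolding ev_def pw_Suc by (simp only: vec.linear_sum vec.linear_scale matrix_vector_mul_linear_gen mult.commute vec.scale_scale vec.linear_sum[OF matrix_vector_mul_linear_gen] vec.linear_scale[OF matrix_vector_mul_linear_gen])
    finally show ?thesis .
  qed
  have "\<exists>q. q \<noteq> 0 \<and> ev q = 0"
  proof (cases "inj_on pw {..CARD('n)}")
    case False
    then obtain i j where ij: "i \<noteq> j" "pw i = pw j" by (auto simp: inj_on_def)
    have ev_monom: "ev (monom 1 i) = pw i" for i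
    proof -
      have "ev (monom 1 i) = (\<Sum>j<Suc i. coeff (monom 1 i) j *s pw j)"
        by (rule ev_eq) (simp add: degree_monom_eq)
      also have "\<dots> = (\<Sum>j<Suc i. if j = i then pw j else 0)"
        by (rule sum.cong) auto
      finally show ?thesis by simp
    qed
    have "ev (monom 1 i - monom 1 j) = 0"
      by (simp add: ev_diff ev_monom ij)
    moreover have "coeff (monom 1 i - monom 1 j :: complex poly) i = 1" using ij by simp
    then have "monom 1 i - monom 1 j \<noteq> (0 :: complex poly)" by (metis coeff_0 zero_neq_one)
    ultimately show ?thesis by blast
  next
    case True
    \<comment> \<open>The index 0 is included, so these are \<open>CARD('n) + 1\<close> distinct
      vectors.\<close>
    have "vec.dependent (pw ` {..CARD('n)})"
    proof (rule ccontr)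
      assume "\<not> vec.dependent (pw ` {..CARD('n)})"
      then have "card (pw ` {..CARD('n)}) \<le> vec.dim (UNIV :: (complex ^ 'n) set)"
        using vec.independent_card_le_dim[of _ "UNIV :: (complex ^ 'n) set"] by blast
      with True show False by (simp add: card_image vec.dim_UNIV card_cart_basis)
    qed
    then obtain u w where u: "w \<in> pw ` {..CARD('n)}" "u w \<noteq> 0" "(\<Sum>v\<in>pw ` {..CARD('n)}. u v *s v) = 0"
      unfolding vec.dependent_finite[OF finite_imageI[OF finite_atMost]] by blast
    then obtain i0 where i0: "i0 \<le> CARD('n)" "w = pw i0" by auto
    define q where "q = (\<Sum>i\<le>CARD('n). monom (u (pw i)) i)"
    have cq: "coeff q i = (if i \<le> CARD('n) then u (pw i) else 0)" for i
      by (simp add: q_def coeff_sum coeff_monom)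
    have "ev q = (\<Sum>i<Suc (max (degree q) CARD('n)). coeff q i *s pw i)"
      by (rule ev_eq) simp
    also have "\<dots> = (\<Sum>i\<le>CARD('n). u (pw i) *s pw i)"
      by (intro sum.mono_neutral_cong_right) (auto simp: cq)
    also have "\<dots> = 0"
      using u(3) sum.reindex[OF True, of "\<lambda>v. u v *s v"] by simp
    finally have "ev q = 0" .
    moreover have "q \<noteq> 0" using u(2) i0 cq[of i0] by auto
    ultimately show ?thesis by blast
  qed
  then obtain q where q: "q \<noteq> 0" "ev q = 0"
    and least: "\<And>r. r \<noteq> 0 \<Longrightarrow> ev r = 0 \<Longrightarrow> degree q \<le> degree r"
    using exists_least_iff[of "\<lambda>d. \<exists>q. q \<noteq> 0 \<and> ev q = 0 \<and> degree q = d"]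
    by (metis linorder_not_less)
  have "degree q \<noteq> 0"
  proof
    assume "degree q = 0"
    then obtain c where "q = [:c:]" by (meson degree_eq_zeroE)
    with q v ev_pCons[of c 0] show False by (simp add: ev_def)
  qed
  then have "\<not> constant (poly q)"
    by (simp add: constant_degree)
  then obtain z where "poly q z = 0"
    using fundamental_theorem_of_algebra by blast
  then obtain r where r: "q = [:- z, 1:] * r"
    by (metis poly_eq_0_iff_dvd dvdE)
  then have "r \<noteq> 0" using q by auto
  then have "degree q = Suc (degree r)"
    unfolding r by (subst degree_mult_eq) auto
  with least[OF \<open>r \<noteq> 0\<close>] have evr: "ev r \<noteq> 0" by auto
  have "q = pCons 0 r - smult z r" unfolding r by simp
  then have "P *v ev r = z *s ev r"
    using q(2) by (simp add: ev_diff ev_smult ev_pCons)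
  with that[OF evU evr] show ?thesis .
qed


text \<open>Carrying the eigenvectors of \<open>adj P\<close> along in the induction makes the
  orthogonal complement of the vectors found so far stable under \<open>P\<close>, so that it
  contains a further eigenvector.\<close>

lemma normal_orthonormal_eigenvectors:
  fixes P :: "complex ^ 'n ^ 'n"
  assumes normal: "adj P ** P = P ** adj P" and "m \<le> CARD('n)"
  shows "\<exists>v d. (\<forall>i<m. P *v v i = d i *s v i \<and> adj P *v v i = cnj (d i) *s v i) \<and>
     (\<forall>i<m. \<forall>j<m. cdot (v i) (v j) = (if i = j then 1 else 0))"
  using assms(2)
proof (induction m)
  case 0
  then show ?case by simp
next
  case (Suc m)
  then obtain v d where eig: "\<And>i. i < m \<Longrightarrow> P *v v i = d i *s v i \<and> adj P *v v i = cnj (d i) *s v i"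
    and on: "\<And>i j. i < m \<Longrightarrow> j < m \<Longrightarrow> cdot (v i) (v j) = (if i = j then 1 else 0)"
    by (metis Suc_leD)
  define U where "U = {w. \<forall>i<m. cdot w (v i) = 0}"
  have sub: "vec.subspace U"
    by (rule vec.subspaceI) (auto simp: U_def cdot_simps)
  have "vec.dim (vec.span (v ` {..<m})) \<le> card (v ` {..<m})"
    by (metis finite_imageI finite_lessThan vec.dim_le_card vec.span_superset vec.dim_span order_refl)
  also have "\<dots> \<le> m" using card_image_le[of "{..<m}" v] by simp
  also have "\<dots> < vec.dim (UNIV :: (complex ^ 'n) set)" using Suc.prems by (simp add: vec.dim_UNIV card_cart_basis)
  finally have "vec.span (v ` {..<m}) \<noteq> UNIV" by (metis less_irrefl)
  then obtain x where x: "x \<notin> vec.span (v ` {..<m})" by blast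
  define y where "y = x - (\<Sum>i<m. cdot x (v i) *s v i)"
  have "(\<Sum>i<m. cdot x (v i) *s v i) \<in> vec.span (v ` {..<m})"
    by (intro vec.span_sum vec.span_scale vec.span_base) auto
  with x have "y \<noteq> 0" by (auto simp: y_def)
  moreover have "y \<in> U"
    by (auto simp: U_def y_def cdot_simps cdot_sum_left on if_distrib[where f = "\<lambda>z. _ * z"] cong: if_cong)
  ultimately have "U \<noteq> {0}" by blast
  moreover have "P *v w \<in> U" if "w \<in> U" for w
    using that eig by (auto simp: U_def cdot_matrix cdot_simps)
  ultimately obtain w c where w: "w \<in> U" "w \<noteq> 0" "P *v w = c *s w"
    using eigenvector_exists[OF sub] by metis
  define z where "z = of_real (1 / norm w) *s w"
  have zU: "z \<in> U" unfolding z_def by (intro vec.subspace_scale sub w)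
  have zz: "cdot z z = 1"
    using w(2) unfolding z_def cdot_simps by (simp add: cdot_self power2_eq_square)
  have Pz: "P *v z = c *s z"
    by (simp add: z_def matrix_vector_mult_scaleR w(3) vec.scale_scale mult.commute vec.linear_scale[OF matrix_vector_mul_linear_gen])
  \<comment> \<open>Normality gives \<open>adj P *v z\<close> the norm of \<open>P *v z\<close>;
    together with its product with \<open>z\<close> this makes the distance to
    \<open>cnj c *s z\<close> vanish.\<close>
  have "cdot (adj P *v z) (adj P *v z) = cdot (P *v z) (P *v z)"
    using normal by (simp add: cdot_matrix matrix_vector_mul_assoc)
  moreover have "cdot z (adj P *v z) = c"
    using cdot_matrix[of P z z] by (simp add: Pz cdot_simps zz)
  ultimately have "cdot (adj P *v z - cnj c *s z) (adj P *v z - cnj c *s z) = 0"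
    by (simp add: cdot_simps cdot_matrix Pz zz)
  then have aPz: "adj P *v z = cnj c *s z"
    by simp
  have oz: "cdot z (v i) = 0" "cdot (v i) z = 0" if "i < m" for i
    using zU that by (auto simp: U_def) (metis cnj_cdot complex_cnj_zero)
  show ?case
    by (rule exI[of _ "v(m := z)"], rule exI[of _ "d(m := c)"])
       (auto simp: less_Suc_eq eig on oz zz Pz aPz)
qed

lemma spectral_normal:
  fixes P :: "complex ^ 'n ^ 'n"
  assumes normal: "adj P ** P = P ** adj P"
  obtains k d where "unitary k" "P = k ** diagm d ** adj k"
proof -
  obtain v d where eig: "\<And>i. i < CARD('n) \<Longrightarrow> P *v v i = d i *s v i"
    and on: "\<And>i j. i < CARD('n) \<Longrightarrow> j < CARD('n) \<Longrightarrow> cdot (v i) (v j) = (if i = j then 1 else 0)"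
    using normal_orthonormal_eigenvectors[OF normal order_refl] by blast
  obtain e :: "'n \<Rightarrow> nat" where "bij_betw e UNIV {0..<CARD('n)}"
    using ex_bij_betw_finite_nat[of "UNIV :: 'n set"] by auto
  then have e: "inj e" "e i < CARD('n)" for i
    by (auto simp: bij_betw_def)
  define k where "k = (\<chi> i j. v (e j) $ i)"
  have colk: "column j k = v (e j)" for j
    by (simp add: k_def column_def vec_eq_iff)
  have "(adj k ** k) $ a $ b = cdot (v (e b)) (v (e a))" for a b
    by (simp add: matrix_matrix_mult_def adj_def k_def cdot_def mult.commute)
  then have k: "unitary k"
    unfolding unitary_def using e by (auto simp: vec_eq_iff mat_def on inj_eq)
  have "column j (P ** k) = column j (k ** diagm (\<lambda>i. d (e i)))" for j
    unfolding column_mult[of j P] colk using eig[OF e(2)]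
    by (simp add: vec_eq_iff column_def mult_diagm k_def mult.commute)
  then have "P ** k = k ** diagm (\<lambda>i. d (e i))"
    by (simp add: column_def vec_eq_iff)
  then have "P ** (k ** adj k) = k ** diagm (\<lambda>i. d (e i)) ** adj k"
    by (simp add: matrix_mul_assoc)
  with k that show ?thesis by (simp add: unitaryD)
qed

text \<open>If \<open>k\<close> diagonalizes \<open>adj M ** M\<close>, the columns of
  \<open>M ** k\<close> are orthogonal. Their lengths are the singular values, and normalizing them
  gives the other unitary factor.\<close>

lemma svd:
  fixes M :: "complex ^ 'n ^ 'n"
  assumes "invertible M"
  obtains k l d where "unitary k" "unitary l" "\<And>i. d i > (0 :: real)"
    "M = k ** diagm (\<lambda>i. of_real (d i)) ** l"
proof -
  define P where "P = adj M ** M"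
  have "adj P = P" by (simp add: P_def adj_mult)
  then obtain k c where k: "unitary k" and P: "P = k ** diagm c ** adj k"
    using spectral_normal[of P] by auto
  have "adj k ** P ** k = (adj k ** k) ** diagm c ** (adj k ** k)"
    unfolding P by (simp add: matrix_mul_assoc)
  then have kPk: "adj (M ** k) ** (M ** k) = diagm c"
    by (simp add: P_def unitaryD[OF k] adj_mult matrix_mul_assoc)
  have inv: "invertible (M ** k)"
    by (intro invertible_mult assms unitary_invertible k)
  define d where "d i = norm (column i (M ** k))" for i
  have c: "c i = of_real ((d i)\<^sup>2)" for i
  proof -
    have "c i = diagm c $ i $ i" by (simp add: diagm_def)
    also have "\<dots> = cdot (column i (M ** k)) (column i (M ** k))"
      unfolding kPk[symmetric] by (simp add: matrix_matrix_mult_def adj_def cdot_def column_def mult.commute)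
    finally show ?thesis by (simp add: cdot_self d_def)
  qed
  have dpos: "d i > 0" for i
  proof -
    have "column i (M ** k) \<noteq> 0"
    proof
      assume "column i (M ** k) = 0"
      then have "det (M ** k) = 0" by (intro det_zero_column(1)[of i]) (simp add: column_def)
      with inv show False by (simp add: invertible_det_nz)
    qed
    then show ?thesis by (simp add: d_def)
  qed
  define l where "l = M ** k ** diagm (\<lambda>i. of_real (1 / d i))"
  have dd: "diagm (\<lambda>i. complex_of_real (1 / d i)) ** diagm (\<lambda>i. of_real (d i)) = mat 1"
    using dpos by (simp add: diagm_mult mat_eq_diagm less_imp_neq[THEN not_sym])
  have "adj l ** l = diagm (\<lambda>i. of_real (1 / d i)) ** (adj (M ** k) ** (M ** k)) ** diagm (\<lambda>i. of_real (1 / d i))"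
    by (simp add: l_def adj_mult adj_diagm matrix_mul_assoc)
  also have "\<dots> = mat 1"
    unfolding kPk using dpos by (simp add: diagm_mult mat_eq_diagm c power2_eq_square less_imp_neq[THEN not_sym])
  finally have l: "unitary l" by (simp add: unitary_def)
  have "l ** diagm (\<lambda>i. of_real (d i)) ** adj k = M ** k ** (diagm (\<lambda>i. complex_of_real (1 / d i)) ** diagm (\<lambda>i. of_real (d i))) ** adj k"
    by (simp add: l_def matrix_mul_assoc)
  also have "\<dots> = M ** (k ** adj k)"
    unfolding dd by (simp add: matrix_mul_assoc)
  finally have "M = l ** diagm (\<lambda>i. of_real (d i)) ** adj k"
    by (simp add: unitaryD[OF k])
  with l unitary_adj[OF k] dpos that show ?thesis by blast
qed

text \<open>An eigenspace of \<open>M\<close> is stable under everything that commutes with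
  \<open>M\<close>, hence is the whole space.\<close>

lemma schur_scalar:
  fixes M :: "complex ^ 'n ^ 'n"
  assumes irr: "irreducible_module G" and comm: "\<And>g. g \<in> G \<Longrightarrow> g ** M = M ** g"
  obtains c where "M = mat c"
proof -
  have "(UNIV :: (complex ^ 'n) set) \<noteq> {0}" using irr by (simp add: irreducible_module_def)
  then obtain v c where v: "v \<noteq> 0" "M *v v = c *s v"
    using eigenvector_exists[OF vec.subspace_UNIV, of M] by auto
  define W where "W = {w. M *v w = c *s w}"
  have "vec.subspace W"
    by (rule vec.subspaceI)
       (auto simp: W_def matrix_vector_right_distrib vec.scale_right_distrib vec.scale_scale mult.commute
         vec.linear_scale[OF matrix_vector_mul_linear_gen])
  moreover have "g *v w \<in> W" if "g \<in> G" "w \<in> W" for g w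
    using that comm[OF that(1)]
    by (simp add: W_def matrix_vector_mul_assoc flip: comm[OF that(1)])
       (simp add: vec.linear_scale[OF matrix_vector_mul_linear_gen] flip: matrix_vector_mul_assoc)
  ultimately have "W = {0} \<or> W = UNIV"
    using irr by (simp add: irreducible_module_def)
  moreover have "v \<in> W" using v by (simp add: W_def)
  ultimately have "W = UNIV" using v by auto
  then have "M *v w = mat c *v w" for w
    unfolding mat_mult_vec using W_def by blast
  then have "M = mat c" by (simp add: matrix_eq)
  with that show ?thesis .
qed

section \<open>Kolchin's theorem\<close>

text \<open>The index type carries no order, so triangularity is relative to an enumeration
  \<open>e\<close>.\<close>

definition upper_tri :: "('n \<Rightarrow> nat) \<Rightarrow> complex ^ 'n ^ 'n \<Rightarrow> bool" where
  "upper_tri e T \<longleftrightarrow> (\<forall>i j. e j < e i \<longrightarrow> T $ i $ j = 0)"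

text \<open>The next vector is an eigenvector of \<open>P\<close> followed by the projection
  \<open>pr\<close> onto the orthogonal complement of its predecessors; so \<open>P\<close> maps it
  into the span of itself and them.\<close>

lemma schur_flag:
  fixes P :: "complex ^ 'n ^ 'n"
  assumes "m \<le> CARD('n)"
  shows "\<exists>v. (\<forall>i<m. \<forall>j<m. cdot (v i) (v j) = (if i = j then 1 else 0)) \<and>
     (\<forall>j<m. P *v v j = (\<Sum>i\<le>j. cdot (P *v v j) (v i) *s v i))"
  using assms
proof (induction m)
  case 0
  then show ?case by simp
next
  case (Suc m)
  then obtain v where on: "\<And>i j. i < m \<Longrightarrow> j < m \<Longrightarrow> cdot (v i) (v j) = (if i = j then 1 else 0)"
    and fl: "\<And>j. j < m \<Longrightarrow> P *v v j = (\<Sum>i\<le>j. cdot (P *v v j) (v i) *s v i)"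
    by (metis Suc_leD)
  define U where "U = {w. \<forall>i<m. cdot w (v i) = 0}"
  have sub: "vec.subspace U"
    by (rule vec.subspaceI) (auto simp: U_def cdot_simps)
  have "vec.dim (vec.span (v ` {..<m})) \<le> card (v ` {..<m})"
    by (metis finite_imageI finite_lessThan vec.dim_le_card vec.span_superset vec.dim_span order_refl)
  also have "\<dots> \<le> m" using card_image_le[of "{..<m}" v] by simp
  also have "\<dots> < vec.dim (UNIV :: (complex ^ 'n) set)" using Suc.prems by (simp add: vec.dim_UNIV card_cart_basis)
  finally have "vec.span (v ` {..<m}) \<noteq> UNIV" by (metis less_irrefl)
  then obtain x where x: "x \<notin> vec.span (v ` {..<m})" by blast
  define pr where "pr x = x - (\<Sum>i<m. cdot x (v i) *s v i)" for x
  have "(\<Sum>i<m. cdot x (v i) *s v i) \<in> vec.span (v ` {..<m})"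
    by (intro vec.span_sum vec.span_scale vec.span_base) auto
  with x have "pr x \<noteq> 0" by (auto simp: pr_def)
  have prU: "pr x \<in> U" for x
    by (auto simp: U_def pr_def cdot_simps cdot_sum_left on if_distrib[where f = "\<lambda>z. _ * z"] cong: if_cong)
  have lin: "Vector_Spaces.linear (*s) (*s) (\<lambda>w. pr (P *v w))"
    unfolding Vector_Spaces.linear_iff
    by (simp add: vec.vector_space_axioms pr_def matrix_vector_right_distrib cdot_simps vec.linear_scale[OF matrix_vector_mul_linear_gen]
         vec.scale_left_distrib sum.distrib vec.scale_right_diff_distrib vec.scale_sum_right)
  define Q where "Q = matrix (\<lambda>w. pr (P *v w))"
  have Q: "Q *v w = pr (P *v w)" for w
    unfolding Q_def by (rule matrix_works[OF lin])
  have "U \<noteq> {0}" using \<open>pr x \<noteq> 0\<close> prU by blast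
  then obtain w c where w: "w \<in> U" "w \<noteq> 0" "Q *v w = c *s w"
    using eigenvector_exists[OF sub, of Q] prU Q by metis
  define z where "z = of_real (1 / norm w) *s w"
  have zU: "z \<in> U" unfolding z_def by (intro vec.subspace_scale sub w)
  have zz: "cdot z z = 1"
    using w(2) unfolding z_def cdot_simps by (simp add: cdot_self power2_eq_square)
  have oz: "cdot z (v i) = 0" "cdot (v i) z = 0" if "i < m" for i
    using zU that by (auto simp: U_def) (metis cnj_cdot complex_cnj_zero)
  have "Q *v z = c *s z"
    by (simp add: z_def w(3) vec.scale_scale mult.commute vec.linear_scale[OF matrix_vector_mul_linear_gen])
  then have Pz: "P *v z = c *s z + (\<Sum>i<m. cdot (P *v z) (v i) *s v i)"
    unfolding Q pr_def by (simp add: algebra_simps)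
  have "cdot (P *v z) z = c"
    by (subst Pz) (simp add: cdot_simps cdot_sum_left zz oz)
  with Pz have Pz': "P *v z = cdot (P *v z) z *s z + (\<Sum>i<m. cdot (P *v z) (v i) *s v i)"
    by simp
  have "P *v (v(m := z)) j = (\<Sum>i\<le>j. cdot (P *v (v(m := z)) j) ((v(m := z)) i) *s (v(m := z)) i)"
    if "j < Suc m" for j
  proof (cases "j = m")
    case True
    then show ?thesis using Pz' by (simp add: lessThan_Suc_atMost[symmetric] add.commute)
  next
    case False
    with that have "j < m" by simp
    then have "(\<Sum>i\<le>j. cdot (P *v (v(m := z)) j) ((v(m := z)) i) *s (v(m := z)) i)
       = (\<Sum>i\<le>j. cdot (P *v v j) (v i) *s v i)"
      by (intro sum.cong) auto
    with fl[OF \<open>j < m\<close>] \<open>j < m\<close> show ?thesis by simp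
  qed
  then show ?case
    by (intro exI[of _ "v(m := z)"]) (auto simp: less_Suc_eq on oz zz)
qed

lemma schur_triangular:
  fixes P :: "complex ^ 'n ^ 'n"
  obtains k and e :: "'n \<Rightarrow> nat" where "unitary k" "inj e" "upper_tri e (adj k ** P ** k)"
proof -
  obtain v where fl: "\<And>j. j < CARD('n) \<Longrightarrow> P *v v j = (\<Sum>i\<le>j. cdot (P *v v j) (v i) *s v i)"
    and on: "\<And>i j. i < CARD('n) \<Longrightarrow> j < CARD('n) \<Longrightarrow> cdot (v i) (v j) = (if i = j then 1 else 0)"
    using schur_flag[OF order_refl, of P] by blast
  obtain e :: "'n \<Rightarrow> nat" where "bij_betw e UNIV {0..<CARD('n)}"
    using ex_bij_betw_finite_nat[of "UNIV :: 'n set"] by auto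
  then have e: "inj e" "e i < CARD('n)" for i
    by (auto simp: bij_betw_def)
  define k where "k = (\<chi> i j. v (e j) $ i)"
  have colk: "column j k = v (e j)" for j
    by (simp add: k_def column_def vec_eq_iff)
  have entry: "(adj k ** A) $ a $ b = cdot (column b A) (v (e a))" for a b and A :: "complex ^ 'n ^ 'n"
    by (simp add: matrix_matrix_mult_def adj_def k_def cdot_def column_def mult.commute)
  have k: "unitary k"
    unfolding unitary_def using e by (auto simp: vec_eq_iff mat_def on inj_eq entry colk)
  have "(adj k ** (P ** k)) $ i $ j = 0" if "e j < e i" for i j
  proof -
    have "(adj k ** (P ** k)) $ i $ j = cdot (P *v v (e j)) (v (e i))"
      by (simp add: entry column_mult colk)
    also have "\<dots> = (\<Sum>l\<le>e j. cdot (P *v v (e j)) (v l) * cdot (v l) (v (e i)))"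
      by (subst fl[OF e(2)]) (simp add: cdot_simps cdot_sum_left)
    also have "\<dots> = 0"
      using that e(2)[of i] by (intro sum.neutral) (auto simp: on)
    finally show ?thesis .
  qed
  then have "upper_tri e (adj k ** P ** k)"
    by (simp add: upper_tri_def flip: matrix_mul_assoc)
  with k e that show ?thesis by blast
qed

text \<open>On this type, \<open>^\<close> is the componentwise power.\<close>

fun mpow :: "complex ^ 'n ^ 'n \<Rightarrow> nat \<Rightarrow> complex ^ 'n ^ 'n" where
  "mpow A 0 = mat 1"
| "mpow A (Suc k) = A ** mpow A k"

lemma mpow_conj: "unitary k \<Longrightarrow> mpow (adj k ** A ** k) m = adj k ** mpow A m ** k"
proof (induction m)
  case (Suc m)
  have "mpow (adj k ** A ** k) (Suc m) = adj k ** A ** (k ** adj k) ** mpow A m ** k"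
    using Suc by (simp add: matrix_mul_assoc)
  then show ?case
    by (simp add: unitaryD[OF Suc.prems] matrix_mul_assoc)
qed (simp add: unitary_def)

lemma upper_tri_mult:
  assumes e: "inj e" and A: "upper_tri e A" and B: "upper_tri e B"
  shows "upper_tri e (A ** B)" "(A ** B) $ i $ i = A $ i $ i * B $ i $ i"
proof -
  have z: "A $ i $ l * B $ l $ j = 0" if "e j < e i \<or> (i = j \<and> l \<noteq> i)" for i j l
  proof (cases "e l < e i")
    case True then show ?thesis using A by (simp add: upper_tri_def)
  next
    case False
    then have "e j < e l" using that injD[OF e, of l i] by (auto simp: not_less le_less)
    then show ?thesis using B by (simp add: upper_tri_def)
  qed
  show "upper_tri e (A ** B)"
    by (auto simp: upper_tri_def matrix_matrix_mult_def z)
  have "(A ** B) $ i $ i = (\<Sum>l\<in>UNIV. A $ i $ l * B $ l $ i)"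
    by (simp add: matrix_matrix_mult_def)
  also have "\<dots> = (\<Sum>l\<in>UNIV. if l = i then A $ i $ i * B $ i $ i else 0)"
    using z[of i i] by (intro sum.cong) auto
  finally have "(A ** B) $ i $ i = (\<Sum>l\<in>UNIV. if l = i then A $ i $ i * B $ i $ i else 0)" .
  then show "(A ** B) $ i $ i = A $ i $ i * B $ i $ i" by simp
qed

lemma upper_tri_mpow:
  assumes e: "inj e" and A: "upper_tri e A"
  shows "upper_tri e (mpow A m) \<and> mpow A m $ i $ i = (A $ i $ i) ^ m"
proof (induction m)
  case 0 then show ?case by (auto simp: upper_tri_def mat_def)
qed (use upper_tri_mult[OF e A] in auto)

lemma trace_conj: "unitary k \<Longrightarrow> trace (adj k ** A ** k) = trace A"
  by (metis trace_mul_sym matrix_mul_assoc matrix_mul_rid unitaryD(2))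

text \<open>The numbers \<open>t i\<close> are the diagonal of a Schur form, that is, the
  eigenvalues with multiplicity. The second property handles nilpotent matrices, the third detects
  the eigenvalue 1.\<close>

lemma trace_power_sum:
  fixes A :: "complex ^ 'n ^ 'n"
  obtains t :: "'n \<Rightarrow> complex" where "\<And>m. trace (mpow A m) = (\<Sum>i\<in>UNIV. t i ^ m)"
    "\<And>m. (\<And>v. mpow A m *v v = 0) \<Longrightarrow> \<forall>i. t i ^ m = 0"
    "\<And>v. v \<noteq> 0 \<Longrightarrow> A *v v = v \<Longrightarrow> \<exists>i. t i = 1"
proof -
  obtain k and e :: "'n \<Rightarrow> nat" where k: "unitary k" and e: "inj e" and T: "upper_tri e (adj k ** A ** k)"
    by (rule schur_triangular)
  define T where "T = adj k ** A ** k"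
  have T: "upper_tri e T" using T by (simp add: T_def)
  note pw = upper_tri_mpow[OF e T]
  show ?thesis
  proof (rule that[of "\<lambda>i. T $ i $ i"])
    fix m
    have "trace (mpow A m) = trace (mpow T m)"
      by (simp add: T_def mpow_conj trace_conj k)
    then show "trace (mpow A m) = (\<Sum>i\<in>UNIV. (T $ i $ i) ^ m)"
      by (simp add: trace_def pw)
  next
    fix m assume "\<And>v. mpow A m *v v = 0"
    then have "mpow A m = 0" by (simp add: matrix_eq)
    then have "mpow T m = adj k ** 0 ** k"
      by (simp only: T_def mpow_conj[OF k])
    then have "mpow T m = 0"
      by (simp add: vec_eq_iff matrix_matrix_mult_def)
    then show "\<forall>i. (T $ i $ i) ^ m = 0"
      using pw[of m] by simp
  next
    fix v assume v: "v \<noteq> 0" "A *v v = v"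
    define w where "w = adj k *v v"
    have "k *v w = v" by (simp add: w_def matrix_vector_mul_assoc unitaryD[OF k])
    then have "w \<noteq> 0" using v by auto
    have "T *v w = w"
    proof -
      have "T *v w = (adj k ** A ** (k ** adj k)) *v v"
        by (simp add: T_def w_def matrix_vector_mul_assoc matrix_mul_assoc)
      also have "\<dots> = adj k *v (A *v v)"
        by (simp add: unitaryD[OF k] matrix_vector_mul_assoc)
      finally show ?thesis by (simp add: v w_def)
    qed
    \<comment> \<open>In the row of the last nonzero coordinate of the fixed vector, only the
      diagonal entry contributes.\<close>
    define S where "S = {i. w $ i \<noteq> 0}"
    have "S \<noteq> {}" using \<open>w \<noteq> 0\<close> by (auto simp: S_def vec_eq_iff)
    have "Max (e ` S) \<in> e ` S"
      using \<open>S \<noteq> {}\<close> by (intro Max_in) auto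
    then obtain i where "i \<in> S" "e i = Max (e ` S)" by auto
    then have "\<And>j. j \<in> S \<Longrightarrow> e j \<le> e i" by simp
    have "w $ i = (\<Sum>j\<in>UNIV. T $ i $ j * w $ j)"
      by (subst \<open>T *v w = w\<close>[symmetric]) (simp add: matrix_vector_mult_def)
    also have "\<dots> = (\<Sum>j\<in>UNIV. if j = i then T $ i $ i * w $ i else 0)"
    proof (rule sum.cong)
      fix j
      show "T $ i $ j * w $ j = (if j = i then T $ i $ i * w $ i else 0)"
      proof (cases "j = i \<or> w $ j = 0")
        case False
        then have "e j < e i"
          using \<open>\<And>j. j \<in> S \<Longrightarrow> e j \<le> e i\<close>[of j] injD[OF e, of j i] by (auto simp: S_def le_less)
        then show ?thesis using T False by (simp add: upper_tri_def)
      qed auto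
    qed simp
    finally have "T $ i $ i = 1" using \<open>i \<in> S\<close> by (simp add: S_def)
    then show "\<exists>i. T $ i $ i = 1" ..
  qed
qed

text \<open>If all power sums of the eigenvalues \<open>t i\<close> vanish, so does the sum of
  \<open>t i * p(t i)\<close> for every polynomial \<open>p\<close>. For \<open>p\<close> vanishing
  at all eigenvalues other than 1, this sum is the multiplicity of 1 times
  \<open>p(1)\<close>.\<close>

lemma no_eigenvalue_1_if_traces_vanish:
  fixes A :: "complex ^ 'n ^ 'n"
  assumes tr: "\<And>m. trace (mpow A (Suc m)) = 0" and v: "A *v v = v"
  shows "v = 0"
proof (rule ccontr)
  assume "v \<noteq> 0"
  obtain t :: "'n \<Rightarrow> complex" where t: "\<And>m. trace (mpow A m) = (\<Sum>i\<in>UNIV. t i ^ m)"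
    and t1: "\<exists>i. t i = 1"
    by (rule trace_power_sum[of A]) (use v \<open>v \<noteq> 0\<close> in blast)
  have lin: "(\<Sum>i\<in>UNIV. t i * poly p (t i)) = 0" for p
  proof -
    have "(\<Sum>i\<in>UNIV. t i * poly p (t i)) = (\<Sum>i\<in>UNIV. \<Sum>m\<le>degree p. coeff p m * t i ^ Suc m)"
      by (simp add: poly_altdef sum_distrib_left mult_ac)
    also have "\<dots> = (\<Sum>m\<le>degree p. coeff p m * (\<Sum>i\<in>UNIV. t i ^ Suc m))"
      by (subst sum.swap) (simp add: sum_distrib_left)
    also have "\<dots> = 0" using tr unfolding t by simp
    finally show ?thesis .
  qed
  define p where "p = (\<Prod>c\<in>range t - {1}. [:- c, 1:])"
  have p: "poly p (t i) = (if t i = 1 then poly p 1 else 0)" for i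
    by (auto simp: p_def poly_prod)
  have "poly p 1 \<noteq> 0" by (auto simp: p_def poly_prod)
  moreover have "(\<Sum>i\<in>UNIV. t i * poly p (t i)) = (\<Sum>i\<in>UNIV. if t i = 1 then poly p 1 else 0)"
    by (intro sum.cong) (auto simp: p)
  then have "(\<Sum>i\<in>UNIV. t i * poly p (t i)) = of_nat (card {i. t i = 1}) * poly p 1"
    by (simp add: sum.If_cases)
  ultimately have "card {i. t i = 1} = 0" using lin[of p] by simp
  with t1 show False by auto
qed

lemma trace_unipotent:
  fixes u :: "complex ^ 'n ^ 'n"
  assumes "unipotent u"
  shows "trace u = of_nat CARD('n)"
proof -
  obtain m where m: "\<And>v. ((\<lambda>w. (u - mat 1) *v w) ^^ m) v = 0"
    using assms by (auto simp: unipotent_def)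
  have "((\<lambda>w. (u - mat 1) *v w) ^^ l) v = mpow (u - mat 1) l *v v" for l v
    by (induction l) (simp_all add: matrix_vector_mul_assoc)
  then have "mpow (u - mat 1) m *v v = 0" for v using m by simp
  then obtain t :: "'n \<Rightarrow> complex" where t: "\<And>m. trace (mpow (u - mat 1) m) = (\<Sum>i\<in>UNIV. t i ^ m)"
    and "\<forall>i. t i ^ m = 0"
    by (metis trace_power_sum)
  then have "\<forall>i. t i = 0" by auto
  with t[of 1] have "trace (u - mat 1) = 0" by simp
  then show ?thesis by (simp add: trace_sub trace_I)
qed

text \<open>For a monoid \<open>U\<close>, this is the image of the augmentation ideal of its monoid
  algebra in the matrix algebra. It is closed under products, and for unipotent \<open>U\<close> all
  traces on it vanish.\<close>

inductive_set diffspan :: "(complex ^ 'n ^ 'n) set \<Rightarrow> (complex ^ 'n ^ 'n) set" for U where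
  diff: "u \<in> U \<Longrightarrow> u' \<in> U \<Longrightarrow> u - u' \<in> diffspan U"
| add: "x \<in> diffspan U \<Longrightarrow> y \<in> diffspan U \<Longrightarrow> x + y \<in> diffspan U"
| scale: "x \<in> diffspan U \<Longrightarrow> mat c ** x \<in> diffspan U"

lemma matrix_diff_ldistrib: "A ** (B - C) = A ** B - A ** (C :: complex ^ 'n ^ 'n)"
  and matrix_diff_rdistrib: "(B - C) ** A = B ** A - C ** (A :: complex ^ 'n ^ 'n)"
  by (simp_all add: vec_eq_iff matrix_matrix_mult_def algebra_simps sum_subtractf)

lemma matrix_add_rdistrib: "(B + C) ** A = B ** A + C ** (A :: complex ^ 'n ^ 'n)"
  by (simp add: vec_eq_iff matrix_matrix_mult_def algebra_simps sum.distrib)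

lemma mat_minus_1: "mat (-1) ** A = - (A :: complex ^ 'n ^ 'n)"
  by (simp add: vec_eq_iff mat_mult_eq)

lemma diffspan_diff: "x \<in> diffspan U \<Longrightarrow> y \<in> diffspan U \<Longrightarrow> x - y \<in> diffspan U"
  using diffspan.add[OF _ diffspan.scale, of x U y "-1"] by (simp add: mat_minus_1)

lemma diffspan_mult_left:
  assumes mult: "\<And>u v. u \<in> U \<Longrightarrow> v \<in> U \<Longrightarrow> u ** v \<in> U"
  shows "x \<in> diffspan U \<Longrightarrow> u \<in> U \<Longrightarrow> u ** x \<in> diffspan U"
proof (induction rule: diffspan.induct)
  case (scale x c)
  then show ?case
    using diffspan.scale[of "u ** x" U c] by (metis mat_mult_commute matrix_mul_assoc)
qed (auto simp: matrix_diff_ldistrib matrix_add_ldistrib intro: diffspan.intros mult)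

lemma diffspan_mult:
  assumes mult: "\<And>u v. u \<in> U \<Longrightarrow> v \<in> U \<Longrightarrow> u ** v \<in> U"
  shows "x \<in> diffspan U \<Longrightarrow> y \<in> diffspan U \<Longrightarrow> x ** y \<in> diffspan U"
proof (induction rule: diffspan.induct)
  case (diff u u')
  then show ?case by (simp add: matrix_diff_rdistrib diffspan_diff diffspan_mult_left[OF mult])
next
  case (scale x c)
  then show ?case by (metis diffspan.scale matrix_mul_assoc)
qed (auto simp: matrix_add_rdistrib intro: diffspan.intros)

lemma diffspan_mpow:
  assumes mult: "\<And>u v. u \<in> U \<Longrightarrow> v \<in> U \<Longrightarrow> u ** v \<in> U" and x: "x \<in> diffspan U"
  shows "mpow x (Suc m) \<in> diffspan U"
proof (induction m)
  case (Suc m)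
  then show ?case using diffspan_mult[OF mult x] by (metis mpow.simps(2))
qed (simp add: x)

lemma trace_diffspan:
  assumes "\<And>u. u \<in> U \<Longrightarrow> unipotent u"
  shows "x \<in> diffspan U \<Longrightarrow> trace x = 0"
proof (induction rule: diffspan.induct)
  case (scale x c)
  then show ?case by (simp add: trace_def mat_mult_eq flip: sum_distrib_left)
qed (simp_all add: trace_sub trace_add trace_unipotent assms)

text \<open>Let \<open>W\<close> be a nonzero stable subspace of least dimension and
  \<open>w\<close> in \<open>W\<close> nonzero. The vectors \<open>x *v w\<close> with
  \<open>x\<close> in \<open>diffspan U\<close> form a stable subspace \<open>Z\<close> of
  \<open>W\<close>. If \<open>Z = W\<close>, some \<open>x\<close> fixes \<open>w\<close> although
  all its positive powers have trace 0, which is impossible. So \<open>Z = {0}\<close>, which says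
  that \<open>U\<close> fixes \<open>w\<close>.\<close>

lemma kolchin:
  fixes U :: "(complex ^ 'n ^ 'n) set"
  assumes one: "mat 1 \<in> U" and mult: "\<And>u v. u \<in> U \<Longrightarrow> v \<in> U \<Longrightarrow> u ** v \<in> U"
    and unip: "\<And>u. u \<in> U \<Longrightarrow> unipotent u" and ne: "(UNIV :: (complex ^ 'n) set) \<noteq> {0}"
  obtains w where "w \<noteq> 0" "\<And>u. u \<in> U \<Longrightarrow> u *v w = w"
proof -
  define Q where "Q W \<longleftrightarrow> vec.subspace W \<and> W \<noteq> {0} \<and> (\<forall>u\<in>U. \<forall>w\<in>W. u *v w \<in> W)" for W
  have "Q UNIV" using ne by (simp add: Q_def vec.subspace_UNIV)
  then obtain W where W: "Q W" and least: "\<And>W'. Q W' \<Longrightarrow> vec.dim W \<le> vec.dim W'"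
    using ex_has_least_nat[of Q UNIV vec.dim] by blast
  then obtain w where w: "w \<in> W" "w \<noteq> 0"
    using vec.subspace_0[of W] by (auto simp: Q_def)
  have xW: "x *v y \<in> W" if "x \<in> diffspan U" "y \<in> W" for x y
    using that
  proof (induction rule: diffspan.induct)
    case (diff u u')
    then show ?case using W
      by (auto simp: Q_def matrix_vector_mult_diff_rdistrib intro: vec.subspace_diff)
  next
    case (add x y)
    then show ?case using W
      by (auto simp: Q_def matrix_vector_mult_add_rdistrib intro: vec.subspace_add)
  next
    case (scale x c)
    then show ?case using W
      by (simp add: Q_def mat_mult_vec vec.subspace_scale flip: matrix_vector_mul_assoc)
  qed
  define Z where "Z = (\<lambda>x. x *v w) ` diffspan U"
  have Z0: "0 \<in> Z"
    using diffspan.diff[OF one one] by (auto simp: Z_def intro!: image_eqI[of _ _ 0])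
  have subZ: "vec.subspace Z"
  proof (rule vec.subspaceI[OF Z0])
    show "x + y \<in> Z" if "x \<in> Z" "y \<in> Z" for x y
      using that diffspan.add by (force simp: Z_def simp flip: matrix_vector_mult_add_rdistrib)
    show "c *s x \<in> Z" if "x \<in> Z" for c x
      using that by (auto simp: Z_def matrix_vector_mul_assoc intro!: diffspan.scale image_eqI simp flip: mat_mult_vec)
  qed
  have ZU: "u *v z \<in> Z" if "u \<in> U" "z \<in> Z" for u z
    using that diffspan_mult_left[OF mult] by (auto simp: Z_def matrix_vector_mul_assoc)
  have "Z = {0}"
  proof (rule ccontr)
    assume "Z \<noteq> {0}"
    then have "Q Z" using subZ ZU by (simp add: Q_def)
    from least[OF this] have "Z = W"
      using W subZ xW w(1) by (intro vec.subspace_dim_equal) (auto simp: Q_def Z_def)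
    then obtain x where "x \<in> diffspan U" "x *v w = w" using w(1) by (auto simp: Z_def)
    then have "w = 0"
      using diffspan_mpow[OF mult] trace_diffspan[OF unip] by (intro no_eigenvalue_1_if_traces_vanish[of x]) blast+
    with w show False by simp
  qed
  have "u *v w = w" if "u \<in> U" for u
  proof -
    have "(u - mat 1) *v w \<in> Z"
      unfolding Z_def using that one by (intro imageI diffspan.diff)
    with \<open>Z = {0}\<close> show ?thesis by (simp add: matrix_vector_mult_diff_rdistrib)
  qed
  with w that show ?thesis by blast
qed

section \<open>Zariski topology and unipotent radicals\<close>

lemma carrier_GL: "carrier GL = {A. invertible A}"
  and mult_GL: "x \<otimes>\<^bsub>GL\<^esub> y = x ** y"
  and one_GL: "\<one>\<^bsub>GL\<^esub> = mat 1"
  by (simp_all add: GL_def)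

lemma matrix_inv_inverse:
  assumes "invertible (A :: complex ^ 'n ^ 'n)"
  shows "A ** matrix_inv A = mat 1" "matrix_inv A ** A = mat 1" "invertible (matrix_inv A)"
proof -
  show "A ** matrix_inv A = mat 1" "matrix_inv A ** A = mat 1"
    using assms unfolding invertible_def matrix_inv_def by (metis (mono_tags, lifting) someI_ex)+
  then show "invertible (matrix_inv A)" by (auto simp: invertible_def)
qed

lemma inv_GL:
  assumes "invertible (A :: complex ^ 'n ^ 'n)"
  shows "inv\<^bsub>GL\<^esub> A = matrix_inv A"
  using assms matrix_inv_inverse[OF assms]
  by (intro group.inv_equality[OF group_GL]) (auto simp: carrier_GL mult_GL one_GL)

lemma subgroup_GL_I:
  fixes K :: "(complex ^ 'n ^ 'n) set"
  assumes "\<And>k. k \<in> K \<Longrightarrow> invertible k" "mat 1 \<in> K"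
    and "\<And>k l. k \<in> K \<Longrightarrow> l \<in> K \<Longrightarrow> k ** l \<in> K" "\<And>k. k \<in> K \<Longrightarrow> matrix_inv k \<in> K"
  shows "subgroup K GL"
  using assms by (intro subgroup.intro) (auto simp: carrier_GL mult_GL one_GL inv_GL)

lemma subgroup_GL_D:
  assumes "subgroup K GL"
  shows "\<And>k. k \<in> K \<Longrightarrow> invertible k" "mat 1 \<in> K"
    and "\<And>k l. k \<in> K \<Longrightarrow> l \<in> K \<Longrightarrow> k ** l \<in> K" "\<And>k. k \<in> K \<Longrightarrow> matrix_inv k \<in> K"
proof -
  interpret subgroup K GL by fact
  show inv: "\<And>k. k \<in> K \<Longrightarrow> invertible k" using subset by (auto simp: carrier_GL)
  show "mat 1 \<in> K" using one_closed by (simp add: one_GL)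
  show "\<And>k l. k \<in> K \<Longrightarrow> l \<in> K \<Longrightarrow> k ** l \<in> K" using m_closed by (simp add: mult_GL)
  show "\<And>k. k \<in> K \<Longrightarrow> matrix_inv k \<in> K" using m_inv_closed inv_GL inv by metis
qed

lemma topspace_zariski: "topspace zariski = carrier GL"
proof
  show "topspace zariski \<subseteq> carrier GL"
    unfolding topspace_def openin_zariski by auto
  have "\<exists>F\<subseteq>matrix_polys. carrier GL = carrier GL - {A :: complex ^ 'a ^ 'a. \<forall>f\<in>F. f A = 0}"
    by (intro exI[of _ "{\<lambda>_. 1}"]) (auto simp: matrix_polys_def intro: gen_algebra.intros)
  then show "carrier GL \<subseteq> topspace (zariski :: (complex ^ 'a ^ 'a) topology)"
    by (intro openin_subset) (simp only: openin_zariski)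
qed

lemma closedin_zariski:
  "closedin zariski S \<longleftrightarrow> (\<exists>F\<subseteq>matrix_polys. S = carrier GL \<inter> {A. \<forall>f\<in>F. f A = 0})"
  unfolding closedin_def topspace_zariski openin_zariski by (intro iffI; elim conjE exE; intro exI conjI) auto

lemma matrix_polys_entry: "(\<lambda>A. A $ i $ j) \<in> matrix_polys"
  and matrix_polys_const: "(\<lambda>_. c) \<in> matrix_polys"
  and matrix_polys_add: "f \<in> matrix_polys \<Longrightarrow> g \<in> matrix_polys \<Longrightarrow> (\<lambda>x. f x + g x) \<in> matrix_polys"
  and matrix_polys_mult: "f \<in> matrix_polys \<Longrightarrow> g \<in> matrix_polys \<Longrightarrow> (\<lambda>x. f x * g x) \<in> matrix_polys"
  unfolding matrix_polys_def by (auto intro: gen_algebra.intros)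

lemma matrix_polys_diff: "f \<in> matrix_polys \<Longrightarrow> g \<in> matrix_polys \<Longrightarrow> (\<lambda>x. f x - g x) \<in> matrix_polys"
  using matrix_polys_add[OF _ matrix_polys_mult[OF matrix_polys_const[of "-1"]], of f g] by simp

lemma linear_algebraic_group_1: "linear_algebraic_group {mat 1 :: complex ^ 'n ^ 'n}"
proof -
  have "mat 1 = matrix_inv (mat 1 :: complex ^ 'n ^ 'n)"
    using matrix_inv_inverse(1)[of "mat 1 :: complex ^ 'n ^ 'n"] by (simp add: unitary_invertible)
  then have "subgroup {mat 1 :: complex ^ 'n ^ 'n} GL"
    by (intro subgroup_GL_I) (auto simp: unitary_invertible)
  moreover have "closedin zariski {mat 1 :: complex ^ 'n ^ 'n}"
    unfolding closedin_zariski
  proof (intro exI conjI)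
    let ?F = "{\<lambda>A :: complex ^ 'n ^ 'n. A $ i $ j - mat 1 $ i $ j | i j. True}"
    show "?F \<subseteq> matrix_polys"
      by (auto intro!: matrix_polys_diff matrix_polys_entry matrix_polys_const)
    have "A = mat 1" if "\<forall>f\<in>?F. f A = 0" for A :: "complex ^ 'n ^ 'n"
    proof -
      have "A $ i $ j - mat 1 $ i $ j = 0" for i j
      proof -
        have "(\<lambda>A. A $ i $ j - mat 1 $ i $ j) \<in> ?F" by (rule CollectI, rule exI[of _ i], rule exI[of _ j]) simp
        from bspec[OF that this] show ?thesis .
      qed
      then show ?thesis by (simp add: vec_eq_iff)
    qed
    moreover have "mat 1 \<in> carrier GL \<inter> {A :: complex ^ 'n ^ 'n. \<forall>f\<in>?F. f A = 0}"
      by (auto simp: carrier_GL unitary_invertible)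
    ultimately show "{mat 1} = carrier GL \<inter> {A. \<forall>f\<in>?F. f A = 0}" by fast
  qed
  ultimately show ?thesis by (simp add: linear_algebraic_group_def)
qed

text \<open>By Kolchin, a normal unipotent subgroup fixes a nonzero vector, and its fixed space is
  stable under the whole group.\<close>

lemma unipotent_radical_irreducible:
  fixes K :: "(complex ^ 'n ^ 'n) set"
  assumes K: "subgroup K GL" and irr: "irreducible_module K"
  shows "unipotent_radical K = {mat 1}"
  unfolding unipotent_radical_def
proof (rule Greatest_equality)
  interpret GK: group "GL\<lparr>carrier := K\<rparr>"
    by (rule group.subgroup_imp_group[OF group_GL K])
  have "{\<one>\<^bsub>GL\<lparr>carrier := K\<rparr>\<^esub>} \<lhd> GL\<lparr>carrier := K\<rparr>"
    by (rule GK.one_is_normal)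
  then show "linear_algebraic_group {mat 1} \<and> connectedin zariski {mat 1} \<and>
      {mat 1} \<lhd> GL\<lparr>carrier := K\<rparr> \<and> (\<forall>A\<in>{mat 1}. unipotent A)"
    by (auto simp: linear_algebraic_group_1 one_GL topspace_zariski carrier_GL unitary_invertible
        unipotent_def intro!: exI[of _ 1])
next
  fix U assume U: "linear_algebraic_group U \<and> connectedin zariski U \<and>
      U \<lhd> GL\<lparr>carrier := K\<rparr> \<and> (\<forall>A\<in>U. unipotent A)"
  then interpret U: normal U "GL\<lparr>carrier := K\<rparr>" by simp
  have sU: "subgroup U GL" using U by (simp add: linear_algebraic_group_def)
  obtain w where w: "w \<noteq> 0" "\<And>u. u \<in> U \<Longrightarrow> u *v w = w"
    using kolchin[of U] subgroup_GL_D[OF sU] U irr by (auto simp: irreducible_module_def)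
  define W where "W = {w. \<forall>u\<in>U. u *v w = w}"
  have "vec.subspace W"
    by (rule vec.subspaceI)
       (auto simp: W_def matrix_vector_right_distrib vec.linear_scale[OF matrix_vector_mul_linear_gen])
  moreover have "k *v x \<in> W" if "k \<in> K" "x \<in> W" for k x
  proof -
    have "u *v (k *v x) = k *v x" if "u \<in> U" for u
    proof -
      have "u ** k \<in> U #>\<^bsub>GL\<lparr>carrier := K\<rparr>\<^esub> k"
        using that by (auto simp: r_coset_def mult_GL)
      also have "U #>\<^bsub>GL\<lparr>carrier := K\<rparr>\<^esub> k = k <#\<^bsub>GL\<lparr>carrier := K\<rparr>\<^esub> U"
        using U.coset_eq \<open>k \<in> K\<close> by simp
      finally obtain u' where "u' \<in> U" "u ** k = k ** u'"
        by (auto simp: l_coset_def mult_GL)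
      then show ?thesis using \<open>x \<in> W\<close>
        by (simp add: matrix_vector_mul_assoc W_def) (simp add: flip: matrix_vector_mul_assoc)
    qed
    then show ?thesis by (simp add: W_def)
  qed
  ultimately have "W = {0} \<or> W = UNIV"
    using irr by (simp add: irreducible_module_def)
  moreover have "w \<in> W" using w by (simp add: W_def)
  ultimately have "W = UNIV" using w(1) by auto
  then have "u = mat 1" if "u \<in> U" for u
    using that unfolding W_def matrix_eq by auto
  then show "U \<le> {mat 1}" by auto
qed

text \<open>A complement of a trivial radical is the whole group. Zariski closedness of
  \<open>K\<close> is inherited from \<open>L\<close>.\<close>

lemma levi_subgroup_irreducible:
  fixes L K :: "(complex ^ 'n ^ 'n) set"
  assumes K: "subgroup K GL" and irr: "irreducible_module K" and levi: "levi_subgroup L K"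
  shows "L = K" "reductive K"
proof -
  have "L <#>\<^bsub>GL\<^esub> {mat 1} = L"
    by (auto simp: set_mult_def mult_GL)
  then show "L = K" "reductive K"
    using levi unfolding levi_subgroup_def unipotent_radical_irreducible[OF K irr] by auto
qed

lemma irreducible_module_mono: "irreducible_module G \<Longrightarrow> G \<subseteq> K \<Longrightarrow> irreducible_module K"
  unfolding irreducible_module_def by blast

lemma comp_matrix_mult: "f \<circ> (*v) (g ** h) = (f \<circ> (*v) g) \<circ> (*v) h"
  by (auto simp: fun_eq_iff matrix_vector_mul_assoc)

lemma comp_matrix_mat_1: "f \<circ> (*v) (mat 1) = f"
  by (auto simp: fun_eq_iff)

lemma subgroup_G0: "subgroup (G\<^sub>0 G) GL"
proof (rule subgroup_GL_I)
  fix k :: "complex ^ 'a ^ 'a" assume k: "k \<in> G\<^sub>0 G"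
  then have inv: "invertible k" by (simp add: G\<^sub>0_def carrier_GL)
  have "f \<circ> (*v) (matrix_inv k) = f" if "f \<in> invariants G" for f
  proof -
    have "f \<circ> (*v) (matrix_inv k) = (f \<circ> (*v) k) \<circ> (*v) (matrix_inv k)"
      using k that by (simp add: G\<^sub>0_def)
    then show ?thesis
      by (simp add: matrix_inv_inverse[OF inv] comp_matrix_mat_1 flip: comp_matrix_mult)
  qed
  then show "matrix_inv k \<in> G\<^sub>0 G"
    using inv by (simp add: G\<^sub>0_def carrier_GL matrix_inv_inverse)
qed (auto simp: G\<^sub>0_def carrier_GL unitary_invertible comp_matrix_mat_1 comp_matrix_mult intro: invertible_mult)

lemma subgroup_H0: "subgroup (H\<^sub>0 G) GL"
proof (rule subgroup_GL_I)
  fix k :: "complex ^ 'a ^ 'a" assume k: "k \<in> H\<^sub>0 G"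
  then have inv: "invertible k" by (simp add: H\<^sub>0_def carrier_GL)
  have "(\<lambda>f. f \<circ> (*v) (matrix_inv k)) ` null_ideal G = (\<lambda>f. f \<circ> (*v) (matrix_inv k)) ` (\<lambda>f. f \<circ> (*v) k) ` null_ideal G"
    using k by (simp add: H\<^sub>0_def)
  also have "\<dots> = null_ideal G"
    by (simp add: image_image matrix_inv_inverse[OF inv] comp_matrix_mat_1 flip: comp_matrix_mult)
  finally show "matrix_inv k \<in> H\<^sub>0 G"
    using inv by (simp add: H\<^sub>0_def carrier_GL matrix_inv_inverse)
next
  fix k l :: "complex ^ 'a ^ 'a" assume "k \<in> H\<^sub>0 G" "l \<in> H\<^sub>0 G"
  moreover have "(\<lambda>f. f \<circ> (*v) (k ** l)) ` null_ideal G = (\<lambda>f. f \<circ> (*v) l) ` (\<lambda>f. f \<circ> (*v) k) ` null_ideal G"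
    by (simp add: image_image comp_matrix_mult)
  ultimately show "k ** l \<in> H\<^sub>0 G"
    by (simp add: H\<^sub>0_def carrier_GL invertible_mult)
qed (auto simp: H\<^sub>0_def carrier_GL unitary_invertible comp_matrix_mat_1)

section \<open>Polynomials as tensors\<close>

text \<open>Subspaces of the functions on \<open>X\<close>, extended by zero, so that agreement on
  \<open>X\<close> is equality of functions.\<close>

definition fsub :: "'i set \<Rightarrow> ('i \<Rightarrow> complex) set \<Rightarrow> bool" where
  "fsub X A \<longleftrightarrow> (\<lambda>_. 0) \<in> A \<and> (\<forall>S\<in>A. \<forall>T\<in>A. (\<lambda>i. S i + T i) \<in> A) \<and>
     (\<forall>c. \<forall>T\<in>A. (\<lambda>i. c * T i) \<in> A) \<and> (\<forall>T\<in>A. \<forall>i. i \<notin> X \<longrightarrow> T i = 0)"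

definition fip :: "'i set \<Rightarrow> ('i \<Rightarrow> complex) \<Rightarrow> ('i \<Rightarrow> complex) \<Rightarrow> complex" where
  "fip X S T = (\<Sum>i\<in>X. S i * cnj (T i))"

lemma fsubD:
  assumes "fsub X A"
  shows "(\<lambda>_. 0) \<in> A" "S \<in> A \<Longrightarrow> T \<in> A \<Longrightarrow> (\<lambda>i. S i + T i) \<in> A"
    "T \<in> A \<Longrightarrow> (\<lambda>i. c * T i) \<in> A" "T \<in> A \<Longrightarrow> i \<notin> X \<Longrightarrow> T i = 0"
  using assms by (auto simp: fsub_def)

lemma fsub_diff: "fsub X A \<Longrightarrow> S \<in> A \<Longrightarrow> T \<in> A \<Longrightarrow> (\<lambda>i. S i - T i) \<in> A"
  using fsubD(2)[of X A S "\<lambda>i. (-1) * T i"] fsubD(3)[of X A T "-1"] by simp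

lemma fsub_sum:
  assumes "fsub X A" "\<And>j. j \<in> J \<Longrightarrow> T j \<in> A"
  shows "(\<lambda>i. \<Sum>j\<in>J. c j * T j i) \<in> A"
  using assms(2)
proof (induction J rule: infinite_finite_induct)
  case (insert j J)
  then show ?case
    using fsubD(2)[OF assms(1) fsubD(3)[OF assms(1), of "T j" "c j"], of "\<lambda>i. \<Sum>j\<in>J. c j * T j i"] by simp
qed (use fsubD(1)[OF assms(1)] in auto)

lemma cnj_fip: "cnj (fip X S T) = fip X T S"
  by (simp add: fip_def mult.commute)

lemma fip_simps:
  "fip X (\<lambda>i. S i + T i) R = fip X S R + fip X T R" "fip X (\<lambda>i. S i - T i) R = fip X S R - fip X T R"
  "fip X (\<lambda>i. c * T i) R = c * fip X T R"
  "fip X R (\<lambda>i. S i + T i) = fip X R S + fip X R T" "fip X R (\<lambda>i. S i - T i) = fip X R S - fip X R T"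
  "fip X R (\<lambda>i. c * T i) = cnj c * fip X R T" "fip X (\<lambda>_. 0) R = 0" "fip X R (\<lambda>_. 0) = 0"
  by (simp_all add: fip_def algebra_simps sum.distrib sum_subtractf sum_distrib_left)

lemma fip_sum:
  "fip X (\<lambda>i. \<Sum>j\<in>J. c j * T j i) R = (\<Sum>j\<in>J. c j * fip X (T j) R)"
  "fip X R (\<lambda>i. \<Sum>j\<in>J. c j * T j i) = (\<Sum>j\<in>J. cnj (c j) * fip X R (T j))"
  unfolding fip_def
  by (simp_all add: sum_distrib_left sum_distrib_right mult_ac, (subst sum.swap, simp)+)

lemma fip_self: "fip X T T = of_real (\<Sum>i\<in>X. (cmod (T i))\<^sup>2)"
  by (simp add: fip_def complex_mult_cnj cmod_power2)

lemma fip_self_eq_0: "finite X \<Longrightarrow> fip X T T = 0 \<longleftrightarrow> (\<forall>i\<in>X. T i = 0)"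
  unfolding fip_self of_real_eq_0_iff by (subst sum_nonneg_eq_0_iff) auto

definition orthonormal :: "'i set \<Rightarrow> nat \<Rightarrow> (nat \<Rightarrow> 'i \<Rightarrow> complex) \<Rightarrow> bool" where
  "orthonormal X k b \<longleftrightarrow> (\<forall>i<k. \<forall>j<k. fip X (b i) (b j) = (if i = j then 1 else 0))"

text \<open>The vector \<open>u\<close> is the projection of the unit vector at \<open>x\<close> to
  the span of the system: its value at \<open>x\<close> and its squared norm are both the sum
  \<open>s\<close> of the squared moduli at \<open>x\<close>. Hence \<open>s^2 \<le> s\<close>, so
  \<open>s \<le> 1\<close>, and summing over \<open>x\<close> bounds \<open>k\<close>. This lets
  systems of maximal length exist.\<close>

lemma orthonormal_bound:
  assumes X: "finite X" and on: "orthonormal X k b"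
  shows "k \<le> card X"
proof -
  have le1: "(\<Sum>i<k. (cmod (b i x))\<^sup>2) \<le> 1" if "x \<in> X" for x
  proof -
    define s where "s = (\<Sum>i<k. (cmod (b i x))\<^sup>2)"
    define u where "u = (\<lambda>y. \<Sum>i<k. cnj (b i x) * b i y)"
    have "u x = of_real s"
      by (simp add: u_def s_def complex_mult_cnj cmod_power2 mult.commute[of "cnj _"])
    have "fip X u u = (\<Sum>i<k. \<Sum>j<k. cnj (b j x) * b i x * fip X (b j) (b i))"
      unfolding u_def fip_sum by (simp add: sum_distrib_left mult_ac, subst sum.swap, simp)
    also have "\<dots> = (\<Sum>i<k. \<Sum>j<k. if j = i then cnj (b j x) * b i x else 0)"
      using on by (intro sum.cong) (auto simp: orthonormal_def)
    also have "\<dots> = of_real s"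
      by (simp add: s_def complex_mult_cnj cmod_power2 mult.commute[of "cnj _"])
    finally have "(\<Sum>i\<in>X. (cmod (u i))\<^sup>2) = s"
      unfolding fip_self of_real_eq_iff .
    moreover have "(cmod (u x))\<^sup>2 \<le> (\<Sum>i\<in>X. (cmod (u i))\<^sup>2)"
      using X that by (intro member_le_sum) auto
    ultimately have "s\<^sup>2 \<le> s" by (simp add: \<open>u x = of_real s\<close>)
    moreover have "0 \<le> s" by (simp add: s_def sum_nonneg)
    ultimately show ?thesis
      unfolding s_def[symmetric] by (cases "s = 0") (auto simp: power2_eq_square)
  qed
  have "real k = (\<Sum>i<k. \<Sum>x\<in>X. (cmod (b i x))\<^sup>2)"
  proof -
    have "(\<Sum>x\<in>X. (cmod (b i x))\<^sup>2) = 1" if "i < k" for i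
    proof -
      have "complex_of_real (\<Sum>x\<in>X. (cmod (b i x))\<^sup>2) = of_real 1"
        using on that by (simp only: orthonormal_def fip_self[symmetric]) simp
      then show ?thesis by (simp only: of_real_eq_iff)
    qed
    then show ?thesis by simp
  qed
  also have "\<dots> = (\<Sum>x\<in>X. \<Sum>i<k. (cmod (b i x))\<^sup>2)" by (rule sum.swap)
  also have "\<dots> \<le> (\<Sum>x\<in>X. 1)" by (intro sum_mono le1)
  finally show ?thesis by simp
qed

lemma orthonormal_basis_exists:
  assumes X: "finite X" and A: "fsub X A"
  obtains k b where "\<And>i. i < k \<Longrightarrow> b i \<in> A" "orthonormal X k b"
    "\<And>T. T \<in> A \<Longrightarrow> T = (\<lambda>x. \<Sum>i<k. fip X T (b i) * b i x)"
proof -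
  define Q where "Q k \<longleftrightarrow> (\<exists>b. (\<forall>i<k. b i \<in> A) \<and> orthonormal X k b)" for k
  have "Q 0" by (simp add: Q_def orthonormal_def)
  moreover have bd: "\<forall>k. Q k \<longrightarrow> k \<le> card X" using orthonormal_bound[OF X] by (auto simp: Q_def)
  ultimately have "Q (GREATEST k. Q k)" and gr: "\<And>k. Q k \<Longrightarrow> k \<le> (GREATEST k. Q k)"
    using GreatestI_ex_nat[of Q "card X"] Greatest_le_nat[of Q _ "card X"] by blast+
  then obtain k b where k: "k = (GREATEST k. Q k)" and b: "\<And>i. i < k \<Longrightarrow> b i \<in> A" and on: "orthonormal X k b"
    by (auto simp: Q_def)
  have "T = (\<lambda>x. \<Sum>i<k. fip X T (b i) * b i x)" if T: "T \<in> A" for T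
  proof -
    define R where "R = (\<lambda>x. T x - (\<Sum>i<k. fip X T (b i) * b i x))"
    have RA: "R \<in> A"
      unfolding R_def by (intro fsub_diff[OF A] T fsub_sum[OF A] b) auto
    have Rb: "fip X R (b j) = 0" if "j < k" for j
    proof -
      have "(\<Sum>i<k. fip X T (b i) * fip X (b i) (b j)) = (\<Sum>i<k. if i = j then fip X T (b i) else 0)"
        using on that by (intro sum.cong) (auto simp: orthonormal_def)
      with that show ?thesis by (simp add: R_def fip_simps fip_sum)
    qed
    \<comment> \<open>Otherwise the normalized residue could be appended to a system of maximal
      length.\<close>
    have "fip X R R = 0"
    proof (rule ccontr)
      assume nz: "fip X R R \<noteq> 0"
      define r where "r = sqrt (\<Sum>i\<in>X. (cmod (R i))\<^sup>2)"
      have rr: "fip X R R = of_real (r * r)"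
        unfolding fip_self r_def by (simp add: sum_nonneg)
      with nz have r0: "r \<noteq> 0" by auto
      define z where "z = (\<lambda>x. of_real (1 / r) * R x)"
      have "z \<in> A" unfolding z_def by (intro fsubD(3)[OF A] RA)
      moreover have zz: "fip X z z = 1"
        unfolding z_def fip_simps using r0 by (simp add: rr)
      have zb: "fip X z (b j) = 0" "fip X (b j) z = 0" if "j < k" for j
        using Rb[OF that] cnj_fip[of X R "b j"] unfolding z_def fip_simps by simp_all
      have "orthonormal X (Suc k) (b(k := z))"
        using on by (auto simp: orthonormal_def less_Suc_eq zz zb)
      ultimately have "Q (Suc k)"
        using b unfolding Q_def by (intro exI[of _ "b(k := z)"]) (auto simp: less_Suc_eq)
      from gr[OF this] show False using k by simp
    qed
    then have "R x = 0" for x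
      using fip_self_eq_0[OF X, of R] fsubD(4)[OF A RA, of x] by (cases "x \<in> X") auto
    then show ?thesis by (simp add: R_def fun_eq_iff)
  qed
  with b on that show ?thesis by blast
qed

lemma fproj_exists:
  assumes X: "finite X" and A: "fsub X A"
  obtains P where "P \<in> A" "\<And>S. S \<in> A \<Longrightarrow> fip X (\<lambda>i. T i - P i) S = 0"
proof -
  obtain k b where b: "\<And>i. i < k \<Longrightarrow> b i \<in> A" and on: "orthonormal X k b"
    and ex: "\<And>S. S \<in> A \<Longrightarrow> S = (\<lambda>x. \<Sum>i<k. fip X S (b i) * b i x)"
    using orthonormal_basis_exists[OF X A] by blast
  define P where "P = (\<lambda>x. \<Sum>i<k. fip X T (b i) * b i x)"
  show ?thesis
  proof (rule that[of P])
    show "P \<in> A" unfolding P_def by (intro fsub_sum[OF A] b) auto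
    fix S assume "S \<in> A"
    have Pb: "fip X (\<lambda>x. T x - P x) (b j) = 0" if "j < k" for j
    proof -
      have "(\<Sum>i<k. fip X T (b i) * fip X (b i) (b j)) = (\<Sum>i<k. if i = j then fip X T (b i) else 0)"
        using on that by (intro sum.cong) (auto simp: orthonormal_def)
      with that show ?thesis by (simp add: P_def fip_simps fip_sum)
    qed
    show "fip X (\<lambda>x. T x - P x) S = 0"
      by (subst ex[OF \<open>S \<in> A\<close>]) (simp add: fip_sum Pb)
  qed
qed

section \<open>Tensor powers of the standard representation extended by a trivial summand\<close>

definition LL :: "nat \<Rightarrow> 'a list set" where
  "LL N = {I. length I = N}"

lemma finite_LL [simp]: "finite (LL N :: 'a :: finite list set)"
  using finite_lists_length_eq[of "UNIV :: 'a set" N] by (simp add: LL_def)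

lemma LL_0 [simp]: "LL 0 = {[]}"
  by (auto simp: LL_def)

lemma sum_LL_Suc: "(\<Sum>I\<in>LL (Suc N). F I) = (\<Sum>a\<in>UNIV. \<Sum>I\<in>LL N. F (a # I))"
  for F :: "'a :: finite list \<Rightarrow> 'b :: comm_monoid_add"
proof -
  have "(\<Sum>a\<in>UNIV. \<Sum>I\<in>LL N. F (a # I)) = (\<Sum>(a, I)\<in>UNIV \<times> LL N. F (a # I))"
    by (simp add: sum.cartesian_product)
  also have "\<dots> = (\<Sum>I\<in>LL (Suc N). F I)"
    by (rule sum.reindex_bij_witness[of _ "\<lambda>I. (hd I, tl I)" "\<lambda>(a, I). a # I"])
       (auto simp: LL_def length_Suc_conv)
  finally show ?thesis by simp
qed

text \<open>Homogenization: the index \<open>None\<close> stands for an extra coordinate equal to 1, so that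
  tensors of degree \<open>N\<close> on the extended space give the polynomials of degree at most \<open>N\<close>.\<close>

fun ext :: "complex ^ 'n ^ 'n \<Rightarrow> 'n option \<Rightarrow> 'n option \<Rightarrow> complex" where
  "ext g (Some i) (Some j) = g $ i $ j"
| "ext g None None = 1"
| "ext g _ _ = 0"

text \<open>Matrix entries of the tensor powers of \<open>ext g\<close>; the common length of the
  two lists is the order of the power.\<close>

fun rr :: "complex ^ 'n ^ 'n \<Rightarrow> 'n option list \<Rightarrow> 'n option list \<Rightarrow> complex" where
  "rr g [] [] = 1"
| "rr g (a # J) (b # I) = ext g a b * rr g J I"
| "rr g _ _ = 0"

text \<open>Substitution of \<open>g\<close> into the variables, hence a right action:
  \<open>g ** h\<close> acts by \<open>g\<close> first and then by \<open>h\<close>.\<close>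

definition act :: "nat \<Rightarrow> complex ^ 'n ^ 'n \<Rightarrow> ('n option list \<Rightarrow> complex) \<Rightarrow> 'n option list \<Rightarrow> complex" where
  "act N g T I = (\<Sum>J\<in>LL N. T J * rr g J I)"

text \<open>The monomial with index list \<open>I\<close> at \<open>d\<close>. For the entries of a
  diagonal matrix it is an eigenvalue of \<open>act\<close>; for the coordinates of a vector it
  serves to evaluate polynomials.\<close>

definition wt :: "('n \<Rightarrow> 'a :: comm_monoid_mult) \<Rightarrow> 'n option list \<Rightarrow> 'a" where
  "wt d I = prod_list (map (\<lambda>a. case a of None \<Rightarrow> 1 | Some i \<Rightarrow> d i) I)"

lemma sum_UNIV_option: "(\<Sum>a\<in>UNIV. F a) = F None + (\<Sum>i\<in>UNIV. F (Some i))"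
  for F :: "'n :: finite option \<Rightarrow> 'b :: comm_monoid_add"
  unfolding UNIV_option_conv by (subst sum.insert) (auto simp: sum.reindex)

lemma ext_mult: "(\<Sum>c\<in>UNIV. ext g a c * ext h c b) = ext (g ** h) a b"
  by (cases a; cases b) (simp_all add: sum_UNIV_option matrix_matrix_mult_def)

lemma ext_adj: "ext (adj g) a b = cnj (ext g b a)"
  by (cases a; cases b) (simp_all add: adj_def)

lemma ext_diagm: "ext (diagm d) a b = (if a = b then (case a of None \<Rightarrow> 1 | Some i \<Rightarrow> d i) else 0)"
  by (cases a; cases b) (simp_all add: diagm_def)

lemma rr_length: "length J \<noteq> length I \<Longrightarrow> rr g J I = 0"
  by (induction g J I rule: rr.induct) auto

lemma rr_mult: "length J = N \<Longrightarrow> length I = N \<Longrightarrow> (\<Sum>K\<in>LL N. rr g J K * rr h K I) = rr (g ** h) J I"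
proof (induction N arbitrary: J I)
  case (Suc N)
  then obtain a J' b I' where JI: "J = a # J'" "I = b # I'" "length J' = N" "length I' = N"
    by (metis length_Suc_conv)
  have "(\<Sum>K\<in>LL (Suc N). rr g J K * rr h K I)
      = (\<Sum>c\<in>UNIV. \<Sum>K\<in>LL N. (ext g a c * ext h c b) * (rr g J' K * rr h K I'))"
    by (simp add: sum_LL_Suc JI mult_ac)
  also have "\<dots> = ext (g ** h) a b * rr (g ** h) J' I'"
    by (simp add: Suc.IH[OF JI(3,4), symmetric] ext_mult[symmetric] sum_product)
  finally show ?case by (simp add: JI)
qed auto

lemma rr_adj: "rr (adj g) I J = cnj (rr g J I)"
  by (induction g J I rule: rr.induct) (auto simp: ext_adj)

lemma rr_diagm: "rr (diagm d) J I = (if J = I then wt d I else 0)"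
  by (induction "diagm d" J I rule: rr.induct) (auto simp: ext_diagm wt_def)

lemma act_mult: "act N (g ** h) T = act N h (act N g T)"
proof
  fix I :: "'a option list"
  show "act N (g ** h) T I = act N h (act N g T) I"
  proof (cases "length I = N")
    case True
    have "act N (g ** h) T I = (\<Sum>J\<in>LL N. T J * (\<Sum>K\<in>LL N. rr g J K * rr h K I))"
      unfolding act_def using True by (intro sum.cong refl) (subst rr_mult[of _ N], auto simp: LL_def)
    also have "\<dots> = (\<Sum>K\<in>LL N. (\<Sum>J\<in>LL N. T J * rr g J K) * rr h K I)"
      by (simp add: sum_distrib_left sum_distrib_right mult.assoc, subst sum.swap, simp)
    finally show ?thesis by (simp add: act_def)
  next
    case False
    then show ?thesis by (simp add: act_def LL_def rr_length)
  qed
qed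

lemma act_support: "I \<notin> LL N \<Longrightarrow> act N g T I = 0"
  by (simp add: act_def LL_def rr_length)

lemma act_adj: "fip (LL N) (act N g S) T = fip (LL N) S (act N (adj g) T)"
  unfolding fip_def act_def
  by (simp add: sum_distrib_left sum_distrib_right rr_adj mult_ac, subst sum.swap, simp)

lemma act_diagm: "act N (diagm d) T I = (if I \<in> LL N then wt d I * T I else 0)"
  by (simp add: act_def rr_diagm if_distrib[where f = "\<lambda>x. _ * x"] mult.commute cong: if_cong)

lemma wt_1 [simp]: "wt (\<lambda>_. 1) I = 1"
  unfolding wt_def by (induction I) (auto split: option.splits)

lemma act_mat_1: "(\<And>I. I \<notin> LL N \<Longrightarrow> T I = 0) \<Longrightarrow> act N (mat 1) T = T"
  by (auto simp: fun_eq_iff mat_eq_diagm act_diagm)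

lemma act_sum: "act N g (\<lambda>i. \<Sum>j\<in>J. c j * T j i) = (\<lambda>i. \<Sum>j\<in>J. c j * act N g (T j) i)"
  by (simp add: act_def fun_eq_iff sum_distrib_left sum_distrib_right mult.assoc, subst sum.swap, simp)

lemma fip_act_unitary: "unitary k \<Longrightarrow> fip (LL N) (act N k S) (act N k T) = fip (LL N) S T"
proof -
  assume k: "unitary k"
  have "fip (LL N) (act N k S) (act N k T) = fip (LL N) S (act N (k ** adj k) T)"
    by (simp add: act_adj act_mult)
  also have "\<dots> = fip (LL N) S T"
    unfolding unitaryD(2)[OF k] fip_def by (simp add: mat_eq_diagm act_diagm)
  finally show ?thesis .
qed

lemma continuous_on_rr [continuous_intros]:
  fixes f :: "'a :: topological_space \<Rightarrow> complex ^ 'n ^ 'n"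
  assumes f: "continuous_on S f"
  shows "continuous_on S (\<lambda>x. rr (f x) J I)"
proof -
  have "continuous_on S (\<lambda>x. ext (f x) a b)" for a b
    by (cases a; cases b) (auto intro!: continuous_intros f)
  then show ?thesis
    by (induction "mat 1 :: complex ^ 'n ^ 'n" J I rule: rr.induct) (auto intro!: continuous_intros)
qed

lemma continuous_on_act [continuous_intros]:
  fixes f :: "'a :: topological_space \<Rightarrow> complex ^ 'n ^ 'n"
  shows "continuous_on S f \<Longrightarrow> continuous_on S (\<lambda>x. act N (f x) T I)"
  unfolding act_def by (intro continuous_intros)

section \<open>Volumes of tensor tuples\<close>

text \<open>Pluecker coordinates of the tuple \<open>b\<close>: its minors on the rows
  \<open>I 0, ..., I (k - 1)\<close>.\<close>

definition dt :: "nat \<Rightarrow> (nat \<Rightarrow> 'i \<Rightarrow> complex) \<Rightarrow> (nat \<Rightarrow> 'i) \<Rightarrow> complex" where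
  "dt k b I = Determinant.det (Matrix.mat k k (\<lambda>(i, j). b j (I i)))"

text \<open>Up to the factor \<open>k!\<close>, the Gram determinant of \<open>b\<close> (Cauchy--Binet).\<close>

definition vol :: "'i set \<Rightarrow> nat \<Rightarrow> (nat \<Rightarrow> 'i \<Rightarrow> complex) \<Rightarrow> real" where
  "vol X k b = (\<Sum>I\<in>PiE {..<k} (\<lambda>_. X). (cmod (dt k b I))\<^sup>2)"

lemma dt_leibniz: "dt k b I = (\<Sum>p | p permutes {..<k}. signof p * (\<Prod>i<k. b (p i) (I i)))"
proof -
  have "dt k b I = (\<Sum>p | p permutes {0..<k}. signof p *
      (\<Prod>i = 0..<k. Matrix.mat k k (\<lambda>(i, j). b j (I i)) $$ (i, p i)))"
    unfolding dt_def by (rule det_def') simp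
  also have "\<dots> = (\<Sum>p | p permutes {0..<k}. signof p * (\<Prod>i = 0..<k. b (p i) (I i)))"
    by (intro sum.cong prod.cong arg_cong[where f = "(*) _"] refl) (auto simp: permutes_def)
  finally show ?thesis by (simp add: lessThan_atLeast0)
qed

lemma vol_gram:
  assumes X: "finite X"
  shows "complex_of_real (vol X k b) = (\<Sum>p | p permutes {..<k}. \<Sum>q | q permutes {..<k}.
     signof p * cnj (signof q) * (\<Prod>i<k. fip X (b (p i)) (b (q i))))"
proof -
  have "complex_of_real (vol X k b) = (\<Sum>I\<in>PiE {..<k} (\<lambda>_. X). dt k b I * cnj (dt k b I))"
    by (simp add: vol_def complex_mult_cnj cmod_power2)
  also have "\<dots> = (\<Sum>I\<in>PiE {..<k} (\<lambda>_. X). \<Sum>p | p permutes {..<k}. \<Sum>q | q permutes {..<k}.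
     signof p * cnj (signof q) * (\<Prod>i<k. b (p i) (I i) * cnj (b (q i) (I i))))"
    unfolding dt_leibniz cnj_sum sum_product
    by (simp add: prod.distrib mult_ac)
  also have "\<dots> = (\<Sum>p | p permutes {..<k}. \<Sum>q | q permutes {..<k}. \<Sum>I\<in>PiE {..<k} (\<lambda>_. X).
     signof p * cnj (signof q) * (\<Prod>i<k. b (p i) (I i) * cnj (b (q i) (I i))))"
    by (subst sum.swap, intro sum.cong refl, subst sum.swap, rule refl)
  also have "\<dots> = (\<Sum>p | p permutes {..<k}. \<Sum>q | q permutes {..<k}.
     signof p * cnj (signof q) * (\<Prod>i<k. fip X (b (p i)) (b (q i))))"
    unfolding sum_distrib_left[symmetric] fip_def
    by (subst prod_sum_PiE) (auto simp: X)
  finally show ?thesis .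
qed

lemma vol_cong_gram:
  assumes X: "finite X" and "\<And>i j. i < k \<Longrightarrow> j < k \<Longrightarrow> fip X (b i) (b j) = fip X (c i) (c j)"
  shows "vol X k b = vol X k c"
proof -
  have "complex_of_real (vol X k b) = complex_of_real (vol X k c)"
    unfolding vol_gram[OF X]
  proof (intro sum.cong refl arg_cong[where f = "(*) _"] prod.cong)
    fix p q i assume "p \<in> {p. p permutes {..<k}}" "q \<in> {p. p permutes {..<k}}" "i \<in> {..<k}"
    then have "p i < k" "q i < k" using permutes_in_image[of _ "{..<k}" i] by auto
    then show "fip X (b (p i)) (b (q i)) = fip X (c (p i)) (c (q i))" by (rule assms(2))
  qed
  then show ?thesis by (simp only: of_real_eq_iff)
qed

lemma vol_orthonormal:
  assumes X: "finite X" and on: "orthonormal X k b"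
  shows "vol X k b > 0"
proof -
  have "(\<Prod>i<k. fip X (b (p i)) (b (q i))) = (if p = q then 1 else 0)"
    if pq: "p permutes {..<k}" "q permutes {..<k}" for p q
  proof (cases "p = q")
    case True
    have "fip X (b (q i)) (b (q i)) = 1" if "i < k" for i
      using on permutes_in_image[OF pq(2), of i] that by (auto simp: orthonormal_def)
    with True show ?thesis by simp
  next
    case False
    then obtain i where i: "p i \<noteq> q i" by auto
    then have "i < k" using pq by (metis permutes_not_in lessThan_iff)
    then have "p i < k" "q i < k" using permutes_in_image[OF pq(1), of i] permutes_in_image[OF pq(2), of i] by auto
    with on i have "fip X (b (p i)) (b (q i)) = 0" by (auto simp: orthonormal_def)
    with \<open>i < k\<close> False show ?thesis by (auto intro!: prod_zero)
  qed
  then have "complex_of_real (vol X k b) = (\<Sum>p | p permutes {..<k}. \<Sum>q | q permutes {..<k}.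
     signof p * cnj (signof q) * (if p = q then 1 else 0))"
    unfolding vol_gram[OF X] by (intro sum.cong refl arg_cong[where f = "(*) _"]) auto
  also have "\<dots> = (\<Sum>p | p permutes {..<k}. signof p * cnj (signof p))"
    by (intro sum.cong refl) (simp add: if_distrib[where f = "\<lambda>x. _ * x"] finite_permutations cong: if_cong)
  also have "\<dots> = (\<Sum>p | p permutes {..<k}. 1)"
    by (intro sum.cong refl) (auto simp: sign_def)
  also have "\<dots> = of_real (fact k)"
    by (simp add: card_permutations)
  finally have "vol X k b = fact k" by (simp only: of_real_eq_iff)
  then show ?thesis by simp
qed

lemma dt_lincomb:
  assumes "\<And>j x. j < k \<Longrightarrow> c j x = (\<Sum>i<k. M j i * b i x)"
  shows "dt k c I = Determinant.det (Matrix.mat k k (\<lambda>(i, j). M j i)) * dt k b I"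
proof -
  have "Matrix.mat k k (\<lambda>(i, j). c j (I i)) = Matrix.mat k k (\<lambda>(i, j). b j (I i)) * Matrix.mat k k (\<lambda>(i, j). M j i)"
    by (rule eq_matI) (auto simp: assms scalar_prod_def lessThan_atLeast0 mult.commute)
  then show ?thesis
    unfolding dt_def by (simp add: Determinant.det_mult[of _ k] mult.commute)
qed

lemma vol_lincomb:
  assumes "\<And>j x. j < k \<Longrightarrow> c j x = (\<Sum>i<k. M j i * b i x)"
  shows "vol X k c = (cmod (Determinant.det (Matrix.mat k k (\<lambda>(i, j). M j i))))\<^sup>2 * vol X k b"
proof -
  have "dt k c I = Determinant.det (Matrix.mat k k (\<lambda>(i, j). M j i)) * dt k b I" for I
    by (rule dt_lincomb) (rule assms)
  then show ?thesis
    by (simp add: vol_def norm_mult power_mult_distrib sum_distrib_left)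
qed

lemma dt_scale: "dt k (\<lambda>j x. w x * b j x) I = (\<Prod>i<k. w (I i)) * dt k b I"
  unfolding dt_leibniz by (simp add: sum_distrib_left prod.distrib mult_ac)

text \<open>In a basis \<open>\<phi>\<close> of the span that is dual to a tuple \<open>I\<close> of indices with nonvanishing minor,
  \<open>\<phi> j x\<close> is up to a factor the minor of \<open>I(j := x)\<close>; so where it does not vanish, \<open>x\<close> has the
  same weight as \<open>I j\<close>.\<close>

lemma exchange_weights:
  fixes w :: "'i \<Rightarrow> real"
  assumes w: "\<And>x. w x > 0" and I: "I \<in> PiE {..<k} (\<lambda>_. X)" "dt k b I \<noteq> 0"
    and wI: "\<And>J. J \<in> PiE {..<k} (\<lambda>_. X) \<Longrightarrow> dt k b J \<noteq> 0 \<Longrightarrow> (\<Prod>j<k. w (J j)) = 1"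
    and l: "l < k"
  obtains c where "\<And>x. x \<in> X \<Longrightarrow> h (w x) * b l x = (\<Sum>i<k. c i * b i x)"
proof -
  define A where "A = Matrix.mat k k (\<lambda>(i, j). b j (I i))"
  have A: "A \<in> carrier_mat k k" by (simp add: A_def)
  have dA: "Determinant.det A \<noteq> 0" using I by (simp add: dt_def A_def)
  \<comment> \<open>The inverse of \<open>A\<close>, written with the adjugate; it yields the dual
    basis \<open>ph\<close>.\<close>
  define N where "N = (1 / Determinant.det A) \<cdot>\<^sub>m adj_mat A"
  have N: "N \<in> carrier_mat k k" using Determinant.adj_mat(1)[OF A] by (simp add: N_def)
  have AN: "A * N = 1\<^sub>m k" and NA: "N * A = 1\<^sub>m k"
    using Determinant.adj_mat[OF A] A dA by (auto simp: N_def mult_smult_distrib[OF A Determinant.adj_mat(1)[OF A]] mult_smult_assoc_mat[OF Determinant.adj_mat(1)[OF A] A] intro!: eq_matI)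
  have dN: "Determinant.det N \<noteq> 0"
    using Determinant.det_mult[OF A N] AN by auto
  define ph where "ph m x = (\<Sum>i<k. b i x * N $$ (i, m))" for m x
  have ph_I: "ph m (I j) = (if j = m then 1 else 0)" if "m < k" "j < k" for m j
  proof -
    have "ph m (I j) = (A * N) $$ (j, m)"
      using that A N by (simp add: ph_def A_def scalar_prod_def lessThan_atLeast0)
    then show ?thesis using that by (simp add: AN)
  qed
  have b_ph: "b i x = (\<Sum>m<k. ph m x * b i (I m))" if "i < k" for i x
  proof -
    have "(\<Sum>m<k. ph m x * b i (I m)) = (\<Sum>m<k. \<Sum>j<k. b j x * N $$ (j, m) * A $$ (m, i))"
      using that by (simp add: ph_def sum_distrib_right A_def)
    also have "\<dots> = (\<Sum>j<k. b j x * (\<Sum>m<k. N $$ (j, m) * A $$ (m, i)))"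
      by (subst sum.swap) (simp add: sum_distrib_left mult.assoc)
    also have "\<dots> = (\<Sum>j<k. b j x * (N * A) $$ (j, i))"
      using that A N by (intro sum.cong refl) (simp add: scalar_prod_def lessThan_atLeast0)
    also have "\<dots> = (\<Sum>j<k. if j = i then b i x else 0)"
      using that by (intro sum.cong refl) (simp add: NA)
    finally show ?thesis using that by simp
  qed
  have wt: "w x = w (I j)" if j: "j < k" and x: "x \<in> X" "ph j x \<noteq> 0" for j x
  proof -
    define J where "J = I(j := x)"
    have J: "J \<in> PiE {..<k} (\<lambda>_. X)" using I(1) j x by (auto simp: J_def PiE_iff extensional_def)
    have "dt k ph J = Determinant.det (Matrix.mat k k (\<lambda>(i, j). N $$ (i, j))) * dt k b J"
      by (rule dt_lincomb) (simp add: ph_def mult.commute)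
    moreover have "dt k ph J = ph j x"
    proof -
      define v where "v = Matrix.vec k (\<lambda>m. ph m x)"
      have "transpose_mat (Matrix.mat k k (\<lambda>(i, m). ph m (J i))) = replace_col (1\<^sub>m k) (1\<^sub>m k *\<^sub>v v) j"
        by (rule eq_matI) (auto simp: replace_col_def v_def J_def ph_I j)
      then have "Determinant.det (Matrix.mat k k (\<lambda>(i, m). ph m (J i))) = Matrix.vec_index v j * 1"
        by (metis Determinant.det_transpose cramer_lemma_mat det_one j mat_carrier one_carrier_mat v_def vec_carrier)
      with j show ?thesis by (simp add: dt_def v_def)
    qed
    ultimately have "dt k b J \<noteq> 0" using x by auto
    from wI[OF J this] wI[OF I] have "(\<Prod>i<k. w (J i)) = (\<Prod>i<k. w (I i))" by simp
    moreover have "(\<Prod>i<k. w (J i)) = w x * (\<Prod>i\<in>{..<k} - {j}. w (I i))"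
      using j by (subst prod.remove[of _ j]) (auto simp: J_def)
    moreover have "(\<Prod>i<k. w (I i)) = w (I j) * (\<Prod>i\<in>{..<k} - {j}. w (I i))"
      using j by (subst prod.remove[of _ j]) auto
    moreover have "(\<Prod>i\<in>{..<k} - {j}. w (I i)) > 0" by (intro prod_pos ballI w)
    ultimately show ?thesis by (metis mult_right_cancel less_irrefl)
  qed
  show ?thesis
  proof (rule that)
    fix x assume x: "x \<in> X"
    have "h (w x) * b l x = (\<Sum>m<k. h (w x) * ph m x * b l (I m))"
      by (subst b_ph[OF l]) (simp add: sum_distrib_left mult.assoc)
    also have "\<dots> = (\<Sum>m<k. h (w (I m)) * ph m x * b l (I m))"
    proof (intro sum.cong refl)
      fix m assume "m \<in> {..<k}"
      then show "h (w x) * ph m x * b l (I m) = h (w (I m)) * ph m x * b l (I m)"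
        using wt[of m x] x by (cases "ph m x = 0") auto
    qed
    also have "\<dots> = (\<Sum>i<k. (\<Sum>m<k. h (w (I m)) * N $$ (i, m) * b l (I m)) * b i x)"
      unfolding ph_def by (simp add: sum_distrib_left sum_distrib_right mult_ac, subst sum.swap, simp)
    finally show "h (w x) * b l x = (\<Sum>i<k. (\<Sum>m<k. h (w (I m)) * N $$ (i, m) * b l (I m)) * b i x)" .
  qed
qed

lemma continuous_on_vol [continuous_intros]:
  assumes X: "finite X" and b: "\<And>j x. continuous_on S (\<lambda>g. b g j x)"
  shows "continuous_on S (\<lambda>g. vol X k (b g))"
  unfolding vol_def dt_leibniz by (intro continuous_intros b)

section \<open>The Kempf--Ness function\<close>

text \<open>Up to \<open>k!\<close>, the squared norm of the image under \<open>g\<close> of the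
  decomposable vector formed by \<open>b\<close> in the exterior power. An element that preserves
  the span of \<open>b\<close> only multiplies it by a constant.\<close>

definition VF :: "nat \<Rightarrow> nat \<Rightarrow> (nat \<Rightarrow> 'n option list \<Rightarrow> complex) \<Rightarrow> complex ^ 'n ^ 'n \<Rightarrow> real" where
  "VF N k b g = vol (LL N) k (\<lambda>i. act N g (b i))"

abbreviation rdiag :: "('n \<Rightarrow> real) \<Rightarrow> complex ^ 'n ^ 'n" where
  "rdiag d \<equiv> diagm (\<lambda>i. of_real (d i))"

lemma VF_unitary: "unitary u \<Longrightarrow> VF N k b (g ** u) = VF N k b g"
  unfolding VF_def by (rule vol_cong_gram) (simp_all add: act_mult fip_act_unitary)

lemma continuous_on_VF [continuous_intros]:
  fixes f :: "'a :: topological_space \<Rightarrow> complex ^ 'n ^ 'n"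
  shows "continuous_on S f \<Longrightarrow> continuous_on S (\<lambda>x. VF N k b (f x))"
  unfolding VF_def by (intro continuous_intros) auto

section \<open>Behaviour along real powers of a positive diagonal matrix\<close>

definition WT :: "nat \<Rightarrow> ('n \<Rightarrow> real) \<Rightarrow> (nat \<Rightarrow> 'n option list) \<Rightarrow> real" where
  "WT k d I = (\<Prod>i<k. wt d (I i))"

lemma wt_of_real: "wt (\<lambda>i. complex_of_real (d i)) I = of_real (wt d I)"
  unfolding wt_def by (induction I) (auto split: option.splits)

lemma wt_pos: "(\<And>i. d i > (0::real)) \<Longrightarrow> wt d I > 0"
  unfolding wt_def by (induction I) (auto split: option.splits)

lemma wt_powr:
  fixes d :: "'a \<Rightarrow> real"
  assumes d: "\<And>i. d i > 0"
  shows "wt (\<lambda>i. d i powr t) I = wt d I powr t"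
proof (induction I)
  case (Cons a I)
  have *: "wt c (a # I) = (case a of None \<Rightarrow> 1 | Some i \<Rightarrow> c i) * wt c I" for c :: "'a \<Rightarrow> real" and a I
    by (simp add: wt_def)
  show ?case
    unfolding * Cons using wt_pos[of d I, OF d] d by (auto split: option.splits simp: powr_mult less_imp_le)
qed (simp add: wt_def)

lemma prod_powr_real:
  assumes "\<And>i. i \<in> S \<Longrightarrow> f i > (0::real)"
  shows "(\<Prod>i\<in>S. f i powr t) = (\<Prod>i\<in>S. f i) powr t"
  using assms
proof (induction S rule: infinite_finite_induct)
  case (insert x S)
  have "(\<Prod>i\<in>S. f i) > 0" using insert.prems by (intro prod_pos) auto
  with insert show ?case by (simp add: powr_mult less_imp_le)
qed auto

lemma WT_pos: "(\<And>i. d i > 0) \<Longrightarrow> WT k d I > 0"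
  unfolding WT_def by (intro prod_pos ballI wt_pos)

lemma WT_powr: "(\<And>i. d i > (0::real)) \<Longrightarrow> WT k (\<lambda>i. d i powr t) I = WT k d I powr t"
  unfolding WT_def by (simp add: wt_powr prod_powr_real wt_pos)

definition VC :: "nat \<Rightarrow> nat \<Rightarrow> (nat \<Rightarrow> 'n option list \<Rightarrow> complex) \<Rightarrow> complex ^ 'n ^ 'n \<Rightarrow> (nat \<Rightarrow> 'n option list) \<Rightarrow> real" where
  "VC N k b g I = (cmod (dt k (\<lambda>i. act N g (b i)) I))\<^sup>2"

lemma VF_rdiag: "VF N k b (g ** rdiag d) = (\<Sum>I\<in>PiE {..<k} (\<lambda>_. LL N). VC N k b g I * (WT k d I)\<^sup>2)"
  unfolding VF_def vol_def
proof (intro sum.cong refl)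
  fix I assume I: "I \<in> PiE {..<k} (\<lambda>_. LL N :: 'a option list set)"
  have "dt k (\<lambda>i. act N (g ** rdiag d) (b i)) I = dt k (\<lambda>i x. of_real (wt d x) * act N g (b i) x) I"
    unfolding dt_leibniz using I
    by (intro sum.cong prod.cong arg_cong[where f = "(*) _"] refl) (auto simp: act_mult act_diagm wt_of_real PiE_iff)
  also have "\<dots> = of_real (WT k d I) * dt k (\<lambda>i. act N g (b i)) I"
    by (simp add: dt_scale WT_def)
  finally show "(cmod (dt k (\<lambda>i. act N (g ** rdiag d) (b i)) I))\<^sup>2 = VC N k b g I * (WT k d I)\<^sup>2"
    by (simp add: VC_def norm_mult power_mult_distrib)
qed

lemma VF_VC: "VF N k b g = (\<Sum>I\<in>PiE {..<k} (\<lambda>_. LL N). VC N k b g I)"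
  by (simp add: VF_def vol_def VC_def)

lemma VC_nonneg: "VC N k b g I \<ge> 0"
  by (simp add: VC_def)

text \<open>Rearrangement: both powers are nondecreasing, so the differences of the
  \<open>t\<close>-th and of the \<open>(1 - t)\<close>-th powers have a nonnegative
  product.\<close>

lemma powr_swap_le:
  fixes x y t :: real
  assumes "0 < x" "0 < y" "0 \<le> t" "t \<le> 1"
  shows "x powr t * y powr (1 - t) + x powr (1 - t) * y powr t \<le> x + y"
proof -
  have *: "0 \<le> (x powr t - y powr t) * (x powr (1 - t) - y powr (1 - t))"
  proof (cases "x \<le> y")
    case True
    then show ?thesis using assms by (intro mult_nonpos_nonpos) (auto intro: powr_mono2)
  next
    case False
    then show ?thesis using assms by (intro mult_nonneg_nonneg) (auto intro: powr_mono2)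
  qed
  have "x powr t * x powr (1 - t) = x" "y powr t * y powr (1 - t) = y"
    using assms by (simp_all flip: powr_add)
  with * show ?thesis by (simp add: algebra_simps)
qed

text \<open>In \<open>t\<close>, the function is a sum of exponentials with nonnegative coefficients
  \<open>VC\<close>, and symmetrizing the double sum reduces the claim to
  \<open>powr_swap_le\<close>. The symmetric pair \<open>t\<close>, \<open>1 - t\<close> matches the
  two comparison points of \<open>VF_derivative_ineq\<close>.\<close>

lemma VF_log_convex:
  assumes d: "\<And>i. d i > 0" and t: "0 \<le> t" "t \<le> 1"
  shows "VF N k b (g ** rdiag (\<lambda>i. d i powr t)) * VF N k b (g ** rdiag (\<lambda>i. d i powr (1 - t)))
     \<le> VF N k b g * VF N k b (g ** rdiag d)"
proof -
  let ?P = "PiE {..<k} (\<lambda>_. LL N :: 'a option list set)"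
  let ?c = "VC N k b g" and ?w = "\<lambda>I. (WT k d I)\<^sup>2"
  have pw: "(WT k (\<lambda>i. d i powr s) I)\<^sup>2 = ?w I powr s" for s I
    using WT_pos[of d k I] d by (simp add: WT_powr power2_eq_square powr_mult)
  have "2 * (VF N k b (g ** rdiag (\<lambda>i. d i powr t)) * VF N k b (g ** rdiag (\<lambda>i. d i powr (1 - t))))
     = (\<Sum>I\<in>?P. \<Sum>J\<in>?P. (?c I * ?w I powr t) * (?c J * ?w J powr (1 - t)))
     + (\<Sum>I\<in>?P. \<Sum>J\<in>?P. (?c J * ?w J powr t) * (?c I * ?w I powr (1 - t)))"
    unfolding VF_rdiag pw
    by (subst (2) sum.swap) (simp add: sum_product)
  also have "\<dots> = (\<Sum>I\<in>?P. \<Sum>J\<in>?P. ?c I * ?c J * (?w I powr t * ?w J powr (1 - t) + ?w I powr (1 - t) * ?w J powr t))"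
    unfolding sum.distrib[symmetric] by (intro sum.cong refl) (simp add: algebra_simps)
  also have "\<dots> \<le> (\<Sum>I\<in>?P. \<Sum>J\<in>?P. ?c I * ?c J * (?w I + ?w J))"
    using WT_pos[of d] d t
    by (intro sum_mono mult_left_mono powr_swap_le mult_nonneg_nonneg VC_nonneg zero_less_power) auto
  also have "\<dots> = (\<Sum>I\<in>?P. \<Sum>J\<in>?P. (?c I * ?w I) * ?c J) + (\<Sum>I\<in>?P. \<Sum>J\<in>?P. ?c I * (?c J * ?w J))"
    unfolding sum.distrib[symmetric] by (intro sum.cong refl) (simp add: algebra_simps)
  also have "\<dots> = VF N k b (g ** rdiag d) * VF N k b g + VF N k b g * VF N k b (g ** rdiag d)"
    unfolding VF_rdiag VF_VC[of N k b g] sum_product ..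
  finally show ?thesis by simp
qed

lemma det_rdiag: "(\<And>i. d i > 0) \<Longrightarrow> cmod (det (rdiag d)) = (\<Prod>i\<in>UNIV. d i)"
  by (simp add: det_diagm prod_norm[symmetric] less_imp_le)

lemma norm_rdiag_cols: "(norm (G ** rdiag d))\<^sup>2 = (\<Sum>i\<in>UNIV. (norm (column i G))\<^sup>2 * (d i)\<^sup>2)"
proof -
  have "column i (G ** rdiag d) = of_real (d i) *s column i G" for i
    by (simp add: vec_eq_iff column_def mult_diagm mult.commute)
  moreover have "norm (of_real c *s v) = \<bar>c\<bar> * norm v" for c and v :: "complex ^ 'b"
  proof -
    have "of_real c *s v = c *\<^sub>R v"
      unfolding vec_eq_iff vector_scaleR_component vector_smult_component
      by (simp only: scaleR_conv_of_real) simp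
    then show ?thesis by simp
  qed
  ultimately show ?thesis
    unfolding norm_matrix_cols by (simp add: power_mult_distrib mult.commute)
qed

section \<open>Lower bounds and regularized minima\<close>

definition onb :: "nat \<Rightarrow> nat \<Rightarrow> (nat \<Rightarrow> 'n option list \<Rightarrow> complex) \<Rightarrow> bool" where
  "onb N k b \<longleftrightarrow> orthonormal (LL N) k b \<and> (\<forall>i<k. \<forall>x. x \<notin> LL N \<longrightarrow> b i x = 0)"

lemma VF_mat_1: "onb N k b \<Longrightarrow> VF N k b (mat 1) > 0"
proof -
  assume b: "onb N k b"
  have "VF N k b (mat 1) = vol (LL N) k b"
    unfolding VF_def using b by (intro vol_cong_gram) (auto simp: onb_def act_mat_1)
  with b show ?thesis using vol_orthonormal[of "LL N" k b] by (simp add: onb_def)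
qed

text \<open>Unitary factors on the right do not change \<open>VF\<close>, so its value at
  \<open>k1\<close> is that at the identity. A diagonal factor multiplies each minor by a product of
  \<open>N * k\<close> numbers, each of them 1 or an entry of \<open>d\<close>, hence at least
  \<open>s\<close>.\<close>

lemma VF_lower:
  assumes b: "onb N k b" and k1: "unitary k1" "unitary k2" and d: "\<And>i. d i > 0"
    and s: "0 < s" "s \<le> 1" "\<And>i. s \<le> d i"
  shows "VF N k b (k1 ** rdiag d ** k2) \<ge> (s ^ (N * k))\<^sup>2 * VF N k b (mat 1)"
proof -
  have wt: "s ^ N \<le> wt d I" if "I \<in> LL N" for I
  proof -
    have "s ^ length I \<le> wt d I" unfolding wt_def
    proof (induction I)
      case (Cons a I)
      have "s \<le> (case a of None \<Rightarrow> 1 | Some i \<Rightarrow> d i)" using s by (auto split: option.splits)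
      then show ?case using Cons s by (simp add: mult_mono)
    qed simp
    with that show ?thesis by (simp add: LL_def)
  qed
  have WT: "s ^ (N * k) \<le> WT k d I" if "I \<in> PiE {..<k} (\<lambda>_. LL N)" for I
  proof -
    have "(\<Prod>i<k. s ^ N) \<le> (\<Prod>i<k. wt d (I i))"
      using that s by (intro prod_mono) (auto intro!: wt)
    then show ?thesis by (simp add: WT_def power_mult)
  qed
  have "(s ^ (N * k))\<^sup>2 * VF N k b (mat 1) = (s ^ (N * k))\<^sup>2 * VF N k b k1"
    using VF_unitary[OF k1(1), of N k b "mat 1"] by simp
  also have "\<dots> \<le> VF N k b (k1 ** rdiag d)"
    unfolding VF_rdiag VF_VC[of N k b k1] sum_distrib_left using WT s
    by (intro sum_mono) (auto intro!: mult_mono power_mono simp: VC_nonneg mult.commute[of _ "(_)\<^sup>2"])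
  finally show ?thesis by (simp add: VF_unitary k1)
qed

lemma VF_pos:
  assumes b: "onb N k b" and g: "invertible g"
  shows "VF N k b g > 0"
proof -
  obtain k1 k2 d where *: "unitary k1" "unitary k2" "\<And>i. d i > (0 :: real)" "g = k1 ** rdiag d ** k2"
    using svd[OF g] by metis
  \<comment> \<open>The value 1 is included since the extra coordinate \<open>None\<close> has
    weight 1 for every \<open>d\<close>.\<close>
  define s where "s = Min (insert 1 (range d))"
  have s: "0 < s" "s \<le> 1" "\<And>i. s \<le> d i"
    unfolding s_def using * by (auto intro!: Min_le simp del: Min_insert simp: Min_gr_iff)
  have "0 < (s ^ (N * k))\<^sup>2 * VF N k b (mat 1)" using s VF_mat_1[OF b] by simp
  also have "\<dots> \<le> VF N k b g"
    unfolding *(4) by (rule VF_lower[OF b *(1,2,3) s])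
  finally show ?thesis .
qed

text \<open>Each singular value is at most \<open>norm g\<close>. As their product is 1, each is
  also at least \<open>1 / norm g ^ CARD('n)\<close>, which goes into \<open>VF_lower\<close>. So
  \<open>ln VF\<close> drops at most like a multiple of \<open>ln (norm g)\<close>.\<close>

lemma VF_lower_norm:
  fixes g :: "complex ^ 'n ^ 'n"
  assumes b: "onb N k b" and g: "cmod (det g) = 1"
  shows "norm g \<ge> 1" "VF N k b g \<ge> VF N k b (mat 1) / norm g ^ (2 * CARD('n) * N * k)"
proof -
  have "invertible g" using g by (auto simp: invertible_det_nz)
  then obtain k1 k2 d where *: "unitary k1" "unitary k2" "\<And>i. d i > (0 :: real)" "g = k1 ** rdiag d ** k2"
    using svd by metis
  have prod: "(\<Prod>i\<in>UNIV. d i) = 1"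
    using g by (simp add: *(4) det_mul norm_mult cmod_det_unitary * det_rdiag)
  have "norm g = norm (mat 1 ** rdiag d)"
    unfolding *(4) by (simp add: norm_mult_unitary norm_unitary_mult *)
  then have ng: "(norm g)\<^sup>2 = (\<Sum>i\<in>UNIV. (norm (column i (mat 1 :: complex ^ 'n ^ 'n)))\<^sup>2 * (d i)\<^sup>2)"
    by (simp only: norm_rdiag_cols)
  have col1: "norm (column i (mat 1 :: complex ^ 'n ^ 'n)) = 1" for i
  proof -
    have "complex_of_real ((norm (column i (mat 1 :: complex ^ 'n ^ 'n)))\<^sup>2) = of_real 1"
      unfolding cdot_self[symmetric] cdot_def column_def mat_def
      by (simp add: if_distrib[where f = "\<lambda>x. x * _"] cong: if_cong)
    then have "(norm (column i (mat 1 :: complex ^ 'n ^ 'n)))\<^sup>2 = 1"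
      unfolding of_real_eq_iff .
    then show ?thesis by (simp add: power2_eq_1_iff) (metis norm_ge_zero not_one_le_zero neg_0_le_iff_le)
  qed
  have dle: "d i \<le> norm g" for i
  proof (rule power2_le_imp_le)
    show "(d i)\<^sup>2 \<le> (norm g)\<^sup>2"
      unfolding ng by (simp add: col1) (rule member_le_sum, auto)
  qed simp
  show r1: "norm g \<ge> 1"
  proof (rule ccontr)
    assume "\<not> norm g \<ge> 1"
    then have "d i < 1" for i using dle[of i] by simp
    then have "(\<Prod>i\<in>UNIV. d i) < (\<Prod>i\<in>(UNIV :: 'n set). 1)"
      using * by (intro prod_mono_strict) (auto simp: less_imp_le)
    with prod show False by simp
  qed
  define s where "s = 1 / norm g ^ CARD('n)"
  have "1 \<le> d i * norm g ^ CARD('n)" for i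
  proof -
    have "1 = d i * (\<Prod>j\<in>UNIV - {i}. d j)" using prod by (subst (asm) prod.remove[of _ i]) auto
    also have "\<dots> \<le> d i * (\<Prod>j\<in>UNIV - {i}. norm g)"
      using * dle by (intro mult_left_mono prod_mono) (auto simp: less_imp_le)
    also have "\<dots> \<le> d i * norm g ^ CARD('n)"
      using *(3)[of i] r1 by (simp, intro power_increasing) auto
    finally show ?thesis .
  qed
  moreover have "norm g ^ CARD('n) \<ge> 1" by (rule one_le_power[OF r1])
  moreover from this have "norm g ^ CARD('n) > 0" by linarith
  ultimately have s: "0 < s" "s \<le> 1" "\<And>i. s \<le> d i"
    by (simp_all add: s_def pos_divide_le_eq del: zero_less_power_eq zero_less_norm_iff)
  have "VF N k b (mat 1) / norm g ^ (2 * CARD('n) * N * k) = (s ^ (N * k))\<^sup>2 * VF N k b (mat 1)"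
    by (simp add: s_def power_divide power_mult[symmetric] mult_ac)
  also have "(s ^ (N * k))\<^sup>2 * VF N k b (mat 1) \<le> VF N k b (k1 ** rdiag d ** k2)"
    by (rule VF_lower[OF b *(1,2,3) s])
  finally show "VF N k b g \<ge> VF N k b (mat 1) / norm g ^ (2 * CARD('n) * N * k)" unfolding *(4)[symmetric] .
qed

text \<open>On the span of \<open>b\<close> the element \<open>g\<close> acts by a matrix
  \<open>M\<close>, and \<open>\<kappa>\<close> is the squared modulus of its determinant.\<close>

lemma VF_semi_invariant:
  assumes b: "onb N k b" and g: "invertible g"
    and stab: "\<And>i. i < k \<Longrightarrow> \<exists>c. act N g (b i) = (\<lambda>x. \<Sum>j<k. c j * b j x)"
  obtains \<kappa> where "\<kappa> > 0" "\<And>h. VF N k b (g ** h) = \<kappa> * VF N k b h"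
proof -
  obtain M where M: "\<And>i. i < k \<Longrightarrow> act N g (b i) = (\<lambda>x. \<Sum>j<k. M i j * b j x)"
    using stab by metis
  define \<kappa> where "\<kappa> = (cmod (Determinant.det (Matrix.mat k k (\<lambda>(i, j). M j i))))\<^sup>2"
  have eq: "VF N k b (g ** h) = \<kappa> * VF N k b h" for h
    unfolding VF_def \<kappa>_def by (rule vol_lincomb) (simp add: act_mult M act_sum)
  moreover have "\<kappa> > 0"
    using eq[of "mat 1"] VF_pos[OF b g] VF_mat_1[OF b]
    by (simp add: zero_less_mult_iff \<kappa>_def)
  ultimately show ?thesis using that by blast
qed

definition unidet :: "(complex ^ 'n ^ 'n) set" where
  "unidet = {g. cmod (det g) = 1}"

lemma closed_unidet: "closed unidet"
proof -
  have "closed {g :: complex ^ 'n ^ 'n. cmod (det g) = 1}"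
    by (intro closed_Collect_eq continuous_intros)
  then show ?thesis by (simp add: unidet_def)
qed

text \<open>The quadratic term beats the logarithmic decrease of \<open>ln VF\<close>, so the
  sublevel set of the value at the identity is bounded and the minimum can be sought on a compact
  set.\<close>

lemma VF_eps_minimum:
  fixes b :: "nat \<Rightarrow> 'n :: finite option list \<Rightarrow> complex"
  assumes b: "onb N k b" and e: "e > 0"
  obtains g where "g \<in> unidet"
    "\<And>h. h \<in> unidet \<Longrightarrow> ln (VF N k b g) + e * (norm g)\<^sup>2 \<le> ln (VF N k b h) + e * (norm h)\<^sup>2"
proof -
  define F where "F g = ln (VF N k b g) + e * (norm g)\<^sup>2" for g
  have inv: "invertible g" if "g \<in> unidet" for g :: "complex ^ 'n ^ 'n"
    using that by (auto simp: unidet_def invertible_det_nz)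
  have cont: "continuous_on unidet F"
    unfolding F_def using VF_pos[OF b inv] by (intro continuous_intros) (auto simp: less_imp_neq[THEN not_sym])
  define c where "c = real (2 * CARD('n) * N * k)"
  define K where "K = F (mat 1) - ln (VF N k b (mat 1))"
  \<comment> \<open>On the sublevel set, \<open>r = norm g \<ge> 1\<close> satisfies
    \<open>e * r^2 \<le> (c + \<bar>K\<bar>) * r\<close>.\<close>
  define R where "R = 1 + (c + \<bar>K\<bar>) / e"
  have I1: "mat 1 \<in> (unidet :: (complex ^ 'n ^ 'n) set)" by (simp add: unidet_def)
  have bound: "norm g \<le> R" if g: "g \<in> unidet" "F g \<le> F (mat 1)" for g
  proof -
    have r: "norm g \<ge> 1" and low: "VF N k b g \<ge> VF N k b (mat 1) / norm g ^ (2 * CARD('n) * N * k)"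
      using VF_lower_norm[OF b] g by (auto simp: unidet_def)
    have "ln (VF N k b (mat 1)) - c * ln (norm g) = ln (VF N k b (mat 1) / norm g ^ (2 * CARD('n) * N * k))"
      using r VF_mat_1[OF b] by (subst ln_div) (auto simp: c_def ln_realpow)
    also have "\<dots> \<le> ln (VF N k b g)"
    proof (subst ln_le_cancel_iff)
      have "norm g ^ (2 * CARD('n) * N * k) \<ge> 1" by (rule one_le_power[OF r])
      then show "0 < VF N k b (mat 1) / norm g ^ (2 * CARD('n) * N * k)"
        using VF_mat_1[OF b] by (intro divide_pos_pos) linarith+
    qed (use low VF_pos[OF b inv[OF g(1)]] in auto)
    finally have "e * (norm g)\<^sup>2 \<le> K + c * ln (norm g)"
      using g(2) by (simp add: F_def K_def)
    also have "c * ln (norm g) \<le> c * norm g"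
      using r by (intro mult_left_mono ln_bound) (auto simp: c_def)
    also have "K \<le> \<bar>K\<bar> * norm g"
      using r mult_left_mono[of 1 "norm g" "\<bar>K\<bar>"] by auto
    finally have "e * norm g * norm g \<le> (c + \<bar>K\<bar>) * norm g"
      by (simp add: power2_eq_square algebra_simps)
    then have "e * norm g \<le> c + \<bar>K\<bar>" using r by (auto simp: mult_le_cancel_right)
    then show ?thesis using e by (simp add: R_def field_simps)
  qed
  have "compact (unidet \<inter> cball 0 R)"
    by (intro closed_Int_compact closed_unidet compact_cball)
  moreover have "mat 1 \<in> unidet \<inter> cball (0 :: complex ^ 'n ^ 'n) R"
    using bound[OF I1] I1 by (simp add: )
  ultimately obtain g where g: "g \<in> unidet \<inter> cball 0 R" "\<And>h. h \<in> unidet \<inter> cball 0 R \<Longrightarrow> F g \<le> F h"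
    using continuous_attains_inf[of "unidet \<inter> cball 0 R" F] continuous_on_subset[OF cont, of "unidet \<inter> cball 0 R"] by blast
  have "F g \<le> F h" if h: "h \<in> unidet" for h
  proof (cases "F h \<le> F (mat 1)")
    case True
    with bound[OF h] h show ?thesis by (intro g) auto
  next
    case False
    with g(2)[OF \<open>mat 1 \<in> unidet \<inter> cball 0 R\<close>] show ?thesis by simp
  qed
  with g that show ?thesis unfolding F_def by blast
qed

lemma unidet_invertible: "g \<in> unidet \<Longrightarrow> invertible g"
  by (auto simp: unidet_def invertible_det_nz)

lemma unidet_mult: "g \<in> unidet \<Longrightarrow> h \<in> unidet \<Longrightarrow> g ** h \<in> unidet"
  by (simp add: unidet_def det_mul norm_mult)

lemma unidet_unitary: "unitary u \<Longrightarrow> u \<in> unidet"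
  by (simp add: unidet_def cmod_det_unitary)

lemma unidet_inv: "g \<in> unidet \<Longrightarrow> matrix_inv g \<in> unidet"
proof -
  assume g: "g \<in> unidet"
  have "cmod (det (matrix_inv g ** g)) = 1"
    by (simp add: matrix_inv_inverse[OF unidet_invertible[OF g]])
  with g show ?thesis by (simp add: unidet_def det_mul norm_mult)
qed

lemma unidet_rdiag_powr:
  fixes d :: "'n :: finite \<Rightarrow> real"
  assumes "\<And>i. d i > 0" "rdiag d \<in> unidet"
  shows "rdiag (\<lambda>i. d i powr t) \<in> unidet"
proof -
  have "(\<Prod>i\<in>UNIV. d i) = 1" using assms by (simp add: unidet_def det_rdiag)
  moreover have "cmod (det (rdiag (\<lambda>i. d i powr t))) = (\<Prod>i\<in>UNIV. d i powr t)"
    by (rule det_rdiag) (simp add: assms(1)[THEN less_imp_neq, THEN not_sym])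
  ultimately show ?thesis
    using assms by (simp add: unidet_def prod_powr_real)
qed

section \<open>First variation at a regularized minimum\<close>

lemma powr_deriv_limit:
  assumes "d > (0::real)"
  shows "((\<lambda>t. (d powr (2 * t) - 1) / t) \<longlongrightarrow> 2 * ln d) (at_right 0)"
proof -
  have "((\<lambda>t. d powr (2 * t)) has_real_derivative 2 * ln d) (at 0)"
    using assms by (auto intro!: derivative_eq_intros)
  then show ?thesis
    using assms by (simp add: DERIV_def) (rule filterlim_mono[OF _ order_refl at_le], auto)
qed

text \<open>Put \<open>G = g ** u\<close>. Up to unitary factors, the path through
  \<open>G ** rdiag (d^t)\<close> leads from \<open>g\<close> to \<open>\<gamma> ** g\<close>.
  Minimality is applied to its point at \<open>t\<close> and, after translation by the inverse of
  \<open>\<gamma>\<close>, to its point at \<open>1 - t\<close>. In the sum of the two inequalities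
  log-convexity removes the \<open>VF\<close> terms, so that \<open>e\<close> can be divided out and
  a condition on norms alone remains. Its first order in \<open>t\<close> at 0 is the claim.\<close>

lemma VF_derivative_ineq:
  fixes g \<gamma> :: "complex ^ 'n ^ 'n"
  assumes b: "onb N k b" and g: "g \<in> unidet" and \<gamma>: "\<gamma> \<in> unidet"
    and min: "\<And>h. h \<in> unidet \<Longrightarrow> ln (VF N k b g) + e * (norm g)\<^sup>2 \<le> ln (VF N k b h) + e * (norm h)\<^sup>2"
    and e: "e > 0" and \<kappa>: "\<kappa> > 0" "\<And>h. VF N k b (\<gamma> ** h) = \<kappa> * VF N k b h"
    and uv: "unitary u" "unitary v" and d: "\<And>i. d i > 0"
    and M: "matrix_inv g ** \<gamma> ** g = u ** rdiag d ** v"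
  shows "(\<Sum>i\<in>UNIV. ln (d i) * ((norm (matrix_inv \<gamma> *v column i (g ** u)))\<^sup>2 * (d i)\<^sup>2
    - (norm (column i (g ** u)))\<^sup>2)) \<le> 0"
proof -
  note gi = matrix_inv_inverse[OF unidet_invertible[OF g]]
  note \<gamma>i = matrix_inv_inverse[OF unidet_invertible[OF \<gamma>]]
  define G where "G = g ** u"
  define a where "a i = (norm (column i G))\<^sup>2" for i
  define a' where "a' i = (norm (matrix_inv \<gamma> *v column i G))\<^sup>2" for i
  have G: "G \<in> unidet" unfolding G_def by (intro unidet_mult g unidet_unitary uv)
  have "rdiag d = adj u ** (u ** rdiag d ** v) ** adj v"
    using uv by (simp add: matrix_mul_assoc unitaryD, simp add: unitaryD flip: matrix_mul_assoc)
  then have D: "rdiag d \<in> unidet"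
    unfolding M[symmetric] using g \<gamma> uv
    by (metis unidet_mult unidet_unitary unitary_adj unidet_inv)
  note Dt = unidet_rdiag_powr[OF d D]
  have "\<gamma> ** g = g ** (matrix_inv g ** \<gamma> ** g)"
    by (simp add: matrix_mul_assoc gi)
  also have "\<dots> = G ** rdiag d ** v"
    by (simp add: M G_def matrix_mul_assoc)
  finally have \<gamma>g: "\<gamma> ** g = G ** rdiag d ** v" .
  have "g = matrix_inv \<gamma> ** (\<gamma> ** g)" by (simp add: matrix_mul_assoc \<gamma>i)
  then have gv: "g = matrix_inv \<gamma> ** G ** rdiag d ** v"
    by (simp add: \<gamma>g matrix_mul_assoc)
  have VFi: "VF N k b (matrix_inv \<gamma> ** h) = VF N k b h / \<kappa>" for h
    using \<kappa>(2)[of "matrix_inv \<gamma> ** h"] \<kappa>(1) by (simp add: matrix_mul_assoc \<gamma>i)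
  have pos: "VF N k b h > 0" if "h \<in> unidet" for h
    by (rule VF_pos[OF b unidet_invertible[OF that]])
  have col: "column i (matrix_inv \<gamma> ** G) = matrix_inv \<gamma> *v column i G" for i
    by (rule column_mult)
  have sq: "(d i powr t)\<^sup>2 = d i powr (2 * t)" for i t
    using d by (simp add: power2_eq_square flip: powr_add)
  \<comment> \<open>The four sums are arranged as a product in order to expose the factor
    \<open>d^(2 t) - 1\<close>, which is of first order in \<open>t\<close>.\<close>
  have ineq: "(\<Sum>i\<in>UNIV. (d i powr (2 * t) - 1) * (a' i * d i powr (2 * (1 - t)) - a i)) \<le> 0"
    if t: "0 < t" "t < 1" for t
  proof -
    let ?D = "\<lambda>s. rdiag (\<lambda>i. d i powr s)"
    have 1: "ln (VF N k b G) + e * (\<Sum>i\<in>UNIV. a i) \<le> ln (VF N k b (G ** ?D t)) + e * (\<Sum>i\<in>UNIV. a i * d i powr (2 * t))"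
    proof -
      have "VF N k b g = VF N k b G" "norm g = norm G"
        unfolding G_def using uv by (simp_all add: VF_unitary norm_mult_unitary)
      moreover have "(norm (G ** ?D t))\<^sup>2 = (\<Sum>i\<in>UNIV. a i * d i powr (2 * t))"
        by (simp add: norm_rdiag_cols a_def sq)
      moreover have "(norm G)\<^sup>2 = (\<Sum>i\<in>UNIV. a i)" by (simp add: norm_matrix_cols a_def)
      ultimately show ?thesis
        using min[OF unidet_mult[OF G Dt, of t]] by simp
    qed
    have 2: "ln (VF N k b (G ** rdiag d)) + e * (\<Sum>i\<in>UNIV. a' i * (d i)\<^sup>2)
       \<le> ln (VF N k b (G ** ?D (1 - t))) + e * (\<Sum>i\<in>UNIV. a' i * d i powr (2 * (1 - t)))"
    proof -
      have "VF N k b g = VF N k b (matrix_inv \<gamma> ** G ** rdiag d)" "norm g = norm (matrix_inv \<gamma> ** G ** rdiag d)"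
        using gv uv by (metis VF_unitary, metis norm_mult_unitary)
      then have "VF N k b g = VF N k b (G ** rdiag d) / \<kappa>" "(norm g)\<^sup>2 = (\<Sum>i\<in>UNIV. a' i * (d i)\<^sup>2)"
        by (simp_all add: VFi norm_rdiag_cols col a'_def flip: matrix_mul_assoc)
           (simp_all add: matrix_mul_assoc norm_rdiag_cols col)
      moreover have "(norm (matrix_inv \<gamma> ** (G ** ?D (1 - t))))\<^sup>2 = (\<Sum>i\<in>UNIV. a' i * d i powr (2 * (1 - t)))"
        by (simp add: matrix_mul_assoc norm_rdiag_cols a'_def col sq)
      ultimately show ?thesis
        using min[OF unidet_mult[OF unidet_inv[OF \<gamma>] unidet_mult[OF G Dt, of "1 - t"]]] \<kappa>(1)
          pos[OF unidet_mult[OF G D]] pos[OF unidet_mult[OF G Dt, of "1 - t"]]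
        by (simp add: VFi ln_div)
    qed
    have "ln (VF N k b (G ** ?D t)) + ln (VF N k b (G ** ?D (1 - t))) = ln (VF N k b (G ** ?D t) * VF N k b (G ** ?D (1 - t)))"
      using pos[OF unidet_mult[OF G Dt, of t]] pos[OF unidet_mult[OF G Dt, of "1 - t"]]
      by (subst ln_mult) (auto simp del: zero_less_mult_iff)
    also have "\<dots> \<le> ln (VF N k b G * VF N k b (G ** rdiag d))"
      using VF_log_convex[of d t N k b G] d t pos[OF unidet_mult[OF G Dt]] pos[OF G] pos[OF unidet_mult[OF G D]]
      by (subst ln_le_cancel_iff) auto
    also have "\<dots> = ln (VF N k b G) + ln (VF N k b (G ** rdiag d))"
      using pos[OF unidet_mult[OF G D]] pos[OF G] by (simp add: ln_mult)
    finally have "e * ((\<Sum>i\<in>UNIV. a i) + (\<Sum>i\<in>UNIV. a' i * (d i)\<^sup>2))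
       \<le> e * ((\<Sum>i\<in>UNIV. a i * d i powr (2 * t)) + (\<Sum>i\<in>UNIV. a' i * d i powr (2 * (1 - t))))"
      using 1 2 by (simp add: algebra_simps)
    then have "(\<Sum>i\<in>UNIV. a i) + (\<Sum>i\<in>UNIV. a' i * (d i)\<^sup>2)
       \<le> (\<Sum>i\<in>UNIV. a i * d i powr (2 * t)) + (\<Sum>i\<in>UNIV. a' i * d i powr (2 * (1 - t)))"
      using e by simp
    moreover have "(d i powr (2 * t) - 1) * (a' i * d i powr (2 * (1 - t)) - a i)
       = a i + a' i * (d i)\<^sup>2 - a i * d i powr (2 * t) - a' i * d i powr (2 * (1 - t))" for i
    proof -
      have "d i powr (2 * t) * d i powr (2 * (1 - t)) = d i powr 2"
        by (simp flip: powr_add)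
      then have "d i powr (2 * t) * (a' i * d i powr (2 * (1 - t))) = a' i * (d i)\<^sup>2"
        using d[of i] by (simp add: powr_numeral mult.left_commute)
      then show ?thesis by (simp add: algebra_simps)
    qed
    ultimately show ?thesis
      by (simp add: sum.distrib sum_subtractf)
  qed
  have d2: "d i powr 2 = (d i)\<^sup>2" for i
    using d[of i] by simp
  define f where "f t = (\<Sum>i\<in>UNIV. (d i powr (2 * t) - 1) / t * (a' i * d i powr (2 * (1 - t)) - a i))" for t
  have "(f \<longlongrightarrow> (\<Sum>i\<in>UNIV. 2 * ln (d i) * (a' i * d i powr (2 * (1 - 0)) - a i))) (at_right 0)"
    unfolding f_def using d
    by (intro tendsto_intros powr_deriv_limit) (auto simp: less_imp_neq[THEN not_sym])
  moreover have "\<forall>\<^sub>F t in at_right 0. f t \<le> 0"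
    unfolding eventually_at_right_field
  proof (intro exI[of _ 1] conjI allI impI)
    fix t :: real assume t: "0 < t" "t < 1"
    have "f t = (\<Sum>i\<in>UNIV. (d i powr (2 * t) - 1) * (a' i * d i powr (2 * (1 - t)) - a i)) / t"
      by (simp add: f_def sum_divide_distrib)
    with ineq[OF t] t show "f t \<le> 0" by (simp add: divide_le_0_iff)
  qed simp
  ultimately have "(\<Sum>i\<in>UNIV. 2 * ln (d i) * (a' i * d i powr (2 * (1 - 0)) - a i)) \<le> 0"
    by (rule tendsto_upperbound) simp
  then have "2 * (\<Sum>i\<in>UNIV. ln (d i) * (a' i * (d i)\<^sup>2 - a i)) \<le> 0"
    using d by (simp add: d2 sum_distrib_left mult.assoc)
  then show ?thesis by (simp add: a_def a'_def G_def)
qed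

text \<open>A negative term \<open>h i\<close> forces \<open>(d i)^2\<close> to lie between
  \<open>1 / C\<close> and \<open>C\<close>, because \<open>a\<close> and \<open>a'\<close> differ
  at most by the factor \<open>C\<close>; such a term is at least \<open>- C * ln C * a i\<close>.
  So the single term \<open>h j\<close> is bounded by the total of these amounts. The threshold
  \<open>2 * C\<close> makes the bracket in \<open>h j\<close> at least
  \<open>a j * (d j)^2 / (2 * C)\<close>.\<close>

lemma log_weight_bound:
  fixes a a' d :: "'n :: finite \<Rightarrow> real"
  assumes a: "\<And>i. a i > 0" "\<And>i. a' i > 0" "\<And>i. a i \<le> C * a' i" "\<And>i. a' i \<le> C * a i" and C: "C \<ge> 1"
    and d: "\<And>i. d i > 0" and le0: "(\<Sum>i\<in>UNIV. ln (d i) * (a' i * (d i)\<^sup>2 - a i)) \<le> 0"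
    and j: "2 * C \<le> (d j)\<^sup>2"
  shows "ln (d j) * (a j * (d j)\<^sup>2) \<le> 2 * C\<^sup>2 * ln C * (\<Sum>i\<in>UNIV. a i)"
proof -
  define h where "h i = ln (d i) * (a' i * (d i)\<^sup>2 - a i)" for i
  have lnC: "ln C \<ge> 0" using C by simp
  have lnd: "2 * ln (d i) = ln ((d i)\<^sup>2)" for i
    using d[of i] by (simp add: ln_realpow)
  have low: "h i \<ge> - (C * ln C * a i)" for i
  proof (cases "ln (d i) \<ge> 0")
    case True
    show ?thesis
    proof (cases "a' i * (d i)\<^sup>2 \<ge> a i")
      case ge: True
      have "0 \<le> h i" unfolding h_def using True ge by (intro mult_nonneg_nonneg) auto
      moreover have "0 \<le> C * ln C * a i" using C lnC a(1)[of i] by simp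
      ultimately show ?thesis by linarith
    next
      case False
      then have "a' i * (d i)\<^sup>2 \<le> a' i * C" using a(3)[of i] by (simp add: mult.commute)
      then have "(d i)\<^sup>2 \<le> C" using a(2)[of i] by simp
      then have "ln ((d i)\<^sup>2) \<le> ln C" using d[of i] C by (subst ln_le_cancel_iff) auto
      then have "ln (d i) \<le> ln C" using lnd[of i] True by simp
      moreover have "a i - a' i * (d i)\<^sup>2 \<le> a i" using a(2)[of i] by simp
      ultimately have "ln (d i) * (a i - a' i * (d i)\<^sup>2) \<le> ln C * a i"
        using True False by (intro mult_mono) (use lnC in auto)
      also have "\<dots> \<le> C * (ln C * a i)"
        using C lnC a(1)[of i] mult_right_mono[of 1 C "ln C * a i"] by simp
      finally show ?thesis by (simp add: h_def algebra_simps)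
    qed
  next
    case neg: False
    show ?thesis
    proof (cases "a' i * (d i)\<^sup>2 \<le> a i")
      case True
      have "0 \<le> h i" unfolding h_def using True neg by (intro mult_nonpos_nonpos) auto
      moreover have "0 \<le> C * ln C * a i" using C lnC a(1)[of i] by simp
      ultimately show ?thesis by linarith
    next
      case False
      have "a' i * 1 \<le> C * (a' i * (d i)\<^sup>2)"
        using False C order_trans[OF a(4)[of i] mult_left_mono[of "a i" "a' i * (d i)\<^sup>2" C]] by simp
      then have "a' i * 1 \<le> a' i * (C * (d i)\<^sup>2)" by (simp add: mult_ac)
      then have "1 \<le> C * (d i)\<^sup>2" using a(2)[of i] by (subst (asm) mult_le_cancel_left_pos)
      then have "0 \<le> ln (C * (d i)\<^sup>2)" by simp
      also have "\<dots> = ln C + 2 * ln (d i)" using C d[of i] by (simp add: ln_mult ln_realpow)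
      finally have "- ln (d i) \<le> ln C" using neg by simp
      moreover have "(d i)\<^sup>2 \<le> 1" using neg d[of i] by (simp add: power_le_one)
      then have "a' i * (d i)\<^sup>2 - a i \<le> C * a i"
        using a(1)[of i] a(4)[of i] mult_left_mono[of "(d i)\<^sup>2" 1 "a' i"] less_imp_le[OF a(2)[of i]]
        by linarith
      ultimately have "- ln (d i) * (a' i * (d i)\<^sup>2 - a i) \<le> ln C * (C * a i)"
        using neg False by (intro mult_mono) (use lnC in auto)
      then show ?thesis by (simp add: h_def algebra_simps)
    qed
  qed
  have "h j \<le> - (\<Sum>i\<in>UNIV - {j}. h i)"
    using le0 unfolding h_def[symmetric] by (subst (asm) sum.remove[of _ j]) auto
  also have "\<dots> = (\<Sum>i\<in>UNIV - {j}. - h i)" by (simp add: sum_negf)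
  also have "\<dots> \<le> (\<Sum>i\<in>UNIV - {j}. C * ln C * a i)"
    using low by (intro sum_mono) (simp add: minus_le_iff)
  also have "\<dots> \<le> (\<Sum>i\<in>UNIV. C * ln C * a i)"
    using a(1) C lnC by (intro sum_mono2) (auto intro!: mult_nonneg_nonneg simp: less_imp_le)
  finally have hj: "h j \<le> C * ln C * (\<Sum>i\<in>UNIV. a i)" by (simp add: sum_distrib_left)
  have "1 \<le> (d j)\<^sup>2" using j C by linarith
  then have "0 \<le> ln ((d j)\<^sup>2)" by (rule ln_ge_zero)
  then have lnj: "ln (d j) \<ge> 0" using lnd[of j] by linarith
  have "a j * (d j)\<^sup>2 \<le> C * (a' j * (d j)\<^sup>2)"
    using mult_right_mono[OF a(3)[of j], of "(d j)\<^sup>2"] by (simp add: mult.assoc)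
  moreover have "2 * C * a j \<le> a j * (d j)\<^sup>2"
    using j a(1)[of j] by (simp add: mult.commute)
  ultimately have "a j * (d j)\<^sup>2 \<le> 2 * C * (a' j * (d j)\<^sup>2 - a j)"
    by (simp add: algebra_simps)
  then have "ln (d j) * (a j * (d j)\<^sup>2) \<le> ln (d j) * (2 * C * (a' j * (d j)\<^sup>2 - a j))"
    by (intro mult_left_mono lnj)
  also have "\<dots> = 2 * C * h j" by (simp add: h_def)
  also have "\<dots> \<le> 2 * C * (C * ln C * (\<Sum>i\<in>UNIV. a i))"
    using C by (intro mult_left_mono hj) auto
  finally show ?thesis by (simp add: power2_eq_square mult_ac)
qed

lemma cmod_cdot_le: "cmod (cdot u v) \<le> norm u * norm v"
proof -
  have "cmod (cdot u v) \<le> (\<Sum>j\<in>UNIV. \<bar>cmod (u $ j)\<bar> * \<bar>cmod (v $ j)\<bar>)"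
    unfolding cdot_def by (rule order_trans[OF norm_sum]) (simp add: norm_mult)
  also have "\<dots> \<le> norm u * norm v"
    unfolding norm_vec_def by (rule L2_set_mult_ineq)
  finally show ?thesis .
qed

lemma subspace_orthogonal:
  fixes U :: "(complex ^ 'n) set"
  assumes U: "vec.subspace U" and y: "\<And>q. (\<And>u. u \<in> U \<Longrightarrow> cdot u q = 0) \<Longrightarrow> cdot y q = 0"
  shows "y \<in> U"
proof -
  define A where "A = ($) ` U"
  have ip: "fip UNIV (($) u) (($) v) = cdot u v" for u v :: "complex ^ 'n"
    by (simp add: fip_def cdot_def)
  have "fsub UNIV A"
    unfolding fsub_def A_def
  proof (intro conjI ballI allI impI)
    show "(\<lambda>_. 0) \<in> ($) ` U"
      using vec.subspace_0[OF U] by (intro image_eqI[of _ _ 0]) auto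
  next
    fix S T assume "S \<in> ($) ` U" "T \<in> ($) ` U"
    then obtain u v where "u \<in> U" "v \<in> U" "S = ($) u" "T = ($) v" by auto
    then show "(\<lambda>i. S i + T i) \<in> ($) ` U"
      using vec.subspace_add[OF U] by (intro image_eqI[of _ _ "u + v"]) auto
  next
    fix c T assume "T \<in> ($) ` U"
    then obtain v where "v \<in> U" "T = ($) v" by auto
    then show "(\<lambda>i. c * T i) \<in> ($) ` U"
      using vec.subspace_scale[OF U] by (intro image_eqI[of _ _ "c *s v"]) auto
  qed auto
  then obtain P where P: "P \<in> A" "\<And>S. S \<in> A \<Longrightarrow> fip UNIV (\<lambda>i. y $ i - P i) S = 0"
    using fproj_exists[of UNIV A "($) y"] by auto
  then obtain p where p: "p \<in> U" "P = ($) p" by (auto simp: A_def)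
  have "(\<lambda>i. y $ i - P i) = ($) (y - p)" by (auto simp: p)
  with P(2) have "cdot (y - p) u = 0" if "u \<in> U" for u
    using that by (metis A_def image_eqI ip)
  then have *: "cdot u (y - p) = 0" if "u \<in> U" for u
    using that by (metis cnj_cdot complex_cnj_zero)
  then have "cdot (y - p) (y - p) = 0"
    using y[of "y - p"] p by (simp add: cdot_simps)
  then show ?thesis using p by simp
qed


text \<open>Singular directions with \<open>d i \<le> L\<close> account for the first summand; for
  the others, \<open>log_weight_bound\<close> gives the factor \<open>1 / ln L\<close>. The
  constants depend on \<open>\<gamma>\<close> and \<open>q\<close> but not on \<open>g\<close> or
  \<open>e\<close>, so the estimate survives division by \<open>(norm g)^2\<close> and a limit in
  \<open>g\<close>, after which \<open>L\<close> may tend to infinity.\<close>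

lemma VF_estimate:
  fixes g \<gamma> :: "complex ^ 'n ^ 'n"
  assumes b: "onb N k b" and g: "g \<in> unidet" and \<gamma>: "\<gamma> \<in> unidet"
    and min: "\<And>h. h \<in> unidet \<Longrightarrow> ln (VF N k b g) + e * (norm g)\<^sup>2 \<le> ln (VF N k b h) + e * (norm h)\<^sup>2"
    and e: "e > 0" and \<kappa>: "\<kappa> > 0" "\<And>h. VF N k b (\<gamma> ** h) = \<kappa> * VF N k b h"
    and C: "C = 1 + (norm \<gamma>)\<^sup>2 + (norm (matrix_inv \<gamma>))\<^sup>2" and L: "1 < L" "2 * C \<le> L\<^sup>2"
  shows "(norm (adj (\<gamma> ** g) *v q))\<^sup>2 \<le> L\<^sup>2 * (norm (adj g *v q))\<^sup>2
    + real CARD('n) * ((norm q)\<^sup>2 * (2 * C\<^sup>2 * ln C) / ln L) * (norm g)\<^sup>2"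
proof -
  note gi = matrix_inv_inverse[OF unidet_invertible[OF g]]
  note \<gamma>i = matrix_inv_inverse[OF unidet_invertible[OF \<gamma>]]
  have "invertible (matrix_inv g ** \<gamma> ** g)"
    by (intro invertible_mult gi unidet_invertible[OF \<gamma>] unidet_invertible[OF g])
  then obtain u v d where uv: "unitary u" "unitary v" and d: "\<And>i. d i > (0::real)"
    and M: "matrix_inv g ** \<gamma> ** g = u ** rdiag d ** v"
    using svd by metis
  define G where "G = g ** u"
  define a where "a i = (norm (column i G))\<^sup>2" for i
  define a' where "a' i = (norm (matrix_inv \<gamma> *v column i G))\<^sup>2" for i
  have C1: "C \<ge> 1" by (simp add: C)
  have "G \<in> unidet" unfolding G_def by (intro unidet_mult g unidet_unitary uv)
  then have "det G \<noteq> 0" by (auto simp: unidet_def)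
  then have "column i G \<noteq> 0" for i
    using det_zero_column(1)[of i G] by (auto simp: column_def)
  then have a0: "a i > 0" for i by (simp add: a_def)
  have aC: "a i \<le> C * a' i" for i
  proof -
    have "norm (column i G) \<le> norm \<gamma> * norm (matrix_inv \<gamma> *v column i G)"
      using norm_matrix_vec_le[of \<gamma> "matrix_inv \<gamma> *v column i G"] by (simp add: matrix_vector_mul_assoc \<gamma>i)
    then have "a i \<le> (norm \<gamma> * norm (matrix_inv \<gamma> *v column i G))\<^sup>2"
      unfolding a_def by (intro power_mono) auto
    also have "\<dots> \<le> C * a' i"
      unfolding a'_def power_mult_distrib by (intro mult_right_mono) (auto simp: C)
    finally show ?thesis .
  qed
  have a'C: "a' i \<le> C * a i" for i
  proof -
    have "a' i \<le> (norm (matrix_inv \<gamma>) * norm (column i G))\<^sup>2"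
      unfolding a'_def by (intro power_mono norm_matrix_vec_le) auto
    also have "\<dots> \<le> C * a i"
      unfolding a_def power_mult_distrib by (intro mult_right_mono) (auto simp: C)
    finally show ?thesis .
  qed
  have a'0: "a' i > 0" for i
    using a0[of i] aC[of i] C1 by (smt (verit) zero_less_mult_iff)
  have le0: "(\<Sum>i\<in>UNIV. ln (d i) * (a' i * (d i)\<^sup>2 - a i)) \<le> 0"
    unfolding a_def a'_def G_def by (rule VF_derivative_ineq[OF b g \<gamma> min e \<kappa> uv d M])
  have suma: "(\<Sum>i\<in>UNIV. a i) = (norm g)\<^sup>2"
    unfolding a_def norm_matrix_cols[symmetric] G_def by (simp add: norm_mult_unitary uv)
  define K where "K = 2 * C\<^sup>2 * ln C"
  have K0: "K \<ge> 0" unfolding K_def using C1 by simp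
  have lnL: "ln L > 0" using L by simp
  define w where "w = adj G *v q"
  have wi: "(cmod (w $ i))\<^sup>2 \<le> (norm q)\<^sup>2 * a i" for i
  proof -
    have "w $ i = cdot q (column i G)"
      by (simp add: w_def cdot_def adj_def matrix_vector_mult_def column_def mult.commute)
    then have "cmod (w $ i) \<le> norm q * norm (column i G)" by (simp add: cmod_cdot_le)
    then have "(cmod (w $ i))\<^sup>2 \<le> (norm q * norm (column i G))\<^sup>2" by (intro power_mono) auto
    then show ?thesis by (simp add: a_def power_mult_distrib)
  qed
  have "\<gamma> ** g = g ** (matrix_inv g ** \<gamma> ** g)"
    by (simp add: matrix_mul_assoc gi)
  also have "\<dots> = G ** rdiag d ** v"
    by (simp add: M G_def matrix_mul_assoc)
  finally have "adj (\<gamma> ** g) *v q = adj v *v (rdiag d *v w)"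
    by (simp add: adj_mult adj_diagm w_def matrix_vector_mul_assoc matrix_mul_assoc)
  then have "(norm (adj (\<gamma> ** g) *v q))\<^sup>2 = (norm (rdiag d *v w))\<^sup>2"
    by (simp add: norm_unitary_vec unitary_adj uv)
  also have "\<dots> = (\<Sum>i\<in>UNIV. (d i)\<^sup>2 * (cmod (w $ i))\<^sup>2)"
    by (simp add: norm_vec_def L2_set_def sum_nonneg diagm_vec norm_mult power_mult_distrib)
  also have "\<dots> \<le> (\<Sum>i\<in>UNIV. L\<^sup>2 * (cmod (w $ i))\<^sup>2 + (norm q)\<^sup>2 * K / ln L * (norm g)\<^sup>2)"
  proof (rule sum_mono)
    fix i
    show "(d i)\<^sup>2 * (cmod (w $ i))\<^sup>2 \<le> L\<^sup>2 * (cmod (w $ i))\<^sup>2 + (norm q)\<^sup>2 * K / ln L * (norm g)\<^sup>2"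
    proof (cases "d i \<le> L")
      case True
      then have "(d i)\<^sup>2 * (cmod (w $ i))\<^sup>2 \<le> L\<^sup>2 * (cmod (w $ i))\<^sup>2"
        using d[of i] by (intro mult_right_mono power_mono) auto
      moreover have "0 \<le> (norm q)\<^sup>2 * K / ln L * (norm g)\<^sup>2" using K0 lnL by simp
      ultimately show ?thesis by linarith
    next
      case False
      then have "L\<^sup>2 \<le> (d i)\<^sup>2" using L by (intro power_mono) auto
      with L have "2 * C \<le> (d i)\<^sup>2" by linarith
      from log_weight_bound[OF a0 a'0 aC a'C C1 d le0 this]
      have "ln (d i) * (a i * (d i)\<^sup>2) \<le> K * (norm g)\<^sup>2" by (simp add: K_def suma)
      moreover have "ln L * (a i * (d i)\<^sup>2) \<le> ln (d i) * (a i * (d i)\<^sup>2)"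
        using False L a0[of i] by (intro mult_right_mono) (auto intro!: ln_mono)
      ultimately have "a i * (d i)\<^sup>2 \<le> K * (norm g)\<^sup>2 / ln L"
        using lnL by (simp add: pos_le_divide_eq mult.commute)
      then have "(norm q)\<^sup>2 * (a i * (d i)\<^sup>2) \<le> (norm q)\<^sup>2 * (K * (norm g)\<^sup>2 / ln L)"
        by (intro mult_left_mono) auto
      moreover have "(d i)\<^sup>2 * (cmod (w $ i))\<^sup>2 \<le> (norm q)\<^sup>2 * (a i * (d i)\<^sup>2)"
        using mult_left_mono[OF wi, of "(d i)\<^sup>2" i] by (simp add: mult_ac)
      moreover have "0 \<le> L\<^sup>2 * (cmod (w $ i))\<^sup>2" by simp
      ultimately have "(d i)\<^sup>2 * (cmod (w $ i))\<^sup>2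
          \<le> L\<^sup>2 * (cmod (w $ i))\<^sup>2 + (norm q)\<^sup>2 * (K * (norm g)\<^sup>2 / ln L)" by linarith
      then show ?thesis by simp
    qed
  qed
  also have "\<dots> = L\<^sup>2 * (norm w)\<^sup>2 + real CARD('n) * ((norm q)\<^sup>2 * K / ln L * (norm g)\<^sup>2)"
    by (simp add: sum.distrib sum_distrib_left[symmetric] norm_vec_def L2_set_def sum_nonneg)
  also have "norm w = norm (adj g *v q)"
    by (simp add: w_def G_def adj_mult norm_unitary_vec unitary_adj uv flip: matrix_vector_mul_assoc)
  finally show ?thesis by (simp add: K_def mult.assoc)
qed

section \<open>Existence of a minimum\<close>

definition semist :: "nat \<Rightarrow> nat \<Rightarrow> (nat \<Rightarrow> 'n option list \<Rightarrow> complex) \<Rightarrow> complex ^ 'n ^ 'n \<Rightarrow> bool" where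
  "semist N k b g \<longleftrightarrow> invertible g \<and> (\<forall>i<k. \<exists>c. act N g (b i) = (\<lambda>x. \<Sum>j<k. c j * b j x))"

lemma act_lincomb:
  assumes "\<And>j. j < k \<Longrightarrow> \<exists>c. act N h (b j) = (\<lambda>x. \<Sum>i<k. c i * b' i x)"
  shows "\<exists>e. act N h (\<lambda>x. \<Sum>j<k. c j * b j x) = (\<lambda>x. \<Sum>i<k. e i * b' i x)"
proof -
  obtain M where M: "\<And>j. j < k \<Longrightarrow> act N h (b j) = (\<lambda>x. \<Sum>i<k. M j i * b' i x)"
    using assms by metis
  have "act N h (\<lambda>x. \<Sum>j<k. c j * b j x) = (\<lambda>x. \<Sum>i<k. (\<Sum>j<k. c j * M j i) * b' i x)"
    by (simp add: act_sum M sum_distrib_left sum_distrib_right mult.assoc fun_eq_iff, subst sum.swap, simp)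
  then show ?thesis by (intro exI[of _ "\<lambda>i. \<Sum>j<k. c j * M j i"])
qed

lemma semist_mult: "semist N k b g \<Longrightarrow> semist N k b h \<Longrightarrow> semist N k b (g ** h)"
  unfolding semist_def
proof (intro conjI allI impI)
  assume *: "invertible g \<and> (\<forall>i<k. \<exists>c. act N g (b i) = (\<lambda>x. \<Sum>j<k. c j * b j x))"
    "invertible h \<and> (\<forall>i<k. \<exists>c. act N h (b i) = (\<lambda>x. \<Sum>j<k. c j * b j x))"
  then show "invertible (g ** h)" by (simp add: invertible_mult)
  fix i assume "i < k"
  with * obtain c where "act N g (b i) = (\<lambda>x. \<Sum>j<k. c j * b j x)" by blast
  then show "\<exists>c. act N (g ** h) (b i) = (\<lambda>x. \<Sum>j<k. c j * b j x)"
    using act_lincomb[of k N h b b c] * by (simp add: act_mult)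
qed

lemma semist_semi_invariant:
  assumes "onb N k b" "semist N k b g"
  obtains \<kappa> where "\<kappa> > 0" "\<And>h. VF N k b (g ** h) = \<kappa> * VF N k b h"
  using VF_semi_invariant[OF assms(1), of g] assms(2) unfolding semist_def by blast

lemma det_mat_mult: "det (mat c ** g) = c ^ CARD('n) * det (g :: complex ^ 'n ^ 'n)"
  by (simp add: det_mul mat_eq_diagm det_diagm)

lemma unidet_normalize:
  fixes g :: "complex ^ 'n ^ 'n"
  assumes "invertible g"
  obtains c where "c > 0" "mat (complex_of_real c) ** g \<in> unidet"
proof -
  define c where "c = 1 / root CARD('n) (cmod (det g))"
  have g: "cmod (det g) > 0" using assms by (simp add: invertible_det_nz)
  have "c > 0" using g by (simp add: c_def real_root_gt_zero)
  moreover have "c ^ CARD('n) = 1 / cmod (det g)"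
    using g by (simp add: c_def power_divide real_root_pow_pos2)
  then have "mat (complex_of_real c) ** g \<in> unidet"
    using g \<open>c > 0\<close> by (simp add: unidet_def det_mat_mult norm_mult norm_power)
  ultimately show ?thesis using that by blast
qed

lemma continuous_on_adj [continuous_intros]:
  fixes f :: "'a :: topological_space \<Rightarrow> complex ^ 'n ^ 'n"
  shows "continuous_on S f \<Longrightarrow> continuous_on S (\<lambda>x. adj (f x))"
  unfolding adj_def by (intro continuous_intros)

lemma continuous_on_matrix_vector [continuous_intros]:
  fixes f :: "'a :: topological_space \<Rightarrow> complex ^ 'n ^ 'n"
  shows "continuous_on S f \<Longrightarrow> continuous_on S g \<Longrightarrow> continuous_on S (\<lambda>x. f x *v g x)"
  unfolding matrix_vector_mult_def by (intro continuous_intros)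

lemma tendsto_compose_cont:
  assumes "continuous_on UNIV f" "(X \<longlongrightarrow> l) F"
  shows "((\<lambda>x. f (X x)) \<longlongrightarrow> f l) F"
  using assms continuous_on_tendsto_compose[of UNIV f X l F] by auto

text \<open>Let \<open>gm m\<close> be minimizers for \<open>e = 1 / (m + 1)\<close>. A bounded
  subsequence has a limit point that minimizes \<open>VF\<close>. Otherwise normalized minimizers
  accumulate at a nonzero singular \<open>l\<close>. By \<open>VF_estimate\<close>, each
  \<open>\<gamma>\<close> in \<open>\<Gamma>\<close> maps the range of \<open>l\<close> into itself,
  against irreducibility.\<close>

lemma VF_minimizer:
  fixes \<Gamma> :: "(complex ^ 'n ^ 'n) set"
  assumes b: "onb N k b" and irr: "irreducible_module \<Gamma>"
    and st: "\<And>\<gamma>. \<gamma> \<in> \<Gamma> \<Longrightarrow> semist N k b \<gamma>" and sc: "\<And>c. c \<noteq> 0 \<Longrightarrow> semist N k b (mat c)"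
  obtains g where "g \<in> unidet" "\<And>h. h \<in> unidet \<Longrightarrow> VF N k b g \<le> VF N k b h"
proof -
  define e where "e m = inverse (real (Suc m))" for m
  have e0: "e m > 0" for m by (simp add: e_def)
  have elim: "e \<longlonglongrightarrow> 0" unfolding e_def by (rule LIMSEQ_inverse_real_of_nat)
  have "\<exists>g\<in>unidet. \<forall>h\<in>unidet. ln (VF N k b g) + e m * (norm g)\<^sup>2 \<le> ln (VF N k b h) + e m * (norm h)\<^sup>2" for m
    using VF_eps_minimum[OF b e0] by metis
  then obtain gm where gm: "\<And>m. gm m \<in> unidet"
    and min: "\<And>m h. h \<in> unidet \<Longrightarrow> ln (VF N k b (gm m)) + e m * (norm (gm m))\<^sup>2 \<le> ln (VF N k b h) + e m * (norm h)\<^sup>2"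
    by metis
  have contVF: "continuous_on UNIV (VF N k b)"
    using continuous_on_VF[OF continuous_on_id] by simp
  show ?thesis
  proof (cases "\<exists>R. \<exists>r :: nat \<Rightarrow> nat. strict_mono r \<and> (\<forall>m. norm (gm (r m)) \<le> R)")
    case True
    then obtain R and r :: "nat \<Rightarrow> nat" where r: "strict_mono r" "\<And>m. norm (gm (r m)) \<le> R" by blast
    have "compact (unidet \<inter> cball (0 :: complex ^ 'n ^ 'n) R)"
      by (intro closed_Int_compact closed_unidet compact_cball)
    then have "seq_compact (unidet \<inter> cball (0 :: complex ^ 'n ^ 'n) R)"
      by (simp add: compact_eq_seq_compact_metric)
    moreover have "\<forall>m. gm (r m) \<in> unidet \<inter> cball 0 R" using r gm by auto
    ultimately obtain l r' where l: "l \<in> unidet \<inter> cball 0 R" "strict_mono r'" "((\<lambda>m. gm (r m)) \<circ> r') \<longlonglongrightarrow> l"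
      unfolding seq_compact_def by (metis (no_types, lifting))
    have lim: "(\<lambda>m. VF N k b (gm (r (r' m)))) \<longlonglongrightarrow> VF N k b l"
      using tendsto_compose_cont[OF contVF l(3)] by (simp add: o_def)
    have pos: "VF N k b h > 0" if "h \<in> unidet" for h
      by (rule VF_pos[OF b unidet_invertible[OF that]])
    have "VF N k b l \<le> VF N k b h" if h: "h \<in> unidet" for h
    proof -
      have "(\<lambda>m. ln (VF N k b (gm (r (r' m))))) \<longlonglongrightarrow> ln (VF N k b l)"
        using pos[of l] l(1) by (intro tendsto_ln lim) auto
      moreover have "(\<lambda>m. ln (VF N k b h) + e (r (r' m)) * (norm h)\<^sup>2) \<longlonglongrightarrow> ln (VF N k b h) + 0 * (norm h)\<^sup>2"
        using LIMSEQ_subseq_LIMSEQ[OF elim strict_mono_o[OF r(1) l(2)]]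
        by (intro tendsto_intros) (simp add: o_def)
      moreover have "ln (VF N k b (gm (r (r' m)))) \<le> ln (VF N k b h) + e (r (r' m)) * (norm h)\<^sup>2" for m
      proof -
        have "0 \<le> e (r (r' m)) * (norm (gm (r (r' m))))\<^sup>2" using e0[of "r (r' m)"] by simp
        with min[OF h, of "r (r' m)"] show ?thesis by linarith
      qed
      ultimately have "ln (VF N k b l) \<le> ln (VF N k b h) + 0 * (norm h)\<^sup>2"
        by (intro LIMSEQ_le) auto
      then show ?thesis using pos[OF h] pos[of l] l(1) by (simp add: ln_le_cancel_iff)
    qed
    with l(1) that show ?thesis by blast
  next
    case False
    have top: "filterlim (\<lambda>m. norm (gm m)) at_top sequentially"
      unfolding filterlim_at_top
    proof
      fix R
      show "\<forall>\<^sub>F m in sequentially. R \<le> norm (gm m)"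
      proof (rule ccontr)
        assume "\<not> (\<forall>\<^sub>F m in sequentially. R \<le> norm (gm m))"
        then have "infinite {m. norm (gm m) \<le> R}"
          unfolding cofinite_eq_sequentially[symmetric] eventually_cofinite
          by (rule contrapos_nn) (auto elim!: finite_subset[rotated])
        then obtain r :: "nat \<Rightarrow> nat" where "strict_mono r" "\<And>m. r m \<in> {m. norm (gm m) \<le> R}"
          using infinite_enumerate by blast
        with False show False by auto
      qed
    qed
    have np: "norm (gm m) > 0" for m
    proof -
      have "cmod (det (gm m)) = 1" using gm[of m] by (simp add: unidet_def)
      from VF_lower_norm(1)[OF b this] show ?thesis by linarith
    qed
    define gh where "gh m = inverse (norm (gm m)) *\<^sub>R gm m" for m
    have "\<forall>m. gh m \<in> sphere 0 1" using np by (auto simp: gh_def less_imp_neq[THEN not_sym])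
    then obtain l r where l: "l \<in> sphere 0 1" "strict_mono (r :: nat \<Rightarrow> nat)" "(gh \<circ> r) \<longlonglongrightarrow> l"
      using compact_sphere[of "0 :: complex ^ 'n ^ 'n" 1] unfolding compact_eq_seq_compact_metric seq_compact_def by metis
    have ghmat: "gh m = mat (of_real (inverse (norm (gm m)))) ** gm m" for m
      unfolding vec_eq_iff mat_mult_eq gh_def vector_scaleR_component by (simp only: scaleR_conv_of_real) simp
    \<comment> \<open>The determinant of \<open>gh m\<close> has modulus
      \<open>1 / norm (gm m) ^ CARD('n)\<close>.\<close>
    have "det l = 0"
    proof -
      have "(\<lambda>m. cmod (det (gh (r m)))) \<longlonglongrightarrow> cmod (det l)"
        using l(3) by (intro tendsto_norm tendsto_compose_cont[of det] continuous_intros) (simp add: o_def)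
      moreover have "cmod (det (gh m)) = inverse (norm (gm m)) ^ CARD('n)" for m
        using gm[of m] by (simp add: ghmat det_mat_mult unidet_def norm_mult norm_power norm_inverse)
      moreover have "(\<lambda>m. inverse (norm (gm (r m))) ^ CARD('n)) \<longlonglongrightarrow> 0 ^ CARD('n)"
        using filterlim_compose[OF top filterlim_subseq[OF l(2)]]
        by (intro tendsto_power tendsto_inverse_0_at_top) (simp add: o_def)
      ultimately have "cmod (det l) = 0 ^ CARD('n)"
        using LIMSEQ_unique by fastforce
      also have "\<dots> = 0" by (rule zero_power) simp
      finally show ?thesis by simp
    qed
    have "l \<noteq> 0" using l(1) by auto
    \<comment> \<open>The hypothesis on \<open>q\<close> says that it is orthogonal to the range of
      \<open>l\<close>, the conclusion that it is orthogonal to the range of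
      \<open>\<gamma> ** l\<close>.\<close>
    have kill: "adj (\<gamma> ** l) *v q = 0"
      if \<gamma>: "\<gamma> \<in> unidet" "semist N k b \<gamma>" and q: "adj l *v q = 0" for \<gamma> q
    proof -
      obtain \<kappa> where \<kappa>: "\<kappa> > 0" "\<And>h. VF N k b (\<gamma> ** h) = \<kappa> * VF N k b h"
        by (rule semist_semi_invariant[OF b \<gamma>(2)]) blast
      define C where "C = 1 + (norm \<gamma>)\<^sup>2 + (norm (matrix_inv \<gamma>))\<^sup>2"
      define B where "B = real CARD('n) * ((norm q)\<^sup>2 * (2 * C\<^sup>2 * ln C))"
      have bd: "(norm (adj (\<gamma> ** l) *v q))\<^sup>2 \<le> B / ln L" if L: "1 < L" "2 * C \<le> L\<^sup>2" for L
      proof -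
        have "(norm (adj (\<gamma> ** gh m) *v q))\<^sup>2 \<le> L\<^sup>2 * (norm (adj (gh m) *v q))\<^sup>2 + B / ln L" for m
        proof -
          define s where "s = inverse (norm (gm m))"
          have s: "s\<^sup>2 * (norm (gm m))\<^sup>2 = 1" using np[of m] by (simp add: s_def power_mult_distrib[symmetric])
          have sg: "gh m = s *\<^sub>R gm m" by (simp add: gh_def s_def)
          have sc: "adj (s *\<^sub>R A) *v q = s *\<^sub>R (adj A *v q)" "\<gamma> ** (s *\<^sub>R A) = s *\<^sub>R (\<gamma> ** A)" for A
            by (simp_all add: vec_eq_iff adj_def matrix_vector_mult_def matrix_matrix_mult_def scaleR_sum_right)
          have "s\<^sup>2 * (norm (adj (\<gamma> ** gm m) *v q))\<^sup>2 \<le> s\<^sup>2 * (L\<^sup>2 * (norm (adj (gm m) *v q))\<^sup>2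
             + real CARD('n) * ((norm q)\<^sup>2 * (2 * C\<^sup>2 * ln C) / ln L) * (norm (gm m))\<^sup>2)"
            by (intro mult_left_mono VF_estimate[OF b gm \<gamma>(1) min e0 \<kappa> C_def L]) auto
          also have "\<dots> = s\<^sup>2 * (L\<^sup>2 * (norm (adj (gm m) *v q))\<^sup>2) + B / ln L * (s\<^sup>2 * (norm (gm m))\<^sup>2)"
            by (simp add: B_def algebra_simps)
          finally show ?thesis
            unfolding sg sc s by (simp add: power_mult_distrib mult_ac)
        qed
        then have le: "(norm (adj (\<gamma> ** gh (r m)) *v q))\<^sup>2 \<le> L\<^sup>2 * (norm (adj (gh (r m)) *v q))\<^sup>2 + B / ln L" for m
          by blast
        have "(\<lambda>m. (norm (adj (\<gamma> ** gh (r m)) *v q))\<^sup>2) \<longlonglongrightarrow> (norm (adj (\<gamma> ** l) *v q))\<^sup>2"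
          using l(3) by (intro tendsto_compose_cont[of "\<lambda>g. (norm (adj (\<gamma> ** g) *v q))\<^sup>2"] continuous_intros) (simp add: o_def)
        moreover have "(\<lambda>m. L\<^sup>2 * (norm (adj (gh (r m)) *v q))\<^sup>2 + B / ln L) \<longlonglongrightarrow> L\<^sup>2 * (norm (adj l *v q))\<^sup>2 + B / ln L"
          using l(3) by (intro tendsto_compose_cont[of "\<lambda>g. L\<^sup>2 * (norm (adj g *v q))\<^sup>2 + B / ln L"] continuous_intros) (simp add: o_def)
        ultimately have "(norm (adj (\<gamma> ** l) *v q))\<^sup>2 \<le> L\<^sup>2 * (norm (adj l *v q))\<^sup>2 + B / ln L"
          using le by (intro LIMSEQ_le) auto
        then show ?thesis by (simp add: q)
      qed
      have "((\<lambda>L. B / ln L) \<longlongrightarrow> 0) at_top"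
        by (intro tendsto_divide_0[OF tendsto_const] filterlim_at_top_imp_at_infinity ln_at_top)
      moreover have "\<forall>\<^sub>F L in at_top. (norm (adj (\<gamma> ** l) *v q))\<^sup>2 \<le> B / ln L"
        using eventually_ge_at_top[of "2 + 2 * C"]
      proof eventually_elim
        case (elim L)
        have "C \<ge> 1" by (simp add: C_def)
        moreover have "L * 1 \<le> L * L" using elim \<open>C \<ge> 1\<close> by (intro mult_left_mono) auto
        ultimately have "2 * C \<le> L * L" using elim by linarith
        with elim \<open>C \<ge> 1\<close> show ?case by (intro bd) (auto simp: power2_eq_square)
      qed
      ultimately have "(norm (adj (\<gamma> ** l) *v q))\<^sup>2 \<le> 0"
        by (rule tendsto_lowerbound) simp
      then show ?thesis by simp
    qed
    define U where "U = range ((*v) l)"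
    have sub: "vec.subspace U"
      unfolding U_def by (intro vec.linear_subspace_image matrix_vector_mul_linear_gen vec.subspace_UNIV)
    have "\<gamma> *v y \<in> U" if g\<Gamma>: "\<gamma> \<in> \<Gamma>" and yU: "y \<in> U" for \<gamma> y
    proof -
      obtain x where y: "y = l *v x" using yU unfolding U_def by blast
      have "invertible \<gamma>" using st[OF g\<Gamma>] by (simp add: semist_def)
      then obtain c where c: "c > 0" "mat (complex_of_real c) ** \<gamma> \<in> unidet"
        by (rule unidet_normalize)
      \<comment> \<open>The estimate is about \<open>unidet\<close>. A scalar factor affects neither
        the stabilizer property nor the invariance of a subspace.\<close>
      define \<delta> where "\<delta> = mat (complex_of_real c) ** \<gamma>"
      have \<delta>: "\<delta> \<in> unidet" "semist N k b \<delta>"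
        using c st[OF g\<Gamma>] sc by (auto simp: \<delta>_def intro!: semist_mult)
      have "\<delta> *v (l *v x) \<in> U"
      proof (rule subspace_orthogonal[OF sub])
        fix q assume "\<And>u. u \<in> U \<Longrightarrow> cdot u q = 0"
        then have "cdot (l *v (adj l *v q)) q = 0" by (auto simp: U_def)
        then have "adj l *v q = 0" unfolding cdot_matrix[of l "adj l *v q" q] by simp
        from kill[OF \<delta> this] show "cdot (\<delta> *v (l *v x)) q = 0"
          unfolding matrix_vector_mul_assoc cdot_matrix[of "\<delta> ** l" x q] by (simp add: cdot_simps)
      qed
      then have "(1 / of_real c) *s (\<delta> *v (l *v x)) \<in> U" by (rule vec.subspace_scale[OF sub])
      moreover have "\<delta> *v (l *v x) = of_real c *s (\<gamma> *v y)"
        by (simp add: \<delta>_def y mat_mult_vec flip: matrix_vector_mul_assoc)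
      ultimately show ?thesis using c by (simp add: vec.scale_scale)
    qed
    then have "U = {0} \<or> U = UNIV"
      using irr sub by (auto simp: irreducible_module_def)
    then show ?thesis
    proof
      assume "U = {0}"
      then have "l *v x = 0" for x by (auto simp: U_def)
      then have "l = 0" by (simp add: matrix_eq)
      with \<open>l \<noteq> 0\<close> show ?thesis by simp
    next
      assume "U = UNIV"
      then have "invertible l"
        unfolding U_def by (metis matrix_right_invertible_surjective invertible_def matrix_left_right_inverse)
      with \<open>det l = 0\<close> show ?thesis by (simp add: invertible_det_nz)
    qed
  qed
qed

section \<open>Self-adjointness of the stabilizer at a minimum\<close>

lemma mat_mult_left_commute: "A ** (mat c ** B) = mat c ** (A ** B)" for A B :: "complex ^ 'n ^ 'n"
  by (metis mat_mult_commute matrix_mul_assoc)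

lemma unitary_cancel: "unitary u \<Longrightarrow> adj u ** (u ** A) = A" "unitary u \<Longrightarrow> u ** (adj u ** A) = A"
  by (simp_all add: matrix_mul_assoc unitaryD)

lemma inverse_cancel:
  "invertible g \<Longrightarrow> matrix_inv g ** (g ** A) = A" "invertible g \<Longrightarrow> g ** (matrix_inv g ** A) = A"
  for A :: "complex ^ 'n ^ 'n"
  by (simp_all add: matrix_mul_assoc matrix_inv_inverse)

text \<open>With \<open>G = g ** u\<close> and \<open>d'\<close> the multiple of \<open>d\<close>
  that lies in \<open>unidet\<close>, minimality gives \<open>VF\<close> the same value at
  \<open>G\<close> and at \<open>G ** rdiag d'\<close>, and a value at least as large halfway. Hence
  the sum of \<open>VC I * (1 - WT I)^2\<close> is not positive, every nonzero minor has weight 1,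
  and \<open>exchange_weights\<close> turns this into stability under all real powers.\<close>

lemma kempf_ness:
  fixes g s :: "complex ^ 'n ^ 'n"
  assumes b: "onb N k b" and g: "g \<in> unidet" and min: "\<And>h. h \<in> unidet \<Longrightarrow> VF N k b g \<le> VF N k b h"
    and sc: "\<And>c. c \<noteq> 0 \<Longrightarrow> semist N k b (mat c)"
    and uv: "unitary u" "unitary v" and d: "\<And>i. d i > 0" and s: "s = u ** rdiag d ** v"
    and st: "semist N k b (g ** s ** matrix_inv g)"
  shows "semist N k b (g ** (u ** rdiag (\<lambda>i. d i powr t) ** adj u) ** matrix_inv g)"
proof -
  note gi = matrix_inv_inverse[OF unidet_invertible[OF g]]
  have "invertible (g ** s ** matrix_inv g)" using st by (simp add: semist_def)
  then obtain c where c: "c > 0" and ud: "mat (complex_of_real c) ** (g ** s ** matrix_inv g) \<in> unidet"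
    by (rule unidet_normalize)
  define \<sigma> where "\<sigma> = mat (complex_of_real c) ** (g ** s ** matrix_inv g)"
  have \<sigma>: "\<sigma> \<in> unidet" "semist N k b \<sigma>"
    using ud st sc[of "of_real c"] c by (auto simp: \<sigma>_def intro!: semist_mult)
  define d' where "d' i = c * d i" for i
  have d': "d' i > 0" for i using c d by (simp add: d'_def)
  define G where "G = g ** u"
  have G: "G \<in> unidet" unfolding G_def by (intro unidet_mult g unidet_unitary uv)
  have cd: "mat (of_real c) ** rdiag d = rdiag d'"
    by (simp add: mat_eq_diagm diagm_mult d'_def)
  have "\<sigma> ** g = mat (complex_of_real c) ** (g ** s)"
    by (simp add: \<sigma>_def gi flip: matrix_mul_assoc)
  also have "\<dots> = G ** (mat (of_real c) ** rdiag d) ** v"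
    by (simp add: s G_def mat_mult_left_commute flip: matrix_mul_assoc)
  finally have \<sigma>g: "\<sigma> ** g = G ** rdiag d' ** v" by (simp add: cd)
  have "G ** rdiag d' = \<sigma> ** g ** adj v"
    unfolding \<sigma>g by (simp add: uv unitaryD flip: matrix_mul_assoc)
  then have GD: "G ** rdiag d' \<in> unidet"
    using \<sigma> g uv by (metis unidet_mult unidet_unitary unitary_adj)
  have "rdiag d' = adj u ** matrix_inv g ** (G ** rdiag d')"
    by (simp add: G_def unitary_cancel[OF uv(1)] inverse_cancel[OF unidet_invertible[OF g]] flip: matrix_mul_assoc)
  then have D': "rdiag d' \<in> unidet"
    using GD g uv by (metis unidet_mult unidet_unitary unitary_adj unidet_inv)
  note Dt = unidet_rdiag_powr[OF d' D']
  obtain \<kappa> where \<kappa>: "\<kappa> > 0" "\<And>h. VF N k b (\<sigma> ** h) = \<kappa> * VF N k b h"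
    by (rule semist_semi_invariant[OF b \<sigma>(2)]) blast
  note \<sigma>i = matrix_inv_inverse[OF unidet_invertible[OF \<sigma>(1)]]
  have pos: "VF N k b h > 0" if "h \<in> unidet" for h
    by (rule VF_pos[OF b unidet_invertible[OF that]])
  \<comment> \<open>Minimality against \<open>\<sigma> ** g\<close> and against
    \<open>matrix_inv \<sigma> ** g\<close> forces \<open>\<kappa> = 1\<close>.\<close>
  have "VF N k b g \<le> \<kappa> * VF N k b g"
    using min[OF unidet_mult[OF \<sigma>(1) g]] \<kappa> by simp
  moreover have "\<kappa> * VF N k b g \<le> \<kappa> * VF N k b (matrix_inv \<sigma> ** g)"
    using min[OF unidet_mult[OF unidet_inv[OF \<sigma>(1)] g]] \<kappa>(1) by simp
  moreover have "\<kappa> * VF N k b (matrix_inv \<sigma> ** g) = VF N k b g"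
    by (simp add: \<sigma>i matrix_mul_assoc flip: \<kappa>(2))
  ultimately have "VF N k b (\<sigma> ** g) = VF N k b g"
    using \<kappa>(2)[of g] by simp
  then have FD: "VF N k b (G ** rdiag d') = VF N k b G"
    by (simp add: \<sigma>g VF_unitary uv G_def)
  have Fh: "VF N k b G \<le> VF N k b (G ** rdiag (\<lambda>i. d' i powr (1/2)))"
    using min[OF unidet_mult[OF G Dt]] by (simp add: G_def VF_unitary uv)
  let ?P = "PiE {..<k} (\<lambda>_. LL N :: 'n option list set)"
  let ?c = "VC N k b G"
  \<comment> \<open>The exponent 1/2 compensates for the square in \<open>VF_rdiag\<close> and so
    supplies the middle term of \<open>(1 - WT)^2\<close>.\<close>
  have half: "(WT k (\<lambda>i. d' i powr (1/2)) I)\<^sup>2 = WT k d' I" for I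
    using WT_pos[of d' k I] d' by (simp add: WT_powr powr_half_sqrt)
  have "(\<Sum>I\<in>?P. ?c I * (1 - WT k d' I)\<^sup>2) = (\<Sum>I\<in>?P. ?c I) - 2 * (\<Sum>I\<in>?P. ?c I * WT k d' I) + (\<Sum>I\<in>?P. ?c I * (WT k d' I)\<^sup>2)"
    by (simp add: power2_diff algebra_simps sum.distrib sum_subtractf sum_distrib_left)
  also have "\<dots> \<le> 0"
    using FD Fh unfolding VF_rdiag half VF_VC[of N k b G] by simp
  finally have "(\<Sum>I\<in>?P. ?c I * (1 - WT k d' I)\<^sup>2) = 0"
    by (intro antisym sum_nonneg) (auto simp: VC_nonneg)
  moreover have finP: "finite ?P" by (intro finite_PiE) auto
  ultimately have zero: "?c I * (1 - WT k d' I)\<^sup>2 = 0" if "I \<in> ?P" for I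
    using that by (subst (asm) sum_nonneg_eq_0_iff) (auto simp: VC_nonneg)
  define b' where "b' = (\<lambda>i. act N G (b i))"
  have w1: "(\<Prod>j<k. wt d' (I j)) = 1" if "I \<in> ?P" "dt k b' I \<noteq> 0" for I
    using zero[OF that(1)] that(2) by (simp add: VC_def b'_def WT_def)
  have "VF N k b G > 0" by (rule pos[OF G])
  have "\<exists>I0\<in>?P. dt k b' I0 \<noteq> 0"
  proof (rule ccontr)
    assume "\<not> (\<exists>I0\<in>?P. dt k b' I0 \<noteq> 0)"
    then have "VF N k b G = 0"
      unfolding VF_VC by (intro sum.neutral) (auto simp: VC_def b'_def)
    with \<open>VF N k b G > 0\<close> show False by simp
  qed
  then obtain I0 where I0: "I0 \<in> ?P" "dt k b' I0 \<noteq> 0" by blast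
  define \<Delta>' where "\<Delta>' = rdiag (\<lambda>i. d' i powr t)"
  have step: "\<exists>e. act N \<Delta>' (b' l) = (\<lambda>x. \<Sum>j<k. e j * b' j x)" if l: "l < k" for l
  proof -
    obtain e where e: "\<And>x. x \<in> LL N \<Longrightarrow> of_real (wt d' x powr t) * b' l x = (\<Sum>i<k. e i * b' i x)"
      by (rule exchange_weights[of "wt d'" I0 k "LL N" b' l "\<lambda>y. of_real (y powr t)"])
         (use I0 w1 l wt_pos[of d', OF d'] in blast)+
    have "act N \<Delta>' (b' l) x = (\<Sum>j<k. e j * b' j x)" for x
    proof (cases "x \<in> LL N")
      case True
      then show ?thesis
        using e[OF True] d' by (simp add: \<Delta>'_def act_diagm wt_of_real wt_powr)
    next
      case False
      then show ?thesis by (simp add: act_support b'_def)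
    qed
    then show ?thesis by (intro exI[of _ e] ext)
  qed
  have GiG: "G ** (adj u ** matrix_inv g) = mat 1"
    by (simp add: G_def unitary_cancel[OF uv(1)] gi flip: matrix_mul_assoc)
  have undo: "act N (adj u ** matrix_inv g) (b' j) = b j" if "j < k" for j
  proof -
    have "act N (adj u ** matrix_inv g) (b' j) = act N (mat 1) (b j)"
      unfolding b'_def act_mult[symmetric] GiG ..
    then show ?thesis using b that by (simp add: onb_def act_mat_1)
  qed
  have inv: "invertible (G ** \<Delta>' ** (adj u ** matrix_inv g))"
    unfolding \<Delta>'_def
    by (intro unidet_invertible unidet_mult G Dt unidet_unitary unitary_adj uv unidet_inv g)
  have st': "semist N k b (G ** \<Delta>' ** (adj u ** matrix_inv g))"
    unfolding semist_def
  proof (intro conjI inv allI impI)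
    fix i assume "i < k"
    then obtain e where "act N \<Delta>' (b' i) = (\<lambda>x. \<Sum>j<k. e j * b' j x)" using step by blast
    then have "act N (G ** \<Delta>' ** (adj u ** matrix_inv g)) (b i)
       = act N (adj u ** matrix_inv g) (\<lambda>x. \<Sum>j<k. e j * b' j x)"
      by (simp add: act_mult b'_def)
    also have "\<dots> = (\<lambda>x. \<Sum>j<k. e j * b j x)"
      by (simp add: act_sum undo)
    finally show "\<exists>c. act N (G ** \<Delta>' ** (adj u ** matrix_inv g)) (b i) = (\<lambda>x. \<Sum>j<k. c j * b j x)" by (intro exI[of _ e])
  qed
  \<comment> \<open>This undoes the rescaling by \<open>c\<close>, which is harmless since scalars
    preserve the span.\<close>
  have "rdiag (\<lambda>i. d i powr t) = mat (of_real (c powr (- t))) ** \<Delta>'"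
  proof -
    have "c powr (- t) * (d' i) powr t = d i powr t" for i
      using c d[of i] by (simp add: d'_def powr_mult less_imp_le powr_minus)
    then show ?thesis
      by (simp add: \<Delta>'_def mat_eq_diagm diagm_mult flip: of_real_mult)
  qed
  then have "g ** (u ** rdiag (\<lambda>i. d i powr t) ** adj u) ** matrix_inv g
     = mat (of_real (c powr (- t))) ** (G ** \<Delta>' ** (adj u ** matrix_inv g))"
    by (simp add: G_def mat_mult_left_commute flip: matrix_mul_assoc)
  moreover have "semist N k b (mat (of_real (c powr (- t))))" using c by (intro sc) simp
  ultimately show ?thesis using st' by (simp add: semist_mult)
qed

section \<open>Invariant inner products on polynomials\<close>

definition gst :: "nat \<Rightarrow> ('n option list \<Rightarrow> complex) set \<Rightarrow> (complex ^ 'n ^ 'n) set" where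
  "gst N A = {g. invertible g \<and> (\<forall>T\<in>A. act N g T \<in> A) \<and> (\<forall>T\<in>A. act N (matrix_inv g) T \<in> A)}"

definition cj :: "complex ^ 'n ^ 'n \<Rightarrow> complex ^ 'n ^ 'n \<Rightarrow> complex ^ 'n ^ 'n" where
  "cj g s = g ** s ** matrix_inv g"

lemma cj_mult: "invertible g \<Longrightarrow> cj g (s ** t) = cj g s ** cj g t"
  by (simp add: cj_def inverse_cancel flip: matrix_mul_assoc)

lemma cj_cj_inv:
  assumes "invertible g"
  shows "cj g (cj (matrix_inv g) s) = s" "cj (matrix_inv g) (cj g s) = s"
proof -
  note gi = matrix_inv_inverse[OF assms]
  have *: "matrix_inv (matrix_inv g) = g"
    using gi matrix_inv_inverse[OF gi(3)] by (metis matrix_mul_assoc matrix_mul_lid matrix_mul_rid)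
  show "cj g (cj (matrix_inv g) s) = s" "cj (matrix_inv g) (cj g s) = s"
    unfolding cj_def * by (simp_all add: inverse_cancel[OF assms] gi flip: matrix_mul_assoc)
qed

lemma matrix_inv_unique: "A ** B = mat 1 \<Longrightarrow> matrix_inv A = (B :: complex ^ 'n ^ 'n)"
proof -
  assume *: "A ** B = mat 1"
  then have "invertible A" using invertible_def matrix_left_right_inverse by blast
  from inverse_cancel(1)[OF this, of B] show ?thesis by (simp add: *)
qed

lemma matrix_inv_mult:
  "invertible A \<Longrightarrow> invertible B \<Longrightarrow> matrix_inv (A ** B) = matrix_inv B ** matrix_inv A"
  for A B :: "complex ^ 'n ^ 'n"
  by (intro matrix_inv_unique) (simp add: inverse_cancel matrix_inv_inverse flip: matrix_mul_assoc)

lemma invertible_cj: "invertible g \<Longrightarrow> invertible s \<Longrightarrow> invertible (cj g s)"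
  unfolding cj_def by (intro invertible_mult matrix_inv_inverse)

lemma cj_inv: "invertible g \<Longrightarrow> invertible s \<Longrightarrow> matrix_inv (cj g s) = cj g (matrix_inv s)"
  by (intro matrix_inv_unique)
     (simp add: matrix_inv_inverse cj_mult[symmetric], simp add: cj_def matrix_inv_inverse)

lemma matrix_inv_inv: "invertible g \<Longrightarrow> matrix_inv (matrix_inv g) = (g :: complex ^ 'n ^ 'n)"
  by (intro matrix_inv_unique matrix_inv_inverse)

lemma invertible_mat: "c \<noteq> 0 \<Longrightarrow> invertible (mat c :: complex ^ 'n ^ 'n)"
  unfolding invertible_def by (intro exI[of _ "mat (1 / c)"]) (simp add: mat_mult_mat)

lemma matrix_inv_unitary: "unitary u \<Longrightarrow> matrix_inv u = adj u"
  by (intro matrix_inv_unique unitaryD)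

text \<open>Membership in \<open>gst\<close> also concerns the inverse. For the positive matrices in
  question the inverse is the power \<open>- t\<close>, to which \<open>kempf_ness\<close> applies
  as well.\<close>

theorem self_adjoint_position:
  fixes \<Gamma> :: "(complex ^ 'n ^ 'n) set"
  assumes A: "fsub (LL N) A" and irr: "irreducible_module \<Gamma>" and st: "\<Gamma> \<subseteq> gst N A"
    and sc: "\<And>c. c \<noteq> 0 \<Longrightarrow> mat c \<in> gst N A"
  obtains g where "invertible g" "\<And>u v d t. unitary u \<Longrightarrow> unitary v \<Longrightarrow> (\<And>i. d i > 0) \<Longrightarrow>
      cj g (u ** rdiag d ** v) \<in> gst N A \<Longrightarrow> cj g (u ** rdiag (\<lambda>i. d i powr t) ** adj u) \<in> gst N A"
proof -
  obtain k b where bA: "\<And>i. i < k \<Longrightarrow> b i \<in> A" and on: "orthonormal (LL N) k b"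
    and ex: "\<And>T. T \<in> A \<Longrightarrow> T = (\<lambda>x. \<Sum>i<k. fip (LL N) T (b i) * b i x)"
    by (rule orthonormal_basis_exists[OF finite_LL A]) (rule that)
  have onb: "onb N k b" using on bA fsubD(4)[OF A] by (auto simp: onb_def)
  have to: "semist N k b g" if "g \<in> gst N A" for g
    unfolding semist_def
  proof (intro conjI allI impI)
    show "invertible g" using that by (simp add: gst_def)
    fix i assume "i < k"
    then have "act N g (b i) \<in> A" using that bA by (simp add: gst_def)
    from ex[OF this] show "\<exists>c. act N g (b i) = (\<lambda>x. \<Sum>j<k. c j * b j x)"
      by (intro exI[of _ "\<lambda>j. fip (LL N) (act N g (b i)) (b j)"])
  qed
  have from_st: "act N g T \<in> A" if g: "semist N k b g" and T: "T \<in> A" for g T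
  proof -
    have "\<exists>e. act N g (\<lambda>x. \<Sum>j<k. fip (LL N) T (b j) * b j x) = (\<lambda>x. \<Sum>i<k. e i * b i x)"
      using g by (intro act_lincomb) (auto simp: semist_def)
    then obtain e where e: "act N g (\<lambda>x. \<Sum>j<k. fip (LL N) T (b j) * b j x) = (\<lambda>x. \<Sum>i<k. e i * b i x)"
      by (elim exE)
    have "act N g T = (\<lambda>x. \<Sum>i<k. e i * b i x)"
      by (rule trans[OF arg_cong[OF ex[OF T], of "act N g"] e])
    then show ?thesis using fsub_sum[OF A, of "{..<k}" b e] bA by simp
  qed
  have scb: "semist N k b (mat c)" if "c \<noteq> 0" for c by (rule to[OF sc[OF that]])
  obtain g where g: "g \<in> unidet" and min: "\<And>h. h \<in> unidet \<Longrightarrow> VF N k b g \<le> VF N k b h"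
    by (rule VF_minimizer[OF onb irr _ scb]) (use st to in blast)+
  show ?thesis
  proof (rule that[OF unidet_invertible[OF g]])
    fix u v :: "complex ^ 'n ^ 'n" and d :: "'n \<Rightarrow> real" and t
    assume uv: "unitary u" "unitary v" and d: "\<And>i. d i > 0" and s: "cj g (u ** rdiag d ** v) \<in> gst N A"
    have key: "semist N k b (cj g (u ** rdiag (\<lambda>i. d i powr t) ** adj u))" for t
      unfolding cj_def by (rule kempf_ness[OF onb g min scb uv d refl to[OF s[unfolded cj_def]]])
    have prod: "u ** rdiag (\<lambda>i. d i powr t) ** adj u ** (u ** rdiag (\<lambda>i. d i powr (- t)) ** adj u) = mat 1"
    proof -
      have "d i powr t * d i powr (- t) = 1" for i using d[of i] by (simp flip: powr_add)
      then have "rdiag (\<lambda>i. d i powr t) ** rdiag (\<lambda>i. d i powr (- t)) = mat 1"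
        by (simp add: diagm_mult mat_eq_diagm flip: of_real_mult)
      then have "u ** (rdiag (\<lambda>i. d i powr t) ** rdiag (\<lambda>i. d i powr (- t))) ** adj u = mat 1"
        using uv by (simp add: unitaryD)
      then show ?thesis using uv by (simp add: unitary_cancel flip: matrix_mul_assoc)
    qed
    have "matrix_inv (cj g (u ** rdiag (\<lambda>i. d i powr t) ** adj u)) = cj g (u ** rdiag (\<lambda>i. d i powr (- t)) ** adj u)"
      by (rule matrix_inv_unique)
         (simp only: cj_mult[OF unidet_invertible[OF g], symmetric] prod, simp add: cj_def matrix_inv_inverse[OF unidet_invertible[OF g]])
    then show "cj g (u ** rdiag (\<lambda>i. d i powr t) ** adj u) \<in> gst N A"
      using from_st[OF key] key by (simp add: gst_def semist_def)
  qed
qed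

section \<open>From tensors to polynomial functions\<close>

definition evalt :: "nat \<Rightarrow> ('n option list \<Rightarrow> complex) \<Rightarrow> complex ^ 'n \<Rightarrow> complex" where
  "evalt N T v = (\<Sum>I\<in>LL N. T I * wt (($) v) I)"

text \<open>The polynomial functions of degree at most \<open>N\<close>.\<close>

definition PN :: "nat \<Rightarrow> (complex ^ 'n \<Rightarrow> complex) set" where
  "PN N = range (evalt N)"

lemma evalt_simps:
  "evalt N (\<lambda>i. S i + T i) = (\<lambda>v. evalt N S v + evalt N T v)"
  "evalt N (\<lambda>i. S i - T i) = (\<lambda>v. evalt N S v - evalt N T v)"
  "evalt N (\<lambda>i. c * T i) = (\<lambda>v. c * evalt N T v)" "evalt N (\<lambda>_. 0) = (\<lambda>_. 0)"
  by (simp_all add: evalt_def fun_eq_iff algebra_simps sum.distrib sum_distrib_left sum_subtractf)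

lemma rr_wt: "length J = N \<Longrightarrow> (\<Sum>I\<in>LL N. rr g J I * wt (($) v) I) = wt (($) (g *v v)) J"
proof (induction N arbitrary: J)
  case 0
  then show ?case by (simp add: wt_def)
next
  case (Suc N)
  then obtain a J' where J: "J = a # J'" "length J' = N" by (metis length_Suc_conv)
  define co where "co w b = (case b of None \<Rightarrow> 1 | Some i \<Rightarrow> w $ i)" for w :: "complex ^ 'a" and b
  have wtC: "wt (($) w) (b # I) = co w b * wt (($) w) I" for w :: "complex ^ 'a" and b I
    by (simp add: wt_def co_def)
  have co: "(\<Sum>b\<in>UNIV. ext g a b * co v b) = co (g *v v) a"
    by (cases a) (simp_all add: sum_UNIV_option co_def matrix_vector_mult_def)
  have "(\<Sum>I\<in>LL (Suc N). rr g J I * wt (($) v) I)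
     = (\<Sum>b\<in>UNIV. \<Sum>I\<in>LL N. (ext g a b * co v b) * (rr g J' I * wt (($) v) I))"
    by (simp add: sum_LL_Suc J wtC mult_ac)
  also have "\<dots> = co (g *v v) a * wt (($) (g *v v)) J'"
    by (simp add: Suc.IH[OF J(2), symmetric] co[symmetric] sum_product)
  finally show ?case by (simp add: J wtC)
qed

lemma evalt_act: "evalt N (act N g T) = evalt N T \<circ> (*v) g"
proof
  fix v
  have "evalt N (act N g T) v = (\<Sum>J\<in>LL N. T J * (\<Sum>I\<in>LL N. rr g J I * wt (($) v) I))"
    unfolding evalt_def act_def
    by (simp add: sum_distrib_left sum_distrib_right mult.assoc, subst sum.swap, simp)
  also have "\<dots> = (evalt N T \<circ> (*v) g) v"
    unfolding evalt_def o_def by (intro sum.cong refl) (subst rr_wt[of _ N], auto simp: LL_def)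
  finally show "evalt N (act N g T) v = (evalt N T \<circ> (*v) g) v" .
qed

text \<open>Distinct tensors may give the same polynomial; the orthogonal complement of the kernel of
  \<open>evalt\<close> provides canonical representatives, which transports the inner product to polynomials.\<close>

definition SN :: "nat \<Rightarrow> ('n :: finite option list \<Rightarrow> complex) set" where
  "SN N = {T. (\<forall>I. I \<notin> LL N \<longrightarrow> T I = 0) \<and> (\<forall>Z. evalt N Z = (\<lambda>_. 0) \<longrightarrow> fip (LL N) T Z = 0)}"

lemma SN_fsub: "fsub (LL N) (SN N)"
  by (auto simp: fsub_def SN_def fip_simps)

lemma SN_act: "T \<in> SN N \<Longrightarrow> act N g T \<in> SN N"
  by (auto simp: SN_def act_support act_adj evalt_act)

lemma SN_unique:
  assumes "S \<in> SN N" "T \<in> SN N" "evalt N S = evalt N T"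
  shows "S = T"
proof -
  define Z where "Z = (\<lambda>i. S i - T i)"
  have Z: "Z \<in> SN N" unfolding Z_def by (intro fsub_diff[OF SN_fsub] assms)
  have "evalt N Z = (\<lambda>_. 0)" by (simp add: Z_def evalt_simps assms)
  with Z have "fip (LL N) Z Z = 0" by (simp add: SN_def)
  then have "Z i = 0" for i
    using Z fip_self_eq_0[of "LL N" Z] by (cases "i \<in> LL N") (auto simp: SN_def)
  then show ?thesis by (simp add: Z_def fun_eq_iff)
qed

lemma SN_exists:
  fixes f :: "complex ^ 'n \<Rightarrow> complex"
  assumes "f \<in> PN N"
  obtains T where "T \<in> SN N" "evalt N T = f"
proof -
  obtain T0 where T0: "f = evalt N T0" using assms by (auto simp: PN_def)
  define T1 where "T1 = (\<lambda>i. if i \<in> LL N then T0 i else 0)"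
  have T1: "evalt N T1 = f" by (simp add: T0 T1_def evalt_def fun_eq_iff)
  define K where "K = {Z :: 'n option list \<Rightarrow> complex. evalt N Z = (\<lambda>_. 0) \<and> (\<forall>i. i \<notin> LL N \<longrightarrow> Z i = 0)}"
  have "fsub (LL N) K" by (auto simp: fsub_def K_def evalt_simps)
  then obtain P where P: "P \<in> K" "\<And>S. S \<in> K \<Longrightarrow> fip (LL N) (\<lambda>i. T1 i - P i) S = 0"
    using fproj_exists[OF finite_LL, of N K T1] by blast
  have "(\<lambda>i. T1 i - P i) \<in> SN N"
    unfolding SN_def
  proof (intro CollectI conjI allI impI)
    fix Z :: "'n option list \<Rightarrow> complex" assume Z: "evalt N Z = (\<lambda>_. 0)"
    define Z' where "Z' = (\<lambda>i. if i \<in> LL N then Z i else 0)"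
    have "Z' \<in> K" using Z by (auto simp: Z'_def K_def evalt_def fun_eq_iff)
    from P(2)[OF this] show "fip (LL N) (\<lambda>i. T1 i - P i) Z = 0"
      by (simp add: Z'_def fip_def)
  qed (use P(1) in \<open>auto simp: K_def T1_def\<close>)
  moreover have "evalt N (\<lambda>i. T1 i - P i) = f"
    using P(1) by (simp add: evalt_simps T1 K_def)
  ultimately show ?thesis using that by blast
qed

definition lift :: "nat \<Rightarrow> (complex ^ 'n \<Rightarrow> complex) \<Rightarrow> 'n :: finite option list \<Rightarrow> complex" where
  "lift N f = (THE T. T \<in> SN N \<and> evalt N T = f)"

lemma lift: "f \<in> PN N \<Longrightarrow> lift N f \<in> SN N" "f \<in> PN N \<Longrightarrow> evalt N (lift N f) = f"
proof -
  assume "f \<in> PN N"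
  then have "\<exists>!T. T \<in> SN N \<and> evalt N T = f" by (metis SN_exists SN_unique)
  from theI'[OF this] show "lift N f \<in> SN N" "evalt N (lift N f) = f" by (auto simp: lift_def)
qed

lemma lift_eq: "T \<in> SN N \<Longrightarrow> lift N (evalt N T) = T"
  by (intro SN_unique[of _ N] lift) (auto simp: PN_def)

definition fsubspace :: "('a \<Rightarrow> complex) set \<Rightarrow> bool" where
  "fsubspace A \<longleftrightarrow> (\<lambda>_. 0) \<in> A \<and> (\<forall>f\<in>A. \<forall>h\<in>A. (\<lambda>x. f x + h x) \<in> A) \<and> (\<forall>c. \<forall>f\<in>A. (\<lambda>x. c * f x) \<in> A)"

lemma fsubspaceD:
  assumes "fsubspace A"
  shows "(\<lambda>_. 0) \<in> A" "f \<in> A \<Longrightarrow> h \<in> A \<Longrightarrow> (\<lambda>x. f x + h x) \<in> A" "f \<in> A \<Longrightarrow> (\<lambda>x. c * f x) \<in> A"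
    "f \<in> A \<Longrightarrow> h \<in> A \<Longrightarrow> (\<lambda>x. f x - h x) \<in> A"
proof -
  show *: "(\<lambda>_. 0) \<in> A" "f \<in> A \<Longrightarrow> h \<in> A \<Longrightarrow> (\<lambda>x. f x + h x) \<in> A" "f \<in> A \<Longrightarrow> (\<lambda>x. c * f x) \<in> A" for f h c
    using assms by (auto simp: fsubspace_def)
  show "f \<in> A \<Longrightarrow> h \<in> A \<Longrightarrow> (\<lambda>x. f x - h x) \<in> A"
    using *(2)[of f "\<lambda>x. (-1) * h x"] *(3)[of h "-1"] by simp
qed

lemma fsubspace_sum: "fsubspace A \<Longrightarrow> (\<And>j. j \<in> J \<Longrightarrow> f j \<in> A) \<Longrightarrow> (\<lambda>x. \<Sum>j\<in>J. f j x) \<in> A"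
  by (induction J rule: infinite_finite_induct) (auto intro: fsubspaceD)

lemma fsubspace_PN: "fsubspace (PN N)"
  unfolding fsubspace_def PN_def
proof (intro conjI ballI allI)
  show "(\<lambda>_. 0) \<in> range (evalt N)"
    by (rule range_eqI[of _ _ "\<lambda>_. 0"]) (simp add: evalt_simps)
next
  fix f h :: "complex ^ 'a \<Rightarrow> complex" assume "f \<in> range (evalt N)" "h \<in> range (evalt N)"
  then obtain S T where "f = evalt N S" "h = evalt N T" by auto
  then show "(\<lambda>x. f x + h x) \<in> range (evalt N)"
    by (intro range_eqI[of _ _ "\<lambda>i. S i + T i"]) (simp add: evalt_simps)
next
  fix c and f :: "complex ^ 'a \<Rightarrow> complex" assume "f \<in> range (evalt N)"
  then obtain S where "f = evalt N S" by auto
  then show "(\<lambda>x. c * f x) \<in> range (evalt N)"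
    by (intro range_eqI[of _ _ "\<lambda>i. c * S i"]) (simp add: evalt_simps)
qed

lemma PN_comp:
  fixes g :: "complex ^ 'n ^ 'n"
  assumes "f \<in> PN N"
  shows "f \<circ> (*v) g \<in> PN N"
proof -
  obtain T where "f = evalt N T" using assms by (auto simp: PN_def)
  then have "f \<circ> (*v) g = evalt N (act N g T)" by (simp add: evalt_act)
  then show ?thesis by (simp add: PN_def)
qed

text \<open>As \<open>SN\<close> is stable under \<open>act\<close>, substitution of
  \<open>adj g\<close> remains the adjoint of substitution of \<open>g\<close>, see
  \<open>pip_adj\<close>.\<close>

definition pip :: "nat \<Rightarrow> (complex ^ 'n \<Rightarrow> complex) \<Rightarrow> (complex ^ 'n \<Rightarrow> complex) \<Rightarrow> complex" where
  "pip N f h = fip (LL N) (lift N f) (lift N h)"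

lemma lift_scale: "f \<in> PN N \<Longrightarrow> lift N (\<lambda>x. c * f x) = (\<lambda>i. c * lift N f i)"
  using lift_eq[OF fsubD(3)[OF SN_fsub lift(1)[of f N]], of c] by (simp add: evalt_simps lift)

lemma lift_comp: "f \<in> PN N \<Longrightarrow> lift N (f \<circ> (*v) g) = act N g (lift N f)"
  for g :: "complex ^ 'n ^ 'n"
  using lift_eq[OF SN_act[OF lift(1)[of f N]], of g] by (simp add: evalt_act lift)

lemma lift_add: "f \<in> PN N \<Longrightarrow> h \<in> PN N \<Longrightarrow> lift N (\<lambda>x. f x + h x) = (\<lambda>i. lift N f i + lift N h i)"
  using lift_eq[OF fsubD(2)[OF SN_fsub lift(1)[of f N] lift(1)[of h N]]] by (simp add: evalt_simps lift)

lemma lift_diff: "f \<in> PN N \<Longrightarrow> h \<in> PN N \<Longrightarrow> lift N (\<lambda>x. f x - h x) = (\<lambda>i. lift N f i - lift N h i)"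
  using lift_eq[OF fsub_diff[OF SN_fsub lift(1)[of f N] lift(1)[of h N]]] by (simp add: evalt_simps lift)

lemmas lift_simps = lift_scale lift_comp lift_add lift_diff

lemma pip_diff: "f \<in> PN N \<Longrightarrow> h \<in> PN N \<Longrightarrow> pip N (\<lambda>x. f x - h x) k = pip N f k - pip N h k"
  "f \<in> PN N \<Longrightarrow> h \<in> PN N \<Longrightarrow> pip N k (\<lambda>x. f x - h x) = pip N k f - pip N k h"
  and pip_add: "f \<in> PN N \<Longrightarrow> h \<in> PN N \<Longrightarrow> pip N (\<lambda>x. f x + h x) k = pip N f k + pip N h k"
  "f \<in> PN N \<Longrightarrow> h \<in> PN N \<Longrightarrow> pip N k (\<lambda>x. f x + h x) = pip N k f + pip N k h"
  and pip_scale: "f \<in> PN N \<Longrightarrow> pip N (\<lambda>x. c * f x) k = c * pip N f k"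
  "f \<in> PN N \<Longrightarrow> pip N k (\<lambda>x. c * f x) = cnj c * pip N k f"
  by (simp_all add: pip_def lift_simps fip_simps)

lemma pip_adj: "f \<in> PN N \<Longrightarrow> h \<in> PN N \<Longrightarrow> pip N (f \<circ> (*v) g) h = pip N f (h \<circ> (*v) (adj g))"
  for g :: "complex ^ 'n ^ 'n"
  by (simp add: pip_def lift_simps act_adj)

lemma pip_self: "f \<in> PN N \<Longrightarrow> pip N f f = 0 \<Longrightarrow> f = (\<lambda>_. 0)"
proof -
  assume f: "f \<in> PN N" and z: "pip N f f = 0"
  then have "\<forall>i\<in>LL N. lift N f i = 0" by (simp add: pip_def fip_self_eq_0)
  then have "evalt N (lift N f) = (\<lambda>_. 0)" by (simp add: evalt_def fun_eq_iff)
  with lift(2)[OF f] show ?thesis by simp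
qed

definition TS :: "nat \<Rightarrow> (complex ^ 'n \<Rightarrow> complex) set \<Rightarrow> ('n :: finite option list \<Rightarrow> complex) set" where
  "TS N A = {T \<in> SN N. evalt N T \<in> A}"

lemma fsub_TS: "fsubspace A \<Longrightarrow> fsub (LL N) (TS N A)"
  using SN_fsub[of N] unfolding fsub_def fsubspace_def TS_def
  by (intro conjI ballI allI impI) (auto simp: evalt_simps)

lemma pip_projection:
  assumes A: "fsubspace A" "A \<subseteq> PN N" and f: "f \<in> PN N"
  obtains p where "p \<in> A" "\<And>h. h \<in> A \<Longrightarrow> pip N (\<lambda>x. f x - p x) h = 0"
proof -
  obtain P where P: "P \<in> TS N A" "\<And>S. S \<in> TS N A \<Longrightarrow> fip (LL N) (\<lambda>i. lift N f i - P i) S = 0"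
    using fproj_exists[OF finite_LL fsub_TS[OF A(1)]] by blast
  define p where "p = evalt N P"
  have p: "p \<in> A" "lift N p = P" using P(1) lift_eq by (auto simp: TS_def p_def)
  have "pip N (\<lambda>x. f x - p x) h = 0" if h: "h \<in> A" for h
  proof -
    have "lift N h \<in> TS N A" using h A lift[of h N] by (auto simp: TS_def)
    from P(2)[OF this] show ?thesis
      using p f A h by (auto simp: pip_def lift_simps)
  qed
  with p that show ?thesis by blast
qed

section \<open>Stabilizers in good position\<close>

definition fst_set :: "(complex ^ 'n \<Rightarrow> complex) set \<Rightarrow> (complex ^ 'n ^ 'n) set" where
  "fst_set A = {g. invertible g \<and> (\<forall>f\<in>A. f \<circ> (*v) g \<in> A) \<and> (\<forall>f\<in>A. f \<circ> (*v) (matrix_inv g) \<in> A)}"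

lemma gst_TS: "A \<subseteq> PN N \<Longrightarrow> gst N (TS N A) = fst_set A"
proof -
  assume A: "A \<subseteq> PN N"
  have "(\<forall>T\<in>TS N A. act N g T \<in> TS N A) \<longleftrightarrow> (\<forall>f\<in>A. f \<circ> (*v) g \<in> A)" for g
  proof
    assume *: "\<forall>T\<in>TS N A. act N g T \<in> TS N A"
    show "\<forall>f\<in>A. f \<circ> (*v) g \<in> A"
    proof
      fix f assume f: "f \<in> A"
      then have "lift N f \<in> TS N A" using A lift[of f N] by (auto simp: TS_def)
      then have "evalt N (act N g (lift N f)) \<in> A" using * by (simp add: TS_def)
      with f A show "f \<circ> (*v) g \<in> A" by (auto simp: evalt_act lift)
    qed
  qed (auto simp: TS_def SN_act evalt_act)
  then show ?thesis by (simp add: gst_def fst_set_def)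
qed

lemma fst_set_mult: "g \<in> fst_set A \<Longrightarrow> h \<in> fst_set A \<Longrightarrow> g ** h \<in> fst_set A"
  by (simp add: fst_set_def invertible_mult matrix_inv_mult comp_matrix_mult)

lemma fst_set_inv: "g \<in> fst_set A \<Longrightarrow> matrix_inv g \<in> fst_set A"
  by (simp add: fst_set_def matrix_inv_inv matrix_inv_inverse)

text \<open>The adjoint with respect to the inner product \<open>\<langle>g\<^sup>-\<^sup>1 u, g\<^sup>-\<^sup>1 v\<rangle>\<close>.\<close>

definition star :: "complex ^ 'n ^ 'n \<Rightarrow> complex ^ 'n ^ 'n \<Rightarrow> complex ^ 'n ^ 'n" where
  "star g s = cj g (adj (cj (matrix_inv g) s))"

text \<open>Together with an element, the stabilizer of \<open>A\<close> contains all powers of the positive factor of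
  its polar decomposition with respect to the inner product \<open>\<langle>g\<^sup>-\<^sup>1 u, g\<^sup>-\<^sup>1 v\<rangle>\<close>.\<close>

definition good_position :: "(complex ^ 'n \<Rightarrow> complex) set \<Rightarrow> complex ^ 'n ^ 'n \<Rightarrow> bool" where
  "good_position A g \<longleftrightarrow> invertible g \<and> (\<forall>u v d t. unitary u \<longrightarrow> unitary v \<longrightarrow> (\<forall>i. d i > 0) \<longrightarrow>
      cj g (u ** rdiag d ** v) \<in> fst_set A \<longrightarrow> cj g (u ** rdiag (\<lambda>i. d i powr t) ** adj u) \<in> fst_set A)"

lemma good_position_exists:
  fixes \<Gamma> :: "(complex ^ 'n ^ 'n) set"
  assumes A: "fsubspace A" "A \<subseteq> PN N" and irr: "irreducible_module \<Gamma>" and st: "\<Gamma> \<subseteq> fst_set A"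
    and sc: "\<And>c. c \<noteq> 0 \<Longrightarrow> mat c \<in> fst_set A"
  obtains g where "good_position A g"
proof -
  note eq = gst_TS[OF A(2)]
  show ?thesis
  proof (rule self_adjoint_position[OF fsub_TS[OF A(1), of N] irr, unfolded eq, OF st sc])
    fix g :: "complex ^ 'n ^ 'n"
    assume 1: "invertible g" and 2: "\<And>u v d t. unitary u \<Longrightarrow> unitary v \<Longrightarrow> (\<And>i. d i > 0) \<Longrightarrow>
      cj g (u ** rdiag d ** v) \<in> fst_set A \<Longrightarrow> cj g (u ** rdiag (\<lambda>i. d i powr t) ** adj u) \<in> fst_set A"
    have "good_position A g"
      unfolding good_position_def by (intro conjI allI impI 1) (rule 2, auto)
    then show ?thesis by (rule that)
  qed
qed

text \<open>Let \<open>s' = p ** (u ** v)\<close> be the polar decomposition of the transported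
  \<open>s\<close>. The position, at \<open>t = 1\<close>, puts \<open>p\<close> into the
  stabilizer, hence also the unitary factor; the adjoint of \<open>s'\<close> is the inverse of that
  factor times \<open>p\<close>.\<close>

lemma good_position_star:
  assumes g: "good_position A g" and s: "s \<in> fst_set A"
  shows "star g s \<in> fst_set A"
proof -
  have ig: "invertible g" using g by (simp add: good_position_def)
  have iv: "invertible s" using s by (simp add: fst_set_def)
  define s' where "s' = cj (matrix_inv g) s"
  have "invertible s'" unfolding s'_def by (intro invertible_cj matrix_inv_inverse ig iv)
  then obtain u v d where uv: "unitary u" "unitary v" and d: "\<And>i. d i > (0::real)" and s': "s' = u ** rdiag d ** v"
    using svd by metis
  have cs': "cj g s' = s" by (simp add: s'_def cj_cj_inv ig)
  define p where "p = u ** rdiag (\<lambda>i. d i powr 1) ** adj u"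
  have p: "cj g p \<in> fst_set A"
    using g uv d s cs' unfolding good_position_def p_def s' by blast
  have pd: "p = u ** rdiag d ** adj u" using d by (simp add: p_def less_imp_le)
  have "p ** (u ** v) = s'" using uv by (simp add: pd s' unitary_cancel flip: matrix_mul_assoc)
  moreover have ip: "invertible p"
  proof -
    have "invertible (u ** rdiag d ** v ** (adj v ** adj u))"
      using invertible_mult[OF \<open>invertible s'\<close> invertible_mult[of "adj v" "adj u"]] uv
      by (simp add: s' unitary_invertible unitary_adj)
    then show ?thesis using uv by (simp add: pd unitary_cancel flip: matrix_mul_assoc)
  qed
  ultimately have uvp: "u ** v = matrix_inv p ** s'" by (metis inverse_cancel(1))
  have "cj g (u ** v) = matrix_inv (cj g p) ** s"
    unfolding uvp by (simp add: cj_mult ig cj_inv ip cs')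
  then have "cj g (u ** v) \<in> fst_set A"
    using p s by (simp add: fst_set_mult fst_set_inv)
  then have "matrix_inv (cj g (u ** v)) ** cj g p \<in> fst_set A"
    using p by (simp add: fst_set_mult fst_set_inv)
  also have "matrix_inv (cj g (u ** v)) ** cj g p = cj g (adj (u ** v) ** p)"
    by (simp add: cj_inv[OF ig unitary_invertible[OF unitary_mult[OF uv]]]
        matrix_inv_unitary[OF unitary_mult[OF uv]] cj_mult[OF ig, of "adj (u ** v)" p])
  also have "adj (u ** v) ** p = adj s'"
    using uv by (simp add: adj_mult pd s' adj_diagm unitary_cancel flip: matrix_mul_assoc)
  finally show ?thesis by (simp add: star_def s'_def)
qed

text \<open>Pulling the inner product back along \<open>g\<close> turns the adjoint into
  \<open>star g\<close>, see \<open>gip_star\<close>.\<close>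

definition gip :: "complex ^ 'n ^ 'n \<Rightarrow> nat \<Rightarrow> (complex ^ 'n \<Rightarrow> complex) \<Rightarrow> (complex ^ 'n \<Rightarrow> complex) \<Rightarrow> complex" where
  "gip g N f h = pip N (f \<circ> (*v) g) (h \<circ> (*v) g)"

lemma gip_diff: "f \<in> PN N \<Longrightarrow> h \<in> PN N \<Longrightarrow> gip g N (\<lambda>x. f x - h x) k = gip g N f k - gip g N h k"
  "f \<in> PN N \<Longrightarrow> h \<in> PN N \<Longrightarrow> gip g N k (\<lambda>x. f x - h x) = gip g N k f - gip g N k h"
  and gip_add: "f \<in> PN N \<Longrightarrow> h \<in> PN N \<Longrightarrow> gip g N (\<lambda>x. f x + h x) k = gip g N f k + gip g N h k"
  "f \<in> PN N \<Longrightarrow> h \<in> PN N \<Longrightarrow> gip g N k (\<lambda>x. f x + h x) = gip g N k f + gip g N k h"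
  and gip_scale: "f \<in> PN N \<Longrightarrow> gip g N (\<lambda>x. c * f x) k = c * gip g N f k"
  "f \<in> PN N \<Longrightarrow> gip g N k (\<lambda>x. c * f x) = cnj c * gip g N k f"
  using pip_diff[OF PN_comp[of f N g] PN_comp[of h N g]] pip_add[OF PN_comp[of f N g] PN_comp[of h N g]]
    pip_scale[OF PN_comp[of f N g]]
  by (simp_all add: gip_def o_def)

lemma gip_star:
  assumes "invertible g" "f \<in> PN N" "h \<in> PN N"
  shows "gip g N (f \<circ> (*v) s) h = gip g N f (h \<circ> (*v) (star g s))"
proof -
  have 1: "f \<circ> (*v) s \<circ> (*v) g = f \<circ> (*v) g \<circ> (*v) (cj (matrix_inv g) s)"
    unfolding comp_matrix_mult[symmetric]
    by (simp add: cj_def matrix_inv_inv inverse_cancel assms flip: matrix_mul_assoc)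
  have 2: "h \<circ> (*v) (star g s) \<circ> (*v) g = h \<circ> (*v) g \<circ> (*v) (adj (cj (matrix_inv g) s))"
    unfolding comp_matrix_mult[symmetric]
    by (simp add: star_def cj_def[of g] inverse_cancel matrix_inv_inverse assms flip: matrix_mul_assoc)
  show ?thesis
    unfolding gip_def 1 2 by (intro pip_adj PN_comp assms)
qed

lemma comp_inv_cancel:
  fixes g :: "complex ^ 'n ^ 'n"
  assumes "invertible g"
  shows "f \<circ> (*v) g \<circ> (*v) (matrix_inv g) = f" "f \<circ> (*v) (matrix_inv g) \<circ> (*v) g = f"
  by (simp_all add: matrix_inv_inverse[OF assms] comp_matrix_mat_1 flip: comp_matrix_mult)

lemma gip_self:
  assumes "invertible g" "f \<in> PN N" "gip g N f f = 0"
  shows "f = (\<lambda>_. 0)"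
proof -
  have "f \<circ> (*v) g = (\<lambda>_. 0)" using assms by (auto simp: gip_def intro: pip_self PN_comp)
  then have "f \<circ> (*v) g \<circ> (*v) (matrix_inv g) = (\<lambda>_. 0)" by (simp add: o_def)
  then show ?thesis by (simp add: comp_inv_cancel assms)
qed

lemma gip_projection:
  assumes A: "fsubspace A" "A \<subseteq> PN N" and f: "f \<in> PN N" and g: "invertible g"
  obtains p where "p \<in> A" "\<And>h. h \<in> A \<Longrightarrow> gip g N (\<lambda>x. f x - p x) h = 0"
proof -
  define A' where "A' = (\<lambda>f. f \<circ> (*v) g) ` A"
  have "fsubspace A'"
    using A(1) unfolding fsubspace_def A'_def by (auto simp: o_def)
  moreover have "A' \<subseteq> PN N" using A(2) PN_comp by (auto simp: A'_def)
  ultimately obtain p' where p': "p' \<in> A'" "\<And>h. h \<in> A' \<Longrightarrow> pip N (\<lambda>x. (f \<circ> (*v) g) x - p' x) h = 0"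
    using pip_projection PN_comp[OF f] by metis
  then obtain p where p: "p \<in> A" "p' = p \<circ> (*v) g" by (auto simp: A'_def)
  show ?thesis
  proof (rule that[OF p(1)])
    fix h assume "h \<in> A"
    with p'(2)[of "h \<circ> (*v) g"] show "gip g N (\<lambda>x. f x - p x) h = 0"
      by (simp add: gip_def A'_def p o_def)
  qed
qed

section \<open>The null ideal\<close>

lemma PN_0: "f \<in> PN 0 \<longleftrightarrow> (\<exists>c. f = (\<lambda>_. c))"
proof -
  have "evalt 0 T = (\<lambda>_. T [])" for T :: "'a option list \<Rightarrow> complex"
    by (simp add: evalt_def wt_def fun_eq_iff)
  moreover have "(\<lambda>_. c) = evalt 0 (\<lambda>_. c)" for c
    by (simp add: evalt_def wt_def fun_eq_iff)
  ultimately show ?thesis unfolding PN_def by auto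
qed

lemma evalt_Suc: "evalt (Suc N) T v = evalt N (\<lambda>I. T (None # I)) v + (\<Sum>i\<in>UNIV. v $ i * evalt N (\<lambda>I. T (Some i # I)) v)"
  by (simp add: evalt_def sum_LL_Suc sum_UNIV_option wt_def sum_distrib_left mult_ac)

lemma PN_Suc: "p \<in> PN (Suc N) \<longleftrightarrow> (\<exists>q f. q \<in> PN N \<and> (\<forall>i. f i \<in> PN N) \<and> p = (\<lambda>v. q v + (\<Sum>i\<in>UNIV. v $ i * f i v)))"
proof
  assume "p \<in> PN (Suc N)"
  then obtain T where p: "p = evalt (Suc N) T" by (auto simp: PN_def)
  show "\<exists>q f. q \<in> PN N \<and> (\<forall>i. f i \<in> PN N) \<and> p = (\<lambda>v. q v + (\<Sum>i\<in>UNIV. v $ i * f i v))"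
    unfolding PN_def
    by (rule exI[of _ "evalt N (\<lambda>I. T (None # I))"], rule exI[of _ "\<lambda>i. evalt N (\<lambda>I. T (Some i # I))"],
        intro conjI allI rangeI) (simp add: p evalt_Suc fun_eq_iff)
next
  assume "\<exists>q f. q \<in> PN N \<and> (\<forall>i. f i \<in> PN N) \<and> p = (\<lambda>v. q v + (\<Sum>i\<in>UNIV. v $ i * f i v))"
  then obtain q f where qf: "q \<in> PN N" "\<And>i. f i \<in> PN N" and p: "p = (\<lambda>v. q v + (\<Sum>i\<in>UNIV. v $ i * f i v))"
    by blast
  obtain Tq where Tq: "q = evalt N Tq" using qf by (auto simp: PN_def)
  have "\<forall>i. \<exists>T. f i = evalt N T" using qf(2) by (auto simp: PN_def)
  then obtain Tf where Tf: "\<And>i. f i = evalt N (Tf i)" by metis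
  define T where "T = (\<lambda>I. case I of [] \<Rightarrow> 0 | None # J \<Rightarrow> Tq J | Some i # J \<Rightarrow> Tf i J)"
  have "p = evalt (Suc N) T"
    by (simp add: fun_eq_iff p evalt_Suc T_def Tq Tf)
  then show "p \<in> PN (Suc N)" by (simp add: PN_def)
qed

lemma PN_Suc_mono: "PN N \<subseteq> PN (Suc N)"
proof
  fix f :: "complex ^ 'n \<Rightarrow> complex" assume "f \<in> PN N"
  then show "f \<in> PN (Suc N)"
    unfolding PN_Suc by (intro exI[of _ f] exI[of _ "\<lambda>_ _. 0"]) (simp add: fsubspaceD(1)[OF fsubspace_PN])
qed

lemma PN_mono: "N \<le> M \<Longrightarrow> PN N \<subseteq> PN M"
  by (rule lift_Suc_mono_le[of PN, OF PN_Suc_mono])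

lemma PN_const: "(\<lambda>_. c) \<in> PN N"
  using PN_mono[of 0 N] PN_0[of "\<lambda>_. c"] by auto

lemma PN_coord_mult: "f \<in> PN N \<Longrightarrow> (\<lambda>v. v $ i * f v) \<in> PN (Suc N)"
  unfolding PN_Suc
proof (intro exI conjI allI)
  show "(\<lambda>_. 0) \<in> PN N" by (rule PN_const)
  show "(\<lambda>v. if j = i then f v else 0) \<in> PN N" if "f \<in> PN N" for j
    using that by (cases "j = i") (simp_all add: PN_const)
  show "(\<lambda>v. v $ i * f v) = (\<lambda>v. 0 + (\<Sum>j\<in>UNIV. v $ j * (if j = i then f v else 0)))"
    by (simp add: fun_eq_iff if_distrib[where f = "\<lambda>x. _ * x"] cong: if_cong)
qed

lemma PN_mult: "f \<in> PN N \<Longrightarrow> h \<in> PN M \<Longrightarrow> (\<lambda>v. f v * h v) \<in> PN (N + M)"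
proof (induction N arbitrary: f)
  case 0
  then show ?case using fsubspaceD(3)[OF fsubspace_PN] by (auto simp: PN_0)
next
  case (Suc N)
  then obtain q k where qf: "q \<in> PN N" "\<And>i. k i \<in> PN N" and p: "f = (\<lambda>v. q v + (\<Sum>i\<in>UNIV. v $ i * k i v))"
    unfolding PN_Suc by blast
  show ?case unfolding add_Suc PN_Suc
  proof (intro exI conjI allI)
    show "(\<lambda>v. q v * h v) \<in> PN (N + M)" by (intro Suc qf)
    show "(\<lambda>v. k i v * h v) \<in> PN (N + M)" for i by (intro Suc qf)
    show "(\<lambda>v. f v * h v) = (\<lambda>v. q v * h v + (\<Sum>i\<in>UNIV. v $ i * (k i v * h v)))"
      by (simp add: p fun_eq_iff algebra_simps sum_distrib_left)
  qed
qed

lemma poly_ring_simps: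
  "carrier poly_ring = gen_algebra {(\<lambda>v. v $ i) | i. True}"
  "f \<otimes>\<^bsub>poly_ring\<^esub> h = (\<lambda>v. f v * h v)" "f \<oplus>\<^bsub>poly_ring\<^esub> h = (\<lambda>v. f v + h v)"
  "\<zero>\<^bsub>poly_ring\<^esub> = (\<lambda>_. 0)" "\<one>\<^bsub>poly_ring\<^esub> = (\<lambda>_. 1)"
  by (simp_all add: poly_ring_def)

lemma R_closed:
  "(\<lambda>_. c) \<in> carrier poly_ring" "(\<lambda>v. v $ i) \<in> carrier poly_ring"
  "f \<in> carrier poly_ring \<Longrightarrow> h \<in> carrier poly_ring \<Longrightarrow> (\<lambda>v. f v + h v) \<in> carrier poly_ring"
  "f \<in> carrier poly_ring \<Longrightarrow> h \<in> carrier poly_ring \<Longrightarrow> (\<lambda>v. f v * h v) \<in> carrier poly_ring"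
  unfolding poly_ring_simps by (auto intro: gen_algebra.intros)

lemma R_sum: "finite J \<Longrightarrow> (\<And>j. j \<in> J \<Longrightarrow> f j \<in> carrier poly_ring) \<Longrightarrow> (\<lambda>v. \<Sum>j\<in>J. f j v) \<in> carrier poly_ring"
  by (induction J rule: finite_induct) (auto intro: R_closed)

lemma PN_R: "PN N \<subseteq> carrier poly_ring"
proof (induction N)
  case 0
  then show ?case by (auto simp: PN_0 R_closed)
next
  case (Suc N)
  show ?case
  proof
    fix p :: "complex ^ 'a \<Rightarrow> complex" assume "p \<in> PN (Suc N)"
    then obtain q f where "q \<in> PN N" "\<And>i. f i \<in> PN N" "p = (\<lambda>v. q v + (\<Sum>i\<in>UNIV. v $ i * f i v))"
      unfolding PN_Suc by blast
    with Suc show "p \<in> carrier poly_ring" by (auto intro!: R_closed R_sum)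
  qed
qed

lemma R_PN: "f \<in> carrier poly_ring \<Longrightarrow> \<exists>N. f \<in> PN N"
  unfolding poly_ring_simps
proof (induction rule: gen_algebra.induct)
  case (gen f)
  then obtain i where "f = (\<lambda>v. v $ i * 1)" by auto
  then show ?case using PN_coord_mult[OF PN_const[of 1 0]] by blast
next
  case (const c)
  then show ?case using PN_const by blast
next
  case (add f h)
  then obtain N M where "f \<in> PN N" "h \<in> PN M" by blast
  then have "f \<in> PN (max N M)" "h \<in> PN (max N M)" using PN_mono[of N "max N M"] PN_mono[of M "max N M"] by auto
  then show ?case using fsubspaceD(2)[OF fsubspace_PN] by blast
next
  case (mult f h)
  then show ?case using PN_mult by blast
qed

section \<open>Homogeneous components\<close>

definition hom_deg :: "nat \<Rightarrow> (complex ^ 'n \<Rightarrow> complex) \<Rightarrow> bool" where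
  "hom_deg k f \<longleftrightarrow> (\<forall>c v. f (c *s v) = c ^ k * f v)"

text \<open>On the line through \<open>v\<close> both sums are polynomials in the scalar, so their
  coefficients agree.\<close>

lemma hom_deg_unique:
  assumes f: "\<And>k. k \<le> M \<Longrightarrow> hom_deg k (f k)" and h: "\<And>k. k \<le> M \<Longrightarrow> hom_deg k (h k)"
    and eq: "\<And>v. (\<Sum>k\<le>M. f k v) = (\<Sum>k\<le>M. h k v)" and k: "k \<le> M"
  shows "f k = h k"
proof
  fix v
  have "(\<Sum>i\<le>M. (f i v - h i v) * c ^ i) = 0" for c
  proof -
    have "(\<Sum>i\<le>M. (f i v - h i v) * c ^ i) = (\<Sum>i\<le>M. f i (c *s v)) - (\<Sum>i\<le>M. h i (c *s v))"
      using f h by (simp add: sum_subtractf[symmetric] hom_deg_def algebra_simps)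
    then show ?thesis by (simp add: eq)
  qed
  then have "\<forall>i\<le>M. f i v - h i v = 0" using polyfun_eq_0[of "\<lambda>i. f i v - h i v" M] by blast
  then show "f k v = h k v" using k by simp
qed

lemma hom_deg_0 [simp]: "hom_deg k (\<lambda>_. 0)"
  by (simp add: hom_deg_def)

lemma hom_decomp:
  "p \<in> PN N \<Longrightarrow> \<exists>f. (\<forall>k. f k \<in> PN k \<and> hom_deg k (f k)) \<and> (\<forall>k>N. f k = (\<lambda>_. 0)) \<and> p = (\<lambda>v. \<Sum>k\<le>N. f k v)"
proof (induction N arbitrary: p)
  case 0
  then obtain c where "p = (\<lambda>_. c)" by (auto simp: PN_0)
  then show ?case
    by (intro exI[of _ "\<lambda>k. if k = 0 then p else (\<lambda>_. 0)"])
       (auto simp: PN_const hom_deg_def)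
next
  case (Suc N)
  then obtain q h where q: "q \<in> PN N" and h: "\<And>i. h i \<in> PN N" and p: "p = (\<lambda>v. q v + (\<Sum>i\<in>UNIV. v $ i * h i v))"
    unfolding PN_Suc by blast
  obtain Q where Q: "\<And>k. Q k \<in> PN k \<and> hom_deg k (Q k)" "\<And>k. k > N \<Longrightarrow> Q k = (\<lambda>_. 0)" "q = (\<lambda>v. \<Sum>k\<le>N. Q k v)"
    using Suc.IH[OF q] by blast
  have "\<forall>i. \<exists>f. (\<forall>k. f k \<in> PN k \<and> hom_deg k (f k)) \<and> (\<forall>k>N. f k = (\<lambda>_. 0)) \<and> h i = (\<lambda>v. \<Sum>k\<le>N. f k v)"
    using Suc.IH[OF h] by blast
  then obtain F where F: "\<And>i k. F i k \<in> PN k \<and> hom_deg k (F i k)" "\<And>i k. k > N \<Longrightarrow> F i k = (\<lambda>_. 0)" "\<And>i. h i = (\<lambda>v. \<Sum>k\<le>N. F i k v)"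
    by metis
  define E where "E k = (case k of 0 \<Rightarrow> Q 0 | Suc l \<Rightarrow> (\<lambda>v. Q (Suc l) v + (\<Sum>i\<in>UNIV. v $ i * F i l v)))" for k
  have "E k \<in> PN k" for k
  proof (cases k)
    case (Suc l)
    have "(\<lambda>v. \<Sum>i\<in>UNIV. v $ i * F i l v) \<in> PN (Suc l)"
      by (intro fsubspace_sum[OF fsubspace_PN] PN_coord_mult) (use F in auto)
    then show ?thesis using Q(1)[of "Suc l"] by (simp add: E_def Suc fsubspaceD(2)[OF fsubspace_PN])
  qed (use Q(1)[of 0] in \<open>simp add: E_def\<close>)
  moreover have "hom_deg k (E k)" for k
    using Q(1)[of k] F(1) by (cases k) (simp_all add: E_def hom_deg_def algebra_simps sum_distrib_left)
  moreover have "E k = (\<lambda>_. 0)" if "k > Suc N" for k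
    using that Q(2) F(2) by (cases k) (simp_all add: E_def)
  moreover have "p = (\<lambda>v. \<Sum>k\<le>Suc N. E k v)"
  proof
    fix v
    have "(\<Sum>k\<le>Suc N. E k v) = Q 0 v + (\<Sum>k\<le>N. Q (Suc k) v + (\<Sum>i\<in>UNIV. v $ i * F i k v))"
      by (subst sum.atMost_Suc_shift) (simp add: E_def)
    also have "\<dots> = (\<Sum>k\<le>Suc N. Q k v) + (\<Sum>i\<in>UNIV. v $ i * (\<Sum>k\<le>N. F i k v))"
      by (subst sum.atMost_Suc_shift) (simp add: sum.distrib sum_distrib_left, subst sum.swap, simp)
    also have "\<dots> = p v" using Q(2)[of "Suc N"] by (simp add: p Q(3) F(3))
    finally show "p v = (\<Sum>k\<le>Suc N. E k v)" ..
  qed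
  ultimately show ?case by blast
qed

section \<open>Generators of the null ideal, degree by degree\<close>

lemma null_ideal_ideal: "ideal (null_ideal G) poly_ring"
  unfolding null_ideal_def
  by (rule ring.genideal_ideal)
     (auto intro: cring.axioms(1)[OF cring_poly_ring] simp: invariants_plus_def invariants_def)

lemma null_ideal_closed:
  shows "invariants_plus G \<subseteq> null_ideal G" "null_ideal G \<subseteq> carrier poly_ring"
    "f \<in> null_ideal G \<Longrightarrow> h \<in> null_ideal G \<Longrightarrow> (\<lambda>v. f v + h v) \<in> null_ideal G"
    "f \<in> null_ideal G \<Longrightarrow> r \<in> carrier poly_ring \<Longrightarrow> (\<lambda>v. r v * f v) \<in> null_ideal G"
    "(\<lambda>_. 0) \<in> null_ideal G"
proof -
  interpret I: ideal "null_ideal G" poly_ring by (rule null_ideal_ideal)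
  show "invariants_plus G \<subseteq> null_ideal G"
    unfolding null_ideal_def
    by (rule ring.genideal_self)
       (auto intro: cring.axioms(1)[OF cring_poly_ring] simp: invariants_plus_def invariants_def)
  show "null_ideal G \<subseteq> carrier poly_ring" using I.Icarr by blast
  show "f \<in> null_ideal G \<Longrightarrow> h \<in> null_ideal G \<Longrightarrow> (\<lambda>v. f v + h v) \<in> null_ideal G"
    using additive_subgroup.a_closed[OF I.additive_subgroup_axioms, of f h] by (simp add: poly_ring_simps)
  show "f \<in> null_ideal G \<Longrightarrow> r \<in> carrier poly_ring \<Longrightarrow> (\<lambda>v. r v * f v) \<in> null_ideal G"
    using I.I_l_closed by (simp add: poly_ring_simps)
  show "(\<lambda>_. 0) \<in> null_ideal G" using additive_subgroup.zero_closed[OF I.additive_subgroup_axioms] by (simp add: poly_ring_simps)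
qed

lemma fsubspace_null_ideal: "fsubspace (null_ideal G \<inter> PN N)"
  using null_ideal_closed(3,5) null_ideal_closed(4)[OF _ R_closed(1)] fsubspaceD[OF fsubspace_PN[of N]]
  by (auto simp: fsubspace_def)

lemma invariants_closed:
  "(\<lambda>_. c) \<in> invariants G" "f \<in> invariants G \<Longrightarrow> h \<in> invariants G \<Longrightarrow> (\<lambda>v. f v + h v) \<in> invariants G"
  "f \<in> invariants G \<Longrightarrow> h \<in> invariants G \<Longrightarrow> (\<lambda>v. f v * h v) \<in> invariants G"
  by (auto simp: invariants_def R_closed fun_eq_iff)

lemma fsubspace_invariants: "fsubspace (invariants G \<inter> PN N)"
  using invariants_closed(1,2) invariants_closed(3)[OF invariants_closed(1)] fsubspaceD[OF fsubspace_PN[of N]]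
  by (auto simp: fsubspace_def)

text \<open>The product of the maximal ideal at the origin with the null ideal, in degrees up to
  \<open>N + 1\<close>. As in Nakayama's lemma, a complement of it in
  \<open>null_ideal G \<inter> PN (Suc N)\<close> supplies generators. It involves no choices, so
  \<open>H\<^sub>0 G\<close> preserves it.\<close>

definition Bn :: "(complex ^ 'n ^ 'n) set \<Rightarrow> nat \<Rightarrow> (complex ^ 'n \<Rightarrow> complex) set" where
  "Bn G N = {f. \<exists>h. (\<forall>i. h i \<in> null_ideal G \<inter> PN N) \<and> f = (\<lambda>v. \<Sum>i\<in>UNIV. v $ i * h i v)}"

lemma null_ideal_sum:
  "finite J \<Longrightarrow> (\<And>j. j \<in> J \<Longrightarrow> f j \<in> null_ideal G) \<Longrightarrow> (\<lambda>v. \<Sum>j\<in>J. f j v) \<in> null_ideal G"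
  by (induction J rule: finite_induct) (auto intro: null_ideal_closed)

lemma Bn_subset: "Bn G N \<subseteq> null_ideal G \<inter> PN (Suc N)"
  unfolding Bn_def
  by (auto intro!: null_ideal_sum null_ideal_closed(4) R_closed(2) fsubspace_sum[OF fsubspace_PN] PN_coord_mult)

lemma fsubspace_Bn: "fsubspace (Bn G N)"
  unfolding fsubspace_def
proof (intro conjI ballI allI)
  note * = fsubspaceD[OF fsubspace_null_ideal[of G N]]
  show "(\<lambda>_. 0) \<in> Bn G N"
    unfolding Bn_def by (intro CollectI exI[of _ "\<lambda>_ _. 0"]) (use * in simp)
  fix f assume "f \<in> Bn G N"
  then obtain h where h: "\<And>i. h i \<in> null_ideal G \<inter> PN N" "f = (\<lambda>v. \<Sum>i\<in>UNIV. v $ i * h i v)"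
    by (auto simp: Bn_def)
  show "(\<lambda>x. c * f x) \<in> Bn G N" for c
    unfolding Bn_def
    by (intro CollectI exI[of _ "\<lambda>i v. c * h i v"] conjI allI *(3) h(1))
       (simp add: h(2) sum_distrib_left mult_ac)
  fix f' assume "f' \<in> Bn G N"
  then obtain h' where h': "\<And>i. h' i \<in> null_ideal G \<inter> PN N" "f' = (\<lambda>v. \<Sum>i\<in>UNIV. v $ i * h' i v)"
    by (auto simp: Bn_def)
  show "(\<lambda>x. f x + f' x) \<in> Bn G N"
    unfolding Bn_def
    by (intro CollectI exI[of _ "\<lambda>i v. h i v + h' i v"] conjI allI *(2) h(1) h'(1))
       (simp add: h(2) h'(2) sum.distrib algebra_simps)
qed

text \<open>Expressions whose summands all have degree at most \<open>N\<close>. That they exhaust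
  \<open>null_ideal G \<inter> PN N\<close> requires an argument, since summands of higher degree
  might cancel. In degree 0 nothing but 0 is left, because \<open>invariants_plus\<close> asks for
  the value 0 at the origin.\<close>

fun Dn :: "(complex ^ 'n ^ 'n) set \<Rightarrow> nat \<Rightarrow> (complex ^ 'n \<Rightarrow> complex) set" where
  "Dn G 0 = {\<lambda>_. 0}"
| "Dn G (Suc N) = {f. \<exists>w\<in>invariants_plus G \<inter> PN (Suc N). \<exists>b\<in>Bn G N. f = (\<lambda>v. w v + b v)}"

lemma fsubspace_invariants_plus: "fsubspace (invariants_plus G \<inter> PN N)"
  using fsubspaceD[OF fsubspace_invariants[of G N]]
  by (auto simp: fsubspace_def invariants_plus_def)

lemma fsubspace_Dn: "fsubspace (Dn G N)"
proof (cases N)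
  case 0
  then show ?thesis by (auto simp: fsubspace_def)
next
  case (Suc M)
  note 1 = fsubspaceD[OF fsubspace_invariants_plus[of G N]] and 2 = fsubspaceD[OF fsubspace_Bn[of G M]]
  show ?thesis
    unfolding fsubspace_def Suc Dn.simps
  proof (intro conjI ballI allI)
    show "(\<lambda>_. 0) \<in> {f. \<exists>w\<in>invariants_plus G \<inter> PN (Suc M). \<exists>b\<in>Bn G M. f = (\<lambda>v. w v + b v)}"
      by (intro CollectI bexI[of _ "\<lambda>_. 0"]) (use 1(1) 2(1) Suc in auto)
    fix f assume "f \<in> {f. \<exists>w\<in>invariants_plus G \<inter> PN (Suc M). \<exists>b\<in>Bn G M. f = (\<lambda>v. w v + b v)}"
    then obtain w b where f: "w \<in> invariants_plus G \<inter> PN (Suc M)" "b \<in> Bn G M" "f = (\<lambda>v. w v + b v)" by blast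
    show "(\<lambda>x. c * f x) \<in> {f. \<exists>w\<in>invariants_plus G \<inter> PN (Suc M). \<exists>b\<in>Bn G M. f = (\<lambda>v. w v + b v)}" for c
      by (intro CollectI bexI[of _ "\<lambda>v. c * w v"] bexI[of _ "\<lambda>v. c * b v"] 2(3) 1(3)[unfolded Suc] f)
         (simp add: f algebra_simps)
    fix f' assume "f' \<in> {f. \<exists>w\<in>invariants_plus G \<inter> PN (Suc M). \<exists>b\<in>Bn G M. f = (\<lambda>v. w v + b v)}"
    then obtain w' b' where f': "w' \<in> invariants_plus G \<inter> PN (Suc M)" "b' \<in> Bn G M" "f' = (\<lambda>v. w' v + b' v)" by blast
    show "(\<lambda>x. f x + f' x) \<in> {f. \<exists>w\<in>invariants_plus G \<inter> PN (Suc M). \<exists>b\<in>Bn G M. f = (\<lambda>v. w v + b v)}"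
      by (intro CollectI bexI[of _ "\<lambda>v. w v + w' v"] bexI[of _ "\<lambda>v. b v + b' v"] 2(2) 1(2)[unfolded Suc] f f')
         (simp add: f f' algebra_simps)
  qed
qed

lemma Dn_subset: "Dn G N \<subseteq> null_ideal G \<inter> PN N"
proof (cases N)
  case 0
  then show ?thesis by (auto simp: null_ideal_closed PN_const)
next
  case (Suc M)
  have "(\<lambda>v. w v + b v) \<in> null_ideal G \<inter> PN (Suc M)"
    if "w \<in> invariants_plus G \<inter> PN (Suc M)" "b \<in> Bn G M" for w b
    using that null_ideal_closed(1)[of G] Bn_subset[of G M]
    by (intro fsubspaceD(2)[OF fsubspace_null_ideal]) auto
  then show ?thesis by (auto simp: Suc)
qed

lemma Dn_null: "f \<in> Dn G N \<Longrightarrow> f \<in> null_ideal G" and Dn_PN: "f \<in> Dn G N \<Longrightarrow> f \<in> PN N"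
  using Dn_subset by blast+

lemma Dn_coord_mult: "f \<in> Dn G k \<Longrightarrow> (\<lambda>v. v $ i * f v) \<in> Dn G (Suc k)"
proof -
  assume f: "f \<in> Dn G k"
  have "(\<lambda>v. v $ i * f v) \<in> Bn G k"
    unfolding Bn_def
  proof (intro CollectI exI conjI allI)
    show "(\<lambda>v. if j = i then f v else 0) \<in> null_ideal G \<inter> PN k" for j
      using f by (cases "j = i") (simp_all add: Dn_null Dn_PN PN_const null_ideal_closed)
    show "(\<lambda>v. v $ i * f v) = (\<lambda>v. \<Sum>j\<in>UNIV. v $ j * (if j = i then f v else 0))"
      by (simp add: fun_eq_iff if_distrib[where f = "\<lambda>x. _ * x"] cong: if_cong)
  qed
  moreover have "(\<lambda>_. 0) \<in> invariants_plus G \<inter> PN (Suc k)"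
    by (rule fsubspaceD(1)[OF fsubspace_invariants_plus])
  ultimately show ?thesis
    unfolding Dn.simps by (intro CollectI bexI[of _ "\<lambda>_. 0"] bexI[of _ "\<lambda>v. v $ i * f v"]) simp_all
qed

text \<open>Polynomials whose homogeneous components lie in the \<open>Dn\<close> of their own
  degree. They form an ideal that contains \<open>invariants_plus G\<close>, hence the null
  ideal.\<close>

definition homs :: "(complex ^ 'n ^ 'n) set \<Rightarrow> (complex ^ 'n \<Rightarrow> complex) set" where
  "homs G = {f. \<exists>M F. (\<forall>k. hom_deg k (F k) \<and> F k \<in> Dn G k) \<and> (\<forall>k>M. F k = (\<lambda>_. 0)) \<and> f = (\<lambda>v. \<Sum>k\<le>M. F k v)}"

lemma homs_I:
  "(\<And>k. hom_deg k (F k)) \<Longrightarrow> (\<And>k. F k \<in> Dn G k) \<Longrightarrow> (\<And>k. k > M \<Longrightarrow> F k = (\<lambda>_. 0)) \<Longrightarrow> f = (\<lambda>v. \<Sum>k\<le>M. F k v) \<Longrightarrow> f \<in> homs G"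
  unfolding homs_def by (intro CollectI exI[of _ M] exI[of _ F]) auto

lemma homs_E:
  assumes "f \<in> homs G"
  obtains M F where "\<And>k. hom_deg k (F k)" "\<And>k. F k \<in> Dn G k" "\<And>k. k > M \<Longrightarrow> F k = (\<lambda>_. 0)"
    "\<And>L. L \<ge> M \<Longrightarrow> f = (\<lambda>v. \<Sum>k\<le>L. F k v)"
proof -
  obtain M F where F: "\<And>k. hom_deg k (F k)" "\<And>k. F k \<in> Dn G k" "\<And>k. k > M \<Longrightarrow> F k = (\<lambda>_. 0)" "f = (\<lambda>v. \<Sum>k\<le>M. F k v)"
    using assms unfolding homs_def by blast
  have "f = (\<lambda>v. \<Sum>k\<le>L. F k v)" if "L \<ge> M" for L
    unfolding F(4) using that F(3) by (intro ext sum.mono_neutral_left) auto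
  with F that show ?thesis by blast
qed

lemma homs_closed:
  "(\<lambda>_. 0) \<in> homs G" "f \<in> homs G \<Longrightarrow> h \<in> homs G \<Longrightarrow> (\<lambda>v. f v + h v) \<in> homs G"
  "f \<in> homs G \<Longrightarrow> (\<lambda>v. c * f v) \<in> homs G" "f \<in> homs G \<Longrightarrow> (\<lambda>v. v $ i * f v) \<in> homs G"
proof -
  note D = fsubspaceD[OF fsubspace_Dn]
  show "(\<lambda>_. 0) \<in> homs G" by (rule homs_I[of "\<lambda>_ _. 0" _ 0]) (auto simp: D)
  assume "f \<in> homs G"
  then obtain M F where F: "\<And>k. hom_deg k (F k)" "\<And>k. F k \<in> Dn G k" "\<And>k. k > M \<Longrightarrow> F k = (\<lambda>_. 0)"
    "\<And>L. L \<ge> M \<Longrightarrow> f = (\<lambda>v. \<Sum>k\<le>L. F k v)" by (rule homs_E) blast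
  show "(\<lambda>v. c * f v) \<in> homs G"
  proof (rule homs_I[of "\<lambda>k v. c * F k v" _ M])
    show "hom_deg k (\<lambda>v. c * F k v)" for k using F(1)[of k] by (simp add: hom_deg_def algebra_simps)
    show "(\<lambda>v. c * F k v) \<in> Dn G k" for k by (intro D F)
    show "(\<lambda>v. c * F k v) = (\<lambda>_. 0)" if "k > M" for k using F(3)[OF that] by simp
    show "(\<lambda>v. c * f v) = (\<lambda>v. \<Sum>k\<le>M. c * F k v)" by (subst F(4)[OF order_refl]) (simp add: sum_distrib_left)
  qed
  define E where "E k = (case k of 0 \<Rightarrow> (\<lambda>_. 0) | Suc l \<Rightarrow> (\<lambda>v. v $ i * F l v))" for k
  show "(\<lambda>v. v $ i * f v) \<in> homs G"
  proof (rule homs_I[of E _ "Suc M"])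
    show "hom_deg k (E k)" for k
      using F(1) by (cases k) (simp_all add: E_def hom_deg_def algebra_simps)
    show "E k \<in> Dn G k" for k
    proof (cases k)
      case (Suc l)
      then show ?thesis using Dn_coord_mult[OF F(2)[of l], of i] by (simp only: E_def nat.case)
    qed (simp add: E_def)
    show "E k = (\<lambda>_. 0)" if "k > Suc M" for k
      using that F(3) by (cases k) (simp_all add: E_def)
    show "(\<lambda>v. v $ i * f v) = (\<lambda>v. \<Sum>k\<le>Suc M. E k v)"
      by (subst F(4)[OF order_refl], subst sum.atMost_Suc_shift) (simp add: E_def sum_distrib_left)
  qed
  assume "h \<in> homs G"
  then obtain M' F' where F': "\<And>k. hom_deg k (F' k)" "\<And>k. F' k \<in> Dn G k" "\<And>k. k > M' \<Longrightarrow> F' k = (\<lambda>_. 0)"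
    "\<And>L. L \<ge> M' \<Longrightarrow> h = (\<lambda>v. \<Sum>k\<le>L. F' k v)" by (rule homs_E) blast
  show "(\<lambda>v. f v + h v) \<in> homs G"
  proof (rule homs_I[of "\<lambda>k v. F k v + F' k v" _ "max M M'"])
    show "hom_deg k (\<lambda>v. F k v + F' k v)" for k
      using F(1)[of k] F'(1)[of k] by (simp add: hom_deg_def algebra_simps)
    show "(\<lambda>v. F k v + F' k v) \<in> Dn G k" for k by (intro D F F')
    show "(\<lambda>v. F k v + F' k v) = (\<lambda>_. 0)" if "k > max M M'" for k using F(3)[of k] F'(3)[of k] that by simp
    show "(\<lambda>v. f v + h v) = (\<lambda>v. \<Sum>k\<le>max M M'. F k v + F' k v)"
      by (subst F(4)[OF max.cobounded1], subst F'(4)[OF max.cobounded2]) (simp add: sum.distrib)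
  qed
qed

lemma homs_mult: "r \<in> carrier poly_ring \<Longrightarrow> f \<in> homs G \<Longrightarrow> (\<lambda>v. r v * f v) \<in> homs G"
  unfolding poly_ring_simps
proof (induction arbitrary: f rule: gen_algebra.induct)
  case (mult r s)
  then have "(\<lambda>v. r v * (\<lambda>v. s v * f v) v) \<in> homs G" by blast
  then show ?case by (simp add: mult.assoc)
next
  case (add r s)
  then have "(\<lambda>v. (\<lambda>v. r v * f v) v + (\<lambda>v. s v * f v) v) \<in> homs G" by (intro homs_closed) blast+
  then show ?case by (simp add: algebra_simps)
qed (auto intro: homs_closed)

lemma homs_subset: "homs G \<subseteq> null_ideal G"
proof
  fix f assume "f \<in> homs G"
  then obtain M F where F: "\<And>k. F k \<in> Dn G k" "\<And>L. L \<ge> M \<Longrightarrow> f = (\<lambda>v. \<Sum>k\<le>L. F k v)" by (rule homs_E) blast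
  then show "f \<in> null_ideal G"
    by (subst F(2)[OF order_refl]) (intro null_ideal_sum Dn_null, auto)
qed

lemma ideal_homs: "ideal (homs G) poly_ring"
proof (rule idealI)
  show ring: "ring (poly_ring :: (complex ^ 'a \<Rightarrow> complex) ring)"
    by (rule cring.axioms(1)[OF cring_poly_ring])
  interpret ring "poly_ring :: (complex ^ 'a \<Rightarrow> complex) ring" by (rule ring)
  have sub: "homs G \<subseteq> carrier poly_ring" using homs_subset null_ideal_closed(2) by blast
  show "subgroup (homs G) (add_monoid poly_ring)"
  proof (rule add.subgroupI)
    show "homs G \<subseteq> carrier poly_ring" by (rule sub)
    show "homs G \<noteq> {}" using homs_closed(1) by blast
    fix f assume f: "f \<in> homs G"
    then have "(\<lambda>v. - 1 * f v) \<in> homs G" by (intro homs_closed)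
    moreover have "\<ominus>\<^bsub>poly_ring\<^esub> f = (\<lambda>v. - 1 * f v)"
    proof (rule minus_equality)
      show "(\<lambda>v. - 1 * f v) \<oplus>\<^bsub>poly_ring\<^esub> f = \<zero>\<^bsub>poly_ring\<^esub>" by (simp add: poly_ring_simps)
    qed (use f sub calculation in auto)
    ultimately show "\<ominus>\<^bsub>poly_ring\<^esub> f \<in> homs G" by simp
    fix h assume "h \<in> homs G"
    with f show "f \<oplus>\<^bsub>poly_ring\<^esub> h \<in> homs G" by (simp add: poly_ring_simps homs_closed)
  qed
  show "x \<otimes>\<^bsub>poly_ring\<^esub> f \<in> homs G" "f \<otimes>\<^bsub>poly_ring\<^esub> x \<in> homs G"
    if "f \<in> homs G" "x \<in> carrier poly_ring" for f x
    using homs_mult[OF that(2,1)] by (simp_all add: poly_ring_simps mult.commute)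
qed

lemma hom_deg_comp: "hom_deg k f \<Longrightarrow> hom_deg k (f \<circ> (*v) g)"
  by (simp add: hom_deg_def vec.linear_scale[OF matrix_vector_mul_linear_gen])

lemma invariants_hom_components:
  assumes f: "f \<in> invariants G" and F: "\<And>k. F k \<in> PN k" "\<And>k. hom_deg k (F k)" "f = (\<lambda>v. \<Sum>k\<le>N. F k v)" and k: "k \<le> N"
  shows "F k \<in> invariants G"
proof -
  have "F k \<circ> (*v) g = F k" if g: "g \<in> G" for g
  proof (rule hom_deg_unique[of N "\<lambda>k. F k \<circ> (*v) g" F])
    fix v
    have "f (g *v v) = f v" using f g by (auto simp: invariants_def fun_eq_iff)
    then show "(\<Sum>k\<le>N. (F k \<circ> (*v) g) v) = (\<Sum>k\<le>N. F k v)" by (simp add: F(3))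
  qed (auto intro: hom_deg_comp F k)
  then show ?thesis using F(1)[of k] PN_R by (auto simp: invariants_def)
qed

text \<open>The components of an invariant are invariant since linear substitutions preserve
  homogeneity; the one of degree 0 vanishes with the value at the origin.\<close>

lemma invariants_plus_homs: "invariants_plus G \<subseteq> homs G"
proof
  fix f assume f: "f \<in> invariants_plus G"
  then have fi: "f \<in> invariants G" and f0: "f 0 = 0" by (auto simp: invariants_plus_def)
  then obtain N where "f \<in> PN N" using R_PN by (auto simp: invariants_def)
  then obtain F where F: "\<And>k. F k \<in> PN k" "\<And>k. hom_deg k (F k)" "\<And>k. k > N \<Longrightarrow> F k = (\<lambda>_. 0)" "f = (\<lambda>v. \<Sum>k\<le>N. F k v)"
    using hom_decomp[of f N] by metis
  have z: "F k 0 = 0" if "k > 0" for k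
    using F(2)[of k] that by (auto simp: hom_deg_def zero_power dest: spec[of _ 0])
  have "f 0 = (\<Sum>k\<in>{0}. F k 0)"
    unfolding F(4) using z by (intro sum.mono_neutral_right) auto
  with f0 have "F 0 0 = 0" by simp
  then have F0: "F 0 = (\<lambda>_. 0)" using F(1)[of 0] by (auto simp: PN_0)
  show "f \<in> homs G"
  proof (rule homs_I[of F _ N])
    fix k
    show "F k \<in> Dn G k"
    proof (cases k)
      case (Suc l)
      have "F k \<in> invariants G"
      proof (cases "k \<le> N")
        case True
        then show ?thesis by (intro invariants_hom_components[OF fi F(1,2,4)])
      next
        case False
        then show ?thesis using F(3) invariants_closed(1) by auto
      qed
      then have "F k \<in> invariants_plus G \<inter> PN (Suc l)"
        using z[of k] F(1)[of k] Suc by (auto simp: invariants_plus_def)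
      then show ?thesis
        unfolding Suc Dn.simps using fsubspaceD(1)[OF fsubspace_Bn]
        by (intro CollectI bexI[of _ "F (Suc l)"] bexI[of _ "\<lambda>_. 0"]) auto
    qed (simp add: F0)
  qed (use F in auto)
qed

lemma null_ideal_homs: "null_ideal G = homs G"
proof
  show "null_ideal G \<subseteq> homs G"
    unfolding null_ideal_def
    by (rule ring.genideal_minimal[OF cring.axioms(1)[OF cring_poly_ring] ideal_homs invariants_plus_homs])
qed (rule homs_subset)

lemma Dn_Suc_mono: "Dn G N \<subseteq> Dn G (Suc N)"
proof (cases N)
  case 0
  then show ?thesis using fsubspaceD(1)[OF fsubspace_Dn[of G "Suc 0"]] by simp
next
  case (Suc M)
  have "Bn G M \<subseteq> Bn G (Suc M)"
    unfolding Bn_def using PN_Suc_mono[of M] by (intro Collect_mono ex_mono) auto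
  show ?thesis
  proof
    fix f assume "f \<in> Dn G N"
    then obtain w b where f: "w \<in> invariants_plus G \<inter> PN (Suc M)" "b \<in> Bn G M" "f = (\<lambda>v. w v + b v)"
      unfolding Suc Dn.simps by blast
    have "w \<in> invariants_plus G \<inter> PN (Suc N)" "b \<in> Bn G N"
      using f PN_Suc_mono[of "Suc M"] \<open>Bn G M \<subseteq> Bn G (Suc M)\<close> Suc by auto
    with f(3) show "f \<in> Dn G (Suc N)" unfolding Dn.simps by (intro CollectI bexI[of _ w] bexI[of _ b])
  qed
qed

text \<open>By uniqueness, the components provided by \<open>homs\<close> are those of a
  decomposition of \<open>f\<close> within \<open>PN N\<close>, so none of degree above
  \<open>N\<close> occurs.\<close>

lemma null_ideal_Dn: "null_ideal G \<inter> PN N = Dn G N"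
proof
  show "null_ideal G \<inter> PN N \<subseteq> Dn G N"
  proof
    fix f assume f: "f \<in> null_ideal G \<inter> PN N"
    then have "f \<in> homs G" by (simp add: null_ideal_homs)
    then obtain M F where F: "\<And>k. hom_deg k (F k)" "\<And>k. F k \<in> Dn G k" "\<And>k. k > M \<Longrightarrow> F k = (\<lambda>_. 0)"
      "\<And>L. L \<ge> M \<Longrightarrow> f = (\<lambda>v. \<Sum>k\<le>L. F k v)" by (rule homs_E) blast
    obtain E where E: "\<And>k. E k \<in> PN k \<and> hom_deg k (E k)" "\<And>k. k > N \<Longrightarrow> E k = (\<lambda>_. 0)" "f = (\<lambda>v. \<Sum>k\<le>N. E k v)"
      using hom_decomp[of f N] f by blast
    have E': "f = (\<lambda>v. \<Sum>k\<le>max M N. E k v)"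
      unfolding E(3) using E(2) by (intro ext sum.mono_neutral_left) auto
    have "E k = F k" if "k \<le> max M N" for k
    proof (rule hom_deg_unique[OF _ _ _ that])
      show "(\<Sum>k\<le>max M N. E k v) = (\<Sum>k\<le>max M N. F k v)" for v
        using fun_cong[OF E', of v] fun_cong[OF F(4)[OF max.cobounded1[of M N]], of v] by simp
    qed (use E F in auto)
    then have "f = (\<lambda>v. \<Sum>k\<le>N. F k v)" unfolding E(3) by simp
    moreover have "F k \<in> Dn G N" if "k \<le> N" for k
      using F(2)[of k] lift_Suc_mono_le[of "Dn G", OF Dn_Suc_mono that] by blast
    then have "(\<lambda>v. \<Sum>k\<le>N. F k v) \<in> Dn G N"
      by (intro fsubspace_sum[OF fsubspace_Dn]) auto
    ultimately show "f \<in> Dn G N" by simp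
  qed
qed (rule Dn_subset)

text \<open>The ideal is homogeneous, and a scalar \<open>c\<close> multiplies the component of
  degree \<open>k\<close> by \<open>c ^ k\<close>.\<close>

lemma null_ideal_scalar:
  assumes "f \<in> null_ideal G"
  shows "f \<circ> (*v) (mat c) \<in> null_ideal G"
proof -
  obtain M F where F: "\<And>k. hom_deg k (F k)" "\<And>k. F k \<in> Dn G k" "\<And>L. L \<ge> M \<Longrightarrow> f = (\<lambda>v. \<Sum>k\<le>L. F k v)"
    using assms unfolding null_ideal_homs by (rule homs_E) blast
  have "f \<circ> (*v) (mat c) = (\<lambda>v. \<Sum>k\<le>M. c ^ k * F k v)"
    using F(1) by (subst F(3)[OF order_refl]) (auto simp: hom_deg_def mat_mult_vec)
  also have "\<dots> \<in> null_ideal G"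
    by (intro null_ideal_sum null_ideal_closed(4)[OF _ R_closed(1)] Dn_null[OF F(2)]) auto
  finally show ?thesis .
qed

section \<open>Invariants under the group preserving the null ideal\<close>

lemma coord_comp: "(s *v v) $ i = (\<Sum>j\<in>UNIV. s $ i $ j * v $ j)"
  by (simp add: matrix_vector_mult_def)

text \<open>Substitution turns a coordinate into a combination of coordinates and keeps its cofactor
  in the ideal without raising the degree.\<close>

lemma PN_Suc_subset_comp:
  assumes s: "\<And>f. f \<in> null_ideal G \<inter> PN (Suc N) \<Longrightarrow> f \<circ> (*v) s \<in> null_ideal G \<inter> PN (Suc N)"
    and f: "f \<in> Bn G N"
  shows "f \<circ> (*v) s \<in> Bn G N"
proof -
  obtain h where h: "\<And>i. h i \<in> null_ideal G \<inter> PN N" "f = (\<lambda>v. \<Sum>i\<in>UNIV. v $ i * h i v)"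
    using f unfolding Bn_def by blast
  have hs: "h i \<circ> (*v) s \<in> null_ideal G \<inter> PN N" for i
    using s[of "h i"] h(1)[of i] PN_Suc_mono[of N] PN_comp[of "h i" N s] by auto
  have sub: "fsubspace (null_ideal G \<inter> PN N)" by (rule fsubspace_null_ideal)
  show ?thesis
    unfolding Bn_def
  proof (intro CollectI exI conjI allI)
    show "(\<lambda>v. \<Sum>i\<in>UNIV. s $ i $ j * (h i \<circ> (*v) s) v) \<in> null_ideal G \<inter> PN N" for j
      by (intro fsubspace_sum[OF sub] fsubspaceD(3)[OF sub] hs)
    show "f \<circ> (*v) s = (\<lambda>v. \<Sum>j\<in>UNIV. v $ j * (\<Sum>i\<in>UNIV. s $ i $ j * (h i \<circ> (*v) s) v))"
      by (simp add: h(2) fun_eq_iff coord_comp sum_distrib_left sum_distrib_right mult_ac, subst sum.swap, simp)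
  qed
qed

lemma matrix_inv_mat: "c \<noteq> 0 \<Longrightarrow> matrix_inv (mat c) = (mat (1 / c) :: complex ^ 'n ^ 'n)"
  by (intro matrix_inv_unique) (simp add: mat_mult_mat)

lemma H0_comp:
  assumes "h \<in> H\<^sub>0 G" "f \<in> null_ideal G"
  shows "f \<circ> (*v) h \<in> null_ideal G" "f \<circ> (*v) (matrix_inv h) \<in> null_ideal G"
proof -
  show "f \<circ> (*v) h \<in> null_ideal G" using assms by (auto simp: H\<^sub>0_def)
  have "matrix_inv h \<in> H\<^sub>0 G" by (rule subgroup_GL_D(4)[OF subgroup_H0 assms(1)])
  then show "f \<circ> (*v) (matrix_inv h) \<in> null_ideal G" using assms(2) by (auto simp: H\<^sub>0_def)
qed

lemma mat_in_H0: "c \<noteq> 0 \<Longrightarrow> mat c \<in> H\<^sub>0 G"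
proof -
  assume c: "c \<noteq> 0"
  have "null_ideal G \<subseteq> (\<lambda>f. f \<circ> (*v) (mat c)) ` null_ideal G"
  proof
    fix f assume "f \<in> null_ideal G"
    then have "f \<circ> (*v) (mat (1 / c)) \<in> null_ideal G" by (rule null_ideal_scalar)
    moreover have "f = f \<circ> (*v) (mat (1 / c)) \<circ> (*v) (mat c)"
      using c by (simp add: mat_mult_mat comp_matrix_mat_1 flip: comp_matrix_mult)
    ultimately show "f \<in> (\<lambda>f. f \<circ> (*v) (mat c)) ` null_ideal G" by blast
  qed
  then show ?thesis
    using c null_ideal_scalar by (auto simp: H\<^sub>0_def carrier_GL invertible_mat)
qed

lemma H0_fst_set: "h \<in> H\<^sub>0 G \<Longrightarrow> h \<in> fst_set (null_ideal G \<inter> PN N)"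
  using H0_comp[of h G] PN_comp subgroup_GL_D(1)[OF subgroup_H0, of h G]
  by (auto simp: fst_set_def)

text \<open>\<open>W\<close> is the orthogonal complement of \<open>Bn\<close> for the inner product
  of a good position. Since the stabilizer is closed under \<open>star g\<close>, it preserves
  \<open>W\<close> along with \<open>Bn\<close>. Modulo \<open>Bn\<close> every element of the ideal
  is represented by an invariant, so \<open>G\<close> acts trivially on the quotient and therefore
  on \<open>W\<close>.\<close>

lemma complement_exists:
  fixes G :: "(complex ^ 'n ^ 'n) set"
  assumes irr: "irreducible_module G" and GH: "G \<subseteq> H\<^sub>0 G"
  obtains W where "W \<subseteq> invariants_plus G \<inter> PN (Suc N)"
    "\<And>h w. h \<in> H\<^sub>0 G \<Longrightarrow> w \<in> W \<Longrightarrow> w \<circ> (*v) h \<in> W"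
    "\<And>f. f \<in> null_ideal G \<inter> PN (Suc N) \<Longrightarrow> \<exists>w\<in>W. \<exists>b\<in>Bn G N. f = (\<lambda>v. w v + b v)"
proof -
  define A where "A = null_ideal G \<inter> PN (Suc N)"
  have A: "fsubspace A" "A \<subseteq> PN (Suc N)" by (auto simp: A_def fsubspace_null_ideal)
  obtain g where g: "good_position A g"
    using good_position_exists[OF A irr] GH H0_fst_set[of _ G "Suc N"] mat_in_H0[of _ G] unfolding A_def by blast
  have ig: "invertible g" using g by (simp add: good_position_def)
  let ?ip = "gip g (Suc N)"
  define W where "W = {f \<in> A. \<forall>b\<in>Bn G N. ?ip f b = 0}"
  have Bst: "b \<circ> (*v) s \<in> Bn G N" if "s \<in> fst_set A" "b \<in> Bn G N" for s b
    by (rule PN_Suc_subset_comp[OF _ that(2)]) (use that(1) in \<open>simp add: fst_set_def A_def\<close>)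
  have BA: "Bn G N \<subseteq> A" unfolding A_def by (rule Bn_subset)
  have Wst: "w \<circ> (*v) s \<in> W" if s: "s \<in> fst_set A" and w: "w \<in> W" for s w
  proof -
    have "?ip (w \<circ> (*v) s) b = 0" if b: "b \<in> Bn G N" for b
    proof -
      have "?ip (w \<circ> (*v) s) b = ?ip w (b \<circ> (*v) (star g s))"
        using w b A BA by (intro gip_star ig) (auto simp: W_def)
      also have "\<dots> = 0" using w Bst[OF good_position_star[OF g s] b] by (simp add: W_def)
      finally show ?thesis .
    qed
    then show ?thesis using w s by (simp add: W_def fst_set_def)
  qed
  have dec: "\<exists>w\<in>W. \<exists>b\<in>Bn G N. f = (\<lambda>v. w v + b v)" if f: "f \<in> A" for f
  proof -
    obtain b where b: "b \<in> Bn G N" "\<And>h. h \<in> Bn G N \<Longrightarrow> ?ip (\<lambda>x. f x - b x) h = 0"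
      using gip_projection[OF fsubspace_Bn _ _ ig, of G N "Suc N" f] BA A f by blast
    have "(\<lambda>x. f x - b x) \<in> W"
      using b BA f by (auto simp: W_def intro: fsubspaceD(4)[OF A(1)])
    then show ?thesis using b(1) by (intro bexI[of _ "\<lambda>x. f x - b x"] bexI[of _ b]) auto
  qed
  have "W \<subseteq> invariants_plus G \<inter> PN (Suc N)"
  proof
    fix w assume w: "w \<in> W"
    then have wA: "w \<in> A" by (simp add: W_def)
    then obtain r b where rb: "r \<in> invariants_plus G \<inter> PN (Suc N)" "b \<in> Bn G N" "w = (\<lambda>v. r v + b v)"
      unfolding A_def null_ideal_Dn by auto
    have inv: "w \<circ> (*v) \<gamma> = w" if \<gamma>: "\<gamma> \<in> G" for \<gamma>
    proof -
      have \<gamma>A: "\<gamma> \<in> fst_set A" using \<gamma> GH H0_fst_set unfolding A_def by blast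
      \<comment> \<open>This difference lies both in \<open>W\<close> and in \<open>Bn\<close>,
        hence is orthogonal to itself.\<close>
      define x where "x = (\<lambda>v. (w \<circ> (*v) \<gamma>) v - w v)"
      have "r \<circ> (*v) \<gamma> = r" using rb(1) \<gamma> by (auto simp: invariants_plus_def invariants_def)
      then have "x = (\<lambda>v. (b \<circ> (*v) \<gamma>) v - b v)" by (auto simp: x_def rb(3) fun_eq_iff)
      then have xB: "x \<in> Bn G N"
        using Bst[OF \<gamma>A rb(2)] rb(2) fsubspaceD(4)[OF fsubspace_Bn] by blast
      have "?ip x x = 0"
      proof -
        have "w \<circ> (*v) \<gamma> \<in> PN (Suc N)" "w \<in> PN (Suc N)" using wA A PN_comp by blast+
        from gip_diff(1)[OF this, of g x]
        have "?ip x x = ?ip (w \<circ> (*v) \<gamma>) x - ?ip w x" unfolding x_def[symmetric] .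
        also have "\<dots> = 0" using w Wst[OF \<gamma>A w] xB by (simp add: W_def)
        finally show ?thesis .
      qed
      then have "x = (\<lambda>_. 0)" using xB BA A by (intro gip_self[OF ig, of x "Suc N"]) auto
      then show ?thesis by (auto simp: x_def fun_eq_iff)
    qed
    have "w 0 = 0" using rb by (auto simp: invariants_plus_def Bn_def)
    moreover have "w \<in> carrier poly_ring" using wA PN_R by (auto simp: A_def)
    ultimately show "w \<in> invariants_plus G \<inter> PN (Suc N)"
      using inv wA by (auto simp: invariants_plus_def invariants_def A_def)
  qed
  moreover have "w \<circ> (*v) h \<in> W" if "h \<in> H\<^sub>0 G" "w \<in> W" for h w
    using that Wst H0_fst_set unfolding A_def by blast
  ultimately show ?thesis using dec that unfolding A_def by blast
qed

text \<open>The complement of the invariants of \<open>K\<close> on which a Reynolds operator vanishes.\<close>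

inductive_set nsp :: "(complex ^ 'n ^ 'n) set \<Rightarrow> nat \<Rightarrow> (complex ^ 'n \<Rightarrow> complex) set" for K N where
  zero: "(\<lambda>_. 0) \<in> nsp K N"
| diff: "f \<in> PN N \<Longrightarrow> s \<in> K \<Longrightarrow> (\<lambda>v. f (s *v v) - f v) \<in> nsp K N"
| add: "f \<in> nsp K N \<Longrightarrow> h \<in> nsp K N \<Longrightarrow> (\<lambda>v. f v + h v) \<in> nsp K N"
| scale: "f \<in> nsp K N \<Longrightarrow> (\<lambda>v. c * f v) \<in> nsp K N"

lemma fsubspace_nsp: "fsubspace (nsp K N)"
  by (auto simp: fsubspace_def intro: nsp.intros)

lemma nsp_PN: "nsp K N \<subseteq> PN N"
proof
  fix f assume "f \<in> nsp K N"
  then show "f \<in> PN N"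
  proof induction
    case (diff f s)
    then show ?case using fsubspaceD(4)[OF fsubspace_PN PN_comp[of f N s]] by (simp add: o_def)
  qed (auto intro: fsubspaceD[OF fsubspace_PN])
qed

text \<open>Multiplication by a polynomial fixed by \<open>K\<close> commutes with the action. This
  expresses the linearity of the Reynolds operator over the invariants.\<close>

lemma nsp_mult:
  assumes w: "w \<in> PN M" "\<And>s v. s \<in> K \<Longrightarrow> w (s *v v) = w v"
  shows "f \<in> nsp K a \<Longrightarrow> (\<lambda>v. f v * w v) \<in> nsp K (a + M)"
proof (induction rule: nsp.induct)
  case (diff f s)
  have "(\<lambda>v. (\<lambda>v. f v * w v) (s *v v) - (\<lambda>v. f v * w v) v) \<in> nsp K (a + M)"
    by (intro nsp.diff PN_mult diff w)
  then show ?case using w(2)[OF diff(2)] by (simp add: algebra_simps)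
next
  case (add f h)
  then show ?case using nsp.add by (simp add: distrib_right)
next
  case (scale f c)
  then show ?case using nsp.scale by (simp add: mult.assoc)
qed (simp add: nsp.zero)

lemma nsp_mono: "N \<le> M \<Longrightarrow> nsp K N \<subseteq> nsp K M"
proof
  fix f assume "N \<le> M" "f \<in> nsp K N"
  from this(2) show "f \<in> nsp K M"
    by induction (use PN_mono[OF \<open>N \<le> M\<close>] in \<open>auto intro: nsp.intros\<close>)
qed

text \<open>If \<open>e\<close> is orthogonal to \<open>nsp K N\<close> and \<open>x\<close> is
  \<open>e \<circ> s - e\<close>, then \<open><x, x> = <e, x \<circ> star g s - x> = 0\<close>,
  because \<open>star g s\<close> is in \<open>K\<close> and the second argument is in
  \<open>nsp\<close>. So \<open>K\<close> fixes \<open>e\<close>. By the same adjunction, fixed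
  polynomials are orthogonal to \<open>nsp\<close>.\<close>

lemma reynolds:
  assumes g: "invertible g" and K: "\<And>s. s \<in> K \<Longrightarrow> star g s \<in> K"
  shows "f \<in> PN N \<Longrightarrow> \<exists>e n. e \<in> PN N \<and> (\<forall>s\<in>K. e \<circ> (*v) s = e) \<and> n \<in> nsp K N \<and> f = (\<lambda>v. e v + n v)"
    and "f \<in> nsp K N \<Longrightarrow> (\<And>s. s \<in> K \<Longrightarrow> f \<circ> (*v) s = f) \<Longrightarrow> f = (\<lambda>_. 0)"
proof -
  let ?ip = "gip g N"
  assume f: "f \<in> PN N"
  obtain n where n: "n \<in> nsp K N" "\<And>h. h \<in> nsp K N \<Longrightarrow> ?ip (\<lambda>x. f x - n x) h = 0"
    using gip_projection[OF fsubspace_nsp nsp_PN f g] by blast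
  define e where "e = (\<lambda>x. f x - n x)"
  have nP: "n \<in> PN N" using n(1) nsp_PN by blast
  have eP: "e \<in> PN N" unfolding e_def by (intro fsubspaceD(4)[OF fsubspace_PN] f nP)
  have "e \<circ> (*v) s = e" if s: "s \<in> K" for s
  proof -
    define x where "x = (\<lambda>v. (e \<circ> (*v) s) v - e v)"
    have xP: "x \<in> PN N" unfolding x_def by (intro fsubspaceD(4)[OF fsubspace_PN] PN_comp eP)
    have "(\<lambda>v. (x \<circ> (*v) (star g s)) v - x v) \<in> nsp K N"
      unfolding o_def by (intro nsp.diff xP K s)
    then have "0 = ?ip e (\<lambda>v. (x \<circ> (*v) (star g s)) v - x v)" using n(2) by (simp add: e_def)
    also have "\<dots> = ?ip e (x \<circ> (*v) (star g s)) - ?ip e x" by (intro gip_diff PN_comp xP)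
    also have "?ip e (x \<circ> (*v) (star g s)) = ?ip (e \<circ> (*v) s) x" by (intro gip_star[symmetric] g eP xP)
    also have "?ip (e \<circ> (*v) s) x - ?ip e x = ?ip x x"
      unfolding x_def by (intro gip_diff(1)[symmetric] PN_comp eP)
    finally have "x = (\<lambda>_. 0)" using gip_self[OF g xP] by simp
    then show ?thesis by (auto simp: x_def fun_eq_iff)
  qed
  then show "\<exists>e n. e \<in> PN N \<and> (\<forall>s\<in>K. e \<circ> (*v) s = e) \<and> n \<in> nsp K N \<and> f = (\<lambda>v. e v + n v)"
    using n(1) eP by (intro exI[of _ e] exI[of _ n]) (auto simp: e_def)
next
  let ?ip = "gip g N"
  assume f: "f \<in> nsp K N" and fixd: "\<And>s. s \<in> K \<Longrightarrow> f \<circ> (*v) s = f"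
  have fP: "f \<in> PN N" using f nsp_PN by blast
  have "?ip h f = 0" if "h \<in> nsp K N" for h
    using that
  proof induction
    case zero
    then show ?case using gip_scale(1)[OF fP, of g 0 f] by simp
  next
    case (diff h s)
    have "?ip (\<lambda>v. (h \<circ> (*v) s) v - h v) f = ?ip (h \<circ> (*v) s) f - ?ip h f"
      by (intro gip_diff PN_comp diff)
    also have "?ip (h \<circ> (*v) s) f = ?ip h f"
      using gip_star[OF g diff(1) fP, of s] fixd[OF K[OF diff(2)]] by simp
    finally show ?case by (simp add: o_def)
  next
    case (add h h')
    then show ?case using gip_add(1)[of h N h' g f] nsp_PN by auto
  next
    case (scale h c)
    then show ?case using gip_scale(1)[of h N g c f] nsp_PN by auto
  qed
  from this[OF f] show "f = (\<lambda>_. 0)" by (rule gip_self[OF g fP])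
qed

section \<open>Invariants of bounded degree in good position, and generation of the invariant
  algebra\<close>

lemma G_fst_set_invariants: "subgroup G GL \<Longrightarrow> \<gamma> \<in> G \<Longrightarrow> \<gamma> \<in> fst_set (invariants G \<inter> PN N)"
proof -
  assume G: "subgroup G GL" and \<gamma>: "\<gamma> \<in> G"
  have "f \<circ> (*v) \<gamma> = f" "f \<circ> (*v) (matrix_inv \<gamma>) = f" if "f \<in> invariants G" for f
    using that \<gamma> subgroup_GL_D(4)[OF G \<gamma>] by (auto simp: invariants_def)
  then show ?thesis using subgroup_GL_D(1)[OF G \<gamma>] by (auto simp: fst_set_def)
qed

lemma invariants_scalar: "f \<in> invariants G \<Longrightarrow> f \<circ> (*v) (mat c) \<in> invariants G"
proof -
  assume f: "f \<in> invariants G"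
  then obtain N where "f \<in> PN N" using R_PN by (auto simp: invariants_def)
  then have "f \<circ> (*v) (mat c) \<in> carrier poly_ring" using PN_comp PN_R by blast
  moreover have "f \<circ> (*v) (mat c) \<circ> (*v) g = f \<circ> (*v) (mat c)" if "g \<in> G" for g
  proof -
    have "f \<circ> (*v) (mat c) \<circ> (*v) g = f \<circ> (*v) g \<circ> (*v) (mat c)"
      by (simp add: mat_mult_commute flip: comp_matrix_mult)
    also have "f \<circ> (*v) g = f" using f that by (simp add: invariants_def)
    finally show ?thesis .
  qed
  ultimately show ?thesis by (auto simp: invariants_def)
qed

lemma mat_fst_set_invariants: "c \<noteq> 0 \<Longrightarrow> mat c \<in> fst_set (invariants G \<inter> PN N)"
  by (auto simp: fst_set_def invertible_mat matrix_inv_mat invariants_scalar PN_comp)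

lemma good_position_invariants:
  fixes G :: "(complex ^ 'n ^ 'n) set"
  assumes irr: "irreducible_module G" and G: "subgroup G GL"
  obtains g where "good_position (invariants G \<inter> PN N) g"
  using good_position_exists[OF fsubspace_invariants _ irr, of G N] G_fst_set_invariants[OF G]
    mat_fst_set_invariants by blast

text \<open>Closedness under \<open>star g\<close> can be shown for this set, which contains the
  group \<open>G\<close>, when \<open>g\<close> is a good position for the same \<open>N\<close>. It
  therefore takes the role of \<open>G\<close> in \<open>reynolds\<close>.\<close>

definition fixer :: "(complex ^ 'n ^ 'n) set \<Rightarrow> nat \<Rightarrow> (complex ^ 'n ^ 'n) set" where
  "fixer G N = {s. invertible s \<and> (\<forall>f\<in>invariants G \<inter> PN N. f \<circ> (*v) s = f)}"

text \<open>For an invariant \<open>f\<close> of the given degree,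
  \<open>x = f \<circ> star g s - f\<close> is again one, as the stabilizer is closed under
  \<open>star g\<close>. Adjunction and \<open>x \<circ> s = x\<close> give
  \<open><x, x> = 0\<close>.\<close>

lemma fixer_star:
  assumes g: "good_position (invariants G \<inter> PN N) g" and s: "s \<in> fixer G N"
  shows "star g s \<in> fixer G N"
proof -
  let ?A = "invariants G \<inter> PN N" and ?ip = "gip g N"
  have ig: "invertible g" using g by (simp add: good_position_def)
  have inv: "f \<circ> (*v) (matrix_inv s) = f" if "f \<in> ?A" for f
  proof -
    have "f \<circ> (*v) s = f" "invertible s" using s that by (auto simp: fixer_def)
    then show ?thesis using comp_inv_cancel(1)[of s f] by simp
  qed
  then have "s \<in> fst_set ?A" using s by (auto simp: fst_set_def fixer_def)
  from good_position_star[OF g this] have st: "star g s \<in> fst_set ?A" .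
  have "f \<circ> (*v) (star g s) = f" if f: "f \<in> ?A" for f
  proof -
    define y where "y = f \<circ> (*v) (star g s)"
    define x where "x = (\<lambda>v. y v - f v)"
    have yA: "y \<in> ?A" using st f unfolding fst_set_def y_def by blast
    have xA: "x \<in> ?A" unfolding x_def by (intro fsubspaceD(4)[OF fsubspace_invariants] yA f)
    have "?ip x y = ?ip (x \<circ> (*v) s) f"
      unfolding y_def using xA f by (intro gip_star[symmetric] ig) auto
    also have "x \<circ> (*v) s = x" using s xA by (auto simp: fixer_def)
    finally have "?ip x y - ?ip x f = 0" by simp
    moreover have "?ip x (\<lambda>v. y v - f v) = ?ip x y - ?ip x f"
      using yA f by (intro gip_diff(2)) auto
    ultimately have "?ip x x = 0" by (simp add: x_def[symmetric])
    then have "x = (\<lambda>_. 0)" using xA by (intro gip_self[OF ig, of x N]) auto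
    then show ?thesis by (auto simp: x_def y_def fun_eq_iff)
  qed
  then show ?thesis using st by (auto simp: fixer_def fst_set_def)
qed

text \<open>Hilbert's argument: elements of \<open>W\<close> generate the ideal, and the Reynolds operator, killing
  \<open>nsp K\<close>, turns an ideal expression of an invariant into an algebra expression.\<close>

lemma invariants_generated:
  fixes G :: "(complex ^ 'n ^ 'n) set"
  assumes irr: "irreducible_module G" and G: "subgroup G GL"
    and W: "\<And>N. W N \<subseteq> invariants_plus G \<inter> PN (Suc N)"
    and dec: "\<And>N f. f \<in> null_ideal G \<inter> PN (Suc N) \<Longrightarrow> \<exists>w\<in>W N. \<exists>b\<in>Bn G N. f = (\<lambda>v. w v + b v)"
  shows "invariants G \<inter> PN N \<subseteq> gen_algebra (\<Union>N. W N)"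
proof (induction N rule: less_induct)
  case (less N)
  define X where "X = gen_algebra (\<Union>N. W N)"
  obtain g where g: "good_position (invariants G \<inter> PN N) g"
    using good_position_invariants[OF irr G] by blast
  have ig: "invertible g" using g by (simp add: good_position_def)
  define K where "K = fixer G N"
  note K = fixer_star[OF g, folded K_def]
  have GK: "G \<subseteq> K"
    using subgroup_GL_D(1)[OF G] by (auto simp: K_def fixer_def invariants_def)
  \<comment> \<open>The cofactor \<open>r\<close> is carried along to absorb the coordinates that
    are split off from \<open>f\<close> in the induction on its degree.\<close>
  have claim: "\<exists>x\<in>X. \<exists>n\<in>nsp K N. (\<lambda>v. r v * f v) = (\<lambda>v. x v + n v)"
    if "r \<in> PN a" "f \<in> null_ideal G \<inter> PN M" "a + M \<le> N" for r f a M
    using that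
  proof (induction M arbitrary: r f a)
    case 0
    then have "f = (\<lambda>_. 0)" unfolding null_ideal_Dn by simp
    then show ?case unfolding X_def
      by (intro bexI[of _ "\<lambda>_. 0"] gen_algebra.const nsp.zero) simp
  next
    case (Suc M)
    obtain w b where wb: "w \<in> W M" "b \<in> Bn G M" "f = (\<lambda>v. w v + b v)"
      using dec[OF Suc.prems(2)] by blast
    obtain h where h: "\<And>i. h i \<in> null_ideal G \<inter> PN M" "b = (\<lambda>v. \<Sum>i\<in>UNIV. v $ i * h i v)"
      using wb(2) unfolding Bn_def by blast
    have wi: "w \<in> invariants_plus G" "w \<in> PN (Suc M)" using wb(1) W by blast+
    have "\<exists>x\<in>X. \<exists>n\<in>nsp K N. (\<lambda>v. (v $ i * r v) * h i v) = (\<lambda>v. x v + n v)" for i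
      by (rule Suc.IH[OF PN_coord_mult[OF Suc.prems(1)] h(1)]) (use Suc.prems(3) in simp)
    then obtain x n where xn: "\<And>i. x i \<in> X" "\<And>i. n i \<in> nsp K N" "\<And>i. (\<lambda>v. (v $ i * r v) * h i v) = (\<lambda>v. x i v + n i v)"
      by metis
    \<comment> \<open>\<open>e\<close> is the average of the cofactor. Its degree bound
      \<open>a\<close> is strictly below \<open>N\<close>, so the outer induction puts it into
      \<open>X\<close>. The part \<open>m * w\<close> stays in \<open>nsp\<close>, as
      \<open>w\<close> is fixed by \<open>K\<close>.\<close>
    obtain e m where em: "e \<in> PN a" "\<And>s. s \<in> K \<Longrightarrow> e \<circ> (*v) s = e" "m \<in> nsp K a" "r = (\<lambda>v. e v + m v)"
      using reynolds(1)[OF ig K Suc.prems(1)] by blast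
    have "e \<in> invariants G \<inter> PN a"
      using em(1,2) GK PN_R by (auto simp: invariants_def)
    then have eX: "e \<in> X" unfolding X_def using less.IH[of a] Suc.prems(3) by auto
    have wX: "w \<in> X" unfolding X_def using wb(1) by (intro gen_algebra.gen) blast
    have wK: "w (s *v v) = w v" if "s \<in> K" for s v
    proof -
      have "PN (Suc M) \<subseteq> PN N" by (rule PN_mono) (use Suc.prems(3) in simp)
      then have "w \<in> invariants G \<inter> PN N" using wi by (auto simp: invariants_plus_def)
      then have "w \<circ> (*v) s = w" using that by (auto simp: K_def fixer_def)
      then show ?thesis by (auto simp: fun_eq_iff)
    qed
    have mw: "(\<lambda>v. m v * w v) \<in> nsp K N"
      using nsp_mult[OF wi(2) wK em(3)] nsp_mono[of "a + Suc M" N K] Suc.prems(3) by auto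
    have fX: "(\<lambda>v. \<Sum>i\<in>S. x i v) \<in> X" if "finite S" for S
      using that by (induction S rule: finite_induct) (auto simp: X_def xn(1)[unfolded X_def] intro!: gen_algebra.const gen_algebra.add)
    show ?case
    proof (intro bexI)
      show "(\<lambda>v. e v * w v + (\<Sum>i\<in>UNIV. x i v)) \<in> X"
        using eX wX fX[of UNIV] unfolding X_def by (auto intro!: gen_algebra.add gen_algebra.mult)
      show "(\<lambda>v. m v * w v + (\<Sum>i\<in>UNIV. n i v)) \<in> nsp K N"
        by (intro fsubspaceD(2)[OF fsubspace_nsp] mw fsubspace_sum[OF fsubspace_nsp] xn)
      show "(\<lambda>v. r v * f v) = (\<lambda>v. e v * w v + (\<Sum>i\<in>UNIV. x i v) + (m v * w v + (\<Sum>i\<in>UNIV. n i v)))"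
      proof
        fix v
        have "r v * f v = r v * w v + (\<Sum>i\<in>UNIV. (v $ i * r v) * h i v)"
          by (simp add: wb(3) h(2) algebra_simps sum_distrib_left)
        also have "\<dots> = (e v + m v) * w v + (\<Sum>i\<in>UNIV. x i v + n i v)"
          using fun_cong[OF xn(3), of v] by (simp add: em(4))
        finally show "r v * f v = e v * w v + (\<Sum>i\<in>UNIV. x i v) + (m v * w v + (\<Sum>i\<in>UNIV. n i v))"
          by (simp add: algebra_simps sum.distrib)
      qed
    qed
  qed
  have XK: "x \<circ> (*v) s = x" if "x \<in> invariants G \<inter> PN N" "s \<in> K" for x s
    using that by (auto simp: K_def fixer_def)
  have Xinv: "X \<subseteq> invariants G"
  proof
    fix x assume "x \<in> X"
    then show "x \<in> invariants G"
      unfolding X_def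
      by induction (use W in \<open>auto simp: invariants_plus_def intro: invariants_closed\<close>)
  qed
  show ?case
  proof
    fix f assume f: "f \<in> invariants G \<inter> PN N"
    define f0 where "f0 = (\<lambda>v. f v - f 0)"
    have f0: "f0 \<in> invariants G \<inter> PN N"
      unfolding f0_def using fsubspaceD(4)[OF fsubspace_invariants f, of "\<lambda>_. f 0"] by (simp add: invariants_closed PN_const)
    then have "f0 \<in> null_ideal G \<inter> PN N"
      using null_ideal_closed(1)[of G] by (auto simp: invariants_plus_def f0_def)
    then obtain x n where xn: "x \<in> X" "n \<in> nsp K N" "(\<lambda>v. 1 * f0 v) = (\<lambda>v. x v + n v)"
      using claim[of "\<lambda>_. 1" 0 f0 N] PN_const by auto
    have n: "n = (\<lambda>v. f0 v - x v)" using fun_cong[OF xn(3)] by (auto simp: fun_eq_iff)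
    have "x = (\<lambda>v. f0 v - n v)" by (simp add: n)
    then have "x \<in> PN N" using f0 nsp_PN xn(2) by (auto intro: fsubspaceD(4)[OF fsubspace_PN])
    then have "n \<in> invariants G \<inter> PN N"
      unfolding n using f0 xn(1) Xinv by (intro fsubspaceD(4)[OF fsubspace_invariants]) auto
    \<comment> \<open>The remainder is fixed by \<open>K\<close> and lies in
      \<open>nsp\<close>.\<close>
    then have "n = (\<lambda>_. 0)" using XK by (intro reynolds(2)[OF ig K xn(2)]) auto
    then have f0x: "f0 v = x v" for v using fun_cong[OF n, of v] by simp
    define c where "c = f 0"
    have "f = (\<lambda>v. x v + c)"
    proof
      fix v show "f v = x v + c" using f0x[of v] unfolding f0_def c_def by (simp add: diff_eq_eq)
    qed
    moreover have "(\<lambda>v. x v + (\<lambda>_. c) v) \<in> gen_algebra (\<Union>N. W N)"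
      by (rule gen_algebra.add[OF xn(1)[unfolded X_def] gen_algebra.const])
    ultimately show "f \<in> gen_algebra (\<Union>N. W N)" by simp
  qed
qed

text \<open>The complements \<open>W N\<close> are stable under \<open>H\<^sub>0 G\<close>, consist
  of invariants and generate them as an algebra; substitution is an algebra homomorphism.\<close>

lemma invariants_H0_stable:
  fixes G :: "(complex ^ 'n ^ 'n) set"
  assumes irr: "irreducible_module G" and G: "subgroup G GL" and GH: "G \<subseteq> H\<^sub>0 G"
    and h: "h \<in> H\<^sub>0 G" and f: "f \<in> invariants G"
  shows "f \<circ> (*v) h \<in> invariants G"
proof -
  define Q where "Q N W \<longleftrightarrow> W \<subseteq> invariants_plus G \<inter> PN (Suc N) \<and>
    (\<forall>h w. h \<in> H\<^sub>0 G \<longrightarrow> w \<in> W \<longrightarrow> w \<circ> (*v) h \<in> W) \<and>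
    (\<forall>f. f \<in> null_ideal G \<inter> PN (Suc N) \<longrightarrow> (\<exists>w\<in>W. \<exists>b\<in>Bn G N. f = (\<lambda>v. w v + b v)))" for N W
  have "\<exists>W. Q N W" for N
    unfolding Q_def by (rule complement_exists[OF irr GH, of N]) blast
  then obtain W where Q: "\<And>N. Q N (W N)" by metis
  have W: "W N \<subseteq> invariants_plus G \<inter> PN (Suc N)" for N using Q[of N] by (simp add: Q_def)
  have Wst: "w \<circ> (*v) h \<in> W N" if "h \<in> H\<^sub>0 G" "w \<in> W N" for N h w using Q[of N] that by (simp add: Q_def)
  have dec: "\<exists>w\<in>W N. \<exists>b\<in>Bn G N. f = (\<lambda>v. w v + b v)" if "f \<in> null_ideal G \<inter> PN (Suc N)" for N f
    using Q[of N] that by (simp add: Q_def)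
  obtain N where "f \<in> PN N" using f R_PN by (auto simp: invariants_def)
  then have "f \<in> gen_algebra (\<Union>N. W N)" using invariants_generated[OF irr G W dec, of N] f by blast
  then show ?thesis
  proof induction
    case (gen f)
    then obtain N where "f \<in> W N" by blast
    from subsetD[OF W Wst[OF h this]] have "f \<circ> (*v) h \<in> invariants_plus G" by (rule IntD1)
    then show ?case unfolding invariants_plus_def by blast
  next
    case (const c)
    then show ?case using invariants_closed(1)[of c G] by (simp add: o_def)
  next
    case (add f k)
    then show ?case using invariants_closed(2) by (simp add: o_def)
  next
    case (mult f k)
    then show ?case using invariants_closed(3) by (simp add: o_def)
  qed
qed

section \<open>Lie algebras\<close>

text \<open>\<open>has_derivative\<close> is a real notion, so complex homogeneity of the derivative
  is carried through the induction.\<close>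

lemma poly_has_derivative:
  "f \<in> carrier poly_ring \<Longrightarrow> \<exists>D. (\<forall>v. (f has_derivative D v) (at v)) \<and> (\<forall>v c w. D v (c *s w) = c * D v w)"
  unfolding poly_ring_simps
proof (induction rule: gen_algebra.induct)
  case (gen f)
  then obtain i where "f = (\<lambda>v. v $ i)" by auto
  then show ?case
    by (intro exI[of _ "\<lambda>_ w. w $ i"]) (auto intro!: bounded_linear_imp_has_derivative bounded_linear_vec_nth)
next
  case (const c)
  then show ?case by (intro exI[of _ "\<lambda>_ _. 0"]) auto
next
  case (add f h)
  then obtain D E where D: "\<forall>v. (f has_derivative D v) (at v)" "\<forall>v c w. D v (c *s w) = c * D v w"
    and E: "\<forall>v. (h has_derivative E v) (at v)" "\<forall>v c w. E v (c *s w) = c * E v w" by blast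
  show ?case
  proof (intro exI conjI allI)
    show "((\<lambda>v. f v + h v) has_derivative (\<lambda>w. D v w + E v w)) (at v)" for v
      using D E by (intro has_derivative_add) auto
  qed (simp add: D E algebra_simps)
next
  case (mult f h)
  then obtain D E where D: "\<forall>v. (f has_derivative D v) (at v)" "\<forall>v c w. D v (c *s w) = c * D v w"
    and E: "\<forall>v. (h has_derivative E v) (at v)" "\<forall>v c w. E v (c *s w) = c * E v w" by blast
  show ?case
  proof (intro exI conjI allI)
    show "((\<lambda>v. f v * h v) has_derivative (\<lambda>w. f v * E v w + D v w * h v)) (at v)" for v
      using D E by (intro has_derivative_mult) auto
  qed (simp add: D E algebra_simps)
qed

definition Df :: "(complex ^ 'n \<Rightarrow> complex) \<Rightarrow> complex ^ 'n \<Rightarrow> complex ^ 'n \<Rightarrow> complex" where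
  "Df f v = frechet_derivative f (at v)"

lemma Df:
  assumes "f \<in> carrier poly_ring"
  shows "(f has_derivative Df f v) (at v)" "Df f v (c *s w) = c * Df f v w"
    "Df f v (w + w') = Df f v w + Df f v w'"
proof -
  obtain D where D: "\<And>v. (f has_derivative D v) (at v)" "\<And>v c w. D v (c *s w) = c * D v w"
    using poly_has_derivative[OF assms] by metis
  have "Df f v = D v" unfolding Df_def by (rule frechet_derivative_at[OF D(1), symmetric])
  with D show "(f has_derivative Df f v) (at v)" "Df f v (c *s w) = c * Df f v w" by simp_all
  then show "Df f v (w + w') = Df f v w + Df f v w'"
    using has_derivative_linear linear_add by blast
qed

lemma bounded_linear_matrix_vector: "bounded_linear ((*v) (A :: complex ^ 'n ^ 'm))"
proof (rule linear_conv_bounded_linear[THEN iffD1], rule linearI)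
  show "A *v (r *\<^sub>R v) = r *\<^sub>R (A *v v)" for r v
    by (simp add: vec_eq_iff matrix_vector_mult_def scaleR_sum_right)
qed (simp add: matrix_vector_right_distrib)

lemma Df_chain:
  assumes f: "f \<in> carrier poly_ring" and fix_\<tau>: "f \<circ> (*v) \<tau> = f"
  shows "Df f (\<tau> *v v) (\<tau> *v w) = Df f v w"
proof -
  have "(f \<circ> (*v) \<tau> has_derivative Df f (\<tau> *v v) \<circ> (*v) \<tau>) (at v)"
    by (intro diff_chain_at bounded_linear_imp_has_derivative bounded_linear_matrix_vector Df f)
  then have "(f has_derivative Df f (\<tau> *v v) \<circ> (*v) \<tau>) (at v)" by (simp only: fix_\<tau>)
  from has_derivative_unique[OF this Df(1)[OF f]] show ?thesis by (metis comp_apply)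
qed

text \<open>The Lie algebra of the group fixing the invariants of degree at most \<open>N\<close>.\<close>

definition liek :: "(complex ^ 'n ^ 'n) set \<Rightarrow> nat \<Rightarrow> (complex ^ 'n ^ 'n) set" where
  "liek G N = {X. \<forall>f\<in>invariants G \<inter> PN N. \<forall>v. Df f v (X *v v) = 0}"

lemma invariants_R: "invariants G \<subseteq> carrier poly_ring"
  by (auto simp: invariants_def)

lemma scaleR_matrix_vector: "(r *\<^sub>R A) *v v = complex_of_real r *s (A *v v)"
  by (simp add: vec_eq_iff matrix_vector_mult_def sum_distrib_left) (simp only: scaleR_conv_of_real, simp)

lemma liek_closed:
  "0 \<in> liek G N" "X \<in> liek G N \<Longrightarrow> Y \<in> liek G N \<Longrightarrow> X + Y \<in> liek G N"
  "X \<in> liek G N \<Longrightarrow> r *\<^sub>R X \<in> liek G N" "X \<in> liek G N \<Longrightarrow> Y \<in> liek G N \<Longrightarrow> X - Y \<in> liek G N"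
proof -
  note D = Df(2,3)[OF subsetD[OF invariants_R]]
  have z: "Df f v 0 = 0" if "f \<in> invariants G" for f v
    using D(1)[OF that, of v 0 0] by simp
  show "0 \<in> liek G N" using z by (simp add: liek_def matrix_vector_mult_0)
  show add: "X + Y \<in> liek G N" if "X \<in> liek G N" "Y \<in> liek G N" for X Y
    using that by (auto simp: liek_def matrix_vector_mult_add_rdistrib D)
  show scale: "r *\<^sub>R X \<in> liek G N" if "X \<in> liek G N" for r X
    using that by (auto simp: liek_def scaleR_matrix_vector D)
  show "X \<in> liek G N \<Longrightarrow> Y \<in> liek G N \<Longrightarrow> X - Y \<in> liek G N"
    using add[of X "(-1) *\<^sub>R Y"] scale[of Y "-1"] by simp
qed

lemma liek_subspace: "subspace (liek G N)"
  by (rule real_vector.subspaceI) (auto intro: liek_closed)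

lemma liek_antimono: "N \<le> M \<Longrightarrow> liek G M \<subseteq> liek G N"
  using PN_mono[of N M] by (auto simp: liek_def)

text \<open>The spaces decrease with \<open>N\<close>, so one of least dimension lies in all others.
  This takes the place of a finite set of generators of the invariants.\<close>

lemma liek_stabilizes:
  fixes G :: "(complex ^ 'n ^ 'n) set"
  obtains N where "\<And>M. liek G N \<subseteq> liek G M"
proof -
  obtain N where N: "\<And>M. dim (liek G N) \<le> dim (liek G M)"
    using ex_has_least_nat[of "\<lambda>_. True" 0 "\<lambda>N. dim (liek G N)"] by auto
  have "liek G N \<subseteq> liek G M" for M
  proof -
    have "liek G (max N M) = liek G N"
      using N by (intro subspace_dim_equal liek_subspace liek_antimono) auto
    then show ?thesis using liek_antimono[of M "max N M" G] by simp
  qed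
  with that show ?thesis by blast
qed

text \<open>By the chain rule, as for the adjoint action of a group on its Lie algebra.\<close>

lemma liek_fixer:
  assumes X: "X \<in> liek G N" and \<tau>: "\<tau> \<in> fixer G N"
  shows "\<tau> ** X ** matrix_inv \<tau> \<in> liek G N"
proof -
  have it: "invertible \<tau>" using \<tau> by (simp add: fixer_def)
  have "Df f v ((\<tau> ** X ** matrix_inv \<tau>) *v v) = 0" if f: "f \<in> invariants G \<inter> PN N" for f v
  proof -
    define w where "w = matrix_inv \<tau> *v v"
    have v: "v = \<tau> *v w" by (simp add: w_def matrix_vector_mul_assoc matrix_inv_inverse it)
    have "(\<tau> ** X ** matrix_inv \<tau>) *v v = \<tau> *v (X *v w)"
      by (simp add: w_def matrix_vector_mul_assoc matrix_mul_assoc)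
    then have "Df f v ((\<tau> ** X ** matrix_inv \<tau>) *v v) = Df f (\<tau> *v w) (\<tau> *v (X *v w))" by (simp add: v)
    also have "\<dots> = Df f w (X *v w)"
      using f \<tau> by (intro Df_chain) (auto simp: fixer_def invariants_def)
    also have "\<dots> = 0" using X f by (auto simp: liek_def)
    finally show ?thesis .
  qed
  then show ?thesis by (auto simp: liek_def)
qed

text \<open>The Euclidean inner product of the type is the real part of the trace form, so
  orthogonal projections of real subspaces are compatible with \<open>adj\<close>.\<close>

lemma inner_matrix: "inner A B = Re (trace (A ** adj B))" for A B :: "complex ^ 'n ^ 'n"
  by (simp add: inner_vec_def inner_complex_def trace_def matrix_matrix_mult_def adj_def)

lemma inner_conj:
  fixes A X B Y :: "complex ^ 'n ^ 'n"
  shows "inner (A ** X ** B) Y = inner X (adj A ** Y ** adj B)"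
proof -
  have "trace (A ** X ** B ** adj Y) = trace (X ** (B ** adj Y ** A))"
    by (metis matrix_mul_assoc trace_mul_sym)
  then show ?thesis by (simp add: inner_matrix adj_mult matrix_mul_assoc)
qed

section \<open>Exponential paths with diagonalizable generator\<close>

lemma poly_curve_derivative:
  assumes f: "f \<in> carrier poly_ring" and p: "(p has_vector_derivative p') (at t)"
  shows "((\<lambda>t. f (p t)) has_vector_derivative Df f (p t) p') (at t)"
proof -
  have "(f \<circ> p has_derivative Df f (p t) \<circ> (\<lambda>h. h *\<^sub>R p')) (at t)"
    using p Df(1)[OF f] unfolding has_vector_derivative_def by (rule diff_chain_at)
  moreover have "Df f (p t) (h *\<^sub>R p') = h *\<^sub>R Df f (p t) p'" for h
    using has_derivative_linear[OF Df(1)[OF f]] linear_scale by blast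
  ultimately show ?thesis unfolding has_vector_derivative_def by (simp add: o_def)
qed

text \<open>The exponential of \<open>z\<close> times the diagonalizable matrix
  \<open>cj P (diagm x)\<close>.\<close>

definition epath :: "complex ^ 'n ^ 'n \<Rightarrow> ('n \<Rightarrow> complex) \<Rightarrow> complex \<Rightarrow> complex ^ 'n ^ 'n" where
  "epath P x z = cj P (diagm (\<lambda>i. exp (z * x i)))"

lemma epath_0: "invertible P \<Longrightarrow> epath P x 0 = mat 1"
  by (simp add: epath_def cj_def matrix_inv_inverse flip: mat_eq_diagm)

lemma epath_vec: "epath P x z *v v = (\<Sum>i\<in>UNIV. (exp (z * x i) * (matrix_inv P *v v) $ i) *s column i P)"
proof -
  have "epath P x z *v v = P *v (diagm (\<lambda>i. exp (z * x i)) *v (matrix_inv P *v v))"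
    by (simp add: epath_def cj_def matrix_vector_mul_assoc matrix_mul_assoc)
  then show ?thesis by (simp add: matrix_mult_sum[of P] diagm_vec)
qed

lemma bounded_linear_smult_vec: "bounded_linear (\<lambda>c. c *s (w :: complex ^ 'n))"
proof (rule linear_conv_bounded_linear[THEN iffD1], rule linearI)
  show "(r *\<^sub>R c) *s w = r *\<^sub>R (c *s w)" for r c
    by (simp add: vec_eq_iff)
qed (simp add: vec.scale_left_distrib)

lemma epath_derivative:
  assumes P: "invertible P"
  shows "((\<lambda>t. epath P x (of_real t * z) *v v) has_vector_derivative
    z *s (cj P (diagm x) *v (epath P x (of_real t * z) *v v))) (at t)"
proof -
  define c where "c = matrix_inv P *v v"
  have "((\<lambda>t. exp (of_real t * z * x i) * c $ i) has_vector_derivative (exp (of_real t * z * x i) * (z * x i)) * c $ i) (at t)" for i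
  proof -
    have "((\<lambda>s. exp (s * z * x i) * c $ i) has_field_derivative (exp (of_real t * z * x i) * (z * x i)) * c $ i) (at (of_real t))"
      by (auto intro!: derivative_eq_intros)
    from has_vector_derivative_real_field[OF this] show ?thesis by simp
  qed
  from bounded_linear.has_vector_derivative[OF bounded_linear_smult_vec this]
  have "((\<lambda>t. \<Sum>i\<in>UNIV. (exp (of_real t * z * x i) * c $ i) *s column i P) has_vector_derivative
      (\<Sum>i\<in>UNIV. ((exp (of_real t * z * x i) * (z * x i)) * c $ i) *s column i P)) (at t)"
    by (intro has_vector_derivative_sum) auto
  moreover have "(\<Sum>i\<in>UNIV. ((exp (of_real t * z * x i) * (z * x i)) * c $ i) *s column i P)
     = z *s (cj P (diagm x) *v (epath P x (of_real t * z) *v v))"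
  proof -
    have "cj P (diagm x) *v (epath P x (of_real t * z) *v v)
       = P *v (diagm x *v (diagm (\<lambda>i. exp (of_real t * z * x i)) *v c))"
      by (simp add: epath_def cj_def c_def inverse_cancel[OF P] matrix_vector_mul_assoc flip: matrix_mul_assoc)
    also have "\<dots> = (\<Sum>i\<in>UNIV. (x i * (exp (of_real t * z * x i) * c $ i)) *s column i P)"
      by (simp add: matrix_mult_sum[of P] diagm_vec)
    finally show ?thesis
      by (simp add: vec.scale_sum_right vec.scale_scale mult_ac)
  qed
  ultimately show ?thesis unfolding epath_vec c_def by simp
qed

text \<open>Along the real path from the identity to \<open>epath P x z\<close>, the velocity at a
  point \<open>u\<close> is \<open>z\<close> times the generator applied to \<open>u\<close>. So the
  derivative of \<open>f\<close> vanishes by \<open>X\<close> and complex homogeneity.\<close>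

lemma epath_fixes:
  assumes P: "invertible P" and f: "f \<in> carrier poly_ring"
    and X: "\<And>v. Df f v (cj P (diagm x) *v v) = 0"
  shows "f \<circ> (*v) (epath P x z) = f"
proof
  fix v
  define p where "p t = f (epath P x (of_real t * z) *v v)" for t
  have "(p has_vector_derivative 0) (at t)" for t
  proof -
    have "(p has_vector_derivative Df f (epath P x (of_real t * z) *v v)
        (z *s (cj P (diagm x) *v (epath P x (of_real t * z) *v v)))) (at t)"
      unfolding p_def by (rule poly_curve_derivative[OF f epath_derivative[OF P]])
    then show ?thesis by (simp add: Df(2)[OF f] X)
  qed
  then have "\<And>t. (p has_derivative (\<lambda>h. 0)) (at t within UNIV)"
    by (simp add: has_vector_derivative_def)
  then obtain c where "\<And>t. p t = c" using has_derivative_zero_constant[of UNIV p] by auto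
  then have "p 1 = p 0" by simp
  then show "(f \<circ> (*v) (epath P x z)) v = f v" by (simp add: p_def epath_0[OF P])
qed

lemma scaleR_matrix_mult:
  "(r *\<^sub>R A) ** B = r *\<^sub>R (A ** B)" "A ** (r *\<^sub>R B) = r *\<^sub>R (A ** B)" for A B :: "complex ^ 'n ^ 'n"
  by (simp_all add: vec_eq_iff matrix_matrix_mult_def scaleR_sum_right)

lemma cj_linear:
  "cj g (A + B) = cj g A + cj g B" "cj g (A - B) = cj g A - cj g B" "cj g (r *\<^sub>R A) = r *\<^sub>R cj g A" "cj g 0 = 0"
  by (simp_all add: cj_def matrix_add_ldistrib matrix_add_rdistrib matrix_diff_ldistrib matrix_diff_rdistrib scaleR_matrix_mult)

lemma cj_mat: "invertible g \<Longrightarrow> cj g (mat c) = mat c"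
  unfolding cj_def mat_mult_commute[of c g, symmetric] by (simp add: matrix_inv_inverse flip: matrix_mul_assoc)

lemma cj_cj: "invertible g \<Longrightarrow> invertible u \<Longrightarrow> cj (g ** u) s = cj g (cj u s)"
  by (simp add: cj_def matrix_inv_mult matrix_mul_assoc)

text \<open>With respect to the invariant inner product, the orthogonal complement of the Lie algebra of
  the fixer inside that of the stabilizer is a trivial \<open>G\<close>-module, hence scalar by Schur.\<close>

lemma stabilizer_lie_scalar:
  fixes G :: "(complex ^ 'n ^ 'n) set"
  assumes irr: "irreducible_module G" and G: "subgroup G GL"
    and g: "good_position (invariants G \<inter> PN N) g" and P: "invertible P"
    and st: "\<And>t. epath P y (of_real t) \<in> fst_set (invariants G \<inter> PN N)"
  obtains c where "cj P (diagm y) - mat c \<in> liek G N"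
proof -
  let ?A = "invariants G \<inter> PN N"
  have ig: "invertible g" using g by (simp add: good_position_def)
  define Y where "Y = cj P (diagm y)"
  \<comment> \<open>The Lie algebra is transported to the frame in which the stabilizer is closed
    under \<open>adj\<close>, so that the standard inner product can be used.\<close>
  define L where "L = {X. cj g X \<in> liek G N}"
  have L: "subspace L"
    by (rule real_vector.subspaceI) (auto simp: L_def cj_linear intro: liek_closed)
  obtain X M where "X \<in> span L" "\<forall>w\<in>span L. real_inner_class.orthogonal M w" "cj (matrix_inv g) Y = X + M"
    by (rule orthogonal_subspace_decomp_exists[of L "cj (matrix_inv g) Y"]) blast
  moreover have "span L = L" using L by (rule span_eq_iff[THEN iffD2])
  ultimately have XM: "X \<in> L" "\<And>Z. Z \<in> L \<Longrightarrow> inner M Z = 0" "cj (matrix_inv g) Y = X + M"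
    by (simp_all add: real_inner_class.orthogonal_def)
  have comm: "\<gamma> ** cj g M = cj g M ** \<gamma>" if \<gamma>: "\<gamma> \<in> G" for \<gamma>
  proof -
    have i\<gamma>: "invertible \<gamma>" by (rule subgroup_GL_D(1)[OF G \<gamma>])
    have \<gamma>K: "\<gamma> \<in> fixer G N" using \<gamma> i\<gamma> by (auto simp: fixer_def invariants_def)
    define \<delta> where "\<delta> = cj (matrix_inv g) \<gamma>"
    have i\<delta>: "invertible \<delta>" unfolding \<delta>_def by (intro invertible_cj matrix_inv_inverse ig i\<gamma>)
    have c\<delta>: "cj g \<delta> = \<gamma>" by (simp add: \<delta>_def cj_cj_inv ig)
    have cc: "cj g (cj \<delta> Z) = cj \<gamma> (cj g Z)" for Z
      unfolding cj_def[of \<delta>] cj_def[of \<gamma>] by (simp add: cj_mult ig c\<delta> flip: cj_inv[OF ig i\<delta>])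
    \<comment> \<open>Composing an invariant with the path generated by \<open>Y\<close> gives an
      invariant. Hence \<open>Y\<close> and its conjugate by \<open>\<gamma>\<close> differentiate
      the invariants of degree at most \<open>N\<close> in the same way.\<close>
    have Y\<gamma>: "cj \<gamma> Y - Y \<in> liek G N"
    proof -
      have "Df f v ((cj \<gamma> Y - Y) *v v) = 0" if f: "f \<in> ?A" for f v
      proof -
        have fR: "f \<in> carrier poly_ring" using f invariants_R by blast
        define w where "w = matrix_inv \<gamma> *v v"
        have v: "v = \<gamma> *v w" by (simp add: w_def matrix_vector_mul_assoc matrix_inv_inverse i\<gamma>)
        have f\<gamma>: "f \<circ> (*v) \<gamma> = f" using f \<gamma> by (auto simp: invariants_def)
        have der: "((\<lambda>t. f (epath P y (of_real t) *v u)) has_vector_derivative Df f u (Y *v u)) (at 0)" for u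
        proof -
          have "((\<lambda>t. f (epath P y (of_real t * 1) *v u)) has_vector_derivative Df f (epath P y (of_real 0 * 1) *v u)
              (1 *s (cj P (diagm y) *v (epath P y (of_real 0 * 1) *v u)))) (at 0)"
            by (rule poly_curve_derivative[OF fR epath_derivative[OF P]])
          then show ?thesis by (simp add: epath_0[OF P] Y_def)
        qed
        have "f (epath P y (of_real t) *v v) = f (epath P y (of_real t) *v w)" for t
        proof -
          have "f \<circ> (*v) (epath P y (of_real t)) \<in> invariants G" using st[of t] f by (auto simp: fst_set_def)
          then have "f \<circ> (*v) (epath P y (of_real t)) \<circ> (*v) \<gamma> = f \<circ> (*v) (epath P y (of_real t))"
            using \<gamma> by (auto simp: invariants_def)
          from fun_cong[OF this, of w] show ?thesis by (simp add: v)
        qed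
        then have "Df f v (Y *v v) = Df f w (Y *v w)"
          using vector_derivative_unique_at[OF der[of v]] der[of w] by simp
        moreover have "Df f v (cj \<gamma> Y *v v) = Df f w (Y *v w)"
        proof -
          have "cj \<gamma> Y *v v = \<gamma> *v (Y *v w)"
            by (simp add: w_def cj_def matrix_vector_mul_assoc matrix_mul_assoc)
          then show ?thesis using Df_chain[OF fR f\<gamma>, of w "Y *v w"] by (simp add: v)
        qed
        moreover have "Df f v (a - b) = Df f v a - Df f v b" for a b
          using Df(3)[OF fR, of v "a - b" b] by simp
        ultimately show ?thesis by (simp add: matrix_vector_mult_diff_rdistrib)
      qed
      then show ?thesis by (auto simp: liek_def)
    qed
    \<comment> \<open>\<open>D\<close> lies in \<open>L\<close>, and the adjoint of conjugation by
      \<open>\<delta>\<close> preserves \<open>L\<close> because \<open>star g \<gamma>\<close> is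
      in the fixer. So \<open>D\<close> is orthogonal to both \<open>cj \<delta> M\<close> and
      \<open>M\<close>, and therefore to itself.\<close>
    define D where "D = cj \<delta> M - M"
    have "cj g D = (cj \<gamma> Y - Y) - (cj \<gamma> (cj g X) - cj g X)"
    proof -
      have "cj g M = Y - cj g X"
        using arg_cong[OF XM(3), of "cj g"] by (simp add: cj_cj_inv ig cj_linear)
      then show ?thesis by (simp add: D_def cj_linear cc)
    qed
    then have DL: "D \<in> L"
      using Y\<gamma> liek_fixer[OF _ \<gamma>K] XM(1) unfolding L_def cj_def[of \<gamma>] by (auto intro!: liek_closed)
    have "inner (cj \<delta> M) D = inner M (adj \<delta> ** D ** adj (matrix_inv \<delta>))"
      unfolding cj_def by (rule inner_conj)
    also have "adj (matrix_inv \<delta>) = matrix_inv (adj \<delta>)"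
      by (intro matrix_inv_unique[symmetric])
         (simp add: adj_mult[symmetric] matrix_inv_inverse i\<delta>)
    also have "adj \<delta> ** D ** matrix_inv (adj \<delta>) \<in> L"
    proof -
      have sf: "star g \<gamma> \<in> fixer G N" by (rule fixer_star[OF g \<gamma>K])
      have sg: "star g \<gamma> = cj g (adj \<delta>)" by (simp add: star_def \<delta>_def)
      have ia: "invertible (adj \<delta>)"
        using i\<delta> det_adj[of \<delta>] by (simp add: invertible_det_nz)
      have "cj g (adj \<delta> ** D ** matrix_inv (adj \<delta>)) = star g \<gamma> ** cj g D ** matrix_inv (star g \<gamma>)"
        by (simp add: sg cj_mult ig cj_inv ia)
      then show ?thesis using liek_fixer[OF _ sf] DL by (simp add: L_def)
    qed
    then have "inner M (adj \<delta> ** D ** matrix_inv (adj \<delta>)) = 0" by (rule XM(2))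
    finally have "inner (cj \<delta> M) D = 0" .
    moreover have "inner M D = 0" using XM(2)[OF DL] .
    ultimately have "inner D D = 0" by (simp add: D_def inner_diff_left)
    then have "cj \<delta> M = M" by (simp add: D_def)
    then have "cj \<gamma> (cj g M) = cj g M" using cc[of M] by simp
    then have "\<gamma> ** cj g M ** matrix_inv \<gamma> ** \<gamma> = cj g M ** \<gamma>" by (simp add: cj_def[of \<gamma>])
    then show ?thesis by (simp add: matrix_inv_inverse i\<gamma> flip: matrix_mul_assoc)
  qed
  obtain c where c: "cj g M = mat c"
    using schur_scalar[OF irr, of "cj g M"] comm by blast
  have "Y - mat c = cj g X"
    using arg_cong[OF XM(3), of "cj g"] by (simp add: cj_cj_inv ig cj_linear c)
  then have "cj P (diagm y) - mat c \<in> liek G N" using XM(1) by (simp add: L_def Y_def)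
  then show ?thesis by (rule that)
qed

text \<open>Scalars times exponentials of diagonalizable elements of \<open>liek G N\<close>.
  Closure under products is not claimed here; it enters through the group containing this set in
  \<open>expset_subset\<close>.\<close>

definition expset :: "(complex ^ 'n ^ 'n) set \<Rightarrow> nat \<Rightarrow> (complex ^ 'n ^ 'n) set" where
  "expset G N = {s. \<exists>c P x. c \<noteq> 0 \<and> invertible P \<and> cj P (diagm x) \<in> liek G N \<and> s = mat c ** epath P x 1}"

lemma epath_in_expset:
  fixes G :: "(complex ^ 'n ^ 'n) set"
  assumes irr: "irreducible_module G" and G: "subgroup G GL"
    and g: "good_position (invariants G \<inter> PN N) g" and P: "invertible P"
    and st: "\<And>t. epath P y (of_real t) \<in> fst_set (invariants G \<inter> PN N)"
  shows "epath P y 1 \<in> expset G N"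
proof -
  obtain c where c: "cj P (diagm y) - mat c \<in> liek G N"
    by (rule stabilizer_lie_scalar[OF irr G g P st])
  have "diagm (\<lambda>i. y i - c) = diagm y - mat c" by (auto simp: vec_eq_iff diagm_def mat_def)
  then have 1: "cj P (diagm (\<lambda>i. y i - c)) \<in> liek G N" using c by (simp add: cj_linear cj_mat P)
  have "diagm (\<lambda>i. exp (y i)) = mat (exp c) ** diagm (\<lambda>i. exp (y i - c))"
    by (simp add: mat_eq_diagm diagm_mult flip: exp_add)
  then have "epath P y 1 = mat (exp c) ** epath P (\<lambda>i. y i - c) 1"
    by (simp add: epath_def cj_mult P cj_mat)
  then show ?thesis unfolding expset_def using 1 P by (intro CollectI exI[of _ "exp c"] exI[of _ P] exI[of _ "\<lambda>i. y i - c"]) auto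
qed

section \<open>Polar decomposition of the stabilizer\<close>

text \<open>A subspace preserved by a diagonal operator is preserved by its polynomials, and
  Lagrange interpolation makes every function of its finitely many eigenvalues such a
  polynomial.\<close>

lemma diag_functional_calculus:
  fixes m :: "'i \<Rightarrow> complex"
  assumes X: "finite X" and A: "fsub X A" and st: "\<And>T. T \<in> A \<Longrightarrow> (\<lambda>I. m I * T I) \<in> A" and T: "T \<in> A"
  shows "(\<lambda>I. h (m I) * T I) \<in> A"
proof -
  have pol: "(\<lambda>I. poly p (m I) * T I) \<in> A" for p
  proof (induction p)
    case 0
    then show ?case using fsubD(1)[OF A] by simp
  next
    case (pCons a p)
    have "(\<lambda>I. a * T I + m I * (poly p (m I) * T I)) \<in> A"
      by (intro fsubD(2)[OF A] fsubD(3)[OF A] T st[OF pCons(2)])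
    then show ?case by (simp add: algebra_simps)
  qed
  define V where "V = m ` X"
  have V: "finite V" using X by (simp add: V_def)
  define q where "q = (\<Sum>c\<in>V. Polynomial.smult (h c / (\<Prod>d\<in>V - {c}. c - d)) (\<Prod>d\<in>V - {c}. [:- d, 1:]))"
  have "poly q v = h v" if v: "v \<in> V" for v
  proof -
    have "poly q v = (\<Sum>c\<in>V. h c / (\<Prod>d\<in>V - {c}. c - d) * (\<Prod>d\<in>V - {c}. v - d))"
      by (simp add: q_def poly_sum poly_prod)
    also have "\<dots> = (\<Sum>c\<in>V. if c = v then h v else 0)"
    proof (intro sum.cong refl)
      fix c assume "c \<in> V"
      show "h c / (\<Prod>d\<in>V - {c}. c - d) * (\<Prod>d\<in>V - {c}. v - d) = (if c = v then h v else 0)"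
      proof (cases "c = v")
        case True
        have "(\<Prod>d\<in>V - {v}. v - d) \<noteq> 0" using V by auto
        then show ?thesis using True by simp
      next
        case False
        then have "(\<Prod>d\<in>V - {c}. v - d) = 0" using V v by (intro prod_zero bexI[of _ v]) auto
        then show ?thesis using False by simp
      qed
    qed
    finally show ?thesis using V v by simp
  qed
  then have "poly q (m I) * T I = h (m I) * T I" for I
    using fsubD(4)[OF A T, of I] by (cases "I \<in> X") (auto simp: V_def)
  with pol[of q] show ?thesis by simp
qed

lemma wt_exp: "wt (\<lambda>i. exp (c * complex_of_real (\<theta> i))) I =
    exp (c * of_real (sum_list (map (\<lambda>a. case a of None \<Rightarrow> 0 | Some i \<Rightarrow> \<theta> i) I)))"
  unfolding wt_def by (induction I) (auto split: option.splits simp: exp_add distrib_left)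

text \<open>A weight adds up at most \<open>N\<close> of the angles, so the bound
  \<open>pi / (N + 1)\<close> keeps its argument below \<open>pi\<close>. Then \<open>Ln\<close>
  recovers the sum of the angles, which makes the power \<open>t\<close> a function of the
  eigenvalue and \<open>diag_functional_calculus\<close> applicable.\<close>

lemma diag_power_stable:
  fixes A :: "(complex ^ 'n \<Rightarrow> complex) set"
  assumes A: "fsubspace A" "A \<subseteq> PN N"
    and \<theta>: "\<And>i. \<bar>\<theta> i\<bar> < pi / real (Suc N)"
    and st: "\<And>f. f \<in> A \<Longrightarrow> f \<circ> (*v) (diagm (\<lambda>i. exp (\<i> * of_real (\<theta> i)))) \<in> A" and f: "f \<in> A"
  shows "f \<circ> (*v) (diagm (\<lambda>i. exp (of_real t * (\<i> * of_real (\<theta> i))))) \<in> A"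
proof -
  define s where "s I = sum_list (map (\<lambda>a. case a of None \<Rightarrow> 0 | Some i \<Rightarrow> \<theta> i) I)" for I :: "'n option list"
  define m where "m I = (if I \<in> LL N then wt (\<lambda>i. exp (\<i> * complex_of_real (\<theta> i))) I else 0)" for I
  have s: "\<bar>s I\<bar> \<le> real (length I) * (pi / real (Suc N))" for I
  proof (induction I)
    case (Cons a I)
    have "\<bar>case a of None \<Rightarrow> 0 | Some i \<Rightarrow> \<theta> i\<bar> \<le> pi / real (Suc N)"
      using \<theta> by (auto split: option.splits intro: less_imp_le)
    then show ?case using Cons by (simp add: s_def algebra_simps add_divide_distrib)
  qed (simp add: s_def)
  have sLL: "\<bar>s I\<bar> < pi" if "I \<in> LL N" for I
  proof -
    have "real N * (pi / real (Suc N)) < pi" by (simp add: field_simps)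
    with s[of I] that show ?thesis by (simp add: LL_def)
  qed
  have mI: "m I = exp (\<i> * of_real (s I))" if "I \<in> LL N" for I
    using that by (simp add: m_def wt_exp s_def)
  have stT: "(\<lambda>I. m I * T I) \<in> TS N A" if T: "T \<in> TS N A" for T
  proof -
    have "(\<lambda>I. m I * T I) = act N (diagm (\<lambda>i. exp (\<i> * complex_of_real (\<theta> i)))) T"
      by (auto simp: fun_eq_iff act_diagm m_def)
    then show ?thesis using T st by (simp add: TS_def SN_act evalt_act)
  qed
  have fN: "f \<in> PN N" using f A by blast
  have T: "lift N f \<in> TS N A" using f lift[OF fN] by (simp add: TS_def)
  have "(\<lambda>I. exp (of_real t * Ln (m I)) * lift N f I) \<in> TS N A"
    by (rule diag_functional_calculus[OF finite_LL fsub_TS[OF A(1)] stT T])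
  also have "(\<lambda>I. exp (of_real t * Ln (m I)) * lift N f I) = act N (diagm (\<lambda>i. exp (of_real t * (\<i> * of_real (\<theta> i))))) (lift N f)"
  proof
    fix I
    show "exp (of_real t * Ln (m I)) * lift N f I = act N (diagm (\<lambda>i. exp (of_real t * (\<i> * of_real (\<theta> i))))) (lift N f) I"
    proof (cases "I \<in> LL N")
      case True
      have "Ln (m I) = \<i> * of_real (s I)"
        unfolding mI[OF True] using sLL[OF True] by (intro Ln_exp) auto
      then show ?thesis
        using True wt_exp[of "of_real t * \<i>" \<theta> I] by (simp add: act_diagm s_def mult.assoc)
    next
      case False
      then show ?thesis using lift(1)[OF fN] by (simp add: act_diagm SN_def)
    qed
  qed
  finally have "evalt N (act N (diagm (\<lambda>i. exp (of_real t * (\<i> * of_real (\<theta> i))))) (lift N f)) \<in> A"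
    by (simp add: TS_def)
  then show ?thesis by (simp add: evalt_act lift(2)[OF fN])
qed

lemma entry_le_norm: "cmod (A $ i $ j) \<le> norm (A :: complex ^ 'n ^ 'm)"
  using Finite_Cartesian_Product.norm_nth_le[of "A $ i" j] Finite_Cartesian_Product.norm_nth_le[of A i] by simp

lemma epath_inv: "invertible P \<Longrightarrow> matrix_inv (epath P y z) = epath P y (- z)"
proof (rule matrix_inv_unique)
  assume P: "invertible P"
  have "diagm (\<lambda>i. exp (z * y i)) ** diagm (\<lambda>i. exp (- z * y i)) = mat 1"
    by (simp add: diagm_mult mat_eq_diagm flip: exp_add)
  then show "epath P y z ** epath P y (- z) = mat 1"
    by (simp add: epath_def cj_mat P flip: cj_mult)
qed

lemma invertible_diagm: "(\<And>i. d i \<noteq> 0) \<Longrightarrow> invertible (diagm d)"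
  by (simp add: invertible_det_nz det_diagm)

lemma invertible_epath: "invertible P \<Longrightarrow> invertible (epath P y z)"
  unfolding epath_def by (intro invertible_cj invertible_diagm) auto

lemma epath_comp_conj:
  assumes g: "invertible g" and u: "unitary u"
  shows "epath (g ** u) y z = cj g (u ** diagm (\<lambda>i. exp (z * y i)) ** adj u)"
  unfolding epath_def by (subst cj_cj[OF g unitary_invertible[OF u]]) (simp add: cj_def[of u] matrix_inv_unitary u)

text \<open>Near 1 the eigenvalues of a unitary matrix have small angles. Then
  \<open>diag_power_stable\<close> puts a whole one-parameter group through the matrix into the
  stabilizer, as \<open>epath_in_expset\<close> requires.\<close>

lemma unitary_near_1_in_expset:
  fixes G :: "(complex ^ 'n ^ 'n) set"
  assumes irr: "irreducible_module G" and G: "subgroup G GL"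
    and g: "good_position (invariants G \<inter> PN N) g"
  obtains r where "r > 0" "\<And>w. unitary w \<Longrightarrow> cj g w \<in> fst_set (invariants G \<inter> PN N) \<Longrightarrow> norm (w - mat 1) < r \<Longrightarrow> cj g w \<in> expset G N"
proof -
  let ?A = "invariants G \<inter> PN N"
  have ig: "invertible g" using g by (simp add: good_position_def)
  have "isCont (\<lambda>z. Im (Ln z)) 1" by (intro isCont_Im continuous_at_Ln) (auto simp: complex_nonpos_Reals_iff)
  moreover have "0 < pi / real (Suc N)" by simp
  ultimately obtain r where r: "r > 0" "\<And>\<mu>. dist \<mu> 1 < r \<Longrightarrow> dist (Im (Ln \<mu>)) (Im (Ln 1)) < pi / real (Suc N)"
    unfolding continuous_at_eps_delta by blast
  show ?thesis
  proof (rule that[OF r(1)])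
    fix w :: "complex ^ 'n ^ 'n"
    assume w: "unitary w" "cj g w \<in> fst_set ?A" "norm (w - mat 1) < r"
    have "adj w ** w = w ** adj w" using unitaryD[OF w(1)] by simp
    then obtain u \<mu> where u: "unitary u" and weq: "w = u ** diagm \<mu> ** adj u"
      using spectral_normal by metis
    have D: "diagm \<mu> = adj u ** w ** u"
      using u by (simp add: weq unitary_cancel unitaryD flip: matrix_mul_assoc)
    have "unitary (diagm \<mu>)" unfolding D by (intro unitary_mult unitary_adj u w)
    then have "diagm (\<lambda>i. cnj (\<mu> i) * \<mu> i) = mat 1" by (simp add: unitary_def adj_diagm diagm_mult)
    then have "diagm (\<lambda>i. cnj (\<mu> i) * \<mu> i) $ i $ i = mat 1 $ i $ i" for i by simp
    then have cc: "cnj (\<mu> i) * \<mu> i = 1" for i by (simp add: diagm_def mat_def)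
    have \<mu>1: "cmod (\<mu> i) = 1" for i
    proof -
      have "cmod (cnj (\<mu> i)) * cmod (\<mu> i) = cmod 1" by (simp only: cc flip: norm_mult)
      then have "(cmod (\<mu> i))\<^sup>2 = 1" by (simp add: power2_eq_square)
      then show ?thesis by (metis abs_norm_cancel abs_square_eq_1)
    qed
    define \<theta> where "\<theta> i = Im (Ln (\<mu> i))" for i
    have \<mu>: "\<mu> i = exp (\<i> * of_real (\<theta> i))" for i
    proof -
      have nz: "\<mu> i \<noteq> 0" using \<mu>1[of i] by auto
      have "Ln (\<mu> i) = \<i> * of_real (\<theta> i)"
        using nz \<mu>1[of i] by (intro complex_eqI) (simp_all add: \<theta>_def)
      then show ?thesis using exp_Ln[OF nz] by simp
    qed
    have \<theta>: "\<bar>\<theta> i\<bar> < pi / real (Suc N)" for i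
    proof -
      have "cmod (\<mu> i - 1) \<le> norm (diagm \<mu> - mat 1)"
        using entry_le_norm[of "diagm \<mu> - mat 1" i i] by (simp add: diagm_def mat_def)
      also have "diagm \<mu> - mat 1 = adj u ** (w - mat 1) ** u"
        by (simp add: D matrix_diff_ldistrib matrix_diff_rdistrib unitaryD[OF u])
      also have "norm \<dots> = norm (w - mat 1)"
        by (simp add: norm_mult_unitary norm_unitary_mult unitary_adj u)
      finally show ?thesis using r(2)[of "\<mu> i"] w(3) by (simp add: dist_norm \<theta>_def)
    qed
    define P where "P = g ** u"
    have P: "invertible P" unfolding P_def by (intro invertible_mult ig unitary_invertible u)
    \<comment> \<open>The space is moved to the eigenbasis of \<open>w\<close>, where the action
      becomes diagonal.\<close>
    define A1 where "A1 = (\<lambda>f. f \<circ> (*v) P) ` ?A"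
    have A1: "fsubspace A1"
      using fsubspace_invariants[of G N] unfolding fsubspace_def A1_def by (auto simp: o_def)
    have A1N: "A1 \<subseteq> PN N" using PN_comp by (auto simp: A1_def)
    have PD: "P ** D = cj P D ** P" for D by (simp add: cj_def matrix_inv_inverse P flip: matrix_mul_assoc)
    have ep1: "epath P (\<lambda>i. \<i> * of_real (\<theta> i)) 1 = cj g w"
      unfolding P_def epath_comp_conj[OF ig u] by (simp add: weq flip: \<mu>)
    have st1: "f \<circ> (*v) (diagm (\<lambda>i. exp (\<i> * of_real (\<theta> i)))) \<in> A1" if f: "f \<in> A1" for f
    proof -
      obtain f' where f': "f' \<in> ?A" "f = f' \<circ> (*v) P" using f by (auto simp: A1_def)
      have "f \<circ> (*v) (diagm (\<lambda>i. exp (\<i> * of_real (\<theta> i)))) = f' \<circ> (*v) (cj g w) \<circ> (*v) P"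
        unfolding f'(2) comp_matrix_mult[symmetric] PD by (simp add: ep1[symmetric] epath_def)
      moreover have "f' \<circ> (*v) (cj g w) \<in> ?A" using w(2) f'(1) unfolding fst_set_def by blast
      ultimately show ?thesis unfolding A1_def by (intro image_eqI)
    qed
    have comp: "f \<circ> (*v) (epath P (\<lambda>i. \<i> * of_real (\<theta> i)) (of_real t)) \<in> ?A" if f: "f \<in> ?A" for f t
    proof -
      have "f \<circ> (*v) P \<in> A1" using f unfolding A1_def by (intro imageI)
      from diag_power_stable[OF A1 A1N \<theta> st1 this, of t]
      obtain f' where f': "f' \<in> ?A" "f \<circ> (*v) P \<circ> (*v) (diagm (\<lambda>i. exp (of_real t * (\<i> * of_real (\<theta> i))))) = f' \<circ> (*v) P"
        unfolding A1_def by blast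
      have "f \<circ> (*v) (epath P (\<lambda>i. \<i> * of_real (\<theta> i)) (of_real t)) \<circ> (*v) P = f' \<circ> (*v) P"
        unfolding f'(2)[symmetric] comp_matrix_mult[symmetric] PD by (simp add: epath_def)
      then have "f \<circ> (*v) (epath P (\<lambda>i. \<i> * of_real (\<theta> i)) (of_real t)) \<circ> (*v) P \<circ> (*v) (matrix_inv P) = f' \<circ> (*v) P \<circ> (*v) (matrix_inv P)"
        by (rule arg_cong)
      then show ?thesis using f'(1) by (simp only: comp_inv_cancel[OF P])
    qed
    have "epath P (\<lambda>i. \<i> * of_real (\<theta> i)) (of_real t) \<in> fst_set ?A" for t
      using comp[of _ t] comp[of _ "- t"] unfolding fst_set_def
      by (auto simp only: epath_inv[OF P] invertible_epath[OF P] mem_Collect_eq of_real_minus)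
    from epath_in_expset[OF irr G g P this] show "cj g w \<in> expset G N" unfolding ep1 .
  qed
qed

text \<open>The logarithms \<open>y\<close> of the singular values generate the positive factor, and
  the good position puts all its real powers into the stabilizer. The unitary factor is left
  over.\<close>

lemma polar_in_expset:
  fixes G :: "(complex ^ 'n ^ 'n) set"
  assumes irr: "irreducible_module G" and G: "subgroup G GL"
    and g: "good_position (invariants G \<inter> PN N) g" and s: "s \<in> fst_set (invariants G \<inter> PN N)"
  obtains p w where "p \<in> expset G N" "unitary w" "cj g w \<in> fst_set (invariants G \<inter> PN N)" "s = p ** cj g w"
proof -
  let ?A = "invariants G \<inter> PN N"
  have ig: "invertible g" using g by (simp add: good_position_def)
  have iv: "invertible s" using s by (simp add: fst_set_def)
  define s' where "s' = cj (matrix_inv g) s"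
  have "invertible s'" unfolding s'_def by (intro invertible_cj matrix_inv_inverse ig iv)
  then obtain u v d where uv: "unitary u" "unitary v" and d: "\<And>i. d i > (0::real)" and s': "s' = u ** rdiag d ** v"
    using svd by metis
  have cs': "cj g s' = s" by (simp add: s'_def cj_cj_inv ig)
  define P where "P = g ** u"
  have P: "invertible P" unfolding P_def by (intro invertible_mult ig unitary_invertible uv)
  define y where "y i = complex_of_real (ln (d i))" for i
  have ex: "exp (of_real t * y i) = of_real (d i powr t)" for i t
    using d[of i] by (simp add: y_def powr_def flip: of_real_mult exp_of_real)
  have ep: "epath P y (of_real t) = cj g (u ** rdiag (\<lambda>i. d i powr t) ** adj u)" for t
    unfolding P_def epath_comp_conj[OF ig uv(1)] ex ..
  have st: "epath P y (of_real t) \<in> fst_set ?A" for t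
    using g uv d s cs' unfolding good_position_def ep s' by blast
  have p: "epath P y 1 \<in> expset G N" by (rule epath_in_expset[OF irr G g P st])
  have ep1: "epath P y 1 = cj g (u ** rdiag d ** adj u)"
    using ep[of 1] d by (simp add: less_imp_le)
  have s_eq: "s = epath P y 1 ** cj g (u ** v)"
  proof -
    have "u ** rdiag d ** adj u ** (u ** v) = s'" using uv by (simp add: s' unitary_cancel flip: matrix_mul_assoc)
    then show ?thesis unfolding ep1 by (simp add: cs' ig flip: cj_mult)
  qed
  have "cj g (u ** v) = matrix_inv (epath P y 1) ** s"
    unfolding s_eq by (simp add: inverse_cancel invertible_epath P)
  moreover have "epath P y 1 \<in> fst_set ?A" using st[of 1] by simp
  ultimately have "cj g (u ** v) \<in> fst_set ?A" using s by (simp add: fst_set_mult fst_set_inv)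
  with p s_eq uv show ?thesis using that[of "epath P y 1" "u ** v"] by (simp add: unitary_mult)
qed

text \<open>The unitary factors form a bounded set \<open>U\<close>, so finitely many balls of
  radius \<open>r\<close> centred in \<open>U\<close> cover it. A factor \<open>w\<close> near a
  centre \<open>w0\<close> is \<open>w ** adj w0\<close> times \<open>w0\<close>, and the first of
  these is close to 1.\<close>

lemma fst_set_finite_cover:
  fixes G :: "(complex ^ 'n ^ 'n) set"
  assumes irr: "irreducible_module G" and G: "subgroup G GL"
  obtains F where "finite F" "\<And>s. s \<in> fst_set (invariants G \<inter> PN N) \<Longrightarrow> \<exists>p\<in>expset G N. \<exists>e\<in>expset G N. \<exists>w\<in>F. s = p ** e ** w"
proof -
  let ?A = "invariants G \<inter> PN N"
  obtain g where g: "good_position ?A g" using good_position_invariants[OF irr G] by blast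
  have ig: "invertible g" using g by (simp add: good_position_def)
  obtain r where r: "r > 0" "\<And>w. unitary w \<Longrightarrow> cj g w \<in> fst_set ?A \<Longrightarrow> norm (w - mat 1) < r \<Longrightarrow> cj g w \<in> expset G N"
    using unitary_near_1_in_expset[OF irr G g] by metis
  define U where "U = {w. unitary w \<and> cj g w \<in> fst_set ?A}"
  have "norm w = norm (mat 1 :: complex ^ 'n ^ 'n)" if "w \<in> U" for w
    using norm_unitary_mult[of w "mat 1"] that by (simp add: U_def)
  then have "bounded U" unfolding bounded_iff by (metis order_refl)
  then have "compact (closure U)" by (simp add: compact_closure)
  moreover have "closure U \<subseteq> (\<Union>w\<in>U. ball w r)"
    using r(1) by (auto simp: closure_approachable)
  ultimately have "\<exists>F\<subseteq>U. finite F \<and> closure U \<subseteq> (\<Union>w\<in>F. ball w r)"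
    using compactE_image[of "closure U" U "\<lambda>w. ball w r"] by (metis open_ball)
  then obtain F where F: "F \<subseteq> U" "finite F" "closure U \<subseteq> (\<Union>w\<in>F. ball w r)" by blast
  show ?thesis
  proof (rule that[of "cj g ` F"])
    show "finite (cj g ` F)" using F by simp
    fix s assume s: "s \<in> fst_set ?A"
    obtain p w where pw: "p \<in> expset G N" "unitary w" "cj g w \<in> fst_set ?A" "s = p ** cj g w"
      by (rule polar_in_expset[OF irr G g s])
    then have "w \<in> closure U" using closure_subset[of U] by (auto simp: U_def)
    then obtain w0 where w0: "w0 \<in> F" "dist w0 w < r" using F(3) by auto
    then have u0: "unitary w0" "cj g w0 \<in> fst_set ?A" using F(1) by (auto simp: U_def)
    have "norm (w ** adj w0 - mat 1) = norm ((w - w0) ** adj w0)"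
      by (simp add: matrix_diff_rdistrib unitaryD u0)
    also have "\<dots> = norm (w - w0)" by (simp add: norm_mult_unitary unitary_adj u0)
    also have "\<dots> < r" using w0(2) by (simp add: dist_norm norm_minus_commute)
    finally have near: "norm (w ** adj w0 - mat 1) < r" .
    have "cj g (w ** adj w0) = cj g w ** matrix_inv (cj g w0)"
      by (simp add: cj_mult ig cj_inv unitary_invertible matrix_inv_unitary u0)
    then have "cj g (w ** adj w0) \<in> fst_set ?A" using pw u0 by (simp add: fst_set_mult fst_set_inv)
    then have e: "cj g (w ** adj w0) \<in> expset G N"
      using near pw u0 by (intro r(2) unitary_mult unitary_adj) auto
    have "w = w ** adj w0 ** w0" using u0 by (simp add: unitaryD flip: matrix_mul_assoc)
    then have "cj g w = cj g (w ** adj w0) ** cj g w0" using ig by (metis cj_mult)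
    then have "s = p ** cj g (w ** adj w0) ** cj g w0" by (simp add: pw(4) matrix_mul_assoc)
    then show "\<exists>p\<in>expset G N. \<exists>e\<in>expset G N. \<exists>w\<in>cj g ` F. s = p ** e ** w"
      using pw(1) e w0(1) by blast
  qed
qed

section \<open>Identity components\<close>

lemma matrix_polys_sum:
  "finite I \<Longrightarrow> (\<And>i. i \<in> I \<Longrightarrow> f i \<in> matrix_polys) \<Longrightarrow> (\<lambda>A. \<Sum>i\<in>I. f i A) \<in> matrix_polys"
  by (induction I rule: finite_induct) (auto intro: matrix_polys_const matrix_polys_add)

lemma matrix_polys_power: "f \<in> matrix_polys \<Longrightarrow> (\<lambda>A. f A ^ k) \<in> matrix_polys"
  by (induction k) (auto intro: matrix_polys_const matrix_polys_mult)

lemma matrix_polys_comp: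
  assumes "f \<in> matrix_polys"
  shows "(\<lambda>A. f (B ** A ** C)) \<in> matrix_polys"
  using assms unfolding matrix_polys_def
proof (induction rule: gen_algebra.induct)
  case (gen f)
  then obtain i j where f: "f = (\<lambda>A. A $ i $ j)" by auto
  show ?case unfolding f matrix_matrix_mult_def vec_lambda_beta matrix_polys_def[symmetric]
    by (intro matrix_polys_sum matrix_polys_mult matrix_polys_entry matrix_polys_const) auto
qed (auto intro: gen_algebra.intros)

lemma matrix_polys_orbit:
  assumes "f \<in> carrier poly_ring"
  shows "(\<lambda>A. f (A *v v)) \<in> matrix_polys"
  using assms unfolding poly_ring_simps
proof (induction rule: gen_algebra.induct)
  case (gen f)
  then obtain i where f: "f = (\<lambda>v. v $ i)" by auto
  show ?case unfolding f matrix_vector_mult_def vec_lambda_beta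
    by (intro matrix_polys_sum matrix_polys_mult matrix_polys_entry matrix_polys_const) auto
qed (auto intro: matrix_polys_const matrix_polys_add matrix_polys_mult)

lemma continuous_on_matrix_polys:
  assumes "f \<in> matrix_polys"
  shows "continuous_on S f"
  using assms unfolding matrix_polys_def
  by (induction rule: gen_algebra.induct) (auto intro!: continuous_intros)

lemma poly_altdef_le: "degree p \<le> D \<Longrightarrow> poly p y = (\<Sum>j\<le>D. coeff p j * y ^ j)"
  for p :: "'a :: comm_semiring_1 poly"
  unfolding poly_altdef by (intro sum.mono_neutral_left) (auto simp: coeff_eq_0)

lemma closedin_zariski_translate:
  fixes B C :: "complex ^ 'n ^ 'n"
  assumes S: "closedin zariski S" and B: "invertible B" and C: "invertible C"
  shows "closedin zariski {A \<in> carrier GL. B ** A ** C \<in> S}"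
proof -
  obtain F where F: "F \<subseteq> matrix_polys" "S = carrier GL \<inter> {A. \<forall>f\<in>F. f A = 0}"
    using S unfolding closedin_zariski by blast
  have "{A \<in> carrier GL. B ** A ** C \<in> S} = carrier GL \<inter> {A. \<forall>f\<in>(\<lambda>f A. f (B ** A ** C)) ` F. f A = 0}"
    using B C by (auto simp: F(2) carrier_GL invertible_mult)
  moreover have "(\<lambda>f A. f (B ** A ** C)) ` F \<subseteq> matrix_polys"
    using F(1) matrix_polys_comp by blast
  ultimately show ?thesis unfolding closedin_zariski by blast
qed

lemma continuous_map_zariski_translate:
  fixes B C :: "complex ^ 'n ^ 'n"
  assumes "invertible B" "invertible C"
  shows "continuous_map zariski zariski (\<lambda>A. B ** A ** C)"
  unfolding continuous_map_closedin topspace_zariski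
  using assms closedin_zariski_translate[of _ B C] by (auto simp: carrier_GL invertible_mult)

lemma closedin_zariski_image:
  fixes B C :: "complex ^ 'n ^ 'n"
  assumes S: "closedin zariski S" and B: "invertible B" and C: "invertible C"
  shows "closedin zariski ((\<lambda>A. B ** A ** C) ` S)"
proof -
  have S': "invertible A" if "A \<in> S" for A
    using closedin_subset[OF S] that by (auto simp: topspace_zariski carrier_GL)
  have "(\<lambda>A. B ** A ** C) ` S = {A \<in> carrier GL. matrix_inv B ** A ** matrix_inv C \<in> S}"
  proof (intro equalityI subsetI)
    fix A assume "A \<in> (\<lambda>A. B ** A ** C) ` S"
    then show "A \<in> {A \<in> carrier GL. matrix_inv B ** A ** matrix_inv C \<in> S}"
      using B C S' by (auto simp: carrier_GL invertible_mult inverse_cancel matrix_inv_inverse simp flip: matrix_mul_assoc)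
  next
    fix A assume "A \<in> {A \<in> carrier GL. matrix_inv B ** A ** matrix_inv C \<in> S}"
    then show "A \<in> (\<lambda>A. B ** A ** C) ` S"
      using B C by (intro image_eqI[of _ _ "matrix_inv B ** A ** matrix_inv C"])
        (auto simp: inverse_cancel matrix_inv_inverse simp flip: matrix_mul_assoc)
  qed
  then show ?thesis using closedin_zariski_translate[OF S, of "matrix_inv B" "matrix_inv C"]
    by (simp add: B C matrix_inv_inverse)
qed

text \<open>Polynomial conditions are closed in the Euclidean topology, so a Euclidean-continuous
  map into \<open>GL\<close> is continuous for the Zariski topology.\<close>

lemma connectedin_zariski_curve:
  fixes p :: "'a :: topological_space \<Rightarrow> complex ^ 'n ^ 'n"
  assumes S: "connected S" and p: "continuous_on S p" "\<And>t. t \<in> S \<Longrightarrow> invertible (p t)"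
  shows "connectedin zariski (p ` S)"
proof -
  have "closedin (top_of_set S) {t \<in> S. p t \<in> T}" if T: "closedin zariski T" for T
  proof -
    obtain F where F: "F \<subseteq> matrix_polys" "T = carrier GL \<inter> {A. \<forall>f\<in>F. f A = 0}"
      using T unfolding closedin_zariski by blast
    have "closedin (top_of_set S) {t \<in> S. f (p t) = 0}" if "f \<in> F" for f
      using F(1) that p(1)
      by (intro continuous_closedin_preimage_constant continuous_on_compose2[OF continuous_on_matrix_polys[of f UNIV]]) auto
    moreover have "{t \<in> S. p t \<in> T} = topspace (top_of_set S) \<inter> \<Inter>((\<lambda>f. {t \<in> S. f (p t) = 0}) ` F)"
      using p(2) by (auto simp: F(2) carrier_GL)
    ultimately show ?thesis
      by (cases "F = {}") (auto intro!: closedin_Int closedin_INT)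
  qed
  then have "continuous_map (top_of_set S) zariski p"
    unfolding continuous_map_closedin using p(2) by (auto simp: topspace_zariski carrier_GL)
  from connectedin_continuous_map_image[OF this, of S] show ?thesis
    using S by (simp add: connectedin_subtopology)
qed

lemma identity_component_subset: "identity_component K \<subseteq> K"
  using connected_component_of_subset_topspace[of "subtopology zariski K" "mat 1"]
  by (auto simp: identity_component_def)

lemma identity_component_maximal:
  "connectedin zariski S \<Longrightarrow> S \<subseteq> K \<Longrightarrow> mat 1 \<in> S \<Longrightarrow> S \<subseteq> identity_component K"
  unfolding identity_component_def
  by (intro connected_component_of_maximal) (auto simp: connectedin_subtopology)

lemma identity_component_connected: "connectedin zariski (identity_component K)"
  using connectedin_connected_component_of[of "subtopology zariski K" "mat 1"]
  by (simp add: connectedin_subtopology identity_component_def)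

lemma identity_component_closed: "closedin zariski K \<Longrightarrow> closedin zariski (identity_component K)"
  unfolding identity_component_def
  by (rule closedin_trans_full[OF closedin_connected_component_of])

text \<open>Translation by the inverse of a member yields a connected subset through the
  identity.\<close>

lemma identity_component_subgroup:
  fixes K :: "(complex ^ 'n ^ 'n) set"
  assumes K: "subgroup K GL"
  shows "subgroup (identity_component K) GL"
proof (rule subgroup_GL_I)
  note K = subgroup_GL_D[OF K]
  have "connectedin zariski {mat 1 :: complex ^ 'n ^ 'n}"
    by (simp add: topspace_zariski carrier_GL unitary_invertible)
  from identity_component_maximal[OF this] show 1: "mat 1 \<in> identity_component K" using K(2) by simp
  note sub = subsetD[OF identity_component_subset]
  show inv: "invertible k" if "k \<in> identity_component K" for k using K(1) sub that by blast
  have *: "matrix_inv g ** h \<in> identity_component K" if g: "g \<in> identity_component K" and h: "h \<in> identity_component K" for g h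
  proof -
    have "continuous_map zariski zariski (\<lambda>A. matrix_inv g ** A ** mat 1)"
      using inv[OF g] by (intro continuous_map_zariski_translate) (auto simp: matrix_inv_inverse unitary_invertible)
    from connectedin_continuous_map_image[OF this identity_component_connected[of K]]
    have "connectedin zariski ((\<lambda>A. matrix_inv g ** A) ` identity_component K)" by simp
    moreover have "(\<lambda>A. matrix_inv g ** A) ` identity_component K \<subseteq> K"
      using g K(3,4) sub by blast
    moreover have "mat 1 \<in> (\<lambda>A. matrix_inv g ** A) ` identity_component K"
      using g by (intro image_eqI[of _ _ g]) (auto simp: matrix_inv_inverse inv)
    ultimately have "(\<lambda>A. matrix_inv g ** A) ` identity_component K \<subseteq> identity_component K"
      by (rule identity_component_maximal)
    then show ?thesis using h by blast
  qed
  show mi: "matrix_inv k \<in> identity_component K" if "k \<in> identity_component K" for k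
    using *[OF that 1] by simp
  show "k ** l \<in> identity_component K" if "k \<in> identity_component K" "l \<in> identity_component K" for k l
    using *[OF mi[OF that(1)] that(2)] by (simp add: matrix_inv_inv inv that)
qed

text \<open>The other cosets of \<open>Q\<close> in \<open>H\<close> are finite in number, so their
  union \<open>E\<close> is closed, and a connected set through the identity cannot meet both
  \<open>Q\<close> and \<open>E\<close>.\<close>

lemma finite_index_identity_component:
  fixes Q H :: "(complex ^ 'n ^ 'n) set"
  assumes Q: "subgroup Q GL" "closedin zariski Q" and H: "subgroup H GL" "Q \<subseteq> H"
    and F: "finite F" "\<And>h. h \<in> H \<Longrightarrow> \<exists>q\<in>Q. \<exists>w\<in>F. h = q ** w"
  shows "identity_component H \<subseteq> Q"
proof -
  note Q' = subgroup_GL_D[OF Q(1)] and H' = subgroup_GL_D[OF H(1)]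
  \<comment> \<open>Elements of \<open>F\<close> outside \<open>H\<close> or inside \<open>Q\<close>
    are discarded. The factor \<open>mat 1\<close> brings the translation into the two-sided form of
    \<open>closedin_zariski_image\<close>.\<close>
  define E where "E = (\<Union>w\<in>F \<inter> (H - Q). (\<lambda>A. mat 1 ** A ** w) ` Q)"
  have "closedin zariski E"
    unfolding E_def using F(1) H'(1) Q(2)
    by (intro closedin_Union finite_imageI ballI)
      (auto simp del: matrix_mul_lid intro!: closedin_zariski_image invertible_mat)
  moreover have "E \<inter> Q = {}"
  proof -
    have "w \<in> Q" if "q \<in> Q" "q ** w \<in> Q" for q w
      using Q'(3)[OF Q'(4)[OF that(1)] that(2)] Q'(1)[OF that(1)] by (simp add: inverse_cancel)
    then show ?thesis by (auto simp: E_def)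
  qed
  moreover have "h \<in> E" if h: "h \<in> H" "h \<notin> Q" for h
  proof -
    obtain q w where qw: "q \<in> Q" "w \<in> F" "h = q ** w" using F(2)[OF h(1)] by blast
    then have "w = matrix_inv q ** h" using Q'(1) by (simp add: inverse_cancel)
    then have "w \<in> H" using H'(3,4) h qw H(2) by blast
    moreover have "w \<notin> Q" using Q'(3) qw h(2) by blast
    ultimately show ?thesis using qw by (auto simp: E_def)
  qed
  then have "identity_component H \<subseteq> Q \<union> E" using identity_component_subset[of H] by blast
  moreover have "mat 1 \<in> Q \<inter> identity_component H"
    using Q'(2) subgroup_GL_D(2)[OF identity_component_subgroup[OF H(1)]] by blast
  ultimately have "E \<inter> identity_component H = {}"
    using identity_component_connected[of H] Q(2) unfolding connectedin_closedin by blast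
  with \<open>identity_component H \<subseteq> Q \<union> E\<close> show ?thesis by blast
qed

text \<open>Coefficients polynomial in \<open>A\<close> and a degree bound uniform in
  \<open>A\<close> are what the elimination of the scalar in \<open>scalars_mult_closed\<close>
  uses.\<close>

lemma matrix_polys_scaled:
  assumes "f \<in> matrix_polys"
  shows "\<exists>p D. (\<forall>k. (\<lambda>A. coeff (p A) k) \<in> matrix_polys) \<and> (\<forall>A. degree (p A) \<le> D) \<and>
    (\<forall>A x. f (mat x ** A) = poly (p A) x)"
  using assms unfolding matrix_polys_def
proof (induction rule: gen_algebra.induct)
  case (gen f)
  then obtain i j where f: "f = (\<lambda>A. A $ i $ j)" by auto
  have eq: "(\<lambda>A. coeff [:0, A $ i $ j:] k) = (if k = 1 then (\<lambda>A. A $ i $ j) else (\<lambda>_. 0))" for k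
    by (auto simp: fun_eq_iff coeff_pCons split: nat.splits)
  have "(\<lambda>A. coeff [:0, A $ i $ j:] k) \<in> matrix_polys" for k
    by (rule ssubst[OF eq]) (simp add: matrix_polys_entry matrix_polys_const)
  then show ?case unfolding f matrix_polys_def
    by (intro exI[of _ "\<lambda>A. [:0, A $ i $ j:]"] exI[of _ 1]) (auto simp: mat_mult_eq)
next
  case (const c)
  have "(\<lambda>A. coeff [:c:] k) \<in> matrix_polys" for k by (rule matrix_polys_const)
  then show ?case unfolding matrix_polys_def by (intro exI[of _ "\<lambda>A. [:c:]"] exI[of _ 0]) auto
next
  case (add f h)
  then obtain p D q E where
    p: "\<And>k. (\<lambda>A. coeff (p A) k) \<in> matrix_polys" "\<And>A. degree (p A) \<le> D" "\<And>A x. f (mat x ** A) = poly (p A) x" and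
    q: "\<And>k. (\<lambda>A. coeff (q A) k) \<in> matrix_polys" "\<And>A. degree (q A) \<le> E" "\<And>A x. h (mat x ** A) = poly (q A) x"
    unfolding matrix_polys_def by metis
  then show ?case unfolding matrix_polys_def[symmetric]
    by (intro exI[of _ "\<lambda>A. p A + q A"] exI[of _ "max D E"])
       (auto intro!: matrix_polys_add degree_add_le intro: max.coboundedI1 max.coboundedI2)
next
  case (mult f h)
  then obtain p D q E where
    p: "\<And>k. (\<lambda>A. coeff (p A) k) \<in> matrix_polys" "\<And>A. degree (p A) \<le> D" "\<And>A x. f (mat x ** A) = poly (p A) x" and
    q: "\<And>k. (\<lambda>A. coeff (q A) k) \<in> matrix_polys" "\<And>A. degree (q A) \<le> E" "\<And>A x. h (mat x ** A) = poly (q A) x"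
    unfolding matrix_polys_def by metis
  then show ?case unfolding matrix_polys_def[symmetric]
    by (intro exI[of _ "\<lambda>A. p A * q A"] exI[of _ "D + E"])
       (auto intro!: matrix_polys_mult matrix_polys_sum order_trans[OF degree_mult_le] add_mono simp: coeff_mult)
qed

text \<open>If \<open>\<kappa> = A \<mapsto> f (A v\<^sub>0)\<close> and \<open>c\<^sup>d = \<kappa> A\<close>, then a polynomial \<open>\<phi>\<close> evaluated at \<open>c\<^sup>-\<^sup>1 A\<close> is, up to a
  power of \<open>\<kappa> A\<close>, a combination of \<open>1, c\<^sup>-\<^sup>1, \<dots>, c\<^sup>-\<^sup>(\<^sup>d\<^sup>-\<^sup>1\<^sup>)\<close> with coefficients polynomial in \<open>A\<close>. They
  all vanish if \<open>\<phi>\<close> vanishes at \<open>c\<^sup>-\<^sup>1 A\<close> for each of the \<open>d\<close> roots \<open>c\<close>.\<close>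

lemma scalars_mult_closed:
  fixes K :: "(complex ^ 'n ^ 'n) set"
  assumes K: "subgroup K GL" "closedin zariski K"
    and f: "f \<in> carrier poly_ring" "hom_deg d f" "d > 0" "f v\<^sub>0 = 1"
    and inv: "\<And>k v. k \<in> K \<Longrightarrow> f (k *v v) = f v"
  shows "closedin zariski {mat c ** k | c k. c \<noteq> 0 \<and> k \<in> K}"
proof -
  let ?Q = "{mat c ** k | c k. c \<noteq> 0 \<and> k \<in> K}"
  note K' = subgroup_GL_D[OF K(1)]
  have im: "invertible (mat c :: complex ^ 'n ^ 'n)" if "c \<noteq> 0" for c using that by (rule invertible_mat)
  define \<kappa> where "\<kappa> A = f (A *v v\<^sub>0)" for A
  have fQ: "f ((mat c ** k) *v v) = c ^ d * f v" if "k \<in> K" for c k v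
    using f(2) inv[OF that] by (simp add: hom_deg_def mat_mult_vec flip: matrix_vector_mul_assoc)
  \<comment> \<open>\<open>\<kappa>\<close> determines the scalar only up to \<open>d\<close>-th
    roots of unity, so all their multiples of \<open>K\<close> are taken together.\<close>
  define M where "M = (\<Union>\<zeta>\<in>{\<zeta>. \<zeta> ^ d = 1}. (\<lambda>k. mat \<zeta> ** k ** mat 1) ` K)"
  have rt: "\<zeta> \<noteq> 0" if "\<zeta> ^ d = (1 :: complex)" for \<zeta> using that f(3) by (auto simp: power_0_left)
  have "closedin zariski M"
    unfolding M_def using f(3) K(2) rt im
    by (intro closedin_Union finite_imageI ballI finite_nth_roots)
       (auto simp del: matrix_mul_rid intro!: closedin_zariski_image invertible_mat)
  then obtain \<Phi> where \<Phi>: "\<Phi> \<subseteq> matrix_polys" "M = carrier GL \<inter> {A. \<forall>f\<in>\<Phi>. f A = 0}"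
    unfolding closedin_zariski by blast
  define \<Psi> where "\<Psi> = {\<psi> \<in> matrix_polys. \<forall>A\<in>?Q. \<psi> A = 0}"
  have "h \<in> ?Q" if h: "h \<in> carrier GL" "\<And>\<psi>. \<psi> \<in> \<Psi> \<Longrightarrow> \<psi> h = 0" for h
  proof -
    have ih: "invertible h" using h(1) by (simp add: carrier_GL)
    \<comment> \<open>This polynomial vanishes on the set in question, hence at \<open>h\<close>:
      substituting \<open>h\<close> multiplies \<open>f\<close> by
      \<open>\<kappa> h\<close>.\<close>
    have "(\<lambda>A. f (A *v v) - \<kappa> A * f v) \<in> matrix_polys" for v
      unfolding \<kappa>_def
      by (rule matrix_polys_diff[OF matrix_polys_orbit[OF f(1)] matrix_polys_mult[OF matrix_polys_orbit[OF f(1)] matrix_polys_const]])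
    then have "(\<lambda>A. f (A *v v) - \<kappa> A * f v) \<in> \<Psi>" for v
      using f(4) by (auto simp: \<Psi>_def \<kappa>_def fQ)
    from h(2)[OF this] have fh: "f (h *v v) = \<kappa> h * f v" for v by simp
    have \<kappa>0: "\<kappa> h \<noteq> 0"
      using fh[of "matrix_inv h *v v\<^sub>0"] f(4) by (auto simp: matrix_vector_mul_assoc matrix_inv_inverse ih)
    have "card {z. z ^ d = \<kappa> h} = d" using \<kappa>0 f(3) by (rule card_nth_roots)
    then have "{z. z ^ d = \<kappa> h} \<noteq> {}" using f(3) by (metis card.empty less_irrefl)
    then obtain c where c: "c ^ d = \<kappa> h" by blast
    have c0: "c \<noteq> 0" using c \<kappa>0 f(3) by (auto simp: power_0_left)
    have "\<phi> (mat (1 / c) ** h) = 0" if \<phi>: "\<phi> \<in> \<Phi>" for \<phi>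
    proof -
      obtain p D where p: "\<And>k. (\<lambda>A. coeff (p A) k) \<in> matrix_polys" "\<And>A. degree (p A) \<le> D"
        "\<And>A x. \<phi> (mat x ** A) = poly (p A) x"
        using matrix_polys_scaled[of \<phi>] \<phi> \<Phi>(1) by blast
      \<comment> \<open>\<open>\<psi> r\<close> collects the powers \<open>y ^ j\<close> with
        \<open>j mod d = r\<close>, after \<open>y ^ d\<close> has been replaced by the inverse of
        \<open>\<kappa> A\<close>. The factor \<open>\<kappa> A ^ D\<close> clears the
        denominators.\<close>
      define \<psi> where "\<psi> r A = (\<Sum>j\<le>D. (if j mod d = r then 1 else 0) * (\<kappa> A ^ (D - j div d) * coeff (p A) j))" for r A
      have \<psi>p: "\<psi> r \<in> matrix_polys" for r
        unfolding \<psi>_def \<kappa>_def by (intro matrix_polys_sum matrix_polys_mult matrix_polys_const matrix_polys_power matrix_polys_orbit f(1) p(1)) auto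
      have key: "\<kappa> A ^ D * poly (p A) y = (\<Sum>r<d. \<psi> r A * y ^ r)" if y: "\<kappa> A * y ^ d = 1" for A y
      proof -
        have pA: "\<kappa> A ^ D * poly (p A) y = (\<Sum>j\<le>D. (\<kappa> A ^ D * y ^ j) * coeff (p A) j)"
          by (simp add: poly_altdef_le[OF p(2)] sum_distrib_left mult_ac)
        have red: "\<kappa> A ^ D * y ^ j = \<kappa> A ^ (D - j div d) * y ^ (j mod d)" if "j \<le> D" for j
        proof -
          have jD: "j div d \<le> D" using that div_le_dividend[of j d] by linarith
          have "y ^ j = (y ^ d) ^ (j div d) * y ^ (j mod d)" by (simp flip: power_mult power_add)
          moreover have "\<kappa> A ^ D = \<kappa> A ^ (D - j div d) * \<kappa> A ^ (j div d)" using jD by (simp flip: power_add)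
          ultimately have "\<kappa> A ^ D * y ^ j = \<kappa> A ^ (D - j div d) * (\<kappa> A * y ^ d) ^ (j div d) * y ^ (j mod d)"
            by (simp add: power_mult_distrib)
          then show ?thesis using y by simp
        qed
        have "\<kappa> A ^ D * poly (p A) y = (\<Sum>j\<le>D. \<kappa> A ^ (D - j div d) * coeff (p A) j * y ^ (j mod d))"
          unfolding pA by (intro sum.cong refl) (subst red, auto)
        also have "\<dots> = (\<Sum>j\<le>D. \<Sum>r<d. if j mod d = r then \<kappa> A ^ (D - j div d) * coeff (p A) j * y ^ r else 0)"
          using f(3) by (intro sum.cong) auto
        also have "\<dots> = (\<Sum>r<d. \<psi> r A * y ^ r)"
          unfolding \<psi>_def sum_distrib_right by (subst sum.swap) (intro sum.cong, auto)
        finally show ?thesis .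
      qed
      have "\<psi> r A = 0" if A: "A \<in> ?Q" and r: "r < d" for r A
      proof -
        obtain b k where b: "A = mat b ** k" "b \<noteq> 0" "k \<in> K" using A by blast
        have \<kappa>A: "\<kappa> A = b ^ d" using fQ[OF b(3)] f(4) by (simp add: \<kappa>_def b(1))
        define P where "P = (\<Sum>r<d. monom (\<psi> r A) r)"
        have P: "poly P y = (\<Sum>r<d. \<psi> r A * y ^ r)" for y by (simp add: P_def poly_sum poly_monom)
        have "poly P y = 0" if y: "y ^ d = 1 / b ^ d" for y
        proof -
          have "(y * b) ^ d = 1" using y b(2) by (simp add: power_mult_distrib)
          then have "mat (y * b) ** k ** mat 1 \<in> M" using b(3) by (auto simp: M_def)
          then have "\<phi> (mat (y * b) ** k) = 0" using \<phi> \<Phi>(2) by auto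
          then have "poly (p A) y = 0" by (simp add: b(1) mat_mult_mat matrix_mul_assoc flip: p(3))
          then show ?thesis using key[of A y] y b(2) by (simp add: \<kappa>A P)
        qed
        then have sub: "{y. y ^ d = 1 / b ^ d} \<subseteq> {y. poly P y = 0}" by blast
        \<comment> \<open>There are \<open>d\<close> roots, but the degree is at most
          \<open>d - 1\<close>.\<close>
        have "P = 0"
        proof (rule ccontr)
          assume "P \<noteq> 0"
          have "d = card {y. y ^ d = 1 / b ^ d}" using b(2) f(3) by (intro card_nth_roots[symmetric]) auto
          also have "\<dots> \<le> card {y. poly P y = 0}" by (intro card_mono sub poly_roots_finite \<open>P \<noteq> 0\<close>)
          also have "\<dots> \<le> degree P" by (rule card_poly_roots_bound[OF \<open>P \<noteq> 0\<close>])
          also have "\<dots> \<le> d - 1" unfolding P_def using f(3)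
            by (intro degree_sum_le) (auto intro: order_trans[OF degree_monom_le])
          finally show False using f(3) by simp
        qed
        moreover have "coeff P r = \<psi> r A" using r by (simp add: P_def coeff_sum)
        ultimately show ?thesis by simp
      qed
      then have "\<psi> r \<in> \<Psi>" if "r < d" for r using \<psi>p that by (auto simp: \<Psi>_def)
      then have "\<psi> r h = 0" if "r < d" for r using h(2) that by blast
      moreover have "\<kappa> h * (1 / c) ^ d = 1" using c c0 \<kappa>0 by (simp add: power_divide)
      ultimately have "\<kappa> h ^ D * poly (p h) (1 / c) = 0" using key by simp
      then show ?thesis using \<kappa>0 p(3) by simp
    qed
    moreover have "mat (1 / c) ** h \<in> carrier GL" using c0 ih by (simp add: carrier_GL invertible_mult im)
    ultimately have "mat (1 / c) ** h \<in> M" using \<Phi>(2) by blast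
    then obtain \<zeta> k where \<zeta>: "\<zeta> ^ d = 1" "k \<in> K" "mat (1 / c) ** h = mat \<zeta> ** k" by (auto simp: M_def)
    have "h = mat c ** (mat (1 / c) ** h)" using c0 by (simp add: matrix_mul_assoc mat_mult_mat)
    then have "h = mat (c * \<zeta>) ** k" unfolding \<zeta>(3) by (simp add: matrix_mul_assoc mat_mult_mat)
    moreover have "c * \<zeta> \<noteq> 0" using rt[OF \<zeta>(1)] c0 by simp
    ultimately show ?thesis using \<zeta>(2) by blast
  qed
  moreover have "?Q \<subseteq> carrier GL" using K'(1) im by (auto simp: carrier_GL intro!: invertible_mult)
  ultimately have "?Q = carrier GL \<inter> {A. \<forall>f\<in>\<Psi>. f A = 0}" unfolding \<Psi>_def by blast
  moreover have "\<Psi> \<subseteq> matrix_polys" by (auto simp: \<Psi>_def)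
  ultimately show ?thesis unfolding closedin_zariski by blast
qed

text \<open>Constancy fails in some homogeneous component, which is then of positive degree and can
  be rescaled to take the value 1.\<close>

lemma homogeneous_invariant:
  assumes f: "f \<in> invariants G" and nc: "f v \<noteq> f 0"
  obtains h d v\<^sub>0 where "h \<in> invariants G" "hom_deg d h" "d > 0" "h v\<^sub>0 = 1"
proof -
  obtain N where "f \<in> PN N" using f R_PN[of f] by (auto simp: invariants_def)
  then obtain F where F: "\<And>k. F k \<in> PN k" "\<And>k. hom_deg k (F k)" "f = (\<lambda>v. \<Sum>k\<le>N. F k v)"
    using hom_decomp[of f N] by metis
  have "\<exists>k\<in>{..N}. F k v \<noteq> F k 0" using nc by (auto simp: F(3) intro: sum.cong)
  then obtain k where k: "k \<le> N" "F k v \<noteq> F k 0" by blast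
  have F0: "F k 0 = 0 ^ k * F k w" for w using F(2)[of k] unfolding hom_deg_def by (metis vector_smult_lzero)
  have "k > 0" using k(2) F0[of v] by (cases k) auto
  then have "F k v \<noteq> 0" using k(2) F0[of v] by auto
  have Fi: "F k \<in> invariants G" by (rule invariants_hom_components[OF f F k(1)])
  show thesis
  proof (rule that[of "\<lambda>w. (1 / F k v) * F k w" k v])
    show "(\<lambda>w. (1 / F k v) * F k w) \<in> invariants G"
      using Fi R_closed(4)[OF R_closed(1)[of "1 / F k v"], of "F k"]
      by (auto simp: invariants_def fun_eq_iff simp del: times_divide_eq_left)
    show "hom_deg k (\<lambda>w. (1 / F k v) * F k w)" using F(2)[of k] by (simp add: hom_deg_def)
  qed (use \<open>k > 0\<close> \<open>F k v \<noteq> 0\<close> in auto)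
qed

section \<open>Scalar multiples of the identity component, and the conclusion\<close>

lemma scalars_connected: "connectedin zariski (mat ` (- {0 :: complex}))"
proof (rule connectedin_zariski_curve)
  show "connected (- {0 :: complex})" by (intro connected_punctured_universe) simp
  show "continuous_on (- {0}) (mat :: complex \<Rightarrow> complex ^ 'n ^ 'n)"
  proof -
    have "continuous_on (- {0}) (\<lambda>c :: complex. if i = j then c else 0)" for i j :: 'n
      by (cases "i = j") (auto intro!: continuous_intros)
    then show ?thesis unfolding mat_def by (intro continuous_on_vec_lambda)
  qed
qed (auto intro: invertible_mat)

lemma scalars_mult_connected:
  fixes G H :: "(complex ^ 'n ^ 'n) set"
  assumes G: "subgroup G GL" and H: "subgroup H GL" "G \<subseteq> H" "\<And>c. c \<noteq> 0 \<Longrightarrow> mat c \<in> H"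
  shows "{mat c ** k | c k. c \<noteq> 0 \<and> k \<in> identity_component G} \<subseteq> identity_component H"
proof -
  note G0 = subgroup_GL_D[OF identity_component_subgroup[OF G]]
  note H0 = subgroup_GL_D[OF identity_component_subgroup[OF H(1)]]
  have "identity_component G \<subseteq> identity_component H"
    using H(2) identity_component_subset[of G] G0(2)
    by (intro identity_component_maximal identity_component_connected) auto
  moreover have "mat ` (- {0 :: complex}) \<subseteq> identity_component H"
    by (rule identity_component_maximal[OF scalars_connected]) (use H(3) in auto)
  ultimately show ?thesis using H0(3) by blast
qed

text \<open>By the choice of \<open>N\<close>, elements of \<open>liek G N\<close> annihilate all
  invariants, so their exponentials lie in \<open>G\<^sub>0 G = G\<close>. The complex one-parameter
  group is connected and passes through the identity.\<close>

lemma expset_subset: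
  fixes G :: "(complex ^ 'n ^ 'n) set"
  assumes G: "G\<^sub>0 G = G" and N: "\<And>M. liek G N \<subseteq> liek G M"
  shows "expset G N \<subseteq> {mat c ** k | c k. c \<noteq> 0 \<and> k \<in> identity_component G}"
proof -
  have "epath P x 1 \<in> identity_component G" if P: "invertible P" and X: "cj P (diagm x) \<in> liek G N" for P x
  proof -
    have "epath P x z \<in> G" for z
    proof -
      have "f \<circ> (*v) (epath P x z) = f" if f: "f \<in> invariants G" for f
      proof (rule epath_fixes[OF P])
        show fR: "f \<in> carrier poly_ring" using f invariants_R by blast
        then obtain M where "f \<in> PN M" using R_PN by blast
        then show "Df f v (cj P (diagm x) *v v) = 0" for v using N[of M] X f by (auto simp: liek_def)
      qed
      then have "epath P x z \<in> G\<^sub>0 G" by (simp add: G\<^sub>0_def carrier_GL invertible_epath P)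
      then show ?thesis by (simp add: G)
    qed
    moreover have "connectedin zariski (range (epath P x))"
    proof (rule connectedin_zariski_curve)
      show "continuous_on UNIV (epath P x)"
      proof -
        have "continuous_on UNIV (\<lambda>z. if i = j then exp (z * x i) else 0)" for i j :: 'n
          by (cases "i = j") (auto intro!: continuous_intros)
        then show ?thesis unfolding epath_def cj_def diagm_def
          by (intro continuous_on_matrix_mult continuous_on_const continuous_on_vec_lambda)
      qed
    qed (auto intro: invertible_epath P)
    moreover have "mat 1 \<in> range (epath P x)" using epath_0[OF P, of x] by (metis rangeI)
    ultimately have "range (epath P x) \<subseteq> identity_component G"
      by (intro identity_component_maximal) auto
    then show ?thesis by blast
  qed
  then show ?thesis by (auto simp: expset_def)
qed

lemma scalars_mult_subgroup:
  fixes K :: "(complex ^ 'n ^ 'n) set"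
  assumes "subgroup K GL"
  shows "subgroup {mat c ** k | c k. c \<noteq> 0 \<and> k \<in> K} GL"
proof (rule subgroup_GL_I)
  note K = subgroup_GL_D[OF assms]
  have mm: "(mat c ** k) ** (mat d ** l) = mat (c * d) ** (k ** l)" for c d :: complex and k l :: "complex ^ 'n ^ 'n"
    by (simp add: mat_mult_left_commute[of k] flip: matrix_mul_assoc mat_mult_mat)
  show "mat 1 \<in> {mat c ** k | c k. c \<noteq> 0 \<and> k \<in> K}"
    using K(2) by (intro CollectI exI[of _ 1] exI[of _ "mat 1"]) simp
  show "invertible g" if "g \<in> {mat c ** k | c k. c \<noteq> 0 \<and> k \<in> K}" for g
    using that K(1) by (auto intro: invertible_mult invertible_mat)
  show "g ** h \<in> {mat c ** k | c k. c \<noteq> 0 \<and> k \<in> K}"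
    if gh: "g \<in> {mat c ** k | c k. c \<noteq> 0 \<and> k \<in> K}" "h \<in> {mat c ** k | c k. c \<noteq> 0 \<and> k \<in> K}" for g h
  proof -
    obtain c k d l where "g = mat c ** k" "h = mat d ** l" "c \<noteq> 0" "d \<noteq> 0" "k \<in> K" "l \<in> K" using gh by blast
    then show ?thesis using K(3) by (intro CollectI exI[of _ "c * d"] exI[of _ "k ** l"]) (simp add: mm)
  qed
  show "matrix_inv g \<in> {mat c ** k | c k. c \<noteq> 0 \<and> k \<in> K}" if g: "g \<in> {mat c ** k | c k. c \<noteq> 0 \<and> k \<in> K}" for g
  proof -
    obtain c k where ck: "g = mat c ** k" "c \<noteq> 0" "k \<in> K" using g by blast
    then have "matrix_inv g = mat (1 / c) ** matrix_inv k"
      using K(1) by (intro matrix_inv_unique) (simp add: mm matrix_inv_inverse)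
    then show ?thesis using ck K(4) by (intro CollectI exI[of _ "1 / c"] exI[of _ "matrix_inv k"]) simp
  qed
qed

theorem proposition3p10:
  fixes G H :: "(complex ^ 'n ^ 'n) set"
  assumes "reductive G"
    and "levi_subgroup G (G\<^sub>0 G)"
    and "levi_subgroup H (H\<^sub>0 G)"
    and "G \<subseteq> H"
    and "irreducible_module G"
  shows "reductive (G\<^sub>0 G)
    \<and> reductive (H\<^sub>0 G)
    \<and> identity_component H = scalars <#>\<^bsub>GL\<^esub> identity_component G"
proof -
  note irr = assms(5)
  have "G \<subseteq> G\<^sub>0 G" "H \<subseteq> H\<^sub>0 G" using assms(2,3) by (simp_all add: levi_subgroup_def)
  then have irr': "irreducible_module (G\<^sub>0 G)" "irreducible_module (H\<^sub>0 G)"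
    using irreducible_module_mono[OF irr] assms(4) by blast+
  note levi = levi_subgroup_irreducible[OF subgroup_G0 irr'(1) assms(2)]
    levi_subgroup_irreducible[OF subgroup_H0 irr'(2) assms(3)]
  have G0: "G\<^sub>0 G = G" and H0: "H\<^sub>0 G = H" using levi(1,3) by simp_all
  have G: "subgroup G GL" "closedin zariski G" and H: "subgroup H GL" "closedin zariski H"
    using levi(2,4) by (simp_all add: G0 H0 reductive_def linear_algebraic_group_def)
  let ?K = "identity_component G"
  let ?Q = "{mat c ** k | c k. c \<noteq> 0 \<and> k \<in> ?K}"
  note K = identity_component_subgroup[OF G(1)] identity_component_closed[OF G(2)]
  note K' = subgroup_GL_D[OF K(1)]
  have scH: "mat c \<in> H" if "c \<noteq> 0" for c using mat_in_H0[OF that, of G] by (simp add: H0)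
  have QH: "?Q \<subseteq> identity_component H" by (rule scalars_mult_connected[OF G(1) H(1) assms(4) scH])
  \<comment> \<open>\<open>scalars_mult_closed\<close> asks for a homogeneous invariant of positive
    degree. If all invariants are constant, \<open>G\<close> is the whole of \<open>GL\<close>, and
    its identity component already contains the scalars.\<close>
  have "closedin zariski ?Q"
  proof (cases "\<exists>f\<in>invariants G. \<exists>v. f v \<noteq> f 0")
    case True
    then obtain f d v\<^sub>0 where f: "f \<in> invariants G" "hom_deg d f" "d > 0" "f v\<^sub>0 = 1"
      using homogeneous_invariant by metis
    have "f (k *v v) = f v" if "k \<in> ?K" for k v
      using f(1) subsetD[OF identity_component_subset that] by (auto simp: invariants_def fun_eq_iff)
    moreover have "f \<in> carrier poly_ring" using f(1) invariants_R by blast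
    ultimately show ?thesis using scalars_mult_closed[OF K _ f(2-4)] by blast
  next
    case False
    then have const: "f v = f w" if "f \<in> invariants G" for f v w using that by metis
    have "f \<circ> (*v) g = f" if "f \<in> invariants G" for f g
      by (rule ext) (simp only: comp_apply, rule const[OF that])
    then have "g \<in> G" if "invertible g" for g
      using that by (subst G0[symmetric]) (simp add: G\<^sub>0_def carrier_GL)
    then have "mat ` (- {0 :: complex}) \<subseteq> ?K"
      by (intro identity_component_maximal[OF scalars_connected]) (auto intro: invertible_mat)
    then have "?Q \<subseteq> ?K" using K'(3) by blast
    moreover have "k = mat 1 ** k" for k :: "complex ^ 'n ^ 'n" by simp
    then have "?K \<subseteq> ?Q" by (metis (mono_tags, lifting) mem_Collect_eq subsetI zero_neq_one)
    ultimately have "?Q = ?K" by blast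
    then show ?thesis using K(2) by simp
  qed
  note Q = scalars_mult_subgroup[OF K(1)] this
  \<comment> \<open>From this bound on \<open>liek\<close> is constant, which allows the use of
    \<open>expset_subset\<close>.\<close>
  obtain N where N: "\<And>M. liek G N \<subseteq> liek G M" using liek_stabilizes by blast
  obtain F where F: "finite F" "\<And>s. s \<in> fst_set (invariants G \<inter> PN N) \<Longrightarrow>
      \<exists>p\<in>expset G N. \<exists>e\<in>expset G N. \<exists>w\<in>F. s = p ** e ** w"
    using fst_set_finite_cover[OF irr G(1)] by metis
  have "identity_component H \<subseteq> ?Q"
  proof (rule finite_index_identity_component[OF Q H(1) _ F(1)])
    show "?Q \<subseteq> H" using QH identity_component_subset by blast
    fix h assume h: "h \<in> H"
    \<comment> \<open>Stability of the null ideal enters through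
      \<open>invariants_H0_stable\<close>: it makes \<open>H\<close> act on the invariants of degree
      at most \<open>N\<close>.\<close>
    have st: "f \<circ> (*v) h \<in> invariants G \<inter> PN N" if "h \<in> H" "f \<in> invariants G \<inter> PN N" for h f
      using invariants_H0_stable[OF irr G(1), of h f] that assms(4) PN_comp by (auto simp: H0)
    have "h \<in> fst_set (invariants G \<inter> PN N)"
      using st[OF h] st[OF subgroup_GL_D(4)[OF H(1) h]] subgroup_GL_D(1)[OF H(1) h] by (simp add: fst_set_def)
    then obtain p e w where pew: "p \<in> expset G N" "e \<in> expset G N" "w \<in> F" "h = p ** e ** w" using F(2) by blast
    then have "p \<in> ?Q" "e \<in> ?Q" by (auto dest: subsetD[OF expset_subset[OF G0 N]])
    then have "p ** e \<in> ?Q" by (rule subgroup_GL_D(3)[OF Q(1)])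
    then show "\<exists>q\<in>?Q. \<exists>w\<in>F. h = q ** w" using pew by blast
  qed
  with QH have "identity_component H = ?Q" by blast
  also have "?Q = scalars <#>\<^bsub>GL\<^esub> ?K" by (auto simp: set_mult_def mult_GL scalars_def)
  finally show ?thesis using levi(2,4) by simp
qed

end
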